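(* There exists a non-trivial homomorphism of vertex algebras $$g: N(-2\Lambda_0)\rightarrow \mathcal{V}\otimes F_{-1},$$ which is uniquely determined by $$e(-1)\mathbf 1\mapsto G^{+}(-\tfrac32)\mathbf 1\otimes e^{\beta},\qquad h(-1)\mathbf 1\mapsto -2\bigl(\mathbf 1\otimes\beta(-1)\mathbf 1-T(-1)\mathbf 1\otimes\mathbf 1\bigr),\qquad f(-1)\mathbf 1\mapsto G^{-}(-\tfrac32)\mathbf 1\otimes e^{-\beta}.$$
   Context: $\mathfrak g=sl_2(\mathbb{C})$ with basis $e,f,h$, $[h,e]=2e$, $[h,f]=-2f$, $[e,f]=h$, with the invariant form $(h,h)=2$, $(e,f)=1$; $\hat{\mathfrak g}=\mathfrak g\otimes\mathbb{C}[t,t^{-1}]\oplus\mathbb{C}c$ with $[x(n),y(m)]=[x,y](n+m)+n(x,y)\delta_{n+m,0}c$, $x(n)=x\otimes t^n$. $N(k\Lambda_0)=U(\hat{\mathfrak g})\otimes_{U(\mathfrak g\otimes\mathbb{C}[t]\oplus\mathbb{C}c)}\mathbb{C}v_k$, where $\mathfrak g\otimes\mathbb{C}[t]$ acts as $0$ and $c$ as $k$ on $v_k$; it is the universal affine vertex algebra of level $k$, with vacuum $\mathbf 1=1\otimes v_k$. $F$: the Clifford algebra $CL$ is generated by $\Psi^{\pm}(r)$, $r\in\frac12+\mathbb{Z}$, with $\{\Psi^{\pm}(r),\Psi^{\mp}(s)\}=\delta_{r+s,0}$, $\{\Psi^{\pm}(r),\Psi^{\pm}(s)\}=0$; $F$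 is its irreducible module generated by $\mathbf 1$ with $\Psi^{\pm}(r)\mathbf 1=0$ for $r>0$, a vertex superalgebra generated by $\Psi^{\pm}(z)=\sum_{n}\Psi^{\pm}(n+\frac12)z^{-n-1}$. $M(0)=\mathbb{C}[\gamma^{+}(n),\gamma^{-}(n)\mid n<0]$ is the commutative vertex algebra generated by $\gamma^{\pm}(z)=\sum_{n<0}\gamma^{\pm}(n)z^{-n-1}$. $\mathcal{V}$ is the vertex subalgebra of $F\otimes M(0)$ generated by $\tau^{\pm}=(\Psi^{\pm}(-\frac32)+\gamma^{\pm}(-1)\Psi^{\pm}(-\frac12))\mathbf 1$, $j=\frac12(\gamma^+(-1)-\gamma^-(-1))\mathbf 1$, $\nu=\frac14(2\gamma^+(-1)\gamma^-(-1)+\gamma^+(-2)+\gamma^-(-2))\mathbf 1$, with fields $G^{\pm}(z)=Y(\tau^\pm,z)=\sum_n G^{\pm}(n+\frac12)z^{-n-2}$, $T(z)=Y(j,z)=\sum_n T(n)z^{-n-1}$; so $G^\pm(-\frac32)\mathbf 1=\tau^\pm$ and $T(-1)\mathbf 1=j$. $F_{-1}=V_{\mathbb{Z}\beta}$ is the lattice vertex superalgebra of the lattice $\mathbb{Z}\beta$, $\langle\beta,\beta\rangle=-1$. Sign convention: with the usual super (Koszul) sign rule in $\mathcal{V}\otimes F_{-1}$, the cocycle of $F_{-1}$ is normalized as $\varepsilon(m\beta,n\beta)=(-1)^{mn}$, i.e. $Y(e^{m\beta},z)e^{n\beta}=(-1)^{mn}z^{-mn}(e^{(m+n)\beta}+O(z))$.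 *)

theory Defs
  imports Complex_Main "HOL-Library.Poly_Mapping" "HOL-Library.FSet"
begin

section \<open>Complex vector spaces\<close>

class complex_space = ab_group_add +
  fixes scaleC :: "complex \<Rightarrow> 'a \<Rightarrow> 'a" (infixr \<open>*\<^sub>C\<close> 75)
  assumes scaleC_add_right: "a *\<^sub>C (x + y) = a *\<^sub>C x + a *\<^sub>C y"
    and scaleC_add_left: "(a + b) *\<^sub>C x = a *\<^sub>C x + b *\<^sub>C x"
    and scaleC_scaleC: "a *\<^sub>C (b *\<^sub>C x) = (a * b) *\<^sub>C x"
    and scaleC_one: "1 *\<^sub>C x = x"

global_interpretation cvec: vector_space "scaleC :: complex \<Rightarrow> 'a \<Rightarrow> 'a::complex_space"
  by unfold_locales (fact scaleC_add_right scaleC_add_left scaleC_scaleC scaleC_one)+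

abbreviation clinear :: "('a::complex_space \<Rightarrow> 'b::complex_space) \<Rightarrow> bool" where
  "clinear \<equiv> Vector_Spaces.linear scaleC scaleC"

instantiation complex :: complex_space
begin
definition scaleC_complex :: "complex \<Rightarrow> complex \<Rightarrow> complex" where
  "scaleC_complex = (*)"
instance by standard (simp_all add: scaleC_complex_def algebra_simps)
end

instantiation poly_mapping :: (type, complex_space) complex_space
begin
lift_definition scaleC_poly_mapping :: "complex \<Rightarrow> ('a \<Rightarrow>\<^sub>0 'b) \<Rightarrow> ('a \<Rightarrow>\<^sub>0 'b)"
  is "\<lambda>c f k. c *\<^sub>C f k"
  by (erule finite_subset[rotated]) (auto simp: cvec.scale_zero_right)
instance
  by standard (transfer; simp add: fun_eq_iff scaleC_add_right scaleC_add_left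
      scaleC_scaleC scaleC_one)+
end

text \<open>\<open>'k \<Rightarrow>\<^sub>0 complex\<close> is the vector space with basis \<open>basis k\<close>, \<open>k :: 'k\<close>, and
  \<open>lin_ext f\<close> is the linear map with \<open>basis k \<mapsto> f k\<close>.\<close>

abbreviation basis :: "'k \<Rightarrow> ('k \<Rightarrow>\<^sub>0 complex)" where
  "basis k \<equiv> Poly_Mapping.single k 1"

definition lin_ext :: "('k \<Rightarrow> 'v::complex_space) \<Rightarrow> ('k \<Rightarrow>\<^sub>0 complex) \<Rightarrow> 'v" where
  "lin_ext f v = (\<Sum>k\<in>Poly_Mapping.keys v. Poly_Mapping.lookup v k *\<^sub>C f k)"

lemma lin_ext_add: "lin_ext f (u + v) = lin_ext f u + lin_ext f v"
proof -
  let ?K = "Poly_Mapping.keys u \<union> Poly_Mapping.keys v"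
  have *: "lin_ext f x = (\<Sum>k\<in>?K. Poly_Mapping.lookup x k *\<^sub>C f k)" if "Poly_Mapping.keys x \<subseteq> ?K" for x
    unfolding lin_ext_def using that
    by (intro sum.mono_neutral_left) (auto simp: in_keys_iff)
  show ?thesis
    using Poly_Mapping.keys_add[of u v]
    by (simp add: * lookup_add scaleC_add_left sum.distrib)
qed

lemma lin_ext_scale: "lin_ext f (c *\<^sub>C v) = c *\<^sub>C lin_ext f v"
proof -
  have "lin_ext f (c *\<^sub>C v) = (\<Sum>k\<in>Poly_Mapping.keys v. Poly_Mapping.lookup (c *\<^sub>C v) k *\<^sub>C f k)"
    unfolding lin_ext_def
    by (intro sum.mono_neutral_left)
       (auto simp: in_keys_iff scaleC_poly_mapping.rep_eq scaleC_complex_def)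
  also have "\<dots> = c *\<^sub>C lin_ext f v"
    by (simp add: lin_ext_def scaleC_poly_mapping.rep_eq scaleC_complex_def
        cvec.scale_sum_right scaleC_scaleC)
  finally show ?thesis .
qed

lemma clinear_lin_ext: "clinear (lin_ext f)"
  unfolding Vector_Spaces.linear_def module_hom_def module_hom_axioms_def
  by (simp add: cvec.module_axioms cvec.vector_space_axioms lin_ext_add lin_ext_scale)

lemma lin_ext_basis [simp]: "lin_ext f (basis k) = f k"
  by (simp add: lin_ext_def scaleC_one)

lemma lin_ext_diff: "lin_ext f (u - v) = lin_ext f u - lin_ext f v"
  using lin_ext_add[of f "u - v" v] by (simp add: algebra_simps)

lemma lin_ext_sum: "lin_ext f (sum g A) = (\<Sum>x\<in>A. lin_ext f (g x))"
  by (induction A rule: infinite_finite_induct) (simp_all add: lin_ext_add, simp_all add: lin_ext_def)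

lemma lin_ext_lin_ext: "lin_ext f (lin_ext g v) = lin_ext (\<lambda>k. lin_ext f (g k)) v"
  by (simp add: lin_ext_def[of g] lin_ext_def[of "\<lambda>k. lin_ext f (g k)"] lin_ext_sum lin_ext_scale)

lemma lin_ext_0 [simp]: "lin_ext f 0 = 0"
  by (simp add: lin_ext_def)

lemma lin_ext_basis_self [simp]: "lin_ext basis v = v"
proof (rule poly_mapping_eqI)
  fix k
  have "Poly_Mapping.lookup (lin_ext basis v) k =
      (\<Sum>l\<in>Poly_Mapping.keys v. Poly_Mapping.lookup v l * (if l = k then 1 else 0))"
    by (simp add: lin_ext_def lookup_sum scaleC_poly_mapping.rep_eq scaleC_complex_def
        lookup_single when_def)
  also have "\<dots> = Poly_Mapping.lookup v k"
    by (simp add: in_keys_iff if_distrib[of "\<lambda>t. _ * t"] cong: if_cong)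
  finally show "Poly_Mapping.lookup (lin_ext basis v) k = Poly_Mapping.lookup v k" .
qed

lemma lin_ext_plus: "lin_ext f v + lin_ext g v = lin_ext (\<lambda>k. f k + g k) v"
  by (simp add: lin_ext_def sum.distrib scaleC_add_right)

text \<open>The vector space with basis \<open>'a \<times> 'b\<close> serves as the tensor product of those with
  bases \<open>'a\<close> and \<open>'b\<close>.\<close>

definition tens :: "('a \<Rightarrow>\<^sub>0 complex) \<Rightarrow> ('b \<Rightarrow>\<^sub>0 complex) \<Rightarrow> ('a \<times> 'b \<Rightarrow>\<^sub>0 complex)"
    (infixr \<open>\<otimes>\<close> 72) where
  "u \<otimes> w = lin_ext (\<lambda>a. lin_ext (\<lambda>b. basis (a, b)) w) u"


section \<open>Vertex superalgebras\<close>

text \<open>Parities are truth values (\<open>True\<close> is odd), so \<open>p \<noteq> q\<close> is the sum of parities.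
  The product \<open>vs_prod V a n b\<close> is \<open>a\<^sub>(\<^sub>n\<^sub>) b\<close>, where
  \<open>Y(a,z) = \<Sum>n. a\<^sub>(\<^sub>n\<^sub>) z^(-n-1)\<close>. The structure lives on \<open>carrier V\<close>; the values of
  \<open>vs_prod\<close> outside it are irrelevant.\<close>

record 'v vsa =
  vs_grade :: "bool \<Rightarrow> 'v set"
  vs_vac :: 'v
  vs_prod :: "'v \<Rightarrow> int \<Rightarrow> 'v \<Rightarrow> 'v"

definition carrier :: "'v::complex_space vsa \<Rightarrow> 'v set" where
  "carrier V = {u + w | u w. u \<in> vs_grade V False \<and> w \<in> vs_grade V True}"

definition koszul :: "bool \<Rightarrow> bool \<Rightarrow> complex" where
  "koszul p q = (if p \<and> q then - 1 else 1)"

text \<open>The last two axioms are translation covariance for the operator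
  \<open>a \<mapsto> a\<^sub>(\<^sub>-\<^sub>2\<^sub>) 1\<close> and locality,
  \<open>(z - w)^N (Y(a,z) Y(b,w) - \<plusminus> Y(b,w) Y(a,z)) = 0\<close>, written in modes.\<close>

definition vertex_superalgebra :: "'v::complex_space vsa \<Rightarrow> bool" where
  "vertex_superalgebra V \<longleftrightarrow>
    (\<forall>p. cvec.subspace (vs_grade V p)) \<and>
    vs_grade V False \<inter> vs_grade V True = {0} \<and>
    vs_vac V \<in> vs_grade V False \<and>
    (\<forall>p q. \<forall>a\<in>vs_grade V p. \<forall>b\<in>vs_grade V q. \<forall>n. vs_prod V a n b \<in> vs_grade V (p \<noteq> q)) \<and>
    (\<forall>a\<in>carrier V. \<forall>a'\<in>carrier V. \<forall>b\<in>carrier V. \<forall>c n.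
        vs_prod V (c *\<^sub>C a + a') n b = c *\<^sub>C vs_prod V a n b + vs_prod V a' n b \<and>
        vs_prod V b n (c *\<^sub>C a + a') = c *\<^sub>C vs_prod V b n a + vs_prod V b n a') \<and>
    (\<forall>a\<in>carrier V. \<forall>b\<in>carrier V. \<exists>N. \<forall>n\<ge>N. vs_prod V a n b = 0) \<and>
    (\<forall>a\<in>carrier V. \<forall>n. vs_prod V (vs_vac V) n a = (if n = - 1 then a else 0)) \<and>
    (\<forall>a\<in>carrier V. vs_prod V a (- 1) (vs_vac V) = a \<and>
        (\<forall>n\<ge>0. vs_prod V a n (vs_vac V) = 0)) \<and>
    (\<forall>a\<in>carrier V. \<forall>b\<in>carrier V. \<forall>n.
        vs_prod V (vs_prod V a n b) (- 2) (vs_vac V)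
          - vs_prod V a n (vs_prod V b (- 2) (vs_vac V))
        = - of_int n *\<^sub>C vs_prod V a (n - 1) b) \<and>
    (\<forall>p q. \<forall>a\<in>vs_grade V p. \<forall>b\<in>vs_grade V q. \<exists>N::nat. \<forall>m n. \<forall>c\<in>carrier V.
        (\<Sum>i\<le>N. ((- 1) ^ i * of_nat (N choose i)) *\<^sub>C
          (vs_prod V a (m + int (N - i)) (vs_prod V b (n + int i) c)
           - koszul p q *\<^sub>C vs_prod V b (n + int i) (vs_prod V a (m + int (N - i)) c))) = 0)"

definition vsa_hom :: "'v::complex_space vsa \<Rightarrow> 'w::complex_space vsa \<Rightarrow> ('v \<Rightarrow> 'w) \<Rightarrow> bool" where
  "vsa_hom V W g \<longleftrightarrow>
    vertex_superalgebra V \<and> vertex_superalgebra W \<and>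
    (\<forall>a\<in>carrier V. \<forall>b\<in>carrier V. \<forall>c. g (c *\<^sub>C a + b) = c *\<^sub>C g a + g b) \<and>
    (\<forall>p. \<forall>a\<in>vs_grade V p. g a \<in> vs_grade W p) \<and>
    g (vs_vac V) = vs_vac W \<and>
    (\<forall>a\<in>carrier V. \<forall>b\<in>carrier V. \<forall>n. g (vs_prod V a n b) = vs_prod W (g a) n (g b))"

definition restrict_vsa :: "'v::complex_space vsa \<Rightarrow> 'v set \<Rightarrow> 'v vsa" where
  "restrict_vsa V U = V\<lparr>vs_grade := \<lambda>p. vs_grade V p \<inter> U\<rparr>"

definition vertex_subalgebra :: "'v::complex_space vsa \<Rightarrow> 'v set \<Rightarrow> bool" where
  "vertex_subalgebra V U \<longleftrightarrow> cvec.subspace U \<and> U \<subseteq> carrier V \<and> vs_vac V \<in> U \<and>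
    (\<forall>a\<in>U. \<forall>b\<in>U. \<forall>n. vs_prod V a n b \<in> U)"

definition generated_subalgebra :: "'v::complex_space vsa \<Rightarrow> 'v set \<Rightarrow> 'v vsa" where
  "generated_subalgebra V S = restrict_vsa V (\<Inter>{U. vertex_subalgebra V U \<and> S \<subseteq> U})"

text \<open>\<open>(a \<otimes> b)\<^sub>(\<^sub>n\<^sub>) (c \<otimes> d) = \<plusminus> \<Sum>i. a\<^sub>(\<^sub>i\<^sub>) c \<otimes> b\<^sub>(\<^sub>n\<^sub>-\<^sub>1\<^sub>-\<^sub>i\<^sub>) d\<close>
  with the Koszul sign of \<open>b\<close> and \<open>c\<close>, for two vertex superalgebras
  whose basis vectors are homogeneous.\<close>

definition tensor_vsa ::
  "('a \<Rightarrow>\<^sub>0 complex) vsa \<Rightarrow> ('b \<Rightarrow>\<^sub>0 complex) vsa \<Rightarrow> ('a \<times> 'b \<Rightarrow>\<^sub>0 complex) vsa" where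
  "tensor_vsa V W =
    \<lparr>vs_grade = (\<lambda>p. cvec.span {u \<otimes> w | u w r s.
        u \<in> vs_grade V r \<and> w \<in> vs_grade W s \<and> p = (r \<noteq> s)}),
     vs_vac = vs_vac V \<otimes> vs_vac W,
     vs_prod = (\<lambda>x n y.
       lin_ext (\<lambda>(a, b). lin_ext (\<lambda>(c, d).
         koszul (basis b \<in> vs_grade W True) (basis c \<in> vs_grade V True) *\<^sub>C
         Sum_any (\<lambda>i::int.
           vs_prod V (basis a) i (basis c) \<otimes> vs_prod W (basis b) (n - 1 - i) (basis d)))
       y) x)\<rparr>"


section \<open>Vertex superalgebras generated by fields\<close>

text \<open>A family \<open>A\<close> of operators stands for the field \<open>\<Sum>n. A n z^(-n-1)\<close>.\<close>

type_synonym 'v fld = "int \<Rightarrow> 'v \<Rightarrow> 'v"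

text \<open>The \<open>n\<close>-th product of fields,
  \<open>Res\<^sub>z (A(z) B(w) i\<^sub>z\<^sub>,\<^sub>w (z-w)^n - \<plusminus> B(w) A(z) i\<^sub>w\<^sub>,\<^sub>z (z-w)^n)\<close>;
  on a given vector only finitely many of the summands are non-zero.\<close>

definition fld_prod :: "bool \<Rightarrow> bool \<Rightarrow> 'v::complex_space fld \<Rightarrow> int \<Rightarrow> 'v fld \<Rightarrow> 'v fld" where
  "fld_prod p q A n B = (\<lambda>m v. Sum_any (\<lambda>j::nat. ((- 1) ^ j * (of_int n gchoose j)) *\<^sub>C
     (A (n - int j) (B (m + int j) v)
      - (koszul p q * (- 1) powi n) *\<^sub>C B (n + m - int j) (A (int j) v))))"

text \<open>The fields obtained from a set of generating fields (with their parities) and the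
  identity field by linear combinations and \<open>n\<close>-th products.\<close>

inductive gen_fld :: "(bool \<times> 'v::complex_space fld) set \<Rightarrow> bool \<Rightarrow> 'v fld \<Rightarrow> bool"
  for S where
  generator: "(p, A) \<in> S \<Longrightarrow> gen_fld S p A"
| identity: "gen_fld S False (\<lambda>n v. if n = - 1 then v else 0)"
| zero: "gen_fld S p (\<lambda>n v. 0)"
| add: "gen_fld S p A \<Longrightarrow> gen_fld S p B \<Longrightarrow> gen_fld S p (\<lambda>n v. A n v + B n v)"
| scale: "gen_fld S p A \<Longrightarrow> gen_fld S p (\<lambda>n v. c *\<^sub>C A n v)"
| prod: "gen_fld S p A \<Longrightarrow> gen_fld S q B \<Longrightarrow> gen_fld S (p \<noteq> q) (fld_prod p q A n B)"

text \<open>The vertex superalgebra generated by the fields in \<open>S\<close>: by the reconstruction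
  theorem, \<open>Y(a,z)\<close> is the unique field \<open>A(z)\<close> in the span of these fields with
  \<open>A(z) 1 = a + O(z)\<close>.\<close>

definition field_vsa ::
  "(bool \<Rightarrow> 'v::complex_space set) \<Rightarrow> 'v \<Rightarrow> (bool \<times> 'v fld) set \<Rightarrow> 'v vsa" where
  "field_vsa gr vac S =
    \<lparr>vs_grade = gr, vs_vac = vac,
     vs_prod = (\<lambda>a. THE A. \<exists>A0 A1. gen_fld S False A0 \<and> gen_fld S True A1 \<and>
       A = (\<lambda>n v. A0 n v + A1 n v) \<and> A (- 1) vac = a)\<rparr>"


section \<open>The universal affine vertex algebra of level \<open>-2\<close>\<close>

datatype sl2 = E | F | H

fun sl2_bracket :: "sl2 \<Rightarrow> sl2 \<Rightarrow> (sl2 \<Rightarrow>\<^sub>0 complex)" where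
  "sl2_bracket E F = basis H"
| "sl2_bracket F E = - basis H"
| "sl2_bracket H E = 2 *\<^sub>C basis E"
| "sl2_bracket E H = - (2 *\<^sub>C basis E)"
| "sl2_bracket H F = - (2 *\<^sub>C basis F)"
| "sl2_bracket F H = 2 *\<^sub>C basis F"
| "sl2_bracket E E = 0"
| "sl2_bracket F F = 0"
| "sl2_bracket H H = 0"

fun sl2_form :: "sl2 \<Rightarrow> sl2 \<Rightarrow> complex" where
  "sl2_form H H = 2"
| "sl2_form E F = 1"
| "sl2_form F E = 1"
| "sl2_form _ _ = 0"

text \<open>The basis \<open>x(n)\<close>, \<open>c\<close> of the affine Lie algebra.\<close>

datatype aff = Loop sl2 int | Central

fun aff_bracket :: "aff \<Rightarrow> aff \<Rightarrow> (aff \<Rightarrow>\<^sub>0 complex)" where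
  "aff_bracket (Loop x n) (Loop y m) =
     lin_ext (\<lambda>z. basis (Loop z (n + m))) (sl2_bracket x y)
     + (if n + m = 0 then (of_int n * sl2_form x y) *\<^sub>C basis Central else 0)"
| "aff_bracket Central _ = 0"
| "aff_bracket _ Central = 0"

text \<open>\<open>aff list \<Rightarrow>\<^sub>0 complex\<close> is the tensor algebra of the affine Lie algebra, a word being the
  product of its letters. The first set below spans the ideal with quotient the
  enveloping algebra; with the other two it spans the kernel of the map
  \<open>u \<mapsto> u \<otimes> v\<^sub>k\<close> onto \<open>N(k\<Lambda>\<^sub>0)\<close>.\<close>

definition verma_kernel :: "complex \<Rightarrow> (aff list \<Rightarrow>\<^sub>0 complex) set" where
  "verma_kernel k = cvec.span
    ({lin_ext (\<lambda>r. basis (u @ r @ w))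
        (basis [a, b] - basis [b, a] - lin_ext (\<lambda>c. basis [c]) (aff_bracket a b)) | u a b w. True}
     \<union> {basis (u @ [Loop x n]) | u x n. n \<ge> 0}
     \<union> {basis (u @ [Central]) - k *\<^sub>C basis u | u. True})"

quotient_type affine_vac = "aff list \<Rightarrow>\<^sub>0 complex" / "\<lambda>p q. p - q \<in> verma_kernel (- 2)"
proof (rule equivpI)
  show "reflp (\<lambda>p q. p - q \<in> verma_kernel (- 2))"
    by (auto intro!: reflpI simp: verma_kernel_def cvec.span_zero)
  show "symp (\<lambda>p q. p - q \<in> verma_kernel (- 2))"
    unfolding verma_kernel_def by (rule sympI, drule cvec.span_neg) simp
  show "transp (\<lambda>p q. p - q \<in> verma_kernel (- 2))"
    unfolding verma_kernel_def by (rule transpI, drule (1) cvec.span_add) simp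
qed

instantiation affine_vac :: complex_space
begin
lift_definition zero_affine_vac :: affine_vac is 0 .
lift_definition plus_affine_vac :: "affine_vac \<Rightarrow> affine_vac \<Rightarrow> affine_vac" is "(+)"
  unfolding verma_kernel_def by (drule (1) cvec.span_add) (simp add: algebra_simps)
lift_definition uminus_affine_vac :: "affine_vac \<Rightarrow> affine_vac" is uminus
  unfolding verma_kernel_def by (drule cvec.span_neg) (simp add: algebra_simps)
lift_definition minus_affine_vac :: "affine_vac \<Rightarrow> affine_vac \<Rightarrow> affine_vac" is "(-)"
  unfolding verma_kernel_def by (drule (1) cvec.span_diff) (simp add: algebra_simps)
lift_definition scaleC_affine_vac :: "complex \<Rightarrow> affine_vac \<Rightarrow> affine_vac" is scaleC
  unfolding verma_kernel_def by (drule cvec.span_scale) (simp add: cvec.scale_right_diff_distrib)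
instance
  by standard (transfer; simp add: verma_kernel_def cvec.span_zero
      algebra_simps scaleC_add_right scaleC_add_left scaleC_scaleC scaleC_one)+
end

lemma verma_kernel_left_ideal:
  assumes "p \<in> verma_kernel k"
  shows "lin_ext (\<lambda>w. basis (a # w)) p \<in> verma_kernel k"
  using assms unfolding verma_kernel_def
proof (induction rule: cvec.span_induct_alt)
  case base
  then show ?case
    by (simp add: lin_ext_def cvec.span_zero)
next
  case (step c x y)
  let ?L = "lin_ext (\<lambda>w. basis (a # w))"
  from step.hyps(1) have "?L x \<in> verma_kernel k"
  proof (elim UnE)
    assume "x \<in> {lin_ext (\<lambda>r. basis (u @ r @ w))
        (basis [a, b] - basis [b, a] - lin_ext (\<lambda>c. basis [c]) (aff_bracket a b)) | u a b w. True}"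
    then obtain u b d w where x: "x = lin_ext (\<lambda>r. basis (u @ r @ w))
        (basis [b, d] - basis [d, b] - lin_ext (\<lambda>c. basis [c]) (aff_bracket b d))" by blast
    have "?L x = lin_ext (\<lambda>r. basis ((a # u) @ r @ w))
        (basis [b, d] - basis [d, b] - lin_ext (\<lambda>c. basis [c]) (aff_bracket b d))"
      unfolding x by (subst lin_ext_lin_ext) simp
    then show ?thesis
      unfolding verma_kernel_def by (intro cvec.span_base UnI1) blast
  next
    assume "x \<in> {basis (u @ [Loop x n]) | u x n. n \<ge> 0}"
    then obtain u z n where x: "x = basis (u @ [Loop z n])" and n: "n \<ge> 0" by blast
    have "?L x = basis ((a # u) @ [Loop z n])" by (simp add: x)
    with n show ?thesis
      unfolding verma_kernel_def by (intro cvec.span_base UnI1 UnI2) blast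
  next
    assume "x \<in> {basis (u @ [Central]) - k *\<^sub>C basis u | u. True}"
    then obtain u where x: "x = basis (u @ [Central]) - k *\<^sub>C basis u" by blast
    have "?L x = basis ((a # u) @ [Central]) - k *\<^sub>C basis (a # u)"
      by (simp add: x lin_ext_diff lin_ext_scale)
    then show ?thesis
      unfolding verma_kernel_def by (intro cvec.span_base UnI2) blast
  qed
  then show ?case
    using step.IH unfolding verma_kernel_def lin_ext_add lin_ext_scale
    by (intro cvec.span_add cvec.span_scale)
qed

text \<open>The action of \<open>x(n)\<close> on \<open>N(-2\<Lambda>\<^sub>0)\<close>.\<close>

lift_definition aff_act :: "aff \<Rightarrow> affine_vac \<Rightarrow> affine_vac"
  is "\<lambda>a. lin_ext (\<lambda>w. basis (a # w))"
  by (metis lin_ext_diff verma_kernel_left_ideal)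

lift_definition affine_vacuum :: affine_vac is "basis []" .

definition universal_affine :: "affine_vac vsa" where
  "universal_affine = field_vsa (\<lambda>p. if p then {0} else UNIV) affine_vacuum
     {(False, \<lambda>n. aff_act (Loop x n)) | x. True}"


section \<open>The fermionic vertex superalgebra\<close>

text \<open>The key \<open>(s, n)\<close> stands for \<open>\<Psi>\<^sup>+(-n-1/2)\<close> (\<open>s = True\<close>) or \<open>\<Psi>\<^sup>-(-n-1/2)\<close>
  (\<open>s = False\<close>), and a finite set of keys for the product of these operators, in increasing
  order, applied to the vacuum. The operator \<open>\<Psi>\<^sup>s(n+1/2)\<close> is \<open>psi s n\<close>. Thus for
  \<open>n \<ge> 0\<close> it is dual to the creation operator with the opposite sign.\<close>

definition precedes :: "bool \<times> nat \<Rightarrow> bool \<times> nat \<Rightarrow> bool" where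
  "precedes x y \<longleftrightarrow> snd x < snd y \<or> (snd x = snd y \<and> fst x < fst y)"

definition fermi_sign :: "bool \<times> nat \<Rightarrow> (bool \<times> nat) fset \<Rightarrow> complex" where
  "fermi_sign x S = (- 1) ^ card {y. y |\<in>| S \<and> precedes y x}"

type_synonym fock = "(bool \<times> nat) fset \<Rightarrow>\<^sub>0 complex"

definition create :: "bool \<times> nat \<Rightarrow> fock \<Rightarrow> fock" where
  "create x = lin_ext (\<lambda>S. if x |\<in>| S then 0 else fermi_sign x S *\<^sub>C basis (finsert x S))"

definition annihilate :: "bool \<times> nat \<Rightarrow> fock \<Rightarrow> fock" where
  "annihilate x = lin_ext (\<lambda>S. if x |\<in>| S then fermi_sign x S *\<^sub>C basis (S |-| {|x|}) else 0)"

definition psi :: "bool \<Rightarrow> fock fld" where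
  "psi s n = (if n < 0 then create (s, nat (- n - 1)) else annihilate (\<not> s, nat n))"

definition fermi_vac :: fock where
  "fermi_vac = basis {||}"

lemma fermi_sign_finsert:
  "x |\<notin>| S \<Longrightarrow> fermi_sign z (finsert x S) = (if precedes x z then - 1 else 1) * fermi_sign z S"
proof -
  assume x: "x |\<notin>| S"
  have fin: "finite {y. y |\<in>| S \<and> precedes y z}"
    by (rule finite_subset[of _ "fset S"]) auto
  have "{y. y |\<in>| finsert x S \<and> precedes y z} =
      (if precedes x z then insert x {y. y |\<in>| S \<and> precedes y z} else {y. y |\<in>| S \<and> precedes y z})"
    by auto
  then show ?thesis
    using x fin by (simp add: fermi_sign_def)
qed

lemma fermi_sign_fminus:
  "x |\<in>| S \<Longrightarrow> fermi_sign z (S |-| {|x|}) = (if precedes x z then - 1 else 1) * fermi_sign z S"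
  using fermi_sign_finsert[of x "S |-| {|x|}" z] by (auto simp: finsert_absorb)

lemma precedes_antisym: "x \<noteq> y \<Longrightarrow> precedes y x \<longleftrightarrow> \<not> precedes x y"
  by (auto simp: precedes_def prod_eq_iff)

lemma precedes_irrefl [simp]: "\<not> precedes x x"
  by (simp add: precedes_def)

lemma fermi_sign_square [simp]: "fermi_sign x S * fermi_sign x S = 1"
  by (simp add: fermi_sign_def flip: power_add mult_2)

lemma create_basis: "create x (basis S) =
    (if x |\<in>| S then 0 else fermi_sign x S *\<^sub>C basis (finsert x S))"
  by (simp add: create_def)

lemma annihilate_basis: "annihilate x (basis S) =
    (if x |\<in>| S then fermi_sign x S *\<^sub>C basis (S |-| {|x|}) else 0)"
  by (simp add: annihilate_def)

lemma create_simps [simp]: "create x 0 = 0" "create x (c *\<^sub>C v) = c *\<^sub>C create x v"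
  "create x (u + v) = create x u + create x v"
  by (simp_all add: create_def lin_ext_scale lin_ext_add)

lemma annihilate_simps [simp]: "annihilate x 0 = 0" "annihilate x (c *\<^sub>C v) = c *\<^sub>C annihilate x v"
  "annihilate x (u + v) = annihilate x u + annihilate x v"
  by (simp_all add: annihilate_def lin_ext_scale lin_ext_add)

lemma create_create_basis:
  "create x (create y (basis S)) + create y (create x (basis S)) = 0"
proof (cases "x = y")
  case False
  have "finsert x (finsert y S) = finsert y (finsert x S)" by auto
  then show ?thesis
    using False precedes_antisym[OF False]
    by (cases "precedes x y") (simp_all add: create_basis fermi_sign_finsert scaleC_scaleC mult.commute)
qed (simp add: create_basis)

lemma annihilate_annihilate_basis:
  "annihilate x (annihilate y (basis S)) + annihilate y (annihilate x (basis S)) = 0"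
proof (cases "x = y")
  case False
  have "S |-| {|y|} |-| {|x|} = S |-| {|x|} |-| {|y|}" by auto
  then show ?thesis
    using False precedes_antisym[OF False]
    by (cases "precedes x y") (simp_all add: annihilate_basis fermi_sign_fminus scaleC_scaleC mult.commute)
qed (simp add: annihilate_basis)

lemma create_annihilate_basis:
  "create x (annihilate y (basis S)) + annihilate y (create x (basis S))
    = (if x = y then basis S else 0)"
proof (cases "x = y")
  case True
  then show ?thesis
    by (auto simp: annihilate_basis create_basis fermi_sign_fminus fermi_sign_finsert
        scaleC_scaleC scaleC_one finsert_absorb)
next
  case False
  have "finsert x (S |-| {|y|}) = finsert x S |-| {|y|}"
    using False by auto
  then show ?thesis
    using False precedes_antisym[OF False]
    by (cases "precedes x y")
       (simp_all add: annihilate_basis create_basis fermi_sign_fminus fermi_sign_finsert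
         scaleC_scaleC mult.commute)
qed

text \<open>\<open>fock\<close> is an irreducible module over the Clifford algebra.\<close>

theorem psi_anticommutator:
  "psi s n (psi t m v) + psi t m (psi s n v) = (if s \<noteq> t \<and> n + m = - 1 then v else 0)"
proof -
  have on_basis: "psi s n (psi t m (basis S)) + psi t m (psi s n (basis S)) =
      (if s \<noteq> t \<and> n + m = - 1 then basis S else 0)" for S
  proof -
    have "(s, nat (- n - 1)) = (\<not> t, nat m) \<longleftrightarrow> s \<noteq> t \<and> n + m = - 1" if "n < 0" "m \<ge> 0"
      using that by auto
    moreover have "(t, nat (- m - 1)) = (\<not> s, nat n) \<longleftrightarrow> s \<noteq> t \<and> n + m = - 1"
      if "m < 0" "n \<ge> 0"
      using that by auto
    ultimately show ?thesis
      using create_annihilate_basis[of "(s, nat (- n - 1))" "(\<not> t, nat m)" S]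
        create_annihilate_basis[of "(t, nat (- m - 1))" "(\<not> s, nat n)" S]
      by (cases "n < 0"; cases "m < 0")
         (simp_all add: psi_def create_create_basis annihilate_annihilate_basis add.commute
           del: prod.inject)
  qed
  have comp: "psi s n (psi t m v) = lin_ext (\<lambda>S. psi s n (psi t m (basis S))) v" for s n t m
    by (simp add: psi_def create_def annihilate_def lin_ext_lin_ext)
  have "psi s n (psi t m v) + psi t m (psi s n v) =
      lin_ext (\<lambda>S. psi s n (psi t m (basis S)) + psi t m (psi s n (basis S))) v"
    unfolding comp[of s n t m] comp[of t m s n] by (rule lin_ext_plus)
  then show ?thesis
    by (cases "s \<noteq> t \<and> n + m = - 1")
       (simp_all only: on_basis if_True if_False lin_ext_basis_self, simp_all add: lin_ext_def)
qed

theorem psi_vacuum: "n \<ge> 0 \<Longrightarrow> psi s n fermi_vac = 0"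
  by (simp add: psi_def fermi_vac_def annihilate_basis)

lemma basis_if_vacuum:
  assumes "cvec.subspace U" "\<And>s n v. v \<in> U \<Longrightarrow> psi s n v \<in> U" "fermi_vac \<in> U"
  shows "basis S \<in> U"
proof (induction S rule: fset_induct_stronger)
  case (insert x S)
  have "psi (fst x) (- int (snd x) - 1) (basis S) = fermi_sign x S *\<^sub>C basis (finsert x S)"
    using insert by (simp add: psi_def create_basis)
  then have "fermi_sign x S *\<^sub>C basis (finsert x S) \<in> U"
    using assms(2)[OF insert.IH] by metis
  from cvec.subspace_scale[OF assms(1) this, of "fermi_sign x S"]
  show ?case by (simp add: scaleC_scaleC scaleC_one)
qed (use assms in \<open>simp add: fermi_vac_def\<close>)

theorem fock_irreducible:
  assumes U: "cvec.subspace U" "\<And>s n v. v \<in> U \<Longrightarrow> psi s n v \<in> U"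
  shows "U = {0} \<or> U = UNIV"
proof (rule disjCI)
  assume "U \<noteq> UNIV"
  have ann: "annihilate x v \<in> U" if "v \<in> U" for x v
    using U(2)[OF that, of "\<not> fst x" "int (snd x)"] by (simp add: psi_def)
  have vac: "fermi_vac \<notin> U"
  proof
    assume "fermi_vac \<in> U"
    then have "lin_ext basis v \<in> U" for v :: fock
      unfolding lin_ext_def
      by (intro cvec.subspace_sum cvec.subspace_scale basis_if_vacuum U)
    then show False using \<open>U \<noteq> UNIV\<close> by auto
  qed
  have "v = 0" if "v \<in> U" "\<forall>S\<in>Poly_Mapping.keys v. fcard S \<le> N" for v N
    using that
  proof (induction N arbitrary: v)
    case 0
    then have *: "Poly_Mapping.keys v \<subseteq> {{||}}" by auto
    have "v = lin_ext basis v" by simp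
    also have "\<dots> = (\<Sum>k\<in>{{||}}. Poly_Mapping.lookup v k *\<^sub>C basis k)"
      unfolding lin_ext_def by (rule sum.mono_neutral_left) (use * in \<open>auto simp: in_keys_iff\<close>)
    finally have v: "v = Poly_Mapping.lookup v {||} *\<^sub>C fermi_vac" by (simp add: fermi_vac_def)
    show ?case
    proof (rule ccontr)
      assume "v \<noteq> 0"
      then have nz: "Poly_Mapping.lookup v {||} \<noteq> 0" using v by (metis cvec.scale_zero_left)
      have "(1 / Poly_Mapping.lookup v {||}) *\<^sub>C v \<in> U"
        using U 0 by (intro cvec.subspace_scale)
      also have "(1 / Poly_Mapping.lookup v {||}) *\<^sub>C v = fermi_vac"
        by (subst v) (simp add: nz scaleC_scaleC scaleC_one)
      finally show False using vac by simp
    qed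
  next
    case (Suc N)
    have "annihilate x v = 0" for x
    proof (rule Suc.IH)
      show "annihilate x v \<in> U" using Suc ann by blast
      show "\<forall>S\<in>Poly_Mapping.keys (annihilate x v). fcard S \<le> N"
      proof
        fix S assume "S \<in> Poly_Mapping.keys (annihilate x v)"
        then obtain R where R: "R \<in> Poly_Mapping.keys v"
          "Poly_Mapping.lookup (Poly_Mapping.lookup v R *\<^sub>C annihilate x (basis R)) S \<noteq> 0"
          unfolding annihilate_def lin_ext_def[of _ v] in_keys_iff lookup_sum
          by (auto elim!: sum.not_neutral_contains_not_neutral)
        then have "x |\<in>| R" "S = R |-| {|x|}"
          by (auto simp: annihilate_basis scaleC_poly_mapping.rep_eq scaleC_complex_def
              lookup_single when_def split: if_splits)
        then show "fcard S \<le> N" using Suc.prems(2) R(1)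
          by (metis Suc_le_mono fcard_Suc_fminus1)
      qed
    qed
    note zero = this
    have coeff: "Poly_Mapping.lookup v S = 0" if "x |\<in>| S" for x S
    proof -
      have proj: "create x (annihilate x (basis R)) = (if x |\<in>| R then basis R else 0)" for R
        by (auto simp: create_basis annihilate_basis fermi_sign_fminus scaleC_scaleC scaleC_one
            finsert_absorb)
      have "create x (annihilate x v) = lin_ext (\<lambda>R. create x (annihilate x (basis R))) v"
        by (simp add: create_def annihilate_def lin_ext_lin_ext)
      then have "0 = Poly_Mapping.lookup (lin_ext (\<lambda>R. if x |\<in>| R then basis R else 0) v) S"
        by (simp only: zero proj create_simps lookup_zero)
      also have "\<dots> = (\<Sum>l\<in>Poly_Mapping.keys v. Poly_Mapping.lookup v l * (if l = S then 1 else 0))"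
        unfolding lin_ext_def lookup_sum
        by (rule sum.cong) (use that in \<open>auto simp: scaleC_poly_mapping.rep_eq scaleC_complex_def
            lookup_single when_def\<close>)
      also have "\<dots> = Poly_Mapping.lookup v S"
        by (simp add: in_keys_iff if_distrib[of "\<lambda>t. _ * t"] cong: if_cong)
      finally show ?thesis by simp
    qed
    have "\<forall>S\<in>Poly_Mapping.keys v. fcard S \<le> N"
    proof
      fix S assume S: "S \<in> Poly_Mapping.keys v"
      then have "S = {||}" using coeff by (metis all_not_fin_conv in_keys_iff)
      then show "fcard S \<le> N" by (simp add: fcard.rep_eq)
    qed
    then show ?case using Suc by blast
  qed
  moreover have "\<exists>N. \<forall>S\<in>Poly_Mapping.keys v. fcard S \<le> N" for v :: fock
    by (metis Max_ge finite_imageI finite_keys imageI)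
  ultimately have "U \<subseteq> {0}" by blast
  then show "U = {0}" using cvec.subspace_0[OF U(1)] by auto
qed

definition fermions :: "fock vsa" where
  "fermions = field_vsa (\<lambda>p. cvec.span {basis S | S. odd (fcard S) = p}) fermi_vac
     {(True, psi s) | s. True}"


section \<open>The commutative vertex algebra \<open>M(0)\<close>\<close>

text \<open>\<open>comm_poly\<close> is the polynomial ring in the variables \<open>\<gamma>\<^sup>+(-n-1)\<close> (\<open>s = True\<close>) and
  \<open>\<gamma>\<^sup>-(-n-1)\<close> (\<open>s = False\<close>), \<open>n :: nat\<close>.\<close>

type_synonym comm_poly = "((bool \<times> nat) \<Rightarrow>\<^sub>0 nat) \<Rightarrow>\<^sub>0 complex"

definition gam :: "bool \<Rightarrow> int \<Rightarrow> comm_poly" where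
  "gam s n = (if n < 0 then basis (Poly_Mapping.single (s, nat (- n - 1)) 1) else 0)"

definition comm_va :: "comm_poly vsa" where
  "comm_va = field_vsa (\<lambda>p. if p then {0} else UNIV) 1 {(False, \<lambda>n v. gam s n * v) | s. True}"


section \<open>The vertex superalgebra generated by \<open>\<tau>\<^sup>\<plusminus>\<close>, \<open>j\<close>, \<open>\<nu>\<close>\<close>

type_synonym fm_space = "(bool \<times> nat) fset \<times> ((bool \<times> nat) \<Rightarrow>\<^sub>0 nat) \<Rightarrow>\<^sub>0 complex"

definition tau :: "bool \<Rightarrow> fm_space" where
  "tau s = psi s (- 2) fermi_vac \<otimes> 1 + psi s (- 1) fermi_vac \<otimes> gam s (- 1)"

definition j_vec :: fm_space where
  "j_vec = fermi_vac \<otimes> ((1 / 2) *\<^sub>C (gam True (- 1) - gam False (- 1)))"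

definition nu_vec :: fm_space where
  "nu_vec = fermi_vac \<otimes> ((1 / 4) *\<^sub>C
     (2 *\<^sub>C (gam True (- 1) * gam False (- 1)) + gam True (- 2) + gam False (- 2)))"

definition calV :: "fm_space vsa" where
  "calV = generated_subalgebra (tensor_vsa fermions comm_va) {tau True, tau False, j_vec, nu_vec}"

text \<open>\<open>G_mode s n\<close> is \<open>G\<^sup>s(n+1/2)\<close>, the coefficient of \<open>z^(-n-2)\<close>.\<close>

definition G_mode :: "bool \<Rightarrow> int \<Rightarrow> fm_space \<Rightarrow> fm_space" where
  "G_mode s n = vs_prod calV (tau s) (n + 1)"

definition T_mode :: "int \<Rightarrow> fm_space \<Rightarrow> fm_space" where
  "T_mode n = vs_prod calV j_vec n"


section \<open>The lattice vertex superalgebra \<open>F\<^sub>-\<^sub>1\<close>\<close>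

text \<open>The basis vector with key \<open>(\<mu>, m)\<close> is
  \<open>(\<Prod>i. \<beta>(-i-1)^(\<mu> i)) e^(m\<beta>)\<close>. The operators \<open>\<beta>(n)\<close> satisfy
  \<open>[\<beta>(n), \<beta>(m)] = n \<langle>\<beta>,\<beta>\<rangle> \<delta>\<^sub>n\<^sub>+\<^sub>m\<^sub>,\<^sub>0\<close> and \<open>\<beta>(0) e^(m\<beta>) = \<langle>\<beta>,m\<beta>\<rangle> e^(m\<beta>)\<close>.\<close>

type_synonym lattice_space = "(nat \<Rightarrow>\<^sub>0 nat) \<times> int \<Rightarrow>\<^sub>0 complex"

definition beta_form :: "int \<Rightarrow> int \<Rightarrow> int" where
  "beta_form m n = - (m * n)"

definition beta :: "int \<Rightarrow> lattice_space \<Rightarrow> lattice_space" where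
  "beta n = lin_ext (\<lambda>(\<mu>, m).
     if n < 0 then basis (\<mu> + Poly_Mapping.single (nat (- n - 1)) 1, m)
     else if n = 0 then of_int (beta_form 1 m) *\<^sub>C basis (\<mu>, m)
     else (of_int (n * beta_form 1 1) * of_nat (Poly_Mapping.lookup \<mu> (nat (n - 1)))) *\<^sub>C
            basis (\<mu> - Poly_Mapping.single (nat (n - 1)) 1, m))"

definition e_vec :: "int \<Rightarrow> lattice_space" where
  "e_vec m = basis (0, m)"

text \<open>\<open>pow_coeff a l k\<close> and \<open>exp_coeff a k\<close> are the coefficients of \<open>x^k\<close> in
  \<open>X^l\<close> and in \<open>exp X\<close>, where \<open>X = \<Sum>i\<ge>1. a i x^i\<close>.\<close>

fun pow_coeff :: "(nat \<Rightarrow> 'v \<Rightarrow> 'v) \<Rightarrow> nat \<Rightarrow> nat \<Rightarrow> 'v \<Rightarrow> 'v::complex_space" where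
  "pow_coeff a 0 k v = (if k = 0 then v else 0)"
| "pow_coeff a (Suc l) k v = (\<Sum>i=1..k. a i (pow_coeff a l (k - i) v))"

definition exp_coeff :: "(nat \<Rightarrow> 'v \<Rightarrow> 'v) \<Rightarrow> nat \<Rightarrow> 'v \<Rightarrow> 'v::complex_space" where
  "exp_coeff a k v = (\<Sum>l\<le>k. (1 / fact l) *\<^sub>C pow_coeff a l k v)"

text \<open>The modes of
  \<open>Y(e^(m\<beta>),z) = exp(\<Sum>i>0. m\<beta>(-i)/i z^i) exp(-\<Sum>i>0. m\<beta>(i)/i z^(-i)) e\<^sub>m\<^sub>\<beta> z^(m\<beta>(0))\<close>,
  where \<open>e\<^sub>m\<^sub>\<beta> e^(n\<beta>) = \<epsilon>(m\<beta>,n\<beta>) e^((m+n)\<beta>)\<close> with \<open>\<epsilon>(m\<beta>,n\<beta>) = (-1)^(mn)\<close>. The coefficient of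
  \<open>z^(-k-1)\<close> takes \<open>z^(-q)\<close> from the second exponential and \<open>z^p\<close> from the first, where
  \<open>p - q + \<langle>m\<beta>,n\<beta>\<rangle> = -k-1\<close>.\<close>

definition vertex_op :: "int \<Rightarrow> lattice_space fld" where
  "vertex_op m k = lin_ext (\<lambda>(\<mu>, n).
     (- 1) powi (m * n) *\<^sub>C
     Sum_any (\<lambda>q::nat. let p = int q - beta_form m n - k - 1 in
        if p < 0 then 0 else
        exp_coeff (\<lambda>i v. (of_int m / of_nat i) *\<^sub>C beta (- int i) v) (nat p)
          (exp_coeff (\<lambda>i v. (- of_int m / of_nat i) *\<^sub>C beta (int i) v) q
            (basis (\<mu>, m + n)))))"

definition lattice_vsa :: "lattice_space vsa" where
  "lattice_vsa = field_vsa (\<lambda>p. cvec.span {basis (\<mu>, m) | \<mu> m. odd m = p}) (e_vec 0)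
     ({(False, beta)} \<union> {(odd m, vertex_op m) | m. True})"


section \<open>The vertex superalgebra \<open>\<V> \<otimes> F\<^sub>-\<^sub>1\<close>\<close>

text \<open>As \<open>\<V>\<close> is a subalgebra of \<open>F \<otimes> M(0)\<close>, this is a subalgebra of
  \<open>(F \<otimes> M(0)) \<otimes> F\<^sub>-\<^sub>1\<close>.\<close>

definition calV_lattice ::
  "(((bool \<times> nat) fset \<times> ((bool \<times> nat) \<Rightarrow>\<^sub>0 nat)) \<times> ((nat \<Rightarrow>\<^sub>0 nat) \<times> int) \<Rightarrow>\<^sub>0 complex) vsa" where
  "calV_lattice = restrict_vsa (tensor_vsa (tensor_vsa fermions comm_va) lattice_vsa)
     (cvec.span {v \<otimes> w | v w. v \<in> carrier calV \<and> w \<in> carrier lattice_vsa})"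

end

theory Submission
  imports Defs
begin

text \<open>A homomorphism from \<open>N(-2\<Lambda>\<^sub>0)\<close> into a vertex superalgebra is given by the images of
  \<open>e\<close>, \<open>f\<close>, \<open>h\<close>, any three even vectors whose modes satisfy the relations of the affine Lie
  algebra at level \<open>-2\<close>. By Borcherds' commutator formula these relations can be read off from
  the products \<open>a\<^sub>(\<^sub>n\<^sub>)b\<close> with \<open>n \<ge> 0\<close>. In \<open>F \<otimes> M(0)\<close> one has
  \<open>\<tau>\<^sup>+\<^sub>(\<^sub>1\<^sub>)\<tau>\<^sup>- = 2 j\<close>, \<open>\<tau>\<^sup>+\<^sub>(\<^sub>2\<^sub>)\<tau>\<^sup>- = -2\<close>, \<open>\<tau>\<^sup>+\<^sub>(\<^sub>n\<^sub>)\<tau>\<^sup>- = 0\<close> for \<open>n \<ge> 3\<close>, and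
  \<open>\<tau>\<^sup>\<plusminus>\<^sub>(\<^sub>n\<^sub>)\<tau>\<^sup>\<plusminus> = 0\<close> for \<open>n \<ge> -1\<close>, and all products \<open>j\<^sub>(\<^sub>n\<^sub>)x\<close> with \<open>n \<ge> 0\<close> vanish. Since the
  product of the fields of \<open>e^\<beta>\<close> and \<open>e^(-\<beta>)\<close> has a zero of order one at \<open>z = w\<close>, and the square of either a
  simple pole, the relations of \<open>e\<close> and \<open>f\<close> follow. The map is not trivial: if the image of
  \<open>e\<close> were a multiple of the vacuum, \<open>h\<^sub>(\<^sub>0\<^sub>)e = 2 e\<close> would force it to be zero, which
  contradicts \<open>e\<^sub>(\<^sub>1\<^sub>)f = -2\<close>.\<close>

text \<open>The products of \<open>universal_affine\<close>, \<open>fermions\<close>,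
  \<open>comm_va\<close> and \<open>lattice_vsa\<close> are given by a definite description, so
  nothing can be computed in them before it is known that each state has exactly one generated
  field. This reconstruction theorem rests on Dong's lemma and on Goddard's uniqueness theorem and
  is proved once, for any local, covariant and cyclic family of fields. Each of the four algebras
  then only has to supply a grading, a translation operator, locality of its generators and
  cyclicity. As \<open>vsa_hom\<close> asks both sides to satisfy all axioms, tensor products and
  subalgebras are treated too. All calculations are made with modes: a family in two integer indices
  replaces a distribution in two variables, and multiplication by z - w becomes a difference
  operator. The level is the same in both places where it shows: in \<open>e_(1) f\<close> the
  Koszul sign and the cocycle sign cancel and leave the constant -2 of the product of the two tau's,
  while \<open>h_(1) h\<close> is 4 times <beta, beta> = -1, that is -2 times (h, h) = 2.\<close>

lemmas scaleC_simps = scaleC_add_right scaleC_add_left scaleC_scaleC scaleC_one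
  cvec.scale_right_diff_distrib cvec.scale_left_diff_distrib cvec.scale_minus_left
  cvec.scale_minus_right cvec.scale_zero_left cvec.scale_zero_right

section \<open>Linear maps over the complex numbers and Koszul signs\<close>

lemma clinear_iff:
  "clinear f \<longleftrightarrow> (\<forall>u v. f (u + v) = f u + f v) \<and> (\<forall>c u. f (c *\<^sub>C u) = c *\<^sub>C f u)"
  unfolding Vector_Spaces.linear_def module_hom_def module_hom_axioms_def
  by (auto simp: cvec.module_axioms cvec.vector_space_axioms)

lemma clinearI:
  "(\<And>u v. f (u + v) = f u + f v) \<Longrightarrow> (\<And>c u. f (c *\<^sub>C u) = c *\<^sub>C f u) \<Longrightarrow> clinear f"
  by (simp add: clinear_iff)

lemma clinear_add: "clinear f \<Longrightarrow> f (u + v) = f u + f v"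
  and clinear_scale: "clinear f \<Longrightarrow> f (c *\<^sub>C u) = c *\<^sub>C f u"
  by (simp_all add: clinear_iff)

lemma clinear_0: "clinear f \<Longrightarrow> f 0 = 0"
  using clinear_scale[of f 0 0] by simp

lemma clinear_minus: "clinear f \<Longrightarrow> f (- u) = - f u"
  using clinear_scale[of f "- 1" u] by (simp add: scaleC_simps)

lemma clinear_diff: "clinear f \<Longrightarrow> f (u - v) = f u - f v"
  using clinear_add[of f u "- v"] by (simp add: clinear_minus)

lemma clinear_sum: "clinear f \<Longrightarrow> f (sum g A) = (\<Sum>x\<in>A. f (g x))"
  by (induction A rule: infinite_finite_induct) (simp_all add: clinear_0 clinear_add)

lemmas clinear_simps = clinear_add clinear_scale clinear_0 clinear_minus clinear_diff clinear_sum

lemma koszul_simps [simp]: "koszul False q = 1" "koszul p False = 1" "koszul True True = - 1"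
  by (simp_all add: koszul_def)

lemma koszul_commute: "koszul p q = koszul q p"
  and koszul_square: "koszul p q * koszul p q = 1"
  and koszul_neq: "koszul r (p \<noteq> q) = koszul r p * koszul r q"
  by (auto simp: koszul_def)

lemma gbinomial_Suc_Suc': "(1 + a) gchoose Suc k = (a gchoose k) + (a gchoose Suc k)"
  using gbinomial_Suc_Suc[of a k] by (simp add: add.commute)

section \<open>Formal distributions in two variables\<close>

text \<open>A function \<open>f\<close> of two integers stands for \<open>\<Sum>m k. f m k z^(-m-1) w^(-k-1)\<close>. Then
  \<open>del f\<close> is its product with \<open>z - w\<close>.\<close>

definition del :: "(int \<Rightarrow> int \<Rightarrow> 'v::ab_group_add) \<Rightarrow> int \<Rightarrow> int \<Rightarrow> 'v" where
  "del f = (\<lambda>m k. f (m + 1) k - f m (k + 1))"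

lemma del_apply: "del f m k = f (m + 1) k - f m (k + 1)"
  by (simp add: del_def)

lemma del_pow_0: "(del ^^ N) (\<lambda>_ _. 0) = (\<lambda>_ _. 0)"
  by (induction N) (auto simp: del_def)

lemma del_pow_diff:
  "(del ^^ N) (\<lambda>m k. f m k - g m k) = (\<lambda>m k. (del ^^ N) f m k - (del ^^ N) g m k)"
  by (induction N) (auto simp: del_def algebra_simps fun_eq_iff)

lemma del_pow_add:
  "(del ^^ N) (\<lambda>m k. f m k + g m k) = (\<lambda>m k. (del ^^ N) f m k + (del ^^ N) g m k)"
  by (induction N) (auto simp: del_def algebra_simps fun_eq_iff)

lemma del_pow_clinear:
  "clinear L \<Longrightarrow> (del ^^ N) (\<lambda>m k. L (f m k)) = (\<lambda>m k. L ((del ^^ N) f m k))"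
  by (induction N) (auto simp: del_def clinear_diff)

lemma clinear_scaleC: "clinear ((*\<^sub>C) c)"
  by (rule clinearI) (simp_all add: scaleC_simps mult.commute)

lemmas del_pow_scale = del_pow_clinear[OF clinear_scaleC]

lemma del_pow_mono:
  assumes "(del ^^ N) f = (\<lambda>_ _. 0)" "N \<le> M"
  shows "(del ^^ M) f = (\<lambda>_ _. 0)"
proof -
  have "(del ^^ M) f = (del ^^ (M - N)) ((del ^^ N) f)"
    using assms(2) by (simp flip: funpow_add[unfolded fun_eq_iff comp_def, rule_format])
  then show ?thesis by (simp add: assms(1) del_pow_0)
qed

text \<open>Exchanging the two variables turns z - w into its negative, so an odd power changes
  sign.\<close>

lemma del_pow_swap:
  "(del ^^ N) (\<lambda>m k. f k m) = (\<lambda>m k. (if odd N then - ((del ^^ N) f k m) else (del ^^ N) f k m))"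
  by (induction N) (auto simp: del_def fun_eq_iff)

text \<open>The binomial theorem for (z - w)^N. The right-hand side has the shape in which locality
  is stated in \<open>vertex_superalgebra\<close>, so that axiom can be read as the vanishing of a
  power of \<open>del\<close>.\<close>

lemma del_pow_eq_sum:
  fixes f :: "int \<Rightarrow> int \<Rightarrow> 'v::complex_space"
  shows "(del ^^ N) f m k =
    (\<Sum>i\<le>N. ((- 1) ^ i * of_nat (N choose i)) *\<^sub>C f (m + int (N - i)) (k + int i))"
proof (induction N arbitrary: m k)
  case 0
  then show ?case by (simp add: scaleC_simps)
next
  case (Suc N)
  let ?t = "\<lambda>c i. ((- 1) ^ i * of_nat c) *\<^sub>C f (m + int (Suc N - i)) (k + int i)"
  have 1: "(\<Sum>i\<le>N. ?t (N choose Suc i) (Suc i)) = (\<Sum>i\<le>N. ?t (N choose i) i) - ?t 1 0"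
  proof -
    have "(\<Sum>i\<le>N. ?t (N choose Suc i) (Suc i)) + ?t (N choose 0) 0 = (\<Sum>i\<le>Suc N. ?t (N choose i) i)"
      by (subst sum.atMost_Suc_shift) simp
    also have "\<dots> = (\<Sum>i\<le>N. ?t (N choose i) i)"
      by (simp add: binomial_eq_0 scaleC_simps)
    finally show ?thesis by (simp add: algebra_simps)
  qed
  have "(\<Sum>i\<le>Suc N. ?t (Suc N choose i) i) = ?t 1 0 + (\<Sum>i\<le>N. ?t ((N choose i) + (N choose Suc i)) (Suc i))"
    by (subst sum.atMost_Suc_shift) simp
  also have "\<dots> = ?t 1 0 + (\<Sum>i\<le>N. ?t (N choose i) (Suc i)) + (\<Sum>i\<le>N. ?t (N choose Suc i) (Suc i))"
    by (simp add: sum.distrib scaleC_simps ring_distribs del: power_Suc sum.atMost_Suc)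
  also have "\<dots> = (\<Sum>i\<le>N. ?t (N choose i) (Suc i)) + (\<Sum>i\<le>N. ?t (N choose i) i)"
    unfolding 1 by (simp add: algebra_simps)
  also have "(\<Sum>i\<le>N. ?t (N choose i) i) = (del ^^ N) f (m + 1) k"
    unfolding Suc by (rule sum.cong) (auto simp: algebra_simps Suc_diff_le of_nat_diff)
  also have "(\<Sum>i\<le>N. ?t (N choose i) (Suc i)) = - (del ^^ N) f m (k + 1)"
    unfolding Suc by (simp add: algebra_simps scaleC_simps flip: sum_negf)
  finally have "(\<Sum>i\<le>Suc N. ?t (Suc N choose i) i) = del ((del ^^ N) f) m k"
    unfolding del_apply by simp
  then show ?case by simp
qed

text \<open>Newton's forward difference formula along the lines on which m + k is constant. For
  distributions it is the expansion into derivatives of the delta function, with the residues of the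
  products with (z - w)^j as coefficients.\<close>

lemma newton_expansion:
  fixes f :: "int \<Rightarrow> int \<Rightarrow> 'v::complex_space"
  assumes "(del ^^ N) f = (\<lambda>_ _. 0)"
  shows "f m k = (\<Sum>j<N. (of_int m gchoose j) *\<^sub>C (del ^^ j) f 0 (m + k - int j))"
  using assms
proof (induction N arbitrary: f m k)
  case (Suc N)
  have S: "del f m k = (\<Sum>j<N. (of_int m gchoose j) *\<^sub>C (del ^^ Suc j) f 0 (m + k - int j))" for m k
    using Suc.IH[of "del f" m k] Suc.prems by (simp add: funpow_swap1)
  define g where "g = (\<lambda>m k. f m k - (\<Sum>j<Suc N. (of_int m gchoose j) *\<^sub>C (del ^^ j) f 0 (m + k - int j)))"
  \<comment> \<open>By the induction hypothesis for \<open>del f\<close> the remainder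
    \<open>g\<close> is constant along each line m + k = const; as it vanishes at m = 0, it vanishes
    altogether.\<close>
  have step: "g (m + 1) k = g m (k + 1)" for m k
  proof -
    have "(\<Sum>j<Suc N. (of_int (m + 1) gchoose j) *\<^sub>C (del ^^ j) f 0 (m + 1 + k - int j))
      - (\<Sum>j<Suc N. (of_int m gchoose j) *\<^sub>C (del ^^ j) f 0 (m + (k + 1) - int j))
      = (\<Sum>j<Suc N. (((of_int m + 1) gchoose j) - (of_int m gchoose j)) *\<^sub>C (del ^^ j) f 0 (m + 1 + k - int j))"
      by (simp add: algebra_simps sum_subtractf)
    also have "\<dots> = (\<Sum>j<N. (of_int m gchoose j) *\<^sub>C (del ^^ Suc j) f 0 (m + k - int j))"
      by (subst sum.lessThan_Suc_shift)
        (simp add: gbinomial_Suc_Suc gbinomial_Suc_Suc' cvec.scale_zero_left algebra_simps)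
    also have "\<dots> = f (m + 1) k - f m (k + 1)"
      using S[of m k] by (simp add: del_def)
    finally show ?thesis by (simp add: g_def algebra_simps)
  qed
  have nat: "g (int n) k = g 0 (k + int n)" for n k
  proof (induction n arbitrary: k)
    case (Suc n)
    show ?case using step[of "int n" k] Suc[of "k + 1"] by (simp add: algebra_simps)
  qed simp
  have neg: "g (- int n) k = g 0 (k - int n)" for n k
  proof (induction n arbitrary: k)
    case (Suc n)
    have "- int (Suc n) = - int n - 1" "k - int (Suc n) = k - 1 - int n" by simp_all
    then show ?case using step[of "- int n - 1" "k - 1"] Suc[of "k - 1"]
      by (simp only: diff_add_cancel)
  qed simp
  have "g 0 k = 0" for k
    unfolding g_def by (subst sum.lessThan_Suc_shift) (simp add: scaleC_simps)
  moreover have "g m k = g 0 (k + m)"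
    using nat[of "nat m" k] neg[of "nat (- m)" k] by (cases "m \<ge> 0") simp_all
  ultimately have "g m k = 0" by metis
  then show ?case unfolding g_def by (subst (asm) eq_iff_diff_eq_0[symmetric])
qed simp

subsection \<open>Residues\<close>

text \<open>\<open>res n P Q\<close> is the residue in \<open>z\<close> of \<open>i\<^sub>z\<^sub>,\<^sub>w (z-w)^n P - i\<^sub>w\<^sub>,\<^sub>z (z-w)^n Q\<close>.\<close>

definition res :: "int \<Rightarrow> (int \<Rightarrow> int \<Rightarrow> 'v::complex_space) \<Rightarrow> (int \<Rightarrow> int \<Rightarrow> 'v) \<Rightarrow> int \<Rightarrow> 'v" where
  "res n P Q l = Sum_any (\<lambda>j::nat. ((- 1) ^ j * (of_int n gchoose j)) *\<^sub>C
     (P (n - int j) (l + int j) - (- 1) powi n *\<^sub>C Q (int j) (n + l - int j)))"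

lemma fld_prod_eq_res:
  "fld_prod p q A n B m v = res n (\<lambda>i k. A i (B k v)) (\<lambda>i k. koszul p q *\<^sub>C B k (A i v)) m"
  by (simp add: fld_prod_def res_def scaleC_simps mult.commute)

text \<open>In the applications \<open>P\<close> is A(z)B(w)v and \<open>Q\<close> is B(w)A(z)v up
  to sign, both indexed by the mode of A first. The operator that acts first on v has vanishing
  modes from \<open>K\<close> on; its mode is the second index of \<open>P\<close> and the first of
  \<open>Q\<close>. This bound makes the sum in \<open>res\<close> finite.\<close>

definition trunc :: "int \<Rightarrow> (int \<Rightarrow> int \<Rightarrow> 'v::zero) \<Rightarrow> (int \<Rightarrow> int \<Rightarrow> 'v) \<Rightarrow> bool" where
  "trunc K P Q \<longleftrightarrow> (\<forall>m k. K \<le> k \<longrightarrow> P m k = 0 \<and> Q k m = 0)"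

lemma trunc_mono: "trunc K P Q \<Longrightarrow> K \<le> K' \<Longrightarrow> trunc K' P Q"
  by (auto simp: trunc_def)

lemma trunc_del: "trunc K P Q \<Longrightarrow> trunc K (del P) (del Q)"
  by (auto simp: trunc_def del_def)

text \<open>The length \<open>L\<close> stays free, so residues with different truncation bounds can
  be written over one range and compared term by term.\<close>

lemma res_eq_sum:
  assumes "trunc K P Q" "L \<ge> nat (K - l)" "L \<ge> nat K"
  shows "res n P Q l = (\<Sum>j<L. ((- 1) ^ j * (of_int n gchoose j)) *\<^sub>C P (n - int j) (l + int j))
     - (- 1) powi n *\<^sub>C (\<Sum>j<L. ((- 1) ^ j * (of_int n gchoose j)) *\<^sub>C Q (int j) (n + l - int j))"
proof -
  have "res n P Q l = (\<Sum>j<L. ((- 1) ^ j * (of_int n gchoose j)) *\<^sub>C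
     (P (n - int j) (l + int j) - (- 1) powi n *\<^sub>C Q (int j) (n + l - int j)))"
    unfolding res_def
  proof (rule Sum_any.expand_superset)
    show "{a. ((- 1) ^ a * (of_int n gchoose a)) *\<^sub>C (P (n - int a) (l + int a) -
      (- 1) powi n *\<^sub>C Q (int a) (n + l - int a)) \<noteq> 0} \<subseteq> {..<L}"
    proof safe
      fix a assume nz: "((- 1) ^ a * (of_int n gchoose a)) *\<^sub>C (P (n - int a) (l + int a) -
        (- 1) powi n *\<^sub>C Q (int a) (n + l - int a)) \<noteq> 0"
      show "a < L"
      proof (rule ccontr)
        assume "\<not> a < L"
        then have "P (n - int a) (l + int a) = 0" "Q (int a) (n + l - int a) = 0"
          using assms by (auto simp: trunc_def)
        with nz show False by (simp add: scaleC_simps)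
      qed
    qed
  qed simp
  also have "\<dots> = (\<Sum>j<L. ((- 1) ^ j * (of_int n gchoose j)) *\<^sub>C P (n - int j) (l + int j))
     - (\<Sum>j<L. (- 1) powi n *\<^sub>C ((- 1) ^ j * (of_int n gchoose j)) *\<^sub>C Q (int j) (n + l - int j))"
    unfolding sum_subtractf[symmetric]
    by (rule sum.cong) (simp_all only: cvec.scale_right_diff_distrib scaleC_scaleC mult_ac)
  finally show ?thesis
    by (simp only: cvec.scale_sum_right)
qed

lemma res_add:
  assumes "trunc K P Q" "trunc K' P' Q'"
  shows "res n (\<lambda>m k. P m k + P' m k) (\<lambda>m k. Q m k + Q' m k) l = res n P Q l + res n P' Q' l"
proof -
  let ?K = "max K K'" and ?L = "nat (max K K' - l) + nat (max K K')"
  have t: "trunc ?K P Q" "trunc ?K P' Q'" "trunc ?K (\<lambda>m k. P m k + P' m k) (\<lambda>m k. Q m k + Q' m k)"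
    using assms by (auto simp: trunc_def)
  show ?thesis
    by (simp add: res_eq_sum[OF t(1), of l ?L] res_eq_sum[OF t(2), of l ?L]
        res_eq_sum[OF t(3), of l ?L] sum.distrib scaleC_simps)
qed

lemma res_clinear:
  assumes "trunc K P Q" "clinear f"
  shows "res n (\<lambda>m k. f (P m k)) (\<lambda>m k. f (Q m k)) l = f (res n P Q l)"
proof -
  let ?L = "nat (K - l) + nat K"
  have t: "trunc K (\<lambda>m k. f (P m k)) (\<lambda>m k. f (Q m k))"
    using assms by (auto simp: trunc_def clinear_0)
  show ?thesis
    by (simp add: res_eq_sum[OF t, of l ?L] res_eq_sum[OF assms(1), of l ?L] assms(2) clinear_simps)
qed

text \<open>Pascal's rule followed by summation by parts; the hypothesis on \<open>p L\<close>
  removes the boundary term.\<close>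

lemma pascal_telescope:
  assumes "p L = (0::'v::complex_space)"
  shows "(\<Sum>j<Suc L. ((- 1) ^ j * ((a + 1) gchoose j)) *\<^sub>C p j)
    = (\<Sum>j<L. ((- 1) ^ j * (a gchoose j)) *\<^sub>C (p j - p (Suc j)))"
proof -
  let ?c = "\<lambda>j. (- 1) ^ j * (a gchoose j)"
  have "(\<Sum>j<Suc L. ((- 1) ^ j * ((a + 1) gchoose j)) *\<^sub>C p j)
    = p 0 + (\<Sum>j<L. (?c (Suc j) - ?c j) *\<^sub>C p (Suc j))"
  proof -
    have "(- 1) ^ Suc j * ((a + 1) gchoose Suc j) = ?c (Suc j) - ?c j" for j
      unfolding gbinomial_Suc_Suc by (simp add: algebra_simps)
    then show ?thesis by (subst sum.lessThan_Suc_shift) (simp only: gbinomial_0 power_0 mult_1 scaleC_one)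
  qed
  also have "\<dots> = p 0 + (\<Sum>j<L. ?c (Suc j) *\<^sub>C p (Suc j)) - (\<Sum>j<L. ?c j *\<^sub>C p (Suc j))"
    by (simp add: scaleC_simps sum_subtractf algebra_simps)
  also have "p 0 + (\<Sum>j<L. ?c (Suc j) *\<^sub>C p (Suc j)) = (\<Sum>j<Suc L. ?c j *\<^sub>C p j)"
    by (subst sum.lessThan_Suc_shift) (simp add: scaleC_simps)
  also have "\<dots> = (\<Sum>j<L. ?c j *\<^sub>C p j)"
    using assms by (simp add: scaleC_simps)
  finally show ?thesis by (simp add: scaleC_simps sum_subtractf)
qed

text \<open>Pascal's rule is applied in each of the two expansions. In the second one it comes with
  the opposite sign, which is absorbed by the change from \<open>(- 1) powi n\<close> to
  \<open>(- 1) powi (n + 1)\<close>.\<close>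

lemma res_del:
  assumes t: "trunc K P Q"
  shows "res n (del P) (del Q) l = res (n + 1) P Q l"
proof -
  define L where "L = nat (K - l) + nat K"
  have z: "P (n + 1 - int L) (l + int L) = 0" "Q (int L) (n + 1 + l - int L) = 0"
    using t unfolding trunc_def L_def by auto
  have 1: "(\<Sum>j<Suc L. ((- 1) ^ j * ((of_int n + 1) gchoose j)) *\<^sub>C P (n + 1 - int j) (l + int j))
     = (\<Sum>j<L. ((- 1) ^ j * (of_int n gchoose j)) *\<^sub>C del P (n - int j) (l + int j))"
    by (subst pascal_telescope[of "\<lambda>j. P (n + 1 - int j) (l + int j)", OF z(1)])
      (simp add: del_def algebra_simps)
  have 2: "(\<Sum>j<Suc L. ((- 1) ^ j * ((of_int n + 1) gchoose j)) *\<^sub>C Q (int j) (n + 1 + l - int j))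
     = - (\<Sum>j<L. ((- 1) ^ j * (of_int n gchoose j)) *\<^sub>C del Q (int j) (n + l - int j))"
    by (subst pascal_telescope[of "\<lambda>j. Q (int j) (n + 1 + l - int j)", OF z(2)])
      (simp add: del_def algebra_simps scaleC_simps flip: sum_negf)
  have "res (n + 1) P Q l =
     (\<Sum>j<Suc L. ((- 1) ^ j * ((of_int n + 1) gchoose j)) *\<^sub>C P (n + 1 - int j) (l + int j))
     - (- 1) powi (n + 1) *\<^sub>C (\<Sum>j<Suc L. ((- 1) ^ j * ((of_int n + 1) gchoose j)) *\<^sub>C Q (int j) (n + 1 + l - int j))"
    using res_eq_sum[OF t, of l "Suc L" "n + 1"] by (simp add: L_def)
  also have "\<dots> = res n (del P) (del Q) l"
    unfolding 1 2 using res_eq_sum[OF trunc_del[OF t], of l L n]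
    by (simp add: L_def scaleC_simps power_int_add_1)
  finally show ?thesis by simp
qed

lemma res_del_pow:
  "trunc K P Q \<Longrightarrow> res n ((del ^^ N) P) ((del ^^ N) Q) l = res (n + int N) P Q l"
proof (induction N arbitrary: P Q)
  case (Suc N)
  show ?case
    using Suc.IH[OF trunc_del[OF Suc.prems]] res_del[OF Suc.prems, of "n + int N" l]
    by (simp add: funpow_swap1 algebra_simps)
qed simp

lemma res_0: "res 0 P Q l = P 0 l - Q 0 l"
proof -
  have "res 0 P Q l = Sum_any (\<lambda>j::nat. if j = 0 then P 0 l - Q 0 l else 0)"
    unfolding res_def
    by (rule Sum_any.cong) (auto simp: scaleC_simps gbinomial_0_left)
  then show ?thesis by simp
qed

text \<open>For a nonnegative exponent the two expansions of (z - w)^n coincide, so the residue is a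
  coefficient of (z - w)^n (P - Q).\<close>

lemma res_nonneg:
  assumes "trunc K P Q"
  shows "res (int n) P Q l = (del ^^ n) (\<lambda>m k. P m k - Q m k) 0 l"
  using res_del_pow[OF assms, of 0 n l] by (simp add: res_0 del_pow_diff)

lemma res_eq_0:
  assumes "trunc K P Q" "(del ^^ N) P = (del ^^ N) Q" "int N \<le> n"
  shows "res n P Q l = 0"
proof -
  have "(del ^^ N) (\<lambda>m k. P m k - Q m k) = (\<lambda>_ _. 0)"
    using assms(2) by (simp add: del_pow_diff)
  then have "(del ^^ nat n) (\<lambda>m k. P m k - Q m k) = (\<lambda>_ _. 0)"
    by (rule del_pow_mono) (use assms in simp)
  then show ?thesis
    using res_nonneg[OF assms(1), of "nat n" l] assms(3) by simp
qed

subsection \<open>Dong's lemma\<close>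

text \<open>Multiplication by \<open>z - w\<close>, \<open>z - u\<close> and \<open>w - u\<close> for three variables \<open>z\<close>, \<open>w\<close>, \<open>u\<close>.\<close>

definition del12 :: "(int \<Rightarrow> int \<Rightarrow> int \<Rightarrow> 'v::ab_group_add) \<Rightarrow> int \<Rightarrow> int \<Rightarrow> int \<Rightarrow> 'v" where
  "del12 f = (\<lambda>m k h. f (m + 1) k h - f m (k + 1) h)"
definition del13 :: "(int \<Rightarrow> int \<Rightarrow> int \<Rightarrow> 'v::ab_group_add) \<Rightarrow> int \<Rightarrow> int \<Rightarrow> int \<Rightarrow> 'v" where
  "del13 f = (\<lambda>m k h. f (m + 1) k h - f m k (h + 1))"
definition del23 :: "(int \<Rightarrow> int \<Rightarrow> int \<Rightarrow> 'v::ab_group_add) \<Rightarrow> int \<Rightarrow> int \<Rightarrow> int \<Rightarrow> 'v" where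
  "del23 f = (\<lambda>m k h. f m (k + 1) h - f m k (h + 1))"

lemma del12_pow: "(del12 ^^ N) f = (\<lambda>m k h. (del ^^ N) (\<lambda>m k. f m k h) m k)"
  and del13_pow: "(del13 ^^ N) f = (\<lambda>m k h. (del ^^ N) (\<lambda>m h. f m k h) m h)"
  and del23_pow: "(del23 ^^ N) f = (\<lambda>m k h. (del ^^ N) (\<lambda>k h. f m k h) k h)"
  by (induction N; simp add: del12_def del13_def del23_def del_def)+

lemma del_triple_commute:
  "del13 (del23 f) = del23 (del13 f)" "del12 (del13 f) = del13 (del12 f)"
  by (auto simp: del12_def del13_def del23_def fun_eq_iff algebra_simps)

lemma funpow_commute:
  assumes "\<And>x. f (g x) = g (f x)"
  shows "(f ^^ m) ((g ^^ n) x) = (g ^^ n) ((f ^^ m) x)"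
proof -
  have 1: "f ((g ^^ n) x) = (g ^^ n) (f x)" for x
    by (induction n arbitrary: x) (simp_all only: funpow_0 id_apply funpow.simps comp_apply assms)
  show ?thesis
    by (induction m arbitrary: x) (simp_all only: funpow_0 id_apply funpow.simps comp_apply 1)
qed

text \<open>The induction rests on \<open>z - u = (z - w) + (w - u)\<close>: multiplying the integrand by
  \<open>z - u\<close> amounts to raising \<open>n\<close> and to multiplying the residue by \<open>w - u\<close>.\<close>

lemma res_triple_local:
  fixes P Q :: "int \<Rightarrow> int \<Rightarrow> int \<Rightarrow> 'v::complex_space"
  assumes "\<forall>h. \<exists>K. trunc K (\<lambda>m k. P m k h) (\<lambda>m k. Q m k h)"
    and "(del12 ^^ N) P = (del12 ^^ N) Q"
    and "(del13 ^^ a) ((del23 ^^ b) P) = (\<lambda>_ _ _. 0)" "(del13 ^^ a) ((del23 ^^ b) Q) = (\<lambda>_ _ _. 0)"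
  shows "(del ^^ (a + b + s)) (\<lambda>l h. res (int N - int s) (\<lambda>m k. P m k h) (\<lambda>m k. Q m k h) l)
    = (\<lambda>_ _. 0)"
  using assms
proof (induction a arbitrary: P Q s)
  case 0
  \<comment> \<open>With no factor z - u left, only w - u acts; it does not involve the integration
    variable z and can be taken out of the residue.\<close>
  have res_del2: "(\<lambda>l h. res n (\<lambda>m k. del23 P m k h) (\<lambda>m k. del23 Q m k h) l)
      = del (\<lambda>l h. res n (\<lambda>m k. P m k h) (\<lambda>m k. Q m k h) l)"
    if "\<forall>h. \<exists>K. trunc K (\<lambda>m k. P m k h) (\<lambda>m k. Q m k h)" for n and P Q :: "int \<Rightarrow> int \<Rightarrow> int \<Rightarrow> 'v"
  proof (intro ext)
    fix l h
    from that[rule_format, of h] that[rule_format, of "h + 1"]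
    obtain K K' where K: "trunc K (\<lambda>m k. P m k h) (\<lambda>m k. Q m k h)"
      "trunc K' (\<lambda>m k. P m k (h + 1)) (\<lambda>m k. Q m k (h + 1))" by blast
    define M where "M = max \<bar>K\<bar> \<bar>K'\<bar>"
    define L where "L = nat (M + \<bar>l\<bar> + 2)"
    have t: "trunc M (\<lambda>m k. P m k h) (\<lambda>m k. Q m k h)"
        "trunc M (\<lambda>m k. P m k (h + 1)) (\<lambda>m k. Q m k (h + 1))"
        "trunc (M + 1) (\<lambda>m k. del23 P m k h) (\<lambda>m k. del23 Q m k h)"
      using K by (auto simp: trunc_def del23_def M_def)
    have L: "L \<ge> nat (M - (l + 1))" "L \<ge> nat (M - l)" "L \<ge> nat (M + 1 - l)" "L \<ge> nat M" "L \<ge> nat (M + 1)"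
      by (auto simp: L_def)
    show "res n (\<lambda>m k. del23 P m k h) (\<lambda>m k. del23 Q m k h) l =
        del (\<lambda>l h. res n (\<lambda>m k. P m k h) (\<lambda>m k. Q m k h) l) l h"
      unfolding del_def res_eq_sum[OF t(1) L(1,4)] res_eq_sum[OF t(2) L(2,4)] res_eq_sum[OF t(3) L(3,5)]
      by (simp add: del23_def scaleC_simps sum_subtractf algebra_simps)
  qed
  have trunc23: "\<forall>h. \<exists>K. trunc K (\<lambda>m k. del23 P m k h) (\<lambda>m k. del23 Q m k h)"
    if "\<forall>h. \<exists>K. trunc K (\<lambda>m k. P m k h) (\<lambda>m k. Q m k h)" for P Q :: "int \<Rightarrow> int \<Rightarrow> int \<Rightarrow> 'v"
  proof
    fix h
    from that[rule_format, of h] that[rule_format, of "h + 1"]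
    obtain K K' where K: "trunc K (\<lambda>m k. P m k h) (\<lambda>m k. Q m k h)"
      "trunc K' (\<lambda>m k. P m k (h + 1)) (\<lambda>m k. Q m k (h + 1))" by blast
    then have "trunc (max K K') (\<lambda>m k. del23 P m k h) (\<lambda>m k. del23 Q m k h)"
      by (auto simp: trunc_def del23_def)
    then show "\<exists>K. trunc K (\<lambda>m k. del23 P m k h) (\<lambda>m k. del23 Q m k h)" by blast
  qed
  have pow: "(\<lambda>l h. res n (\<lambda>m k. (del23 ^^ b) P m k h) (\<lambda>m k. (del23 ^^ b) Q m k h) l)
      = (del ^^ b) (\<lambda>l h. res n (\<lambda>m k. P m k h) (\<lambda>m k. Q m k h) l)"
    if "\<forall>h. \<exists>K. trunc K (\<lambda>m k. P m k h) (\<lambda>m k. Q m k h)" for n b and P Q :: "int \<Rightarrow> int \<Rightarrow> int \<Rightarrow> 'v"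
    using that
  proof (induction b arbitrary: P Q)
    case (Suc b)
    show ?case
      using Suc.IH[OF trunc23[OF Suc.prems]] res_del2[OF Suc.prems]
      by (simp add: funpow_swap1)
  qed simp
  have "(del ^^ b) (\<lambda>l h. res (int N - int s) (\<lambda>m k. P m k h) (\<lambda>m k. Q m k h) l) = (\<lambda>_ _. 0)"
    unfolding pow[OF 0(1), symmetric] using 0(3,4)
    by (simp only: funpow_0) (simp add: res_def cvec.scale_zero_right)
  then show ?case by (rule del_pow_mono) simp
next
  case (Suc a)
  note a_IH = Suc.IH
  show ?case
    using Suc.prems
  proof (induction s)
    case 0
    have "res (int N - int 0) (\<lambda>m k. P m k h) (\<lambda>m k. Q m k h) l = 0" for l h
    proof -
      obtain K where K: "trunc K (\<lambda>m k. P m k h) (\<lambda>m k. Q m k h)" using 0(1) by blast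
      show ?thesis
        by (rule res_eq_0[OF K, of N]) (use fun_cong[OF fun_cong[OF fun_cong[OF 0(2)]]] in
            \<open>auto simp: del12_pow fun_eq_iff\<close>)
    qed
    then show ?case by (simp only: del_pow_0)
  next
    case (Suc s)
    let ?n = "int N - int (Suc s)"
    let ?R = "\<lambda>n l h. res n (\<lambda>m k. P m k h) (\<lambda>m k. Q m k h) l"
    have t13: "\<forall>h. \<exists>K. trunc K (\<lambda>m k. del13 P m k h) (\<lambda>m k. del13 Q m k h)"
    proof
      fix h
      from Suc.prems(1)[rule_format, of h] Suc.prems(1)[rule_format, of "h + 1"]
      obtain K K' where K: "trunc K (\<lambda>m k. P m k h) (\<lambda>m k. Q m k h)"
        "trunc K' (\<lambda>m k. P m k (h + 1)) (\<lambda>m k. Q m k (h + 1))" by blast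
      then have "trunc (max K K') (\<lambda>m k. del13 P m k h) (\<lambda>m k. del13 Q m k h)"
        by (auto simp: trunc_def del13_def)
      then show "\<exists>K. trunc K (\<lambda>m k. del13 P m k h) (\<lambda>m k. del13 Q m k h)" by blast
    qed
    \<comment> \<open>The outer hypothesis applies to \<open>del13 P\<close> and
      \<open>del13 Q\<close>, which have consumed one factor z - u. The inner hypothesis disposes of
      the exponent \<open>?n + 1\<close>, so what remains is the residue with exponent
      \<open>?n\<close> after one more multiplication by w - u.\<close>
    have "(del ^^ (a + b + Suc s)) (\<lambda>l h. res ?n (\<lambda>m k. del13 P m k h) (\<lambda>m k. del13 Q m k h) l)
      = (\<lambda>_ _. 0)"
    proof (rule a_IH[OF t13])
      show "(del12 ^^ N) (del13 P) = (del12 ^^ N) (del13 Q)"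
        using Suc.prems(2)
        by (simp add: funpow_commute[of del12 del13 N 1, OF del_triple_commute(2), simplified])
      show "(del13 ^^ a) ((del23 ^^ b) (del13 P)) = (\<lambda>_ _ _. 0)"
        "(del13 ^^ a) ((del23 ^^ b) (del13 Q)) = (\<lambda>_ _ _. 0)"
        using Suc.prems(3,4)
        by (simp_all add: funpow_commute[of del13 del23 1 b, OF del_triple_commute(1), simplified, symmetric] funpow_swap1)
    qed
    moreover have "res ?n (\<lambda>m k. del13 P m k h) (\<lambda>m k. del13 Q m k h) l
      = ?R (?n + 1) l h + del (?R ?n) l h" for l h
    proof -
      from Suc.prems(1)[rule_format, of h] Suc.prems(1)[rule_format, of "h + 1"]
      obtain K K' where K: "trunc K (\<lambda>m k. P m k h) (\<lambda>m k. Q m k h)"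
        "trunc K' (\<lambda>m k. P m k (h + 1)) (\<lambda>m k. Q m k (h + 1))" by blast
      define M where "M = max \<bar>K\<bar> \<bar>K'\<bar>"
      define L where "L = nat (M + \<bar>l\<bar> + 2)"
      have t: "trunc M (\<lambda>m k. P m k h) (\<lambda>m k. Q m k h)"
          "trunc M (\<lambda>m k. P m k (h + 1)) (\<lambda>m k. Q m k (h + 1))"
          "trunc M (\<lambda>m k. del13 P m k h) (\<lambda>m k. del13 Q m k h)"
        using K by (auto simp: trunc_def del13_def M_def)
      have L: "L \<ge> nat (M - (l + 1))" "L \<ge> nat (M - l)" "L \<ge> nat (M + 1 - l)" "L \<ge> nat M" "L \<ge> nat (M + 1)"
        by (auto simp: L_def)
      have e: "?R (?n + 1) l h = res ?n (del (\<lambda>m k. P m k h)) (del (\<lambda>m k. Q m k h)) l"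
        by (simp add: res_del[OF t(1)])
      show ?thesis
        unfolding e unfolding del_def
          res_eq_sum[OF t(1) L(1,4)] res_eq_sum[OF t(2) L(2,4)] res_eq_sum[OF t(3) L(2,4)]
          res_eq_sum[OF trunc_mono[OF trunc_del[OF t(1), unfolded del_def], of "M"] L(2,4), simplified]
        by (simp add: del13_def scaleC_simps sum_subtractf algebra_simps)
    qed
    ultimately have "(\<lambda>l h. (del ^^ (a + b + Suc s)) (?R (?n + 1)) l h
        + (del ^^ (a + b + Suc s)) (del (?R ?n)) l h) = (\<lambda>_ _. 0)"
      by (simp only: del_pow_add)
    moreover have "(del ^^ (a + b + Suc s)) (?R (?n + 1)) = (\<lambda>_ _. 0)"
      using Suc by (simp add: algebra_simps)
    ultimately show ?case
      by (simp add: funpow_swap1 fun_eq_iff del: funpow.simps) (simp add: funpow_swap1)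
  qed
qed

lemma koszul_nonzero [simp]: "koszul p q \<noteq> 0"
  by (simp add: koszul_def)

lemma koszul_eq_not: "koszul (p = (\<not> q)) r = koszul p r * koszul q r"
  by (auto simp: koszul_def)

text \<open>The operator d/dz + d/dw annihilates (z - w)^n and the residue annihilates d/dz, so the
  residue of a total derivative is d/dw of the residue. In modes, minus the derivative sends
  \<open>f m\<close> to \<open>m\<close> times \<open>f (m - 1)\<close>.\<close>

lemma res_derivation:
  assumes t: "trunc K P Q"
  shows "res n (\<lambda>m k. of_int m *\<^sub>C P (m - 1) k + of_int k *\<^sub>C P m (k - 1))
      (\<lambda>m k. of_int m *\<^sub>C Q (m - 1) k + of_int k *\<^sub>C Q m (k - 1)) l
    = of_int l *\<^sub>C res n P Q (l - 1)"
proof -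
  define L where "L = nat (\<bar>K\<bar> + \<bar>l\<bar> + 2)"
  have t': "trunc (K + 1) (\<lambda>m k. of_int m *\<^sub>C P (m - 1) k + of_int k *\<^sub>C P m (k - 1))
      (\<lambda>m k. of_int m *\<^sub>C Q (m - 1) k + of_int k *\<^sub>C Q m (k - 1))"
    using t by (auto simp: trunc_def scaleC_simps)
  have L: "L \<ge> nat (K - (l - 1))" "L \<ge> nat (K + 1 - l)" "L \<ge> nat K" "L \<ge> nat (K + 1)"
    unfolding L_def by auto
  define c :: "nat \<Rightarrow> complex" where "c j = (- 1) ^ j * (of_int n gchoose j)" for j
  \<comment> \<open>The absorption identity for binomial coefficients; it turns the factor n - j
    into a coefficient of the neighbouring summand, which makes both sums telescope.\<close>
  have c_Suc: "of_nat (Suc j) * c (Suc j) = - ((of_int n - of_nat j) * c j)" for j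
    proof -
    have "(of_int n - of_nat j) * (of_int n gchoose j) = of_nat (Suc j) * (of_int n gchoose Suc j :: complex)"
      using gbinomial_mult_1[of "of_int n :: complex" j] by (simp add: algebra_simps)
    then have "(- 1) ^ j * ((of_int n - of_nat j) * (of_int n gchoose j))
        = (- 1) ^ j * (of_nat (Suc j) * (of_int n gchoose Suc j :: complex))" by simp
    then show ?thesis by (simp add: c_def mult_ac del: of_nat_Suc)
  qed
  define p where "p j = P (n - int j) (l - 1 + int j)" for j
  \<comment> \<open>Shifted by one against the summand of the residue, which is
    \<open>q (Suc j)\<close>; the extra \<open>q 0\<close> enters the telescoping sum with the
    factor 0.\<close>
  define q where "q j = Q (int j - 1) (n + l - int j)" for j
  have "p L = 0" "q L = 0"
    using t by (auto simp: p_def q_def L_def trunc_def)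
  have "(\<Sum>j<L. c j *\<^sub>C (of_int (n - int j) *\<^sub>C P (n - int j - 1) (l + int j)
        + of_int (l + int j) *\<^sub>C P (n - int j) (l + int j - 1)))
      = of_int l *\<^sub>C (\<Sum>j<L. c j *\<^sub>C p j)
        + (\<Sum>j<L. (of_nat j * c j) *\<^sub>C p j - (of_nat (Suc j) * c (Suc j)) *\<^sub>C p (Suc j))"
    unfolding c_Suc
    by (simp add: cvec.scale_sum_right p_def scaleC_simps algebra_simps flip: sum.distrib)
  also have "(\<Sum>j<L. (of_nat j * c j) *\<^sub>C p j - (of_nat (Suc j) * c (Suc j)) *\<^sub>C p (Suc j)) = 0"
    by (subst sum_lessThan_telescope') (simp add: \<open>p L = 0\<close> scaleC_simps)
  finally have 1: "(\<Sum>j<L. c j *\<^sub>C (of_int (n - int j) *\<^sub>C P (n - int j - 1) (l + int j)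
        + of_int (l + int j) *\<^sub>C P (n - int j) (l + int j - 1))) = of_int l *\<^sub>C (\<Sum>j<L. c j *\<^sub>C p j)"
    by simp
  have "(\<Sum>j<L. c j *\<^sub>C (of_int (int j) *\<^sub>C Q (int j - 1) (n + l - int j)
        + of_int (n + l - int j) *\<^sub>C Q (int j) (n + l - int j - 1)))
      = of_int l *\<^sub>C (\<Sum>j<L. c j *\<^sub>C q (Suc j))
        + (\<Sum>j<L. (of_nat j * c j) *\<^sub>C q j - (of_nat (Suc j) * c (Suc j)) *\<^sub>C q (Suc j))"
    unfolding c_Suc
    by (simp add: cvec.scale_sum_right q_def scaleC_simps algebra_simps flip: sum.distrib)
  also have "(\<Sum>j<L. (of_nat j * c j) *\<^sub>C q j - (of_nat (Suc j) * c (Suc j)) *\<^sub>C q (Suc j)) = 0"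
    by (subst sum_lessThan_telescope') (simp add: \<open>q L = 0\<close> scaleC_simps)
  finally have 2: "(\<Sum>j<L. c j *\<^sub>C (of_int (int j) *\<^sub>C Q (int j - 1) (n + l - int j)
        + of_int (n + l - int j) *\<^sub>C Q (int j) (n + l - int j - 1))) = of_int l *\<^sub>C (\<Sum>j<L. c j *\<^sub>C q (Suc j))"
    by simp
  have 3: "res n P Q (l - 1) = (\<Sum>j<L. c j *\<^sub>C p j) - (- 1) powi n *\<^sub>C (\<Sum>j<L. c j *\<^sub>C q (Suc j))"
    unfolding res_eq_sum[OF t L(1,3)] by (simp add: c_def p_def q_def algebra_simps)
  show ?thesis
    unfolding res_eq_sum[OF t' L(2,4)] 3 c_def[symmetric] 1 2
    by (simp only: cvec.scale_right_diff_distrib scaleC_scaleC mult.commute)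
qed

section \<open>Fields\<close>

definition is_fld :: "'v::complex_space fld \<Rightarrow> bool" where
  "is_fld A \<longleftrightarrow> (\<forall>n. clinear (A n)) \<and> (\<forall>v. \<exists>N. \<forall>n\<ge>N. A n v = 0)"

lemma is_fldD: "is_fld A \<Longrightarrow> clinear (A n)"
  by (simp add: is_fld_def)

lemma is_fld_trunc:
  assumes "is_fld A"
  obtains N where "\<And>n. N \<le> n \<Longrightarrow> A n v = 0"
  using assms unfolding is_fld_def by blast

lemma is_fld_id: "is_fld (\<lambda>n v. if n = - 1 then v else 0)"
  unfolding is_fld_def
proof (intro conjI allI)
  fix v :: 'a
  show "\<exists>N. \<forall>n\<ge>N::int. (if n = - 1 then v else 0) = 0" by (rule exI[of _ 0]) simp
qed (auto intro!: clinearI simp: scaleC_simps)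

lemma is_fld_add: "is_fld A \<Longrightarrow> is_fld B \<Longrightarrow> is_fld (\<lambda>n v. A n v + B n v)"
proof -
  assume A: "is_fld A" and B: "is_fld B"
  have "\<exists>N. \<forall>n\<ge>N. A n v + B n v = 0" for v
  proof -
    obtain N where N: "\<And>n. N \<le> n \<Longrightarrow> A n v = 0" using A by (rule is_fld_trunc[where v=v]) blast
    obtain M where M: "\<And>n. M \<le> n \<Longrightarrow> B n v = 0" using B by (rule is_fld_trunc[where v=v]) blast
    from N M have "\<forall>n\<ge>max N M. A n v + B n v = 0" by simp
    then show ?thesis by blast
  qed
  then show ?thesis
    using A B by (auto simp: is_fld_def scaleC_simps clinear_simps intro!: clinearI)
qed

lemma is_fld_scale: "is_fld A \<Longrightarrow> is_fld (\<lambda>n v. c *\<^sub>C A n v)"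
  unfolding is_fld_def
  by (auto intro!: clinearI simp: clinear_simps scaleC_simps mult.commute) (metis cvec.scale_zero_right)

lemma is_fld_0: "is_fld (\<lambda>n v. 0)"
  unfolding is_fld_def by (auto intro!: clinearI simp: scaleC_simps)

lemma fld_prod_trunc:
  assumes "is_fld A" "is_fld B"
  shows "\<exists>K. trunc K (\<lambda>m k. A m (B k v)) (\<lambda>m k. c *\<^sub>C B k (A m v))"
proof -
  obtain N where N: "\<And>n. N \<le> n \<Longrightarrow> A n v = 0" using assms(1) by (rule is_fld_trunc[where v=v]) blast
  obtain M where M: "\<And>n. M \<le> n \<Longrightarrow> B n v = 0" using assms(2) by (rule is_fld_trunc[where v=v]) blast
  from N M have "trunc (max N M) (\<lambda>m k. A m (B k v)) (\<lambda>m k. c *\<^sub>C B k (A m v))"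
    using assms by (auto simp: trunc_def is_fldD clinear_0 scaleC_simps)
  then show ?thesis by blast
qed

lemma is_fld_prod:
  assumes A: "is_fld A" and B: "is_fld B"
  shows "is_fld (fld_prod p q A n B)"
  unfolding is_fld_def
proof (intro conjI allI clinearI)
  fix m u v
  obtain K K' where "trunc K (\<lambda>m k. A m (B k u)) (\<lambda>m k. koszul p q *\<^sub>C B k (A m u))"
    "trunc K' (\<lambda>m k. A m (B k v)) (\<lambda>m k. koszul p q *\<^sub>C B k (A m v))"
    using fld_prod_trunc[OF A B] by meson
  from res_add[OF this]
  show "fld_prod p q A n B m (u + v) = fld_prod p q A n B m u + fld_prod p q A n B m v"
    by (simp add: fld_prod_eq_res clinear_add[OF is_fldD[OF A]] clinear_add[OF is_fldD[OF B]] scaleC_simps)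
next
  fix m c u
  obtain K where "trunc K (\<lambda>m k. A m (B k u)) (\<lambda>m k. koszul p q *\<^sub>C B k (A m u))"
    using fld_prod_trunc[OF A B] by meson
  from res_clinear[OF this clinear_scaleC]
  show "fld_prod p q A n B m (c *\<^sub>C u) = c *\<^sub>C fld_prod p q A n B m u"
    by (simp add: fld_prod_eq_res clinear_scale[OF is_fldD[OF A]] clinear_scale[OF is_fldD[OF B]]
        scaleC_simps mult.commute)
next
  fix v
  obtain K where t: "trunc K (\<lambda>m k. A m (B k v)) (\<lambda>m k. koszul p q *\<^sub>C B k (A m v))"
    using fld_prod_trunc[OF A B] by meson
  have "\<forall>j. \<exists>N. \<forall>k\<ge>N. B k (A (int j) v) = 0" using B by (auto simp: is_fld_def)
  then obtain N where N: "\<And>j k. k \<ge> N j \<Longrightarrow> B k (A (int j) v) = 0" by metis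
  \<comment> \<open>In the half with B outside only the finitely many modes of A with index below K
    contribute; the sum of their bounds \<open>N j\<close> dominates each of them.\<close>
  show "\<exists>M. \<forall>m\<ge>M. fld_prod p q A n B m v = 0"
  proof (intro exI[of _ "\<bar>K\<bar> + \<bar>n\<bar> + \<bar>K\<bar> + (\<Sum>j<nat K. \<bar>N j\<bar>)"] allI impI)
    fix m assume m: "m \<ge> \<bar>K\<bar> + \<bar>n\<bar> + \<bar>K\<bar> + (\<Sum>j<nat K. \<bar>N j\<bar>)"
    have pos: "0 \<le> (\<Sum>j<nat K. \<bar>N j\<bar>)" by (rule sum_nonneg) simp
    have "K \<le> m" using m pos by linarith
    then have "A (n - int j) (B (m + int j) v) = 0" for j
      using t by (auto simp: trunc_def)
    moreover have "B (n + m - int j) (A (int j) v) = 0" if j: "j < nat K" for j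
    proof (rule N)
      have "\<bar>N j\<bar> \<le> (\<Sum>j<nat K. \<bar>N j\<bar>)"
        using j by (intro member_le_sum) auto
      then show "N j \<le> n + m - int j" using m j by linarith
    qed
    moreover have "nat (K - m) \<le> nat K" using m pos by linarith
    ultimately show "fld_prod p q A n B m v = 0"
      unfolding fld_prod_eq_res by (subst res_eq_sum[OF t, of m "nat K" n]) (simp_all add: scaleC_simps)
  qed
qed

section \<open>Locality\<close>

text \<open>A single exponent has to serve all vectors \<open>v\<close>: in Dong's lemma locality is
  applied to vectors that already carry a mode of another field.\<close>

definition mut_local :: "bool \<Rightarrow> bool \<Rightarrow> 'v::complex_space fld \<Rightarrow> 'v fld \<Rightarrow> bool" where
  "mut_local p q A B \<longleftrightarrow>
    (\<exists>N. \<forall>v. (del ^^ N) (\<lambda>m k. A m (B k v) - koszul p q *\<^sub>C B k (A m v)) = (\<lambda>_ _. 0))"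

lemma mut_localE:
  assumes "mut_local p q A B"
  obtains N0 where "\<And>N v. N \<ge> N0 \<Longrightarrow>
    (del ^^ N) (\<lambda>m k. A m (B k v) - koszul p q *\<^sub>C B k (A m v)) = (\<lambda>_ _. 0)"
proof -
  from assms obtain N0 where
    "\<And>v. (del ^^ N0) (\<lambda>m k. A m (B k v) - koszul p q *\<^sub>C B k (A m v)) = (\<lambda>_ _. 0)"
    unfolding mut_local_def by blast
  then show thesis by (rule that[OF del_pow_mono])
qed

lemma mut_local_sym:
  assumes "mut_local p q A B"
  shows "mut_local q p B A"
proof -
  obtain N where N: "\<And>v. (del ^^ N) (\<lambda>m k. A m (B k v) - koszul p q *\<^sub>C B k (A m v)) = (\<lambda>_ _. 0)"
    using assms by (auto simp: mut_local_def)
  have "(del ^^ N) (\<lambda>m k. B m (A k v) - koszul q p *\<^sub>C A k (B m v)) = (\<lambda>_ _. 0)" for v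
  proof -
    have eq: "(\<lambda>m k. B m (A k v) - koszul q p *\<^sub>C A k (B m v))
        = (\<lambda>m k. (- koszul p q) *\<^sub>C (A k (B m v) - koszul p q *\<^sub>C B m (A k v)))"
      by (simp add: scaleC_simps koszul_square koszul_commute[of q])
    show ?thesis
      unfolding eq del_pow_scale del_pow_swap[of N "\<lambda>m k. A m (B k v) - koszul p q *\<^sub>C B k (A m v)"] N
      by (simp add: scaleC_simps)
  qed
  then show ?thesis by (auto simp: mut_local_def)
qed

lemma mut_local_id: "\<forall>n. clinear (A n) \<Longrightarrow> mut_local p False A (\<lambda>n v. if n = - 1 then v else 0)"
  unfolding mut_local_def by (rule exI[of _ 0]) (auto simp: scaleC_simps clinear_0 fun_eq_iff)

lemma mut_local_0: "\<forall>n. clinear (A n) \<Longrightarrow> mut_local p q A (\<lambda>n v. 0)"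
  unfolding mut_local_def by (rule exI[of _ 0]) (auto simp: scaleC_simps clinear_0 fun_eq_iff)

lemma mut_local_add:
  assumes "\<forall>n. clinear (A n)" "mut_local p q A B" "mut_local p q A C"
  shows "mut_local p q A (\<lambda>n v. B n v + C n v)"
proof -
  obtain N where N: "\<And>M v. M \<ge> N \<Longrightarrow>
    (del ^^ M) (\<lambda>m k. A m (B k v) - koszul p q *\<^sub>C B k (A m v)) = (\<lambda>_ _. 0)"
    using assms(2) by (rule mut_localE) blast
  obtain N' where N': "\<And>M v. M \<ge> N' \<Longrightarrow>
    (del ^^ M) (\<lambda>m k. A m (C k v) - koszul p q *\<^sub>C C k (A m v)) = (\<lambda>_ _. 0)"
    using assms(3) by (rule mut_localE) blast
  have "(del ^^ max N N') (\<lambda>m k. A m (B k v + C k v) - koszul p q *\<^sub>C (B k (A m v) + C k (A m v)))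
      = (\<lambda>_ _. 0)" for v
  proof -
    have "(\<lambda>m k. A m (B k v + C k v) - koszul p q *\<^sub>C (B k (A m v) + C k (A m v)))
      = (\<lambda>m k. (A m (B k v) - koszul p q *\<^sub>C B k (A m v)) + (A m (C k v) - koszul p q *\<^sub>C C k (A m v)))"
      using assms(1) by (simp add: clinear_add scaleC_simps fun_eq_iff algebra_simps)
    then show ?thesis by (simp only: del_pow_add N N' max.cobounded1 max.cobounded2) simp
  qed
  then show ?thesis by (auto simp: mut_local_def)
qed

lemma mut_local_scale:
  assumes "\<forall>n. clinear (A n)" "mut_local p q A B"
  shows "mut_local p q A (\<lambda>n v. c *\<^sub>C B n v)"
proof -
  obtain N where N: "\<And>v. (del ^^ N) (\<lambda>m k. A m (B k v) - koszul p q *\<^sub>C B k (A m v)) = (\<lambda>_ _. 0)"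
    using assms by (auto simp: mut_local_def)
  have "(del ^^ N) (\<lambda>m k. A m (c *\<^sub>C B k v) - koszul p q *\<^sub>C c *\<^sub>C B k (A m v)) = (\<lambda>_ _. 0)" for v
  proof -
    have eq: "(\<lambda>m k. A m (c *\<^sub>C B k v) - koszul p q *\<^sub>C c *\<^sub>C B k (A m v))
      = (\<lambda>m k. c *\<^sub>C (A m (B k v) - koszul p q *\<^sub>C B k (A m v)))"
      using assms(1) by (simp add: clinear_scale scaleC_simps mult.commute)
    show ?thesis unfolding eq del_pow_scale N by (simp add: scaleC_simps)
  qed
  then show ?thesis by (auto simp: mut_local_def)
qed

text \<open>Below, \<open>P\<close> and \<open>Q\<close> are the supercommutators with C(u) of
  A(z)B(w) and, up to sign, of B(w)A(z), so that the commutator of the product field with C is a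
  residue of them. By the Leibniz rule each is the sum of a term with the commutator of B and C,
  killed by a power of w - u, and a term with the commutator of A and C, killed by a power of z -
  u.\<close>

theorem dong:
  assumes fld: "is_fld A" "is_fld B" "is_fld C"
    and loc: "mut_local p q A B" "mut_local p r A C" "mut_local q r B C"
  shows "mut_local (p \<noteq> q) r (fld_prod p q A n B) C"
proof -
  obtain N1 where N1: "\<And>N v. N \<ge> N1 \<Longrightarrow>
    (del ^^ N) (\<lambda>m k. A m (B k v) - koszul p q *\<^sub>C B k (A m v)) = (\<lambda>_ _. 0)"
    using loc(1) by (rule mut_localE) blast
  obtain N2 where N2: "\<And>N v. N \<ge> N2 \<Longrightarrow>
    (del ^^ N) (\<lambda>m k. A m (C k v) - koszul p r *\<^sub>C C k (A m v)) = (\<lambda>_ _. 0)"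
    using loc(2) by (rule mut_localE) blast
  obtain N3 where N3: "\<And>N v. N \<ge> N3 \<Longrightarrow>
    (del ^^ N) (\<lambda>m k. B m (C k v) - koszul q r *\<^sub>C C k (B m v)) = (\<lambda>_ _. 0)"
    using loc(3) by (rule mut_localE) blast
  define N where "N = N1 + N2 + N3 + nat n"
  \<comment> \<open>Besides dominating the three orders of locality, N is at least n, so that n = N
    - s for a natural number s, the form in which \<open>res_triple_local\<close> takes its
    exponent.\<close>
  have le: "N2 \<le> N" "N3 \<le> N" by (simp_all add: N_def)
  have lin: "clinear (A m)" "clinear (B m)" "clinear (C m)" for m
    using fld by (simp_all add: is_fldD)
  let ?\<kappa> = "koszul (p \<noteq> q) r"
  have "(del ^^ (N + N + nat (int N - n)))
      (\<lambda>l h. fld_prod p q A n B l (C h v) - ?\<kappa> *\<^sub>C C h (fld_prod p q A n B l v)) = (\<lambda>_ _. 0)" for v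
  proof -
    define P where "P = (\<lambda>m k h. A m (B k (C h v)) - ?\<kappa> *\<^sub>C C h (A m (B k v)))"
    define Q where "Q = (\<lambda>m k h. koszul p q *\<^sub>C B k (A m (C h v)) - ?\<kappa> *\<^sub>C C h (koszul p q *\<^sub>C B k (A m v)))"
    have tr: "\<exists>K. trunc K (\<lambda>m k. P m k h) (\<lambda>m k. Q m k h)" for h
    proof -
      obtain K K' where "trunc K (\<lambda>m k. A m (B k v)) (\<lambda>m k. koszul p q *\<^sub>C B k (A m v))"
        "trunc K' (\<lambda>m k. A m (B k (C h v))) (\<lambda>m k. koszul p q *\<^sub>C B k (A m (C h v)))"
        using fld_prod_trunc[OF fld(1,2)] by meson
      then have "trunc (max K K') (\<lambda>m k. P m k h) (\<lambda>m k. Q m k h)"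
        using lin by (simp add: trunc_def P_def Q_def clinear_simps scaleC_simps)
      then show ?thesis by blast
    qed
    have eq: "fld_prod p q A n B l (C h v) - ?\<kappa> *\<^sub>C C h (fld_prod p q A n B l v)
        = res n (\<lambda>m k. P m k h) (\<lambda>m k. Q m k h) l" for l h
    proof -
      obtain K K' where K: "trunc K (\<lambda>m k. A m (B k v)) (\<lambda>m k. koszul p q *\<^sub>C B k (A m v))"
        "trunc K' (\<lambda>m k. A m (B k (C h v))) (\<lambda>m k. koszul p q *\<^sub>C B k (A m (C h v)))"
        using fld_prod_trunc[OF fld(1,2)] by meson
      have L: "clinear (\<lambda>x. (- ?\<kappa>) *\<^sub>C C h x)"
        using lin by (auto intro!: clinearI simp: clinear_simps scaleC_simps mult.commute)
      have K'': "trunc K (\<lambda>m k. (- ?\<kappa>) *\<^sub>C C h (A m (B k v))) (\<lambda>m k. (- ?\<kappa>) *\<^sub>C C h (koszul p q *\<^sub>C B k (A m v)))"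
        using K(1) lin by (simp add: trunc_def clinear_simps scaleC_simps)
      have "res n (\<lambda>m k. P m k h) (\<lambda>m k. Q m k h) l =
          res n (\<lambda>m k. A m (B k (C h v)) + (- ?\<kappa>) *\<^sub>C C h (A m (B k v)))
            (\<lambda>m k. koszul p q *\<^sub>C B k (A m (C h v)) + (- ?\<kappa>) *\<^sub>C C h (koszul p q *\<^sub>C B k (A m v))) l"
        by (simp add: P_def Q_def scaleC_simps)
      also have "\<dots> = fld_prod p q A n B l (C h v) + (- ?\<kappa>) *\<^sub>C C h (fld_prod p q A n B l v)"
        unfolding res_add[OF K(2) K''] fld_prod_eq_res res_clinear[OF K(1) L] ..
      finally show ?thesis by (simp add: scaleC_simps)
    qed
    have 12: "(del12 ^^ N) P = (del12 ^^ N) Q"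
    proof -
      have "(del ^^ N) (\<lambda>m k. P m k h) m k - (del ^^ N) (\<lambda>m k. Q m k h) m k = 0" for m k h
      proof -
        have eq: "(\<lambda>m k. P m k h - Q m k h)
          = (\<lambda>m k. (A m (B k (C h v)) - koszul p q *\<^sub>C B k (A m (C h v)))
             - ?\<kappa> *\<^sub>C C h (A m (B k v) - koszul p q *\<^sub>C B k (A m v)))"
          using lin by (simp add: P_def Q_def clinear_simps scaleC_simps algebra_simps)
        have "N1 \<le> N" by (simp add: N_def)
        then have "(del ^^ N) (\<lambda>m k. P m k h - Q m k h) = (\<lambda>_ _. 0)"
          unfolding eq
          by (subst del_pow_diff) (simp add: N1 del_pow_scale del_pow_clinear[OF lin(3)]
              clinear_0[OF lin(3)] scaleC_simps(9-))
        then show ?thesis by (simp add: del_pow_diff fun_eq_iff)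
      qed
      then show ?thesis by (simp add: del12_pow)
    qed
    have vanish: "(del13 ^^ N) ((del23 ^^ N) (\<lambda>m k h. X m k h + Y m k h)) = (\<lambda>_ _ _. 0)"
      if X: "\<And>m. (del ^^ N) (X m) = (\<lambda>_ _. 0)"
        and Y: "\<And>k. (del ^^ N) (\<lambda>m h. Y m k h) = (\<lambda>_ _. 0)" for X Y :: "int \<Rightarrow> int \<Rightarrow> int \<Rightarrow> 'a"
    proof -
      have z: "(del23 ^^ N) (\<lambda>_ _ _. 0) = (\<lambda>_ _ _. 0 :: 'a)"
        by (simp add: del23_pow del_pow_0)
      have "(del23 ^^ N) (\<lambda>m k h. X m k h + Y m k h) = (del23 ^^ N) Y"
        by (simp add: del23_pow del_pow_add X)
      moreover have "(del13 ^^ N) ((del23 ^^ N) Y) = (del23 ^^ N) ((del13 ^^ N) Y)"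
        by (rule funpow_commute) (rule del_triple_commute)
      moreover have "(del13 ^^ N) Y = (\<lambda>_ _ _. 0)" by (simp add: del13_pow Y)
      ultimately show ?thesis by (simp add: z)
    qed
    have P: "(del13 ^^ N) ((del23 ^^ N) P) = (\<lambda>_ _ _. 0)"
    proof -
      have eq: "P = (\<lambda>m k h. A m (B k (C h v) - koszul q r *\<^sub>C C h (B k v))
          + koszul q r *\<^sub>C (A m (C h (B k v)) - koszul p r *\<^sub>C C h (A m (B k v))))"
        using lin by (simp add: P_def clinear_simps scaleC_simps koszul_eq_not algebra_simps)
      show ?thesis
        unfolding eq
        by (rule vanish) (simp_all add: del_pow_clinear[OF lin(1)] del_pow_scale N2 N3 le
            clinear_0[OF lin(1)] scaleC_simps(9-))
    qed
    have Q: "(del13 ^^ N) ((del23 ^^ N) Q) = (\<lambda>_ _ _. 0)"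
    proof -
      have eq: "Q = (\<lambda>m k h. (koszul p q * koszul p r) *\<^sub>C (B k (C h (A m v)) - koszul q r *\<^sub>C C h (B k (A m v)))
          + koszul p q *\<^sub>C B k (A m (C h v) - koszul p r *\<^sub>C C h (A m v)))"
        using lin by (simp add: Q_def clinear_simps scaleC_simps koszul_eq_not algebra_simps)
      show ?thesis
        unfolding eq
        by (rule vanish) (simp_all add: del_pow_clinear[OF lin(2)] del_pow_scale N2 N3 le
            clinear_0[OF lin(2)] scaleC_simps(9-))
    qed
    have "int N - int (nat (int N - n)) = n" by (simp add: N_def)
    then show ?thesis
      unfolding eq using res_triple_local[OF _ 12 P Q, of "nat (int N - n)"] tr by simp
  qed
  then show ?thesis unfolding mut_local_def by blast
qed

section \<open>Reconstruction\<close>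

locale graded_space =
  fixes gr :: "bool \<Rightarrow> 'v::complex_space set" and vac :: 'v and D :: "'v \<Rightarrow> 'v"
  assumes gr_subspace: "cvec.subspace (gr p)"
    and gr_inter: "gr False \<inter> gr True = {0}"
    and gr_sum: "\<exists>u\<in>gr False. \<exists>w\<in>gr True. v = u + w"
    and vac_even: "vac \<in> gr False"
    and D_linear: "clinear D"
    and D_vac: "D vac = 0"
begin

definition good :: "bool \<Rightarrow> 'v fld \<Rightarrow> bool" where
  "good p A \<longleftrightarrow> is_fld A \<and> (\<forall>q n. \<forall>v\<in>gr q. A n v \<in> gr (p \<noteq> q)) \<and> (\<forall>n\<ge>0. A n vac = 0) \<and>
    (\<forall>n v. D (A n v) - A n (D v) = - of_int n *\<^sub>C A (n - 1) v)"

lemma good_fld: "good p A \<Longrightarrow> is_fld A"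
  and good_clinear: "good p A \<Longrightarrow> clinear (A n)"
  and good_gr: "good p A \<Longrightarrow> v \<in> gr q \<Longrightarrow> A n v \<in> gr (p \<noteq> q)"
  and good_vac: "good p A \<Longrightarrow> n \<ge> 0 \<Longrightarrow> A n vac = 0"
  and good_D: "good p A \<Longrightarrow> D (A n v) - A n (D v) = - of_int n *\<^sub>C A (n - 1) v"
  by (auto simp: good_def is_fldD)

lemma good_state: "good p A \<Longrightarrow> A n vac \<in> gr p"
  using good_gr[OF _ vac_even, of p A n] by simp

lemma good_id: "good False (\<lambda>n v. if n = - 1 then v else 0)"
  unfolding good_def using gr_subspace
  by (auto simp: is_fld_id cvec.subspace_0 clinear_0[OF D_linear] scaleC_simps)

lemma good_0: "good p (\<lambda>n v. 0)"
  unfolding good_def using gr_subspace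
  by (auto simp: is_fld_0 cvec.subspace_0 clinear_0[OF D_linear] scaleC_simps)

lemma good_add: "good p A \<Longrightarrow> good p B \<Longrightarrow> good p (\<lambda>n v. A n v + B n v)"
proof -
  assume A: "good p A" and B: "good p B"
  have "D (A n v + B n v) - (A n (D v) + B n (D v)) = - of_int n *\<^sub>C (A (n - 1) v + B (n - 1) v)" for n v
    using good_D[OF A, of n v] good_D[OF B, of n v]
    by (simp add: clinear_add[OF D_linear] scaleC_simps algebra_simps)
  then show ?thesis
    using A B gr_subspace by (auto simp: good_def is_fld_add intro: cvec.subspace_add)
qed

lemma good_scale: "good p A \<Longrightarrow> good p (\<lambda>n v. c *\<^sub>C A n v)"
proof -
  assume A: "good p A"
  have "D (c *\<^sub>C A n v) - c *\<^sub>C A n (D v) = - of_int n *\<^sub>C c *\<^sub>C A (n - 1) v" for n v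
  proof -
    have "D (c *\<^sub>C A n v) - c *\<^sub>C A n (D v) = c *\<^sub>C (D (A n v) - A n (D v))"
      by (simp add: clinear_scale[OF D_linear] scaleC_simps)
    then show ?thesis unfolding good_D[OF A] by (simp add: scaleC_simps mult.commute)
  qed
  then show ?thesis
    using A gr_subspace by (auto simp: good_def is_fld_scale scaleC_simps intro: cvec.subspace_scale)
qed

text \<open>Covariance is the substantial part: the commutator with \<open>D\<close> acts on the
  integrand as the derivative in both variables, and \<open>res_derivation\<close> turns this into
  the derivative of the residue.\<close>

lemma good_prod:
  assumes A: "good p A" and B: "good q B"
  shows "good (p \<noteq> q) (fld_prod p q A n B)"
  unfolding good_def
proof (intro conjI allI ballI impI)
  show "is_fld (fld_prod p q A n B)"
    using A B by (simp add: is_fld_prod good_fld)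
  have lin: "clinear (A m)" "clinear (B m)" for m
    using A B by (simp_all add: good_clinear)
  show "fld_prod p q A n B m v \<in> gr ((p \<noteq> q) \<noteq> r)" if "v \<in> gr r" for r m v
  proof -
    have "A k (B l v) \<in> gr ((p \<noteq> q) \<noteq> r)" "B l (A k v) \<in> gr ((p \<noteq> q) \<noteq> r)" for k l
      using good_gr[OF A good_gr[OF B that], of k l] good_gr[OF B good_gr[OF A that], of l k]
      by (cases p; cases q; cases r; simp)+
    then show ?thesis
      unfolding fld_prod_def Sum_any.expand_set
      by (intro cvec.subspace_sum cvec.subspace_scale cvec.subspace_diff gr_subspace)
  qed
  show "fld_prod p q A n B m vac = 0" if "m \<ge> 0" for m
    unfolding fld_prod_def using that
    by (simp add: good_vac[OF A] good_vac[OF B] clinear_0[OF lin(1)] clinear_0[OF lin(2)] scaleC_simps)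
  show "D (fld_prod p q A n B m v) - fld_prod p q A n B m (D v)
      = - of_int m *\<^sub>C fld_prod p q A n B (m - 1) v" for m v
  proof -
    obtain K where K: "trunc K (\<lambda>m k. A m (B k v)) (\<lambda>m k. koszul p q *\<^sub>C B k (A m v))"
      using fld_prod_trunc[OF good_fld[OF A] good_fld[OF B]] by blast
    obtain K' where K': "trunc K' (\<lambda>m k. A m (B k (D v))) (\<lambda>m k. koszul p q *\<^sub>C B k (A m (D v)))"
      using fld_prod_trunc[OF good_fld[OF A] good_fld[OF B]] by blast
    let ?d = "\<lambda>P m k. of_int m *\<^sub>C P (m - 1) k + of_int k *\<^sub>C P m (k - 1)"
    let ?P = "\<lambda>m k. A m (B k v)" and ?Q = "\<lambda>m k. koszul p q *\<^sub>C B k (A m v)"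
    have L: "clinear (\<lambda>x. - D x)"
      using D_linear by (auto intro!: clinearI simp: clinear_simps scaleC_simps)
    have DK: "trunc K (\<lambda>m k. - D (A m (B k v))) (\<lambda>m k. - D (koszul p q *\<^sub>C B k (A m v)))"
      using K by (simp add: trunc_def clinear_0[OF D_linear] clinear_scale[OF D_linear] scaleC_simps)
    have DA: "D (A m x) = A m (D x) - of_int m *\<^sub>C A (m - 1) x" for m x
      using good_D[OF A, of m x] by (simp add: algebra_simps scaleC_simps)
    have DB: "D (B m x) = B m (D x) - of_int m *\<^sub>C B (m - 1) x" for m x
      using good_D[OF B, of m x] by (simp add: algebra_simps scaleC_simps)
    have P: "?d ?P m k = A m (B k (D v)) + - D (A m (B k v))" for m k
      by (simp add: DA DB clinear_diff[OF lin(1)] clinear_scale[OF lin(1)])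
    have Q: "?d ?Q m k = koszul p q *\<^sub>C B k (A m (D v)) + - D (koszul p q *\<^sub>C B k (A m v))" for m k
      by (simp add: clinear_scale[OF D_linear] DA DB clinear_diff[OF lin(2)] clinear_scale[OF lin(2)]
          scaleC_simps mult.commute algebra_simps)
    have "of_int m *\<^sub>C res n ?P ?Q (m - 1) = res n (?d ?P) (?d ?Q) m"
      by (rule res_derivation[OF K, symmetric])
    also have "\<dots> = res n (\<lambda>m k. A m (B k (D v))) (\<lambda>m k. koszul p q *\<^sub>C B k (A m (D v))) m
        + - D (res n ?P ?Q m)"
      unfolding P Q res_add[OF K' DK] res_clinear[OF K L] ..
    finally show ?thesis
      unfolding fld_prod_eq_res by (simp add: scaleC_simps algebra_simps)
  qed
qed

text \<open>Covariance and \<open>D vac = 0\<close> amount to A(z) vac = exp(z D) a for the state a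
  of A: each coefficient is, up to a nonzero integer factor, \<open>D\<close> of the previous
  one.\<close>

lemma good_vac_eq_0:
  assumes A: "good p A" and "A (- 1) vac = 0"
  shows "A n vac = 0"
proof -
  have "A (- 1 - int i) vac = 0" for i
  proof (induction i)
    case (Suc i)
    have "- of_int (- 1 - int i) *\<^sub>C A (- 1 - int i - 1) vac = 0"
      using good_D[OF A, of "- 1 - int i" vac] Suc D_linear
      by (simp add: D_vac clinear_0 good_clinear[OF A])
    moreover have "(- of_int (- 1 - int i) :: complex) = of_nat (Suc i)" by simp
    ultimately have "of_nat (Suc i) *\<^sub>C A (- 1 - int i - 1) vac = 0" by metis
    then have "A (- 1 - int i - 1) vac = 0"
      using of_nat_neq_0[of i, where ?'a = complex] by (metis cvec.scale_eq_0_iff)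
    then show ?case by (simp add: algebra_simps)
  qed (use assms in simp)
  from this[of "nat (- 1 - n)"] show ?thesis
    using good_vac[OF A, of n] by (cases "n \<ge> 0") simp_all
qed

text \<open>Goddard's uniqueness theorem. By locality (z - w)^N C(z)B(w) vac equals, up to sign, (z
  - w)^N B(w)C(z) vac, which is 0 because C(z) vac = 0. Setting w = 0 leaves z^N C(z) applied to the
  state of B.\<close>

theorem goddard:
  assumes C: "good p C" and B: "good q B" and loc: "mut_local p q C B" and "C (- 1) vac = 0"
  shows "C m (B (- 1) vac) = 0"
proof -
  obtain N where N: "\<And>v. (del ^^ N) (\<lambda>m k. C m (B k v) - koszul p q *\<^sub>C B k (C m v)) = (\<lambda>_ _. 0)"
    using loc by (auto simp: mut_local_def)
  \<comment> \<open>The index -1 in the second variable is the coefficient of w^0. As B(w) vac has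
    no negative powers of w, only the summand i = 0 survives; the shift by N compensates for
    z^N.\<close>
  let ?t = "\<lambda>i. ((- 1) ^ i * of_nat (N choose i)) *\<^sub>C
    (C (m - int N + int (N - i)) (B (- 1 + int i) vac))"
  have "0 = (del ^^ N) (\<lambda>m k. C m (B k vac) - koszul p q *\<^sub>C B k (C m vac)) (m - int N) (- 1)"
    by (simp add: N)
  also have "\<dots> = (\<Sum>i\<le>N. ?t i)"
    unfolding del_pow_eq_sum
    by (simp add: good_vac_eq_0[OF C assms(4)] clinear_0[OF good_clinear[OF B]] scaleC_simps)
  also have "\<dots> = (\<Sum>i\<in>{0}. ?t i)"
    by (rule sum.mono_neutral_right)
      (auto simp: good_vac[OF B] clinear_0[OF good_clinear[OF C]] scaleC_simps)
  finally show ?thesis by (simp add: scaleC_simps)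
qed

end

text \<open>The hypotheses of the reconstruction theorem. Cyclicity is phrased through invariant
  subspaces, so that it serves directly as an induction over states.\<close>

locale generating_fields = graded_space gr vac D
  for gr :: "bool \<Rightarrow> 'v::complex_space set" and vac D +
  fixes S :: "(bool \<times> 'v fld) set"
  assumes S_good: "(p, A) \<in> S \<Longrightarrow> good p A"
    and S_local: "(p, A) \<in> S \<Longrightarrow> (q, B) \<in> S \<Longrightarrow> mut_local p q A B"
    and S_cyclic: "cvec.subspace U \<Longrightarrow> vac \<in> U \<Longrightarrow>
      (\<And>p A n v. (p, A) \<in> S \<Longrightarrow> v \<in> U \<Longrightarrow> A n v \<in> U) \<Longrightarrow> U = UNIV"
begin

definition pairwise_local :: "(bool \<times> 'v fld) set \<Rightarrow> bool" where
  "pairwise_local T \<longleftrightarrow> (\<forall>p A q B. (p, A) \<in> T \<longrightarrow> (q, B) \<in> T \<longrightarrow> good p A \<and> mut_local p q A B)"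

lemma pairwise_local_iff: "pairwise_local T \<longleftrightarrow>
    (\<forall>x\<in>T. \<forall>y\<in>T. good (fst x) (snd x) \<and> mut_local (fst x) (fst y) (snd x) (snd y))"
  unfolding pairwise_local_def by fastforce

text \<open>Dong's lemma for a product \<open>A\<^sub>(\<^sub>n\<^sub>)B\<close> also needs the locality of \<open>A\<close> with \<open>B\<close>, so an
  induction on one of the two fields does not go through. Instead, all generated fields lie in
  any maximal pairwise local set containing the generators.\<close>

lemma gen_pairwise_local: "\<exists>M. pairwise_local M \<and> (\<forall>p A. gen_fld S p A \<longrightarrow> (p, A) \<in> M)"
proof -
  let ?F = "{T. pairwise_local (T \<union> S)}"
  have "\<exists>M\<in>?F. \<forall>X\<in>?F. M \<subseteq> X \<longrightarrow> X = M"
  proof (rule subset_Zorn')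
    fix C assume C: "subset.chain ?F C"
    have "\<exists>T. pairwise_local T \<and> x \<in> T \<and> y \<in> T" if xy: "x \<in> \<Union>C \<union> S" "y \<in> \<Union>C \<union> S" for x y
    proof (cases "x \<in> S \<and> y \<in> S")
      case True
      have "pairwise_local S" by (auto simp: pairwise_local_def S_good S_local)
      then show ?thesis using True by blast
    next
      case False
      then obtain T where "T \<in> C" "x \<in> T \<union> S" "y \<in> T \<union> S"
        using xy C unfolding subset.chain_def by blast
      moreover from this have "pairwise_local (T \<union> S)" using C by (auto simp: subset.chain_def)
      ultimately show ?thesis by blast
    qed
    then have "pairwise_local (\<Union>C \<union> S)"
      unfolding pairwise_local_iff by meson
    then show "\<Union>C \<in> ?F" by simp
  qed
  then obtain M0 where M0: "pairwise_local (M0 \<union> S)" and max: "\<And>X. pairwise_local (X \<union> S) \<Longrightarrow> M0 \<subseteq> X \<Longrightarrow> X = M0"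
    by blast
  define M where "M = M0 \<union> S"
  have good: "good p A" if "(p, A) \<in> M" for p A
    using M0 that unfolding pairwise_local_def M_def by blast
  have loc: "mut_local p q A B" if "(p, A) \<in> M" "(q, B) \<in> M" for p A q B
    using M0 that unfolding pairwise_local_def M_def by blast
  \<comment> \<open>Maximality in usable form. The premise asks that \<open>A\<close> be local with
    every good field that is local with all of \<open>M\<close>. This covers the members of
    \<open>M\<close>, and then \<open>A\<close> itself, so that \<open>A\<close> can be
    added.\<close>
  have closed: "(p, A) \<in> M" if A: "good p A" "\<And>q B. good q B \<Longrightarrow>
      (\<And>r C. (r, C) \<in> M \<Longrightarrow> mut_local q r B C) \<Longrightarrow> mut_local q p B A" for p A
  proof -
    have 1: "mut_local q p B A" if "(q, B) \<in> M" for q B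
      using A(2) good loc that by blast
    have 2: "mut_local p p A A"
      using A(2)[OF A(1)] 1 mut_local_sym by blast
    have "pairwise_local (insert (p, A) M0 \<union> S)"
    proof -
      have mem: "x \<in> insert (p, A) M0 \<union> S \<longleftrightarrow> x = (p, A) \<or> x \<in> M" for x by (auto simp: M_def)
      show ?thesis
        unfolding pairwise_local_def mem
      proof (intro allI impI conjI)
        fix q B r C assume x: "(q, B) = (p, A) \<or> (q, B) \<in> M" and y: "(r, C) = (p, A) \<or> (r, C) \<in> M"
        show "good q B" using x A(1) good by auto
        show "mut_local q r B C"
          using x y
        proof (elim disjE)
          assume "(q, B) = (p, A)" "(r, C) \<in> M"
          then show ?thesis using mut_local_sym[OF 1] by simp
        qed (use 1 2 loc in simp_all)
      qed
    qed
    then have "insert (p, A) M0 = M0" using max by blast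
    then show ?thesis by (auto simp: M_def)
  qed
  have "(p, A) \<in> M" if "gen_fld S p A" for p A
    using that
  proof (induction rule: gen_fld.induct)
    case (generator p A)
    then show ?case by (simp add: M_def)
  next
    case identity
    show ?case by (rule closed) (auto intro: good_id mut_local_id simp: good_clinear)
  next
    case (zero p)
    show ?case by (rule closed) (auto intro: good_0 mut_local_0 simp: good_clinear)
  next
    case (add p A B)
    then show ?case by (intro closed good_add mut_local_add) (auto intro: good simp: good_clinear)
  next
    case (scale p A c)
    then show ?case by (intro closed good_scale mut_local_scale) (auto intro: good simp: good_clinear)
  next
    case (prod p A q B n)
    show ?case
    proof (rule closed)
      show "good (p \<noteq> q) (fld_prod p q A n B)" using prod good by (intro good_prod)
      fix r C assume C: "good r C" "\<And>q B. (q, B) \<in> M \<Longrightarrow> mut_local r q C B"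
      show "mut_local r (p \<noteq> q) C (fld_prod p q A n B)"
        using prod.IH
        by (intro mut_local_sym[OF dong[OF _ _ _ loc mut_local_sym[OF C(2)] mut_local_sym[OF C(2)]]]
            good_fld[OF good] good_fld[OF C(1)])
    qed
  qed
  moreover have "pairwise_local M"
    unfolding pairwise_local_def by (intro allI impI conjI) (rule good loc, assumption+)+
  ultimately show ?thesis by blast
qed

lemma gen_good_local:
  assumes "gen_fld S p A" "gen_fld S q B"
  shows "good p A \<and> mut_local p q A B"
proof -
  obtain M where M: "pairwise_local M" and mem: "\<And>p A. gen_fld S p A \<Longrightarrow> (p, A) \<in> M"
    using gen_pairwise_local by blast
  show ?thesis
    using M[unfolded pairwise_local_def, rule_format, OF mem mem] assms by blast
qed

lemma gen_local: "gen_fld S p A \<Longrightarrow> gen_fld S q B \<Longrightarrow> mut_local p q A B"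
  and gen_good: "gen_fld S p A \<Longrightarrow> good p A"
  using gen_good_local by blast+

definition full :: "'v fld \<Rightarrow> bool" where
  "full A \<longleftrightarrow> (\<exists>A0 A1. gen_fld S False A0 \<and> gen_fld S True A1 \<and> A = (\<lambda>n v. A0 n v + A1 n v))"

lemma gen_full: "gen_fld S p A \<Longrightarrow> full A"
  using gen_fld.zero[of S False] gen_fld.zero[of S True] unfolding full_def
  by (cases p) fastforce+

lemma full_add: "full A \<Longrightarrow> full B \<Longrightarrow> full (\<lambda>n v. A n v + B n v)"
proof -
  assume "full A" "full B"
  then obtain A0 A1 B0 B1 where *: "gen_fld S False A0" "gen_fld S True A1" "A = (\<lambda>n v. A0 n v + A1 n v)"
    "gen_fld S False B0" "gen_fld S True B1" "B = (\<lambda>n v. B0 n v + B1 n v)"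
    unfolding full_def by blast
  have "(\<lambda>n v. A n v + B n v) = (\<lambda>n v. (A0 n v + B0 n v) + (A1 n v + B1 n v))"
    by (simp add: * add_ac)
  then show ?thesis
    unfolding full_def using gen_fld.add[OF *(1,4)] gen_fld.add[OF *(2,5)] by blast
qed

lemma full_scale: "full A \<Longrightarrow> full (\<lambda>n v. c *\<^sub>C A n v)"
proof -
  assume "full A"
  then obtain A0 A1 where *: "gen_fld S False A0" "gen_fld S True A1" "A = (\<lambda>n v. A0 n v + A1 n v)"
    unfolding full_def by blast
  have "(\<lambda>n v. c *\<^sub>C A n v) = (\<lambda>n v. c *\<^sub>C A0 n v + c *\<^sub>C A1 n v)"
    by (simp add: * scaleC_add_right)
  then show ?thesis
    unfolding full_def using gen_fld.scale[OF *(1)] gen_fld.scale[OF *(2)] by blast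
qed

lemma full_0: "full (\<lambda>n v. 0)"
  using gen_full gen_fld.zero by blast

lemma gen_fld_diff: "gen_fld S p A \<Longrightarrow> gen_fld S p B \<Longrightarrow> gen_fld S p (\<lambda>n v. A n v - B n v)"
  using gen_fld.add[of S p A "\<lambda>n v. (- 1) *\<^sub>C B n v"] gen_fld.scale[of S p B "- 1"]
  by (simp add: scaleC_simps)

text \<open>The state of the n-th product of A and B is \<open>A n\<close> applied to the state of
  B, so the states of generated fields form a subspace stable under the generators, and cyclicity
  applies.\<close>

lemma full_exists: "\<exists>A. full A \<and> A (- 1) vac = a"
proof -
  have "{a. \<exists>A. full A \<and> A (- 1) vac = a} = UNIV" (is "?U = _")
  proof (rule S_cyclic)
    show "cvec.subspace ?U"
      unfolding cvec.subspace_def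
      using full_0 full_add full_scale by (safe; fastforce)
    show "vac \<in> ?U"
      using gen_full[OF gen_fld.identity] by fastforce
    fix p A n v assume A: "(p, A) \<in> S" and "v \<in> ?U"
    then obtain B0 B1 where B: "gen_fld S False B0" "gen_fld S True B1" "v = B0 (- 1) vac + B1 (- 1) vac"
      unfolding full_def by blast
    have *: "fld_prod p q A n B (- 1) vac = A n (B (- 1) vac)" if "gen_fld S q B" for q B
    proof -
      have "good p A" "good q B" using A that by (simp_all add: S_good gen_good)
      then have "fld_prod p q A n B (- 1) vac = Sum_any (\<lambda>j::nat. if j = 0 then A n (B (- 1) vac) else 0)"
        unfolding fld_prod_def
        by (intro Sum_any.cong) (auto simp: good_vac clinear_0[OF good_clinear] scaleC_simps)
      then show ?thesis by simp
    qed
    let ?P = "\<lambda>q B. fld_prod p q A n B"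
    have "full (\<lambda>k w. ?P False B0 k w + ?P True B1 k w)"
      using gen_fld.prod[OF gen_fld.generator[OF A] B(1)] gen_fld.prod[OF gen_fld.generator[OF A] B(2)]
      by (intro full_add gen_full)
    moreover have "?P False B0 (- 1) vac + ?P True B1 (- 1) vac = A n v"
      using A by (simp add: * B clinear_add[OF good_clinear[OF S_good]])
    ultimately show "A n v \<in> ?U" by blast
  qed
  then show ?thesis by blast
qed

text \<open>By \<open>full_exists\<close> every vector is a sum of states of generated fields, so
  Goddard's theorem reaches the whole space.\<close>

lemma gen_eq_0:
  assumes C: "gen_fld S p C" and "C (- 1) vac = 0"
  shows "C n v = 0"
proof -
  obtain B0 B1 where B: "gen_fld S False B0" "gen_fld S True B1" "v = B0 (- 1) vac + B1 (- 1) vac"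
    using full_exists[of v] unfolding full_def by blast
  have "C n (B (- 1) vac) = 0" if "gen_fld S q B" for q B
    using goddard[OF gen_good[OF C] gen_good[OF that] gen_local[OF C that] assms(2)] .
  then show ?thesis
    using B by (simp add: clinear_add[OF good_clinear[OF gen_good[OF C]]])
qed

lemma gr_direct:
  assumes "u \<in> gr False" "u' \<in> gr False" "w \<in> gr True" "w' \<in> gr True" "u + w = u' + w'"
  shows "u = u'" "w = w'"
proof -
  have "u - u' = w' - w" using assms(5) by (simp add: algebra_simps)
  moreover have "u - u' \<in> gr False" "w' - w \<in> gr True"
    using assms gr_subspace cvec.subspace_diff by blast+
  ultimately have "u - u' \<in> gr False \<inter> gr True" by simp
  then show "u = u'" unfolding gr_inter by simp
  with assms(5) show "w = w'" by simp
qed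

text \<open>Goddard's theorem is available for fields of definite parity, so even and odd parts are
  compared separately; their states agree because the grading is direct.\<close>

lemma full_unique:
  assumes "full A" "full B" "A (- 1) vac = B (- 1) vac"
  shows "A = B"
proof -
  obtain A0 A1 B0 B1 where *: "gen_fld S False A0" "gen_fld S True A1" "A = (\<lambda>n v. A0 n v + A1 n v)"
    "gen_fld S False B0" "gen_fld S True B1" "B = (\<lambda>n v. B0 n v + B1 n v)"
    using assms unfolding full_def by blast
  have "A0 (- 1) vac = B0 (- 1) vac" "A1 (- 1) vac = B1 (- 1) vac"
    using assms(3) * gr_direct[of "A0 (- 1) vac" "B0 (- 1) vac" "A1 (- 1) vac" "B1 (- 1) vac"]
    by (simp_all add: gen_good good_state)
  then have "A0 n v - B0 n v = 0" "A1 n v - B1 n v = 0" for n v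
    using gen_eq_0[OF gen_fld_diff[OF *(1,4)]] gen_eq_0[OF gen_fld_diff[OF *(2,5)]] by simp_all
  then show ?thesis using * by simp
qed

definition V where "V = field_vsa gr vac S"

abbreviation Y :: "'v \<Rightarrow> 'v fld" where "Y \<equiv> vs_prod V"

lemma V_simps [simp]: "vs_grade V = gr" "vs_vac V = vac"
  by (simp_all add: V_def field_vsa_def)

text \<open>Existence and uniqueness make the definite description in \<open>field_vsa\<close>
  denote; from here on it is evaluated by exhibiting a generated field with the right state.\<close>

lemma Y_eqI: "full A \<Longrightarrow> A (- 1) vac = a \<Longrightarrow> Y a = A"
  unfolding V_def field_vsa_def vsa.select_convs full_def[symmetric]
proof (rule the_equality)
  fix B assume A: "full A" "A (- 1) vac = a"
    and "\<exists>A0 A1. gen_fld S False A0 \<and> gen_fld S True A1 \<and> B = (\<lambda>n v. A0 n v + A1 n v) \<and> B (- 1) vac = a"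
  then have "full B" "B (- 1) vac = a" by (auto simp: full_def)
  then show "B = A" using A full_unique by simp
qed (auto simp: full_def)

lemma Y_full: "full (Y a)" and Y_vac: "Y a (- 1) vac = a"
  using full_exists[of a] Y_eqI[of _ a] by auto

lemma Y_gen: "gen_fld S p A \<Longrightarrow> Y (A (- 1) vac) = A"
  using Y_eqI gen_full by blast

lemma Y_generator: "(p, A) \<in> S \<Longrightarrow> Y (A (- 1) vac) = A"
  using Y_gen gen_fld.generator by blast

text \<open>The component of \<open>Y a\<close> of the wrong parity has state 0, since the grading
  is direct, and is therefore 0.\<close>

lemma gr_gen:
  assumes "a \<in> gr p"
  shows "gen_fld S p (Y a)"
proof -
  obtain A0 A1 where A: "gen_fld S False A0" "gen_fld S True A1" "Y a = (\<lambda>n v. A0 n v + A1 n v)"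
    using Y_full[of a] unfolding full_def by blast
  have a: "a = A0 (- 1) vac + A1 (- 1) vac"
    using Y_vac[of a] A by metis
  have s: "A0 (- 1) vac \<in> gr False" "A1 (- 1) vac \<in> gr True"
    using A by (simp_all add: gen_good good_state)
  have z: "0 \<in> gr q" for q using gr_subspace cvec.subspace_0 by blast
  show ?thesis
  proof (cases p)
    case True
    then have "a \<in> gr True" "A0 (- 1) vac + A1 (- 1) vac = 0 + a" using assms a by simp_all
    then have "A0 (- 1) vac = 0" by (rule gr_direct(1)[OF s(1) z s(2)])
    from gen_eq_0[OF A(1) this] show ?thesis using A True by simp
  next
    case False
    then have "a \<in> gr False" "A0 (- 1) vac + A1 (- 1) vac = a + 0" using assms a by simp_all
    then have "A1 (- 1) vac = 0" by (rule gr_direct(2)[OF s(1) _ s(2) z])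
    from gen_eq_0[OF A(2) this] show ?thesis using A False by simp
  qed
qed

lemma carrier_V: "carrier V = UNIV"
  using gr_sum by (auto simp: carrier_def) metis

lemma Y_add: "Y (a + b) = (\<lambda>n v. Y a n v + Y b n v)"
  and Y_scale: "Y (c *\<^sub>C a) = (\<lambda>n v. c *\<^sub>C Y a n v)"
  by (rule Y_eqI; simp add: full_add full_scale Y_full Y_vac)+

lemma Y_fld: "is_fld (Y a)"
  using Y_full[of a] unfolding full_def by (auto intro!: is_fld_add dest: good_fld[OF gen_good])

lemma Y_nonneg: "n \<ge> 0 \<Longrightarrow> Y a n vac = 0"
  using Y_full[of a] unfolding full_def by (auto simp: good_vac[OF gen_good])

lemma Y_D: "D (Y a n v) - Y a n (D v) = - of_int n *\<^sub>C Y a (n - 1) v"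
proof -
  obtain A0 A1 where A: "gen_fld S False A0" "gen_fld S True A1" "Y a = (\<lambda>n v. A0 n v + A1 n v)"
    using Y_full[of a] unfolding full_def by blast
  show ?thesis
    using good_D[OF gen_good[OF A(1)], of n v] good_D[OF gen_good[OF A(2)], of n v]
    unfolding A(3) by (simp add: clinear_add[OF D_linear] scaleC_simps algebra_simps)
qed

lemma Y_D_vac: "Y a (- 2) vac = D a"
  using Y_D[of a "- 1" vac] by (simp add: Y_vac D_vac clinear_0[OF is_fldD[OF Y_fld]] scaleC_simps)

lemma clinear_comb: "clinear f \<Longrightarrow> f (c *\<^sub>C a + b) = c *\<^sub>C f a + f b"
  by (simp add: clinear_simps)

theorem vertex_superalgebra_V: "vertex_superalgebra V"
  unfolding vertex_superalgebra_def carrier_V V_simps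
proof (intro conjI allI ballI)
  show "Y a n b \<in> gr (p \<noteq> q)" if "a \<in> gr p" "b \<in> gr q" for p q a b n
    using good_gr[OF gen_good[OF gr_gen[OF that(1)]] that(2)] .
  show "\<exists>N. \<forall>n\<ge>N. Y a n b = 0" for a b
    using Y_fld[of a] by (simp add: is_fld_def)
  show "Y vac n a = (if n = - 1 then a else 0)" for n a
    using fun_cong[OF fun_cong[OF Y_gen[OF gen_fld.identity]], of n a] by simp
  show "\<exists>N::nat. \<forall>m n. \<forall>c\<in>UNIV.
        (\<Sum>i\<le>N. ((- 1) ^ i * of_nat (N choose i)) *\<^sub>C
          (Y a (m + int (N - i)) (Y b (n + int i) c)
           - koszul p q *\<^sub>C Y b (n + int i) (Y a (m + int (N - i)) c))) = 0"
    if ab: "a \<in> gr p" "b \<in> gr q" for p q a b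
  proof -
    obtain N where N: "\<And>v. (del ^^ N) (\<lambda>m k. Y a m (Y b k v) - koszul p q *\<^sub>C Y b k (Y a m v)) = (\<lambda>_ _. 0)"
      using gen_local[OF gr_gen gr_gen, OF ab] by (auto simp: mut_local_def)
    show ?thesis
    proof (intro exI allI ballI)
      fix m n c
      show "(\<Sum>i\<le>N. ((- 1) ^ i * of_nat (N choose i)) *\<^sub>C
          (Y a (m + int (N - i)) (Y b (n + int i) c)
           - koszul p q *\<^sub>C Y b (n + int i) (Y a (m + int (N - i)) c))) = 0"
        using del_pow_eq_sum[of N "\<lambda>m k. Y a m (Y b k c) - koszul p q *\<^sub>C Y b k (Y a m c)" m n]
        unfolding N by simp
    qed
  qed
qed (simp_all add: gr_subspace gr_inter vac_even Y_add Y_scale Y_vac Y_nonneg Y_D_vac Y_D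
    clinear_comb[OF is_fldD[OF Y_fld]])

end

section \<open>Consequences of the axioms\<close>

lemmas vsa_unfold = vertex_superalgebra_def[THEN iffD1]
lemmas vsa_subspace = vsa_unfold[THEN conjunct1, rule_format]
  and vsa_tail1 = vsa_unfold[THEN conjunct2]
lemmas vsa_inter = vsa_tail1[THEN conjunct1]
  and vsa_tail2 = vsa_tail1[THEN conjunct2]
lemmas vsa_vac = vsa_tail2[THEN conjunct1]
  and vsa_tail3 = vsa_tail2[THEN conjunct2]
lemmas vsa_grade = vsa_tail3[THEN conjunct1, rule_format]
  and vsa_tail4 = vsa_tail3[THEN conjunct2]
lemmas vsa_linear = vsa_tail4[THEN conjunct1, rule_format]
  and vsa_tail5 = vsa_tail4[THEN conjunct2]
lemmas vsa_trunc = vsa_tail5[THEN conjunct1, rule_format]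
  and vsa_tail6 = vsa_tail5[THEN conjunct2]
lemmas vsa_vac_left = vsa_tail6[THEN conjunct1, rule_format]
  and vsa_tail7 = vsa_tail6[THEN conjunct2]
lemmas vsa_creation = vsa_tail7[THEN conjunct1, rule_format]
  and vsa_tail8 = vsa_tail7[THEN conjunct2]
lemmas vsa_translation = vsa_tail8[THEN conjunct1, rule_format]
  and vsa_local = vsa_tail8[THEN conjunct2, rule_format]

text \<open>The algebras built from fields and their tensor products fill their types. A proper
  subalgebra is treated as \<open>restrict_vsa\<close> of such an algebra, with the calculations
  made in the large one.\<close>

locale full_vsa =
  fixes V :: "'v::complex_space vsa"
  assumes vsa: "vertex_superalgebra V" and carrier_UNIV: "carrier V = UNIV"
begin

abbreviation Y :: "'v \<Rightarrow> 'v fld" where "Y \<equiv> vs_prod V"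
abbreviation vac :: 'v where "vac \<equiv> vs_vac V"
abbreviation gr :: "bool \<Rightarrow> 'v set" where "gr \<equiv> vs_grade V"

lemma in_carrier [simp]: "a \<in> carrier V" by (simp add: carrier_UNIV)

lemma Y_left: "clinear (\<lambda>a. Y a n b)"
proof (rule clinearI)
  have *: "Y (c *\<^sub>C a + a') n b = c *\<^sub>C Y a n b + Y a' n b" for a a' c
    using vsa_linear[OF vsa, of a a' b c n] by simp
  show "Y (u + v) n b = Y u n b + Y v n b" for u v
    using *[of 1 u v] by (simp add: scaleC_simps)
  have "Y 0 n b = 0" using *[of 1 0 0] by (simp add: scaleC_simps)
  then show "Y (c *\<^sub>C u) n b = c *\<^sub>C Y u n b" for c u
    using *[of c u 0] by simp
qed

lemma Y_right: "clinear (Y a n)"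
proof (rule clinearI)
  have *: "Y b n (c *\<^sub>C a + a') = c *\<^sub>C Y b n a + Y b n a'" for a a' b c
    using vsa_linear[OF vsa, of a a' b c n] by simp
  show "Y a n (u + v) = Y a n u + Y a n v" for u v
    using *[of a 1 u v] by (simp add: scaleC_simps)
  have "Y a n 0 = 0" using *[of a 1 0 0] by (simp add: scaleC_simps)
  then show "Y a n (c *\<^sub>C u) = c *\<^sub>C Y a n u" for c u
    using *[of a c u 0] by simp
qed

lemma Y_gr: "a \<in> gr p \<Longrightarrow> b \<in> gr q \<Longrightarrow> Y a n b \<in> gr (p \<noteq> q)"
  by (rule vsa_grade[OF vsa])

lemma Y_fld: "is_fld (Y a)"
  unfolding is_fld_def using vsa_trunc[OF vsa] Y_right by simp

lemma Y_vac_left: "Y vac n a = (if n = - 1 then a else 0)"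
  by (rule vsa_vac_left[OF vsa]) simp

lemma Y_vac: "Y a (- 1) vac = a" "n \<ge> 0 \<Longrightarrow> Y a n vac = 0"
  using vsa_creation[OF vsa, of a] by simp_all

lemma Y_local: "a \<in> gr p \<Longrightarrow> b \<in> gr q \<Longrightarrow> mut_local p q (Y a) (Y b)"
  unfolding mut_local_def fun_eq_iff del_pow_eq_sum using vsa_local[OF vsa, of a p b q] by fastforce

lemma grade_sum: "\<exists>u\<in>gr False. \<exists>w\<in>gr True. v = u + w"
  using in_carrier[of v] unfolding carrier_def by blast

sublocale graded_space gr vac "\<lambda>a. Y a (- 2) vac"
proof (rule graded_space.intro)
  show "gr False \<inter> gr True = {0}" "vac \<in> gr False"
    by (rule vsa_inter[OF vsa] vsa_vac[OF vsa])+
  show "Y vac (- 2) vac = 0" by (simp add: Y_vac_left)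
qed (rule vsa_subspace[OF vsa] grade_sum Y_left)+

lemma Y_good: "a \<in> gr p \<Longrightarrow> good p (Y a)"
  unfolding good_def using Y_fld Y_gr Y_vac vsa_translation[OF vsa] by simp

lemma homogeneous_induct:
  assumes "\<And>p a. a \<in> gr p \<Longrightarrow> P a" "\<And>a b. P a \<Longrightarrow> P b \<Longrightarrow> P (a + b)"
  shows "P a"
  using gr_sum[of a] assms by blast

lemma good_eq_0:
  assumes C: "good p C" and "C (- 1) vac = 0" and "\<And>q b. b \<in> gr q \<Longrightarrow> mut_local p q C (Y b)"
  shows "C n v = 0"
proof (induction v rule: homogeneous_induct)
  case (1 q b)
  show ?case using goddard[OF C Y_good[OF 1] assms(3)[OF 1] assms(2)] by (simp add: Y_vac)
qed (simp add: clinear_simps good_clinear[OF C])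

text \<open>The iterate form of Borcherds' identity. By Dong's lemma the product field is local with
  all fields of the algebra, and its state is \<open>Y a n b\<close>; uniqueness does the
  rest.\<close>

theorem Y_prod:
  assumes a: "a \<in> gr p" and b: "b \<in> gr q"
  shows "Y (Y a n b) = fld_prod p q (Y a) n (Y b)"
proof (intro ext)
  fix m v
  let ?C = "\<lambda>m v. fld_prod p q (Y a) n (Y b) m v + (- 1) *\<^sub>C Y (Y a n b) m v"
  have ab: "Y a n b \<in> gr (p \<noteq> q)" using Y_gr[OF a b] .
  have "?C m v = 0"
  proof (rule good_eq_0[where p = "p \<noteq> q" and C = ?C])
    show C: "good (p \<noteq> q) ?C"
      by (intro good_add good_scale good_prod Y_good a b ab)
    have "fld_prod p q (Y a) n (Y b) (- 1) vac = Sum_any (\<lambda>j::nat. if j = 0 then Y a n b else 0)"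
      unfolding fld_prod_def
      by (intro Sum_any.cong) (auto simp: Y_vac clinear_0[OF Y_right] scaleC_simps)
    then show "?C (- 1) vac = 0" by (simp add: Y_vac scaleC_simps)
    fix r c assume c: "c \<in> gr r"
    have "mut_local r (p \<noteq> q) (Y c) ?C"
      by (intro mut_local_add mut_local_scale mut_local_sym[OF dong] Y_local Y_fld allI Y_right a b c ab)
    then show "mut_local (p \<noteq> q) r ?C (Y c)" by (rule mut_local_sym)
  qed
  then show "Y (Y a n b) m v = fld_prod p q (Y a) n (Y b) m v" by (simp add: scaleC_simps)
qed

theorem Y_commutator:
  assumes a: "a \<in> gr p" and b: "b \<in> gr q"
  obtains N where "\<And>M m k v. M \<ge> N \<Longrightarrow> Y a m (Y b k v) - koszul p q *\<^sub>C Y b k (Y a m v)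
      = (\<Sum>j<M. (of_int m gchoose j) *\<^sub>C Y (Y a (int j) b) (m + k - int j) v)"
proof -
  obtain N0 where N0: "\<And>N v. N \<ge> N0 \<Longrightarrow>
    (del ^^ N) (\<lambda>m k. Y a m (Y b k v) - koszul p q *\<^sub>C Y b k (Y a m v)) = (\<lambda>_ _. 0)"
    using Y_local[OF a b] by (rule mut_localE) blast
  show thesis
  proof (rule that)
    fix M m k v assume M: "M \<ge> N0"
    obtain K where K: "trunc K (\<lambda>m k. Y a m (Y b k v)) (\<lambda>m k. koszul p q *\<^sub>C Y b k (Y a m v))"
      using fld_prod_trunc[OF Y_fld Y_fld] by blast
    have "(del ^^ j) (\<lambda>m k. Y a m (Y b k v) - koszul p q *\<^sub>C Y b k (Y a m v)) 0 l
        = Y (Y a (int j) b) l v" for j l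
      unfolding Y_prod[OF a b] fld_prod_eq_res res_nonneg[OF K] ..
    then show "Y a m (Y b k v) - koszul p q *\<^sub>C Y b k (Y a m v)
      = (\<Sum>j<M. (of_int m gchoose j) *\<^sub>C Y (Y a (int j) b) (m + k - int j) v)"
      using newton_expansion[OF N0[OF M], of m k v] by simp
  qed
qed

lemma clinear_comb_right: "Y a n (c *\<^sub>C u + v) = c *\<^sub>C Y a n u + Y a n v"
  and clinear_comb_left: "Y (c *\<^sub>C u + v) n a = c *\<^sub>C Y u n a + Y v n a"
  by (simp_all add: clinear_simps[OF Y_right] clinear_simps[OF Y_left])

lemma restrict_vertex_superalgebra:
  assumes U: "cvec.subspace U" "vac \<in> U" "\<And>a b n. a \<in> U \<Longrightarrow> b \<in> U \<Longrightarrow> Y a n b \<in> U"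
  shows "vertex_superalgebra (restrict_vsa V U)"
proof -
  have sel [simp]: "vs_grade (restrict_vsa V U) = (\<lambda>p. gr p \<inter> U)" "vs_vac (restrict_vsa V U) = vac"
    "vs_prod (restrict_vsa V U) = Y"
    by (simp_all add: restrict_vsa_def)
  show ?thesis
    unfolding vertex_superalgebra_def sel
  proof (intro conjI allI ballI)
    show "(gr False \<inter> U) \<inter> (gr True \<inter> U) = {0}"
      using gr_inter cvec.subspace_0[OF U(1)] by auto
    show "Y a n b \<in> gr (p \<noteq> q) \<inter> U" if "a \<in> gr p \<inter> U" "b \<in> gr q \<inter> U" for a b n p q
      using that U Y_gr by auto
    show "\<exists>N. \<forall>n\<ge>N. Y a n b = 0" for a b using vsa_trunc[OF vsa, of a b] by simp
    show "\<exists>N. \<forall>m n. \<forall>c\<in>carrier (restrict_vsa V U).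
        (\<Sum>i\<le>N. ((- 1) ^ i * of_nat (N choose i)) *\<^sub>C
          (Y a (m + int (N - i)) (Y b (n + int i) c)
           - koszul p q *\<^sub>C Y b (n + int i) (Y a (m + int (N - i)) c))) = 0"
      if "a \<in> gr p \<inter> U" "b \<in> gr q \<inter> U" for p q a b
      using vsa_local[OF vsa, of a p b q] that by fastforce
    show "Y (Y a n b) (- 2) vac - Y a n (Y b (- 2) vac) = - of_int n *\<^sub>C Y a (n - 1) b" for a b n
      using vsa_translation[OF vsa] by simp
  qed (use U in \<open>simp_all add: Y_vac_left Y_vac clinear_comb_left clinear_comb_right gr_subspace
      vac_even cvec.subspace_inter\<close>)
qed

end

section \<open>Tensor products\<close>

lemma poly_mapping_expand: "v = (\<Sum>k\<in>Poly_Mapping.keys v. Poly_Mapping.lookup v k *\<^sub>C basis k)"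
  using lin_ext_basis_self[of v, symmetric] unfolding lin_ext_def .

lemma basis_nonzero: "basis k \<noteq> (0 :: 'k \<Rightarrow>\<^sub>0 complex)"
  by (metis lookup_single_eq lookup_zero zero_neq_one)

lemma basis_induct [case_names scale add]:
  assumes "\<And>c k. P (c *\<^sub>C basis k)" "\<And>u v. P u \<Longrightarrow> P v \<Longrightarrow> P (u + v)"
  shows "P (v :: 'k \<Rightarrow>\<^sub>0 complex)"
proof -
  have 0: "P 0" using assms(1)[of 0] by (simp add: scaleC_simps)
  have "P (\<Sum>k\<in>K. Poly_Mapping.lookup v k *\<^sub>C basis k)" if "finite K" for K
    using that by (induction K) (use 0 assms in auto)
  then show ?thesis using poly_mapping_expand[of v] by (metis finite_keys)
qed

lemma clinear_eq_on_keys: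
  assumes "clinear f" "clinear g" "\<And>k. k \<in> Poly_Mapping.keys v \<Longrightarrow> f (basis k) = g (basis k)"
  shows "f v = g v"
  by (subst (1 2) poly_mapping_expand) (simp add: assms clinear_simps)

lemma clinear_lin_ext_comp: "(\<And>k. clinear (f k)) \<Longrightarrow> clinear (\<lambda>x. lin_ext (\<lambda>k. f k x) v)"
  by (auto intro!: clinearI simp: lin_ext_def clinear_simps sum.distrib scaleC_simps
      cvec.scale_sum_right mult.commute)

lemma clinear_comp: "clinear f \<Longrightarrow> clinear g \<Longrightarrow> clinear (\<lambda>x. f (g x))"
  by (auto intro!: clinearI simp: clinear_simps)

lemma tens_left: "clinear (\<lambda>u. u \<otimes> w)"
  unfolding tens_def by (rule clinear_lin_ext)

lemma tens_right: "clinear (\<lambda>w. u \<otimes> w)"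
  unfolding tens_def by (rule clinear_lin_ext_comp) (rule clinear_lin_ext)

lemma tens_basis: "basis a \<otimes> basis b = basis (a, b)"
  by (simp add: tens_def)

lemmas tens_simps = clinear_simps[OF tens_left] clinear_simps[OF tens_right]

lemma keys_span_basis:
  assumes "v \<in> cvec.span {basis k | k. P k}"
  shows "\<forall>k\<in>Poly_Mapping.keys v. P k"
  using assms
proof (induction rule: cvec.span_induct_alt)
  case (step c x y)
  then obtain k where x: "x = basis k" "P k" by blast
  have "Poly_Mapping.keys (c *\<^sub>C x) \<subseteq> {k}"
    by (auto simp: x in_keys_iff scaleC_poly_mapping.rep_eq scaleC_complex_def lookup_single when_def
        split: if_splits)
  then show ?case
    using step.IH x Poly_Mapping.keys_add[of "c *\<^sub>C x" y] by blast
qed simp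

lemma span_basis_inter: "cvec.span {basis k | k. P k} \<inter> cvec.span {basis k | k. \<not> P k} = {0}"
proof -
  have "v = 0" if "v \<in> cvec.span {basis k | k. P k}" "v \<in> cvec.span {basis k | k. \<not> P k}"
    for v :: "'a \<Rightarrow>\<^sub>0 complex"
    using keys_span_basis[OF that(1)] keys_span_basis[OF that(2)] by (metis all_not_in_conv keys_eq_empty)
  then show ?thesis by (auto simp: cvec.span_zero)
qed

lemma span_basis_sum:
  "\<exists>u\<in>cvec.span {basis k | k. P k}. \<exists>w\<in>cvec.span {basis k | k. \<not> P k}. v = u + w"
proof (induction v rule: basis_induct)
  case (scale c k)
  have mem: "c *\<^sub>C basis k \<in> cvec.span {basis k | k. Q k}" if "Q k" for Q
    by (rule cvec.span_scale, rule cvec.span_base) (use that in blast)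
  show ?case
  proof (cases "P k")
    case True
    then show ?thesis
      by (intro bexI[of _ "c *\<^sub>C basis k"] bexI[of _ 0]) (simp_all add: mem cvec.span_zero)
  next
    case False
    then show ?thesis
      by (intro bexI[of _ 0] bexI[of _ "c *\<^sub>C basis k"])
        (simp_all add: mem[of "\<lambda>k. \<not> P k"] cvec.span_zero)
  qed
next
  case (add u v)
  then obtain a b a' b' where
    "a \<in> cvec.span {basis k | k. P k}" "b \<in> cvec.span {basis k | k. \<not> P k}" "u = a + b"
    "a' \<in> cvec.span {basis k | k. P k}" "b' \<in> cvec.span {basis k | k. \<not> P k}" "v = a' + b'" by blast
  then show ?case
    by (intro bexI[of _ "a + a'"] bexI[of _ "b + b'"]) (auto intro: cvec.span_add)
qed

text \<open>\<open>tensor_vsa\<close> reads the Koszul sign off basis vectors by testing whether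
  they are odd. This is faithful when each basis vector is homogeneous.\<close>

locale based_vsa = full_vsa V for V :: "('a \<Rightarrow>\<^sub>0 complex) vsa" +
  assumes homogeneous: "basis k \<in> gr False \<or> basis k \<in> gr True"
begin

abbreviation par :: "'a \<Rightarrow> bool" where "par k \<equiv> basis k \<in> gr True"

lemma basis_gr: "par k = p \<Longrightarrow> basis k \<in> gr p"
  using homogeneous[of k] by (cases p) auto

lemma gr_eq: "gr p = cvec.span {basis k | k. par k = p}"
proof
  show sup: "cvec.span {basis k | k. par k = p} \<subseteq> gr p" for p
    by (rule cvec.span_minimal) (use basis_gr gr_subspace in blast)+
  show "gr p \<subseteq> cvec.span {basis k | k. par k = p}"
  proof
    fix v assume v: "v \<in> gr p"
    obtain u w where uw: "u \<in> cvec.span {basis k | k. par k = p}"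
      "w \<in> cvec.span {basis k | k. par k \<noteq> p}" "v = u + w"
      using span_basis_sum[of "\<lambda>k. par k = p" v] by blast
    have "w = v - u" using uw by simp
    then have "w \<in> gr p" using sup uw v gr_subspace cvec.subspace_diff by blast
    moreover have "w \<in> gr (\<not> p)"
    proof -
      have "(\<lambda>k. par k \<noteq> p) = (\<lambda>k. par k = (\<not> p))" by auto
      then show ?thesis using uw(2) sup[of "\<not> p"] by auto
    qed
    ultimately have "w \<in> gr False \<inter> gr True" by (cases p) auto
    then show "v \<in> cvec.span {basis k | k. par k = p}" using uw unfolding gr_inter by simp
  qed
qed

lemma keys_gr: "v \<in> gr p \<Longrightarrow> k \<in> Poly_Mapping.keys v \<Longrightarrow> par k = p"
  using keys_span_basis[of v "\<lambda>k. par k = p"] unfolding gr_eq[of p] by blast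

end

lemma Sum_any_clinear:
  fixes h :: "'i \<Rightarrow> 'c::complex_space"
  assumes "clinear f" "finite {i. h i \<noteq> 0}"
  shows "f (Sum_any h) = Sum_any (\<lambda>i. f (h i))"
proof -
  have "Sum_any (\<lambda>i. f (h i)) = (\<Sum>i\<in>{i. h i \<noteq> 0}. f (h i))"
    by (rule Sum_any.expand_superset) (use assms in \<open>auto simp: clinear_0\<close>)
  then show ?thesis by (simp add: Sum_any.expand_set assms clinear_sum)
qed

text \<open>The product of a distribution in \<open>V\<close> and one in \<open>W\<close>. The predicate \<open>rtrunc\<close> singles out
  those distributions for which it is defined.\<close>

definition conv :: "(int \<Rightarrow> int \<Rightarrow> 'a \<Rightarrow>\<^sub>0 complex) \<Rightarrow> (int \<Rightarrow> int \<Rightarrow> 'b \<Rightarrow>\<^sub>0 complex) \<Rightarrow>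
    int \<Rightarrow> int \<Rightarrow> 'a \<times> 'b \<Rightarrow>\<^sub>0 complex" where
  "conv f g m k = Sum_any (\<lambda>(i, j). f i j \<otimes> g (m - 1 - i) (k - 1 - j))"

definition rtrunc :: "(int \<Rightarrow> int \<Rightarrow> 'v::zero) \<Rightarrow> bool" where
  "rtrunc f \<longleftrightarrow> (\<exists>J. \<forall>j\<ge>J. \<forall>i. f i j = 0) \<and> (\<forall>j. \<exists>I. \<forall>i\<ge>I. f i j = 0)"

lemma rtruncE:
  assumes "rtrunc f"
  obtains J I where "\<And>i j. j \<ge> J \<Longrightarrow> f i j = 0" "\<And>i j. i \<ge> I j \<Longrightarrow> f i j = 0"
proof -
  obtain J where "\<forall>j\<ge>J. \<forall>i. f i j = 0" using assms unfolding rtrunc_def by blast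
  moreover obtain I where "\<forall>j. \<forall>i\<ge>I j. f i j = 0" using assms unfolding rtrunc_def by metis
  ultimately show thesis using that by blast
qed

lemma rtrunc_del: "rtrunc f \<Longrightarrow> rtrunc (del f)"
proof -
  assume f: "rtrunc f"
  obtain J I where J: "\<And>i j. j \<ge> J \<Longrightarrow> f i j = 0" and I: "\<And>i j. i \<ge> I j \<Longrightarrow> f i j = 0"
    using f by (rule rtruncE) blast
  have "\<forall>i\<ge>max (I j) (I (j + 1)). f (i + 1) j - f i (j + 1) = 0" for j
    using I by simp
  moreover have "\<forall>j\<ge>J. \<forall>i. f (i + 1) j - f i (j + 1) = 0" using J by simp
  ultimately show ?thesis unfolding rtrunc_def del_def by blast
qed

definition conv_fin where
  "conv_fin f g \<longleftrightarrow> (\<forall>m k. finite {(i, j). f i j \<otimes> g (m - 1 - i) (k - 1 - j) \<noteq> 0})"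

text \<open>The bounds of \<open>f\<close> and \<open>g\<close> in the second index confine j to an
  interval; for each such j the other bounds confine i.\<close>

lemma conv_fin_rtrunc:
  assumes f: "rtrunc f" and g: "rtrunc g"
  shows "conv_fin f g"
  unfolding conv_fin_def
proof (intro allI)
  fix m k
  obtain J I where J: "\<And>i j. j \<ge> J \<Longrightarrow> f i j = 0" and I: "\<And>i j. i \<ge> I j \<Longrightarrow> f i j = 0"
    using f by (rule rtruncE) blast
  obtain J' I' where J': "\<And>i j. j \<ge> J' \<Longrightarrow> g i j = 0" and I': "\<And>i j. i \<ge> I' j \<Longrightarrow> g i j = 0"
    using g by (rule rtruncE) blast
  have "{(i, j). f i j \<otimes> g (m - 1 - i) (k - 1 - j) \<noteq> 0}
      \<subseteq> (\<lambda>(j, i). (i, j)) ` (SIGMA j:{k - 1 - J'..J}. {m - 1 - I' (k - 1 - j)..I j})"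
  proof clarify
    fix i j assume "f i j \<otimes> g (m - 1 - i) (k - 1 - j) \<noteq> 0"
    then have "f i j \<noteq> 0" "g (m - 1 - i) (k - 1 - j) \<noteq> 0" by (auto simp: tens_simps)
    then have "\<not> j \<ge> J" "\<not> i \<ge> I j" "\<not> k - 1 - j \<ge> J'" "\<not> m - 1 - i \<ge> I' (k - 1 - j)"
      using I J I' J' by blast+
    then show "(i, j) \<in> (\<lambda>(j, i). (i, j)) ` (SIGMA j:{k - 1 - J'..J}. {m - 1 - I' (k - 1 - j)..I j})"
      by (intro image_eqI[of _ _ "(j, i)"]) auto
  qed
  then show "finite {(i, j). f i j \<otimes> g (m - 1 - i) (k - 1 - j) \<noteq> 0}"
    by (rule finite_subset) (intro finite_imageI finite_SigmaI; simp)
qed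

lemma conv_fin_swap: "conv_fin f g \<Longrightarrow> conv_fin (\<lambda>i j. f j i) (\<lambda>i j. g j i)"
  unfolding conv_fin_def
proof (intro allI)
  fix m k assume "\<forall>m k. finite {(i, j). f i j \<otimes> g (m - 1 - i) (k - 1 - j) \<noteq> 0}"
  then have "finite (prod.swap ` {(i, j). f i j \<otimes> g (k - 1 - i) (m - 1 - j) \<noteq> 0})" by blast
  moreover have "prod.swap ` {(i, j). f i j \<otimes> g (k - 1 - i) (m - 1 - j) \<noteq> 0}
      = {(i, j). f j i \<otimes> g (k - 1 - j) (m - 1 - i) \<noteq> 0}" by auto
  ultimately show "finite {(i, j). f j i \<otimes> g (k - 1 - j) (m - 1 - i) \<noteq> 0}" by simp
qed

lemma conv_swap: "conv (\<lambda>i j. f j i) (\<lambda>i j. g j i) m k = conv f g k m"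
  unfolding conv_def
  by (rule Sum_any.reindex_cong[of prod.swap]) (auto simp: fun_eq_iff)

lemma conv_scale:
  assumes "conv_fin f g"
  shows "conv (\<lambda>i j. c *\<^sub>C f i j) (\<lambda>i j. d *\<^sub>C g i j) m k = (c * d) *\<^sub>C conv f g m k"
proof -
  have fin: "finite {x. (case x of (i, j) \<Rightarrow> f i j \<otimes> g (m - 1 - i) (k - 1 - j)) \<noteq> 0}"
    using assms unfolding conv_fin_def by (simp add: case_prod_unfold)
  show ?thesis
    unfolding conv_def Sum_any_clinear[OF clinear_scaleC fin]
    by (rule arg_cong[of _ _ Sum_any]) (auto simp: fun_eq_iff tens_simps scaleC_simps mult.commute)
qed

lemma conv_nested:
  assumes "conv_fin f g"
  shows "Sum_any (\<lambda>j. Sum_any (\<lambda>i. f i j \<otimes> g (m - 1 - i) (k - 1 - j))) = conv f g m k"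
proof -
  let ?h = "\<lambda>i j. f i j \<otimes> g (m - 1 - i) (k - 1 - j)"
  let ?S = "{(i, j). ?h i j \<noteq> 0}"
  have fin: "finite ?S" using assms unfolding conv_fin_def by blast
  have sub: "{i. \<exists>j. ?h i j \<noteq> 0} \<times> {j. \<exists>i. ?h i j \<noteq> 0} \<subseteq> fst ` ?S \<times> snd ` ?S"
    by (auto simp: image_iff)
  have "Sum_any (\<lambda>i. Sum_any (?h i)) = Sum_any (\<lambda>j. Sum_any (\<lambda>i. ?h i j))"
    by (rule Sum_any.swap[OF _ sub]) (use fin in simp)
  moreover have "Sum_any (\<lambda>i. Sum_any (?h i)) = conv f g m k"
    unfolding conv_def by (rule Sum_any.cartesian_product[OF _ sub]) (use fin in simp)
  ultimately show ?thesis by simp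
qed

lemma Sum_any_diff:
  fixes f g :: "'i \<Rightarrow> 'c::ab_group_add"
  assumes "finite {i. f i \<noteq> 0}" "finite {i. g i \<noteq> 0}"
  shows "Sum_any (\<lambda>i. f i - g i) = Sum_any f - Sum_any g"
proof -
  let ?S = "{i. f i \<noteq> 0} \<union> {i. g i \<noteq> 0}"
  have "Sum_any (\<lambda>i. f i - g i) = (\<Sum>i\<in>?S. f i - g i)" "Sum_any f = sum f ?S" "Sum_any g = sum g ?S"
    by (rule Sum_any.expand_superset; use assms in auto)+
  then show ?thesis by (simp add: sum_subtractf)
qed

lemma del_conv_right:
  assumes "conv_fin f g"
  shows "del (conv f g) = conv f (del g)"
proof (intro ext)
  fix m k
  have fin: "finite {x. (case x of (i, j) \<Rightarrow> f i j \<otimes> g (m' - 1 - i) (k' - 1 - j)) \<noteq> 0}" for m' k'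
    using assms unfolding conv_fin_def by (simp add: case_prod_unfold)
  have "del (conv f g) m k = Sum_any (\<lambda>x. (case x of (i, j) \<Rightarrow> f i j \<otimes> g (m + 1 - 1 - i) (k - 1 - j))
      - (case x of (i, j) \<Rightarrow> f i j \<otimes> g (m - 1 - i) (k + 1 - 1 - j)))"
    unfolding del_def conv_def by (rule Sum_any_diff[symmetric, OF fin fin])
  also have "\<dots> = conv f (del g) m k"
    unfolding conv_def del_def
    by (rule arg_cong[of _ _ Sum_any]) (auto simp: fun_eq_iff tens_simps algebra_simps)
  finally show "del (conv f g) m k = conv f (del g) m k" .
qed

lemma del_conv_left:
  assumes "conv_fin f g"
  shows "del (conv f g) = conv (del f) g"
proof (intro ext)
  fix m k
  have fin: "finite {x. (case x of (i, j) \<Rightarrow> f i j \<otimes> g (m' - 1 - i) (k' - 1 - j)) \<noteq> 0}" for m' k'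
    using assms unfolding conv_fin_def by (simp add: case_prod_unfold)
  have bij1: "bij (\<lambda>(i, j). (i + 1, j :: int) :: int \<times> int)"
    by (rule o_bij[of "\<lambda>(i, j). (i - 1, j)"]) (auto simp: fun_eq_iff)
  have bij2: "bij (\<lambda>(i, j). (i, j + 1) :: int \<times> int)"
    by (rule o_bij[of "\<lambda>(i, j). (i, j - 1)"]) (auto simp: fun_eq_iff)
  let ?h1 = "\<lambda>(i, j). f (i + 1) j \<otimes> g (m - 1 - i) (k - 1 - j)"
  let ?h2 = "\<lambda>(i, j). f i (j + 1) \<otimes> g (m - 1 - i) (k - 1 - j)"
  let ?g1 = "\<lambda>(i, j). f i j \<otimes> g (m + 1 - 1 - i) (k - 1 - j)"
  let ?g2 = "\<lambda>(i, j). f i j \<otimes> g (m - 1 - i) (k + 1 - 1 - j)"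
  have e1: "?g1 \<circ> (\<lambda>(i, j). (i + 1, j)) = ?h1" and e2: "?g2 \<circ> (\<lambda>(i, j). (i, j + 1)) = ?h2"
    by (auto simp: fun_eq_iff algebra_simps)
  have f1: "finite {x. ?h1 x \<noteq> 0}"
    using finite_vimageI[OF fin[of "m + 1" k] bij_is_inj[OF bij1]]
    by (rule finite_subset[rotated]) (auto simp: algebra_simps)
  have f2: "finite {x. ?h2 x \<noteq> 0}"
    using finite_vimageI[OF fin[of m "k + 1"] bij_is_inj[OF bij2]]
    by (rule finite_subset[rotated]) (auto simp: algebra_simps)
  have "del (conv f g) m k = Sum_any ?h1 - Sum_any ?h2"
    unfolding del_def conv_def Sum_any.reindex_cong[OF bij1 e1] Sum_any.reindex_cong[OF bij2 e2] ..
  also have "\<dots> = Sum_any (\<lambda>x. ?h1 x - ?h2 x)"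
    by (rule Sum_any_diff[symmetric, OF f1 f2])
  also have "\<dots> = conv (del f) g m k"
    unfolding conv_def del_def
    by (rule arg_cong[of _ _ Sum_any]) (auto simp: fun_eq_iff tens_simps)
  finally show "del (conv f g) m k = conv (del f) g m k" .
qed

lemma rtrunc_del_pow: "rtrunc f \<Longrightarrow> rtrunc ((del ^^ N) f)"
  by (induction N) (simp_all add: rtrunc_del)

lemma rtrunc_del_swap:
  assumes "rtrunc (\<lambda>i j. f j i)"
  shows "rtrunc (\<lambda>i j. del f j i)"
proof -
  have "(\<lambda>i j. del f j i) = (\<lambda>i j. - del (\<lambda>i j. f j i) i j)"
    by (simp add: del_def)
  moreover have "rtrunc (\<lambda>i j. - h i j)" if "rtrunc h" for h :: "int \<Rightarrow> int \<Rightarrow> 'a"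
    using that by (simp add: rtrunc_def)
  ultimately show ?thesis using rtrunc_del[OF assms] by metis
qed

lemma rtrunc_del_pow_swap:
  "rtrunc (\<lambda>i j. f j i) \<Longrightarrow> rtrunc (\<lambda>i j. (del ^^ N) f j i)"
  by (induction N) (simp_all add: rtrunc_del_swap)

lemma conv_fin_rtrunc_swap:
  "rtrunc (\<lambda>i j. f j i) \<Longrightarrow> rtrunc (\<lambda>i j. g j i) \<Longrightarrow> conv_fin f g"
  using conv_fin_swap[OF conv_fin_rtrunc] by fastforce

text \<open>A factor z - w can be handed to either tensor factor, so the powers needed for locality
  in both can be distributed. The disjunction covers both orders of operators: A(z)B(w) is truncated
  in one order of the variables, B(w)A(z) in the other.\<close>

lemma del_pow_conv:
  assumes "rtrunc f \<and> rtrunc g \<or> rtrunc (\<lambda>i j. f j i) \<and> rtrunc (\<lambda>i j. g j i)"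
  shows "(del ^^ (N + M)) (conv f g) = conv ((del ^^ N) f) ((del ^^ M) g)"
proof -
  have fin: "conv_fin ((del ^^ N) f) ((del ^^ M) g)" for N M
    using assms
    by (metis conv_fin_rtrunc conv_fin_rtrunc_swap rtrunc_del_pow rtrunc_del_pow_swap)
  have "(del ^^ M) (conv f g) = conv f ((del ^^ M) g)" for M
    using fin[of 0] by (induction M) (simp_all add: del_conv_right)
  moreover have "(del ^^ N) (conv f ((del ^^ M) g)) = conv ((del ^^ N) f) ((del ^^ M) g)"
    using fin[of _ M] by (induction N) (simp_all add: del_conv_left)
  ultimately show ?thesis by (simp add: funpow_add)
qed

section \<open>The vertex superalgebra structure on a tensor product\<close>

locale tensor_vsas = V: based_vsa V + W: based_vsa W
  for V :: "('a \<Rightarrow>\<^sub>0 complex) vsa" and W :: "('b \<Rightarrow>\<^sub>0 complex) vsa"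
begin

abbreviation X where "X \<equiv> tensor_vsa V W"
abbreviation Z where "Z \<equiv> vs_prod X"

text \<open>The product of decomposable tensors without its Koszul sign, which makes it linear in
  each of the four arguments.\<close>

definition tsum where
  "tsum u w n u' w' = Sum_any (\<lambda>i::int. V.Y u i u' \<otimes> W.Y w (n - 1 - i) w')"

lemma tsum_bounds: "finite {i. V.Y u i u' \<noteq> 0 \<and> W.Y w (n - 1 - i) w' \<noteq> 0}"
proof -
  obtain R where R: "\<And>i. i \<ge> R \<Longrightarrow> V.Y u i u' = 0" using V.Y_fld by (rule is_fld_trunc[where v = u']) blast
  obtain L where L: "\<And>i. i \<ge> L \<Longrightarrow> W.Y w i w' = 0" using W.Y_fld by (rule is_fld_trunc[where v = w']) blast
  have "{i. V.Y u i u' \<noteq> 0 \<and> W.Y w (n - 1 - i) w' \<noteq> 0} \<subseteq> {n - 1 - L<..<R}"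
  proof clarify
    fix i assume "V.Y u i u' \<noteq> 0" "W.Y w (n - 1 - i) w' \<noteq> 0"
    then have "\<not> i \<ge> R" "\<not> n - 1 - i \<ge> L" using R L by blast+
    then show "i \<in> {n - 1 - L<..<R}" by auto
  qed
  then show ?thesis by (rule finite_subset) simp
qed

lemma tsum_finite: "finite {i. V.Y u i u' \<otimes> W.Y w (n - 1 - i) w' \<noteq> 0}"
  by (rule finite_subset[OF _ tsum_bounds[of u u' w n w']]) (auto simp: tens_simps)

lemma tsum_clinear:
  "clinear (\<lambda>u. tsum u w n u' w')" "clinear (\<lambda>w. tsum u w n u' w')"
  "clinear (\<lambda>u'. tsum u w n u' w')" "clinear (\<lambda>w'. tsum u w n u' w')"
  unfolding tsum_def
  by (rule clinearI;
      simp add: clinear_simps[OF V.Y_left] clinear_simps[OF V.Y_right] clinear_simps[OF W.Y_left]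
        clinear_simps[OF W.Y_right] tens_simps Sum_any.distrib tsum_finite
        Sum_any_clinear[OF clinear_scaleC])+

lemma X_simps: "vs_vac X = V.vac \<otimes> W.vac"
  "vs_grade X p = cvec.span {u \<otimes> w | u w r s. u \<in> V.gr r \<and> w \<in> W.gr s \<and> p = (r \<noteq> s)}"
  by (simp_all add: tensor_vsa_def)

lemma Z_eq: "Z x n y = lin_ext (\<lambda>(a, b). lin_ext (\<lambda>(c, d).
    koszul (W.par b) (V.par c) *\<^sub>C tsum (basis a) (basis b) n (basis c) (basis d)) y) x"
  by (simp add: tensor_vsa_def tsum_def)

lemma Z_left: "clinear (\<lambda>x. Z x n y)"
  unfolding Z_eq by (rule clinear_lin_ext)

lemma Z_right: "clinear (Z x n)"
  unfolding Z_eq[abs_def] by (rule clinear_lin_ext_comp) (auto simp: clinear_lin_ext)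

text \<open>The sign depends on the parities of \<open>w\<close> and \<open>u'\<close> alone, so the
  formula passes from basis vectors to homogeneous \<open>w\<close> and \<open>u'\<close> and to
  arbitrary \<open>u\<close> and \<open>w'\<close>, one argument at a time.\<close>

theorem Z_tens:
  assumes w: "w \<in> W.gr q" and u': "u' \<in> V.gr p"
  shows "Z (u \<otimes> w) n (u' \<otimes> w') = koszul q p *\<^sub>C tsum u w n u' w'"
proof -
  note lin = clinear_comp[OF clinear_scaleC tsum_clinear(1)] clinear_comp[OF clinear_scaleC tsum_clinear(2)]
    clinear_comp[OF clinear_scaleC tsum_clinear(3)] clinear_comp[OF clinear_scaleC tsum_clinear(4)]
    clinear_comp[OF Z_left tens_left] clinear_comp[OF Z_left tens_right]
    clinear_comp[OF Z_right tens_left] clinear_comp[OF Z_right tens_right]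
  have 1: "Z (basis a \<otimes> basis b) n (basis c \<otimes> basis d)
      = koszul q p *\<^sub>C tsum (basis a) (basis b) n (basis c) (basis d)"
    if "b \<in> Poly_Mapping.keys w" "c \<in> Poly_Mapping.keys u'" for a b c d
    using V.keys_gr[OF u' that(2)] W.keys_gr[OF w that(1)] by (simp add: Z_eq tens_basis)
  have 2: "Z (basis a \<otimes> basis b) n (basis c \<otimes> w')
      = koszul q p *\<^sub>C tsum (basis a) (basis b) n (basis c) w'"
    if "b \<in> Poly_Mapping.keys w" "c \<in> Poly_Mapping.keys u'" for a b c
    by (rule clinear_eq_on_keys[where v = w']) (intro lin 1 that)+
  have 3: "Z (basis a \<otimes> basis b) n (u' \<otimes> w') = koszul q p *\<^sub>C tsum (basis a) (basis b) n u' w'"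
    if "b \<in> Poly_Mapping.keys w" for a b
    by (rule clinear_eq_on_keys[where v = u']) (intro lin 2 that)+
  have 4: "Z (basis a \<otimes> w) n (u' \<otimes> w') = koszul q p *\<^sub>C tsum (basis a) w n u' w'" for a
    by (rule clinear_eq_on_keys[where v = w]) (intro lin 3)+
  show ?thesis
    by (rule clinear_eq_on_keys[where v = u]) (intro lin 4)+
qed

lemma clinear_eqI:
  assumes "clinear f" "clinear g" "\<And>a b. f (basis a \<otimes> basis b) = g (basis a \<otimes> basis b)"
  shows "f x = g x"
  by (rule clinear_eq_on_keys[OF assms(1,2)]) (use assms(3) in \<open>auto simp: split_paired_all tens_basis\<close>)

lemma basis_in_gr: "basis a \<in> V.gr (V.par a)" "basis b \<in> W.gr (W.par b)"
  by (rule V.basis_gr W.basis_gr, rule refl)+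

lemma X_gr_eq: "vs_grade X p = cvec.span {basis k | k. (V.par (fst k) \<noteq> W.par (snd k)) = p}"
proof
  show "cvec.span {basis k | k. (V.par (fst k) \<noteq> W.par (snd k)) = p} \<subseteq> vs_grade X p"
    unfolding X_simps
  proof (rule cvec.span_mono, rule subsetI)
    fix x assume "x \<in> {basis k | k. (V.par (fst k) \<noteq> W.par (snd k)) = p}"
    then obtain a b where "x = basis a \<otimes> basis b" "p = (V.par a \<noteq> W.par b)"
      by (auto simp: tens_basis)
    then show "x \<in> {u \<otimes> w | u w r s. u \<in> V.gr r \<and> w \<in> W.gr s \<and> p = (r \<noteq> s)}"
      using basis_in_gr(1)[of a] basis_in_gr(2)[of b] by blast
  qed
  have "u \<otimes> w \<in> cvec.span {basis k | k. (V.par (fst k) \<noteq> W.par (snd k)) = (r \<noteq> s)}"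
    if "u \<in> V.gr r" "w \<in> W.gr s" for u w r s
  proof -
    have "u \<otimes> w = (\<Sum>a\<in>Poly_Mapping.keys u. \<Sum>b\<in>Poly_Mapping.keys w.
        (Poly_Mapping.lookup u a * Poly_Mapping.lookup w b) *\<^sub>C basis (a, b))"
      by (subst poly_mapping_expand[of u], subst poly_mapping_expand[of w], subst sum.swap)
        (simp add: tens_simps cvec.scale_sum_right scaleC_simps mult.commute tens_basis)
    also have "\<dots> \<in> cvec.span {basis k | k. (V.par (fst k) \<noteq> W.par (snd k)) = (r \<noteq> s)}"
      using V.keys_gr[OF that(1)] W.keys_gr[OF that(2)]
      by (intro cvec.span_sum cvec.span_scale cvec.span_base) fastforce
    finally show ?thesis .
  qed
  then show "vs_grade X p \<subseteq> cvec.span {basis k | k. (V.par (fst k) \<noteq> W.par (snd k)) = p}"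
    unfolding X_simps by (intro cvec.span_minimal) auto
qed

lemma tens_gr: "u \<in> V.gr r \<Longrightarrow> w \<in> W.gr s \<Longrightarrow> u \<otimes> w \<in> vs_grade X (r \<noteq> s)"
  unfolding X_simps by (intro cvec.span_base) blast

lemma tens_gr': "u \<in> V.gr r \<Longrightarrow> w \<in> W.gr s \<Longrightarrow> p = (r \<noteq> s) \<Longrightarrow> u \<otimes> w \<in> vs_grade X p"
  using tens_gr by blast

lemma X_carrier: "carrier X = UNIV"
proof -
  have "x \<in> carrier X" for x
  proof -
    obtain u w where "u \<in> cvec.span {basis k | k. V.par (fst k) \<noteq> W.par (snd k)}"
      "w \<in> cvec.span {basis k | k. \<not> (V.par (fst k) \<noteq> W.par (snd k))}" "x = u + w"
      using span_basis_sum[of "\<lambda>k. V.par (fst k) \<noteq> W.par (snd k)" x] by blast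
    then have "u \<in> vs_grade X True" "w \<in> vs_grade X False" "x = w + u"
      by (simp_all add: X_gr_eq add.commute)
    then show ?thesis unfolding carrier_def by blast
  qed
  then show ?thesis by blast
qed

lemma tsum_vac_left: "tsum V.vac W.vac n u' w' = (if n = - 1 then u' \<otimes> w' else 0)"
proof -
  have "V.Y V.vac i u' \<otimes> W.Y W.vac (n - 1 - i) w' = (if i = - 1 then (if n = - 1 then u' \<otimes> w' else 0) else 0)" for i
    by (auto simp: V.Y_vac_left W.Y_vac_left tens_simps)
  then show ?thesis unfolding tsum_def by simp
qed

lemma tsum_vac_right: "n \<ge> - 1 \<Longrightarrow> tsum u w n V.vac W.vac = (if n = - 1 then u \<otimes> w else 0)"
proof -
  assume n: "n \<ge> - 1"
  have "V.Y u i V.vac \<otimes> W.Y w (n - 1 - i) W.vac = (if i = - 1 then (if n = - 1 then u \<otimes> w else 0) else 0)" for i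
  proof -
    consider "i \<ge> 0" | "n - 1 - i \<ge> 0" "i \<noteq> - 1" | "i = - 1" "n \<ge> 0" | "i = - 1" "n = - 1"
      using n by linarith
    then show ?thesis by cases (simp_all add: V.Y_vac W.Y_vac tens_simps)
  qed
  then show ?thesis unfolding tsum_def by simp
qed

abbreviation "DV u \<equiv> V.Y u (- 2) V.vac"
abbreviation "DW w \<equiv> W.Y w (- 2) W.vac"

lemma tsum_D: "tsum u w (- 2) V.vac W.vac = u \<otimes> DW w + DV u \<otimes> w"
proof -
  have "V.Y u i V.vac \<otimes> W.Y w (- 2 - 1 - i) W.vac
      = (if i = - 1 then u \<otimes> DW w else 0) + (if i = - 2 then DV u \<otimes> w else 0)" for i
  proof -
    consider "i \<ge> 0" | "- 2 - 1 - i \<ge> 0" | "i = - 1" | "i = - 2" by linarith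
    then show ?thesis by cases (simp_all add: V.Y_vac W.Y_vac tens_simps)
  qed
  then show ?thesis unfolding tsum_def by (simp add: Sum_any.distrib)
qed

lemma Z_D: "Z (u \<otimes> w) (- 2) (V.vac \<otimes> W.vac) = u \<otimes> DW w + DV u \<otimes> w"
proof (rule clinear_eq_on_keys[where v = w])
  show "clinear (\<lambda>w. Z (u \<otimes> w) (- 2) (V.vac \<otimes> W.vac))" by (rule clinear_comp[OF Z_left tens_right])
  show "clinear (\<lambda>w. u \<otimes> DW w + DV u \<otimes> w)"
    by (auto intro!: clinearI simp: tens_simps clinear_simps[OF W.Y_left] scaleC_simps algebra_simps)
  show "Z (u \<otimes> basis b) (- 2) (V.vac \<otimes> W.vac) = u \<otimes> DW (basis b) + DV u \<otimes> basis b" for b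
    by (simp add: Z_tens[OF basis_in_gr(2) V.vac_even] tsum_D scaleC_simps)
qed

abbreviation "DX x \<equiv> Z x (- 2) (V.vac \<otimes> W.vac)"

lemma finite_tens_scale:
  "finite {i. f i \<otimes> g i \<noteq> 0} \<Longrightarrow> finite {i. c i *\<^sub>C (f i \<otimes> g i) \<noteq> 0}"
  by (erule finite_subset[rotated]) auto

text \<open>\<open>DX\<close> is the sum of the translation operators of the two factors. Covariance
  in each factor leaves two sums; after an index shift their coefficients -(n - 1 - i) and -(i + 1)
  add up to -n.\<close>

lemma tsum_translation:
  "DX (tsum u w n u' w') - (tsum u w n u' (DW w') + tsum u w n (DV u') w')
    = - of_int n *\<^sub>C tsum u w (n - 1) u' w'"
proof -
  let ?f = "\<lambda>i. V.Y u i u'" and ?g = "\<lambda>i. W.Y w i w'"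
  have D1: "DV (?f i) = V.Y u i (DV u') - of_int i *\<^sub>C V.Y u (i - 1) u'" for i
    using vsa_translation[OF V.vsa, of u u' i] by (simp add: algebra_simps scaleC_simps)
  have D2: "DW (?g i) = W.Y w i (DW w') - of_int i *\<^sub>C W.Y w (i - 1) w'" for i
    using vsa_translation[OF W.vsa, of w w' i] by (simp add: algebra_simps scaleC_simps)
  have fin: "finite {i. ?f (i - 1) \<otimes> ?g (n - 1 - i) \<noteq> 0}"
  proof -
    have "{i. ?f (i - 1) \<otimes> ?g (n - 1 - i) \<noteq> 0} \<subseteq> (+) 1 ` {i. ?f i \<otimes> ?g (n - 1 - 1 - i) \<noteq> 0}"
    proof
      fix i assume "i \<in> {i. ?f (i - 1) \<otimes> ?g (n - 1 - i) \<noteq> 0}"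
      then show "i \<in> (+) 1 ` {i. ?f i \<otimes> ?g (n - 1 - 1 - i) \<noteq> 0}"
        by (intro image_eqI[of _ _ "i - 1"]) (simp_all add: algebra_simps)
    qed
    then show ?thesis using tsum_finite[of u u' w "n - 1" w'] by (simp add: finite_subset)
  qed
  have fin': "finite {i. ?f i \<otimes> ?g (n - 1 - i - 1) \<noteq> 0}"
    using tsum_finite[of u u' w "n - 1" w'] by (simp add: algebra_simps)
  have shift: "Sum_any (\<lambda>i. of_int i *\<^sub>C (?f (i - 1) \<otimes> ?g (n - 1 - i)))
      = Sum_any (\<lambda>i. of_int (i + 1) *\<^sub>C (?f i \<otimes> ?g (n - 1 - i - 1)))"
    by (rule Sum_any.reindex_cong[of "\<lambda>i. i + 1"])
      (auto simp: fun_eq_iff algebra_simps intro!: o_bij[of "\<lambda>i. i - 1"])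
  have "DX (tsum u w n u' w') = Sum_any (\<lambda>i. DX (?f i \<otimes> ?g (n - 1 - i)))"
    unfolding tsum_def by (rule Sum_any_clinear[OF Z_left tsum_finite])
  also have "\<dots> = Sum_any (\<lambda>i. (?f i \<otimes> W.Y w (n - 1 - i) (DW w') + V.Y u i (DV u') \<otimes> ?g (n - 1 - i))
      + ((- of_int (n - 1 - i)) *\<^sub>C (?f i \<otimes> ?g (n - 1 - i - 1))
         + (- 1) *\<^sub>C of_int i *\<^sub>C (?f (i - 1) \<otimes> ?g (n - 1 - i))))"
    by (simp add: Z_D D1 D2 tens_simps scaleC_simps algebra_simps)
  also have "\<dots> = (tsum u w n u' (DW w') + tsum u w n (DV u') w')
      + (Sum_any (\<lambda>i. (- of_int (n - 1 - i)) *\<^sub>C (?f i \<otimes> ?g (n - 1 - i - 1)))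
       + (- 1) *\<^sub>C Sum_any (\<lambda>i. of_int i *\<^sub>C (?f (i - 1) \<otimes> ?g (n - 1 - i))))"
  proof -
    have add: "finite {i. g i + h i \<noteq> 0}" if "finite {i. g i \<noteq> 0}" "finite {i. h i \<noteq> 0}"
      for g h :: "int \<Rightarrow> 'a \<times> 'b \<Rightarrow>\<^sub>0 complex"
      by (rule finite_subset[OF _ finite_UnI[OF that]]) auto
    have f3: "finite {i. (- of_int (n - 1 - i)) *\<^sub>C (?f i \<otimes> ?g (n - 1 - i - 1)) \<noteq> 0}"
      by (rule finite_tens_scale[OF fin'])
    have f4: "finite {i. of_int i *\<^sub>C (?f (i - 1) \<otimes> ?g (n - 1 - i)) \<noteq> 0}"
      by (rule finite_tens_scale[OF fin])
    have f5: "finite {i. (- 1) *\<^sub>C of_int i *\<^sub>C (?f (i - 1) \<otimes> ?g (n - 1 - i)) \<noteq> 0}"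
      by (rule finite_subset[OF _ f4]) (auto simp: scaleC_simps)
    show ?thesis
      unfolding tsum_def
      by (simp only: Sum_any.distrib[OF add[OF tsum_finite tsum_finite] add[OF f3 f5]]
          Sum_any.distrib[OF tsum_finite tsum_finite] Sum_any.distrib[OF f3 f5]
          Sum_any_clinear[OF clinear_scaleC f4])
  qed
  also have "Sum_any (\<lambda>i. (- of_int (n - 1 - i)) *\<^sub>C (?f i \<otimes> ?g (n - 1 - i - 1)))
       + (- 1) *\<^sub>C Sum_any (\<lambda>i. of_int i *\<^sub>C (?f (i - 1) \<otimes> ?g (n - 1 - i)))
      = - of_int n *\<^sub>C tsum u w (n - 1) u' w'"
  proof -
    let ?h = "\<lambda>i. ?f i \<otimes> ?g (n - 1 - i - 1)"
    have "Sum_any (\<lambda>i. (- of_int (n - 1 - i)) *\<^sub>C ?h i) + (- 1) *\<^sub>C Sum_any (\<lambda>i. of_int (i + 1) *\<^sub>C ?h i)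
        = Sum_any (\<lambda>i. (- of_int (n - 1 - i)) *\<^sub>C ?h i + (- of_int (i + 1)) *\<^sub>C ?h i)"
      by (simp only: Sum_any_clinear[OF clinear_scaleC finite_tens_scale[OF fin']]
          Sum_any.distrib[OF finite_tens_scale[OF fin'] finite_tens_scale[OF fin']] scaleC_scaleC mult_minus1)
    also have "\<dots> = Sum_any (\<lambda>i. (- of_int n) *\<^sub>C ?h i)"
    proof -
      have "- of_int (n - 1 - i) + - of_int (i + 1) = (- of_int n :: complex)" for i by simp
      then show ?thesis by (simp only: scaleC_add_left[symmetric])
    qed
    also have "\<dots> = - of_int n *\<^sub>C tsum u w (n - 1) u' w'"
      unfolding tsum_def Sum_any_clinear[OF clinear_scaleC fin', symmetric] by (simp add: algebra_simps)
    finally show ?thesis unfolding shift .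
  qed
  finally show ?thesis by simp
qed

lemma rtrunc_compose:
  assumes "is_fld A" "is_fld B"
  shows "rtrunc (\<lambda>i j. A i (B j v))"
proof -
  obtain N where N: "\<And>n. N \<le> n \<Longrightarrow> B n v = 0" using assms(2) by (rule is_fld_trunc[where v=v]) blast
  then have "\<forall>j\<ge>N. \<forall>i. A i (B j v) = 0" using assms(1) by (simp add: is_fldD clinear_0)
  moreover have "\<exists>I. \<forall>i\<ge>I. A i (B j v) = 0" for j
    using assms(1) by (auto simp: is_fld_def)
  ultimately show ?thesis unfolding rtrunc_def by blast
qed

text \<open>The three signs come from moving \<open>d\<close> past \<open>e\<close>, and
  \<open>b\<close> past \<open>c\<close> and \<open>e\<close>; what is left is the product of a
  distribution in V and one in W.\<close>

lemma Z_Z_tens: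
  assumes b: "b \<in> W.gr pb" and c: "c \<in> V.gr pc" and d: "d \<in> W.gr pd" and e: "e \<in> V.gr pe"
  shows "Z (a \<otimes> b) m (Z (c \<otimes> d) k (e \<otimes> f)) = (koszul pd pe * koszul pb pc * koszul pb pe) *\<^sub>C
    conv (\<lambda>i j. V.Y a i (V.Y c j e)) (\<lambda>i j. W.Y b i (W.Y d j f)) m k"
proof -
  have fin: "conv_fin (\<lambda>i j. V.Y a i (V.Y c j e)) (\<lambda>i j. W.Y b i (W.Y d j f))"
    by (intro conv_fin_rtrunc rtrunc_compose V.Y_fld W.Y_fld)
  have e': "V.Y c j e \<in> V.gr (pc \<noteq> pe)" for j by (rule V.Y_gr[OF c e])
  have "Z (a \<otimes> b) m (Z (c \<otimes> d) k (e \<otimes> f))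
      = koszul pd pe *\<^sub>C Sum_any (\<lambda>j. Z (a \<otimes> b) m (V.Y c j e \<otimes> W.Y d (k - 1 - j) f))"
    unfolding Z_tens[OF d e] clinear_scale[OF Z_right]
    by (subst tsum_def) (simp only: Sum_any_clinear[OF Z_right tsum_finite])
  also have "\<dots> = koszul pd pe *\<^sub>C koszul pb (pc \<noteq> pe) *\<^sub>C
      Sum_any (\<lambda>j. tsum a b m (V.Y c j e) (W.Y d (k - 1 - j) f))"
  proof -
    have "finite {j. tsum a b m (V.Y c j e) (W.Y d (k - 1 - j) f) \<noteq> 0}"
      by (rule finite_subset[OF _ tsum_bounds[of c e d k f]])
        (auto simp: clinear_0[OF tsum_clinear(3)] clinear_0[OF tsum_clinear(4)])
    then show ?thesis
      unfolding Z_tens[OF b e'] by (simp only: Sum_any_clinear[OF clinear_scaleC])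
  qed
  also have "Sum_any (\<lambda>j. tsum a b m (V.Y c j e) (W.Y d (k - 1 - j) f))
      = conv (\<lambda>i j. V.Y a i (V.Y c j e)) (\<lambda>i j. W.Y b i (W.Y d j f)) m k"
    unfolding tsum_def by (rule conv_nested[OF fin])
  finally show ?thesis by (simp add: scaleC_simps koszul_neq[simplified] mult_ac)
qed

text \<open>The power N is spent on the first tensor factor and M on the second; each then exchanges
  its two operators at the cost of a sign.\<close>

lemma mut_local_tens:
  assumes a: "a \<in> V.gr pa" and b: "b \<in> W.gr pb" and c: "c \<in> V.gr pc" and d: "d \<in> W.gr pd"
  shows "mut_local (pa \<noteq> pb) (pc \<noteq> pd) (Z (a \<otimes> b)) (Z (c \<otimes> d))"
proof -
  obtain N where N: "\<And>v. (del ^^ N) (\<lambda>m k. V.Y a m (V.Y c k v) - koszul pa pc *\<^sub>C V.Y c k (V.Y a m v)) = (\<lambda>_ _. 0)"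
    using V.Y_local[OF a c] by (auto simp: mut_local_def)
  obtain M where M: "\<And>v. (del ^^ M) (\<lambda>m k. W.Y b m (W.Y d k v) - koszul pb pd *\<^sub>C W.Y d k (W.Y b m v)) = (\<lambda>_ _. 0)"
    using W.Y_local[OF b d] by (auto simp: mut_local_def)
  let ?K = "koszul (pa \<noteq> pb) (pc \<noteq> pd)"
  let ?C = "\<lambda>v m k. Z (a \<otimes> b) m (Z (c \<otimes> d) k v) - ?K *\<^sub>C Z (c \<otimes> d) k (Z (a \<otimes> b) m v)"
  have hom: "(del ^^ (N + M)) (?C (e \<otimes> f)) = (\<lambda>_ _. 0)" if e: "e \<in> V.gr pe" for e f pe
  proof -
    let ?f = "\<lambda>i j. V.Y a i (V.Y c j e)" and ?f' = "\<lambda>i j. V.Y c j (V.Y a i e)"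
    let ?g = "\<lambda>i j. W.Y b i (W.Y d j f)" and ?g' = "\<lambda>i j. W.Y d j (W.Y b i f)"
    let ?A = "koszul pd pe * koszul pb pc * koszul pb pe"
    have r: "rtrunc ?f" "rtrunc ?g" "rtrunc (\<lambda>i j. ?f' j i)" "rtrunc (\<lambda>i j. ?g' j i)"
      by (intro rtrunc_compose V.Y_fld W.Y_fld)+
    have 1: "Z (a \<otimes> b) m (Z (c \<otimes> d) k (e \<otimes> f)) = ?A *\<^sub>C conv ?f ?g m k" for m k
      by (rule Z_Z_tens[OF b c d e])
    have 2: "Z (c \<otimes> d) k (Z (a \<otimes> b) m (e \<otimes> f)) = (koszul pb pe * koszul pd pa * koszul pd pe) *\<^sub>C conv ?f' ?g' m k" for m k
      unfolding Z_Z_tens[OF d a b e] by (subst conv_swap[of ?f' ?g', symmetric]) (rule refl)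
    have 3: "(del ^^ N) ?f = (\<lambda>m k. koszul pa pc *\<^sub>C (del ^^ N) ?f' m k)"
      using N[of e] unfolding del_pow_diff del_pow_scale by (simp add: fun_eq_iff)
    have 4: "(del ^^ M) ?g = (\<lambda>m k. koszul pb pd *\<^sub>C (del ^^ M) ?g' m k)"
      using M[of f] unfolding del_pow_diff del_pow_scale by (simp add: fun_eq_iff)
    have fin: "conv_fin ((del ^^ N) ?f') ((del ^^ M) ?g')"
      by (rule conv_fin_rtrunc_swap) (intro rtrunc_del_pow_swap r)+
    have 5: "(del ^^ (N + M)) (conv ?f ?g) m k = (koszul pa pc * koszul pb pd) *\<^sub>C (del ^^ (N + M)) (conv ?f' ?g') m k" for m k
      using r by (simp add: del_pow_conv 3 4 conv_scale[OF fin])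
    \<comment> \<open>Exchanging a with c and b with d, and moving b past c in one order and d past
      a in the other, yields the sign of the total parities. The signs involving \<open>e\<close>
      are the same in both orders.\<close>
    have 6: "?A * (koszul pa pc * koszul pb pd) = ?K * (koszul pb pe * koszul pd pa * koszul pd pe)"
      by (simp add: koszul_def)
    show ?thesis
      unfolding 1 2 scaleC_scaleC 6[symmetric]
      by (simp add: del_pow_diff del_pow_scale 5 scaleC_simps mult_ac)
  qed
  have "(del ^^ (N + M)) (?C v) m k = 0" for v m k
  proof (rule clinear_eqI[where f = "\<lambda>v. (del ^^ (N + M)) (?C v) m k" and g = "\<lambda>_. 0"])
    show "clinear (\<lambda>v. (del ^^ (N + M)) (?C v) m k)"
      unfolding del_pow_eq_sum
      by (rule clinearI) (simp_all add: clinear_simps[OF Z_right] scaleC_simps sum.distrib[symmetric]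
          cvec.scale_sum_right mult_ac algebra_simps)
    show "(del ^^ (N + M)) (?C (basis e \<otimes> basis f)) m k = 0" for e f
      using hom[OF basis_in_gr(1)] by simp
  qed (auto intro: clinearI simp: scaleC_simps)
  then show ?thesis unfolding mut_local_def by blast
qed

lemma Z_fld: "is_fld (Z x)"
proof -
  have "\<exists>N. \<forall>n\<ge>N. Z x n y = 0" for x y
  proof (induction x rule: basis_induct)
    case (scale c k)
    note k = this
    show ?case
    proof (induction y rule: basis_induct)
      case (scale c' k')
      obtain a b a' b' where ab: "k = (a, b)" "k' = (a', b')" by (metis surj_pair)
      obtain R where R: "\<And>i. i \<ge> R \<Longrightarrow> V.Y (basis a) i (basis a') = 0"
        using V.Y_fld by (rule is_fld_trunc[where v = "basis a'"]) blast
      obtain L where L: "\<And>i. i \<ge> L \<Longrightarrow> W.Y (basis b) i (basis b') = 0"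
        using W.Y_fld by (rule is_fld_trunc[where v = "basis b'"]) blast
      have "Z (basis a \<otimes> basis b) n (basis a' \<otimes> basis b') = 0" if n: "n \<ge> R + L + 1" for n
      proof -
        have "V.Y (basis a) i (basis a') \<otimes> W.Y (basis b) (n - 1 - i) (basis b') = 0" for i
          using R[of i] L[of "n - 1 - i"] n by (cases "i \<ge> R") (simp_all add: tens_simps)
        then show ?thesis by (simp add: Z_tens[OF basis_in_gr(2,1)] tsum_def scaleC_simps)
      qed
      then show ?case
        unfolding ab by (intro exI[of _ "R + L + 1"])
          (simp add: clinear_simps[OF Z_left] clinear_simps[OF Z_right] scaleC_simps tens_basis)
    next
      case (add u v)
      then obtain N M where "\<forall>n\<ge>N. Z (c *\<^sub>C basis k) n u = 0" "\<forall>n\<ge>M. Z (c *\<^sub>C basis k) n v = 0" by blast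
      then have "\<forall>n\<ge>max N M. Z (c *\<^sub>C basis k) n (u + v) = 0"
        by (simp add: clinear_add[OF Z_right])
      then show ?case by blast
    qed
  next
    case (add u v)
    then obtain N M where "\<forall>n\<ge>N. Z u n y = 0" "\<forall>n\<ge>M. Z v n y = 0" by blast
    then have "\<forall>n\<ge>max N M. Z (u + v) n y = 0"
      by (simp add: clinear_add[OF Z_left])
    then show ?case by blast
  qed
  then show ?thesis unfolding is_fld_def using Z_right by blast
qed

lemma Z_local_span:
  assumes B: "\<forall>n. clinear (B n)" and T: "\<And>x. x \<in> T \<Longrightarrow> mut_local q p B (Z x)"
    and x: "x \<in> cvec.span T"
  shows "mut_local q p B (Z x)"
  using x
proof (induction rule: cvec.span_induct_alt)
  case base
  have "Z 0 = (\<lambda>n v. 0)" by (simp add: fun_eq_iff clinear_0[OF Z_left])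
  then show ?case using mut_local_0[OF B] by simp
next
  case (step c x y)
  have "Z (c *\<^sub>C x + y) = (\<lambda>n v. c *\<^sub>C Z x n v + Z y n v)"
    by (simp add: fun_eq_iff clinear_simps[OF Z_left])
  then show ?case
    using mut_local_add[OF B mut_local_scale[OF B T[OF step.hyps(1)]] step.IH] by simp
qed

lemma Z_local:
  assumes x: "x \<in> vs_grade X p" and y: "y \<in> vs_grade X q"
  shows "mut_local p q (Z x) (Z y)"
proof (rule Z_local_span[OF _ _ y[unfolded X_simps]])
  fix y assume "y \<in> {u \<otimes> w | u w r s. u \<in> V.gr r \<and> w \<in> W.gr s \<and> q = (r \<noteq> s)}"
  then obtain u w r s where y: "y = u \<otimes> w" "u \<in> V.gr r" "w \<in> W.gr s" "q = (r \<noteq> s)" by blast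
  have "mut_local q p (Z y) (Z x)"
  proof (rule Z_local_span[OF _ _ x[unfolded X_simps]])
    fix x assume "x \<in> {u \<otimes> w | u w r s. u \<in> V.gr r \<and> w \<in> W.gr s \<and> p = (r \<noteq> s)}"
    then obtain u' w' r' s' where x: "x = u' \<otimes> w'" "u' \<in> V.gr r'" "w' \<in> W.gr s'" "p = (r' \<noteq> s')" by blast
    show "mut_local q p (Z y) (Z x)"
      unfolding x(1,4) y(1,4) by (rule mut_local_tens[OF y(2,3) x(2,3)])
  qed (rule allI, rule Z_right)
  then show "mut_local p q (Z x) (Z y)" by (rule mut_local_sym)
qed (rule allI, rule Z_right)

lemma Z_gr:
  assumes x: "x \<in> vs_grade X p" and y: "y \<in> vs_grade X q"
  shows "Z x n y \<in> vs_grade X (p \<noteq> q)"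
proof -
  have sub: "cvec.subspace (vs_grade X r)" for r unfolding X_simps by (rule cvec.subspace_span)
  have tens: "Z (u \<otimes> w) n (u' \<otimes> w') \<in> vs_grade X ((r \<noteq> s) \<noteq> (r' \<noteq> s'))"
    if "u \<in> V.gr r" "w \<in> W.gr s" "u' \<in> V.gr r'" "w' \<in> W.gr s'" for u w u' w' r s r' s'
  proof -
    have "((r \<noteq> s) \<noteq> (r' \<noteq> s')) = ((r \<noteq> r') \<noteq> (s \<noteq> s'))" by auto
    then show ?thesis
      unfolding Z_tens[OF that(2,3)] tsum_def Sum_any.expand_set
      using that by (auto intro!: cvec.subspace_scale[OF sub] cvec.subspace_sum[OF sub] tens_gr' V.Y_gr W.Y_gr)
  qed
  have 1: "Z x n (u' \<otimes> w') \<in> vs_grade X (p \<noteq> (r' \<noteq> s'))"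
    if "u' \<in> V.gr r'" "w' \<in> W.gr s'" for u' w' r' s'
    using x[unfolded X_simps]
  proof (induction rule: cvec.span_induct_alt)
    case base
    show ?case using cvec.subspace_0[OF sub] by (simp only: clinear_0[OF Z_left])
  next
    case (step c x y)
    then obtain u w r s where x: "x = u \<otimes> w" "u \<in> V.gr r" "w \<in> W.gr s" "p = (r \<noteq> s)" by blast
    show ?case
      unfolding clinear_add[OF Z_left] clinear_scale[OF Z_left]
      using tens[OF x(2,3) that] step.IH x
      by (intro cvec.subspace_add[OF sub] cvec.subspace_scale[OF sub]) simp_all
  qed
  show ?thesis
    using y[unfolded X_simps]
  proof (induction rule: cvec.span_induct_alt)
    case base
    show ?case using cvec.subspace_0[OF sub] by (simp only: clinear_0[OF Z_right])
  next
    case (step c x y)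
    then obtain u w r s where x: "x = u \<otimes> w" "u \<in> V.gr r" "w \<in> W.gr s" "q = (r \<noteq> s)" by blast
    show ?case
      unfolding clinear_add[OF Z_right] clinear_scale[OF Z_right]
      using 1[OF x(2,3)] step.IH x
      by (intro cvec.subspace_add[OF sub] cvec.subspace_scale[OF sub]) simp_all
  qed
qed

lemma Z_translation: "DX (Z x n y) - Z x n (DX y) = - of_int n *\<^sub>C Z x (n - 1) y"
proof -
  have bas: "DX (Z (basis a \<otimes> basis b) n (basis c \<otimes> basis d)) - Z (basis a \<otimes> basis b) n (DX (basis c \<otimes> basis d))
      = - of_int n *\<^sub>C Z (basis a \<otimes> basis b) (n - 1) (basis c \<otimes> basis d)" for a b c d
  proof -
    let ?a = "basis a" and ?b = "basis b" and ?c = "basis c" and ?d = "basis d"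
    let ?k = "koszul (W.par b) (V.par c)"
    have Dc: "DV ?c \<in> V.gr (V.par c)"
      using V.Y_gr[OF basis_in_gr(1) V.vac_even] by simp
    have "DX (Z (?a \<otimes> ?b) n (?c \<otimes> ?d)) - Z (?a \<otimes> ?b) n (DX (?c \<otimes> ?d))
      = ?k *\<^sub>C (DX (tsum ?a ?b n ?c ?d) - (tsum ?a ?b n ?c (DW ?d) + tsum ?a ?b n (DV ?c) ?d))"
      unfolding Z_D[of ?c ?d] Z_tens[OF basis_in_gr(2,1)] clinear_add[OF Z_right]
        Z_tens[OF basis_in_gr(2) Dc] clinear_scale[OF Z_left]
      by (simp add: scaleC_simps)
    then show ?thesis
      unfolding tsum_translation Z_tens[OF basis_in_gr(2,1)] by (simp add: scaleC_simps mult.commute)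
  qed
  have lin: "clinear (\<lambda>x. DX (Z x n y) - Z x n (DX y))" "clinear (\<lambda>x. - of_int n *\<^sub>C Z x (n - 1) y)"
    "clinear (\<lambda>y. DX (Z x n y) - Z x n (DX y))" "clinear (\<lambda>y. - of_int n *\<^sub>C Z x (n - 1) y)" for x y
    by (rule clinearI; simp add: clinear_simps[OF Z_left] clinear_simps[OF Z_right] scaleC_simps algebra_simps)+
  show ?thesis
  proof (rule clinear_eqI[OF lin(1,2)])
    show "DX (Z (basis a \<otimes> basis b) n y) - Z (basis a \<otimes> basis b) n (DX y)
      = - of_int n *\<^sub>C Z (basis a \<otimes> basis b) (n - 1) y" for a b
      by (rule clinear_eqI[OF lin(3,4)]) (rule bas)
  qed
qed

theorem vertex_superalgebra_tensor: "vertex_superalgebra X"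
  unfolding vertex_superalgebra_def X_carrier
proof (intro conjI allI ballI)
  show "cvec.subspace (vs_grade X p)" for p unfolding X_simps by (rule cvec.subspace_span)
  show "vs_grade X False \<inter> vs_grade X True = {0}"
    using span_basis_inter[of "\<lambda>k. V.par (fst k) \<noteq> W.par (snd k)"] by (simp add: X_gr_eq Int_commute)
  show "vs_vac X \<in> vs_grade X False"
    unfolding X_simps(1) by (rule tens_gr'[OF V.vac_even W.vac_even]) simp
  show "Z x n y \<in> vs_grade X (p \<noteq> q)" if "x \<in> vs_grade X p" "y \<in> vs_grade X q" for x y p q n
    by (rule Z_gr[OF that])
  show "\<exists>N. \<forall>n\<ge>N. Z x n y = 0" for x y using Z_fld[of x] by (simp add: is_fld_def)
  have lin1: "clinear (\<lambda>y. if n = - 1 then y else 0)" for n :: int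
    by (rule clinearI) (simp_all add: scaleC_simps)
  show "Z (vs_vac X) n y = (if n = - 1 then y else 0)" for n y
    unfolding X_simps(1)
    by (rule clinear_eqI[OF Z_right lin1])
      (simp add: Z_tens[OF W.vac_even basis_in_gr(1)] tsum_vac_left scaleC_simps)
  have lin2: "clinear (\<lambda>x. if n = - 1 then x else 0)" for n :: int
    by (rule clinearI) (simp_all add: scaleC_simps)
  have vac: "Z x n (V.vac \<otimes> W.vac) = (if n = - 1 then x else 0)" if "n \<ge> - 1" for n x
    by (rule clinear_eqI[OF Z_left lin2])
      (simp add: Z_tens[OF basis_in_gr(2) V.vac_even] tsum_vac_right[OF that] scaleC_simps)
  show "Z x (- 1) (vs_vac X) = x" for x
    unfolding X_simps(1) using vac[of "- 1" x] by simp
  show "n \<ge> 0 \<longrightarrow> Z x n (vs_vac X) = 0" for x n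
    unfolding X_simps(1) using vac[of n x] by simp
  show "Z (Z x n y) (- 2) (vs_vac X) - Z x n (Z y (- 2) (vs_vac X)) = - of_int n *\<^sub>C Z x (n - 1) y" for x y n
    unfolding X_simps(1) by (rule Z_translation)
  show "\<exists>N::nat. \<forall>m n. \<forall>c\<in>UNIV.
        (\<Sum>i\<le>N. ((- 1) ^ i * of_nat (N choose i)) *\<^sub>C
          (Z a (m + int (N - i)) (Z b (n + int i) c)
           - koszul p q *\<^sub>C Z b (n + int i) (Z a (m + int (N - i)) c))) = 0"
    if "a \<in> vs_grade X p" "b \<in> vs_grade X q" for p q a b
    using Z_local[OF that] unfolding mut_local_def fun_eq_iff del_pow_eq_sum by blast
qed (simp_all add: clinear_simps[OF Z_left] clinear_simps[OF Z_right])

lemma X_par: "basis (a, b) \<in> vs_grade X True \<longleftrightarrow> V.par a \<noteq> W.par b"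
  "basis k \<in> vs_grade X (V.par (fst k) \<noteq> W.par (snd k))"
proof -
  show 1: "basis k \<in> vs_grade X (V.par (fst k) \<noteq> W.par (snd k))" for k
    unfolding X_gr_eq by (rule cvec.span_base) blast
  have "vs_grade X False \<inter> vs_grade X True = {0}"
    using vsa_inter[OF vertex_superalgebra_tensor] .
  then show "basis (a, b) \<in> vs_grade X True \<longleftrightarrow> V.par a \<noteq> W.par b"
    using 1[of "(a, b)"] basis_nonzero[of "(a, b)"] by (cases "V.par a"; cases "W.par b") auto
qed

text \<open>The tensor product again has a homogeneous basis, so the construction can be iterated
  for the triple product in the target.\<close>

sublocale X: based_vsa X
proof
  show "vertex_superalgebra X" by (rule vertex_superalgebra_tensor)
  show "carrier X = UNIV" by (rule X_carrier)
  show "basis k \<in> vs_grade X False \<or> basis k \<in> vs_grade X True" for k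
    using X_par(2)[of k] by (cases "V.par (fst k) \<noteq> W.par (snd k)") auto
qed

end

section \<open>Tools for spaces with a basis\<close>

lemma is_fld_basisI:
  assumes "\<And>n. clinear (A n)" "\<And>k. \<exists>N. \<forall>n\<ge>N. A n (basis k) = 0"
  shows "is_fld A"
proof -
  have "\<exists>N. \<forall>n\<ge>N. A n v = 0" for v
  proof (induction v rule: basis_induct)
    case (scale c k)
    show ?case using assms(2)[of k] by (auto simp: clinear_scale[OF assms(1)] scaleC_simps)
  next
    case (add u v)
    then obtain N M where "\<forall>n\<ge>N. A n u = 0" "\<forall>n\<ge>M. A n v = 0" by blast
    then have "\<forall>n\<ge>max N M. A n (u + v) = 0" by (simp add: clinear_add[OF assms(1)])
    then show ?case by blast
  qed
  then show ?thesis using assms(1) by (simp add: is_fld_def)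
qed

lemma clinear_span_map:
  assumes "clinear f" "\<And>x. x \<in> T \<Longrightarrow> f x \<in> W" "cvec.subspace W" "v \<in> cvec.span T"
  shows "f v \<in> W"
  using assms(4)
proof (induction rule: cvec.span_induct_alt)
  case base
  then show ?case using assms by (simp add: clinear_0 cvec.subspace_0)
next
  case (step c x y)
  then show ?case
    using assms by (simp add: clinear_simps cvec.subspace_add cvec.subspace_scale)
qed

lemma subspace_UNIV_if_basis:
  assumes "cvec.subspace U" "\<And>k. basis k \<in> U"
  shows "U = UNIV"
proof -
  have "v \<in> U" for v
    by (subst poly_mapping_expand) (intro cvec.subspace_sum cvec.subspace_scale assms)
  then show ?thesis by blast
qed

lemma clinear_sub: "clinear f \<Longrightarrow> clinear g \<Longrightarrow> clinear (\<lambda>x. f x - g x)"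
  by (rule clinearI) (simp_all add: clinear_simps scaleC_simps)

section \<open>Fermions\<close>

lemma clinear_create: "clinear (create x)" and clinear_annihilate: "clinear (annihilate x)"
  by (rule clinearI; simp)+

lemma clinear_psi: "clinear (psi s n)"
  by (simp add: psi_def clinear_create clinear_annihilate)

lemma create_create: "create x (create y v) + create y (create x v) = 0"
  by (rule clinear_eq_on_keys[where g = "\<lambda>_. 0"])
    (auto simp: create_create_basis scaleC_simps algebra_simps intro!: clinearI)

lemma annihilate_annihilate: "annihilate x (annihilate y v) + annihilate y (annihilate x v) = 0"
  by (rule clinear_eq_on_keys[where g = "\<lambda>_. 0"])
    (auto simp: annihilate_annihilate_basis scaleC_simps algebra_simps intro!: clinearI)

lemma create_annihilate:
  "create x (annihilate y v) + annihilate y (create x v) = (if x = y then v else 0)"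
proof (rule clinear_eq_on_keys[where v = v and g = "\<lambda>v. if x = y then v else 0"])
  show "create x (annihilate y (basis S)) + annihilate y (create x (basis S))
      = (if x = y then basis S else 0)" for S
    by (rule create_annihilate_basis)
qed (auto simp: scaleC_simps algebra_simps intro!: clinearI)

text \<open>The bilinear operator that replaces a mode (s, k) by k + 1 times the mode (s, k + 1).
  The formal sum over all modes reduces to the occupied ones, since the others are annihilated, and
  so is finite on each basis vector.\<close>

definition fermi_D :: "fock \<Rightarrow> fock" where
  "fermi_D = lin_ext (\<lambda>S. \<Sum>x\<in>fset S.
     of_nat (Suc (snd x)) *\<^sub>C create (fst x, Suc (snd x)) (annihilate x (basis S)))"

lemma clinear_fermi_D: "clinear fermi_D"
  unfolding fermi_D_def by (rule clinear_lin_ext)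

text \<open>A larger index set allows the expansions before and after a creation or annihilation to
  share one range.\<close>

lemma fermi_D_basis:
  assumes "finite T" "fset S \<subseteq> T"
  shows "fermi_D (basis S) = (\<Sum>x\<in>T.
     of_nat (Suc (snd x)) *\<^sub>C create (fst x, Suc (snd x)) (annihilate x (basis S)))"
  unfolding fermi_D_def lin_ext_basis
  by (rule sum.mono_neutral_left) (use assms in \<open>auto simp: annihilate_basis scaleC_simps\<close>)

lemma fermi_D_create:
  "fermi_D (create y v) - create y (fermi_D v) = of_nat (Suc (snd y)) *\<^sub>C create (fst y, Suc (snd y)) v"
proof (rule clinear_eq_on_keys[where v = v])
  show "clinear (\<lambda>v. fermi_D (create y v) - create y (fermi_D v))"
    by (rule clinearI) (simp_all add: clinear_simps[OF clinear_fermi_D] scaleC_simps algebra_simps)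
  show "clinear (\<lambda>v. of_nat (Suc (snd y)) *\<^sub>C create (fst y, Suc (snd y)) v)"
    by (rule clinear_comp[OF clinear_scaleC clinear_create])
  fix S
  let ?T = "insert y (fset S)"
  let ?E = "\<lambda>x v. of_nat (Suc (snd x)) *\<^sub>C create (fst x, Suc (snd x)) (annihilate x v)"
  have "fermi_D (create y (basis S)) = (\<Sum>x\<in>?T. ?E x (create y (basis S)))"
    by (simp add: create_basis clinear_simps[OF clinear_fermi_D] fermi_D_basis[of ?T "finsert y S"]
        cvec.scale_sum_right scaleC_simps mult.commute del: of_nat_Suc)
  moreover have "create y (fermi_D (basis S)) = (\<Sum>x\<in>?T. create y (?E x (basis S)))"
    by (simp add: fermi_D_basis[of ?T S] clinear_sum[OF clinear_create] subset_insertI del: of_nat_Suc)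
  moreover have "?E x (create y (basis S)) - create y (?E x (basis S))
      = (if x = y then of_nat (Suc (snd y)) *\<^sub>C create (fst y, Suc (snd y)) (basis S) else 0)" for x
  proof -
    have 1: "annihilate x (create y (basis S)) = (if x = y then basis S else 0) - create y (annihilate x (basis S))"
      using create_annihilate[of y x "basis S"] by (auto simp: algebra_simps)
    have 2: "create y (create (fst x, Suc (snd x)) w) = - create (fst x, Suc (snd x)) (create y w)" for w
      using create_create[of y "(fst x, Suc (snd x))" w] by (simp add: eq_neg_iff_add_eq_0)
    show ?thesis
      by (simp add: 1 2 clinear_diff[OF clinear_create] scaleC_simps del: of_nat_Suc)
  qed
  ultimately show "fermi_D (create y (basis S)) - create y (fermi_D (basis S))
      = of_nat (Suc (snd y)) *\<^sub>C create (fst y, Suc (snd y)) (basis S)"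
    by (simp del: of_nat_Suc sum.insert flip: sum_subtractf)
qed

text \<open>The commutator picks out the summand of the mode directly below \<open>y\<close>. For
  \<open>snd y = 0\<close> there is none, and the factor 0 neutralises the truncated
  subtraction.\<close>

lemma fermi_D_annihilate:
  "fermi_D (annihilate y v) - annihilate y (fermi_D v)
    = - of_nat (snd y) *\<^sub>C annihilate (fst y, snd y - 1) v"
proof (rule clinear_eq_on_keys[where v = v])
  show "clinear (\<lambda>v. fermi_D (annihilate y v) - annihilate y (fermi_D v))"
    by (rule clinearI) (simp_all add: clinear_simps[OF clinear_fermi_D] scaleC_simps algebra_simps)
  show "clinear (\<lambda>v. - of_nat (snd y) *\<^sub>C annihilate (fst y, snd y - 1) v)"
    by (rule clinear_comp[OF clinear_scaleC clinear_annihilate])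
  fix S
  let ?y = "(fst y, snd y - 1)"
  let ?T = "insert ?y (fset S)"
  let ?E = "\<lambda>x v. of_nat (Suc (snd x)) *\<^sub>C create (fst x, Suc (snd x)) (annihilate x v)"
  have "fermi_D (annihilate y (basis S)) = (\<Sum>x\<in>?T. ?E x (annihilate y (basis S)))"
    by (simp add: annihilate_basis clinear_simps[OF clinear_fermi_D] fermi_D_basis[of ?T "S |-| {|y|}"]
        cvec.scale_sum_right scaleC_simps mult.commute subset_iff del: of_nat_Suc)
  moreover have "annihilate y (fermi_D (basis S)) = (\<Sum>x\<in>?T. annihilate y (?E x (basis S)))"
    by (simp add: fermi_D_basis[of ?T S] clinear_sum[OF clinear_annihilate] subset_insertI del: of_nat_Suc)
  moreover have "?E x (annihilate y (basis S)) - annihilate y (?E x (basis S))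
      = (if x = ?y then - of_nat (snd y) *\<^sub>C annihilate ?y (basis S) else 0)" for x
  proof -
    have 1: "annihilate x (annihilate y (basis S)) = - annihilate y (annihilate x (basis S))"
      using annihilate_annihilate[of x y "basis S"] by (simp add: eq_neg_iff_add_eq_0)
    define z where "z = (fst x, Suc (snd x))"
    have 2: "annihilate y (create z w) = (if z = y then w else 0) - create z (annihilate y w)" for w
      using create_annihilate[of z y w] by (auto simp: algebra_simps)
    have "?E x (annihilate y (basis S)) - annihilate y (?E x (basis S))
        = of_nat (Suc (snd x)) *\<^sub>C (create z (annihilate x (annihilate y (basis S)))
          - annihilate y (create z (annihilate x (basis S))))"
      by (simp add: z_def scaleC_simps del: of_nat_Suc)
    also have "\<dots> = of_nat (Suc (snd x)) *\<^sub>C (if z = y then - annihilate x (basis S) else 0)"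
      by (simp add: 1 2 clinear_minus[OF clinear_create] del: of_nat_Suc)
    also have "\<dots> = (if x = ?y then - of_nat (snd y) *\<^sub>C annihilate ?y (basis S) else 0)"
    proof (cases "z = y")
      case True
      then have "x = ?y" "snd y = Suc (snd x)" by (auto simp: z_def)
      then show ?thesis using True by (simp add: scaleC_simps del: of_nat_Suc)
    next
      case False
      then have "x \<noteq> ?y \<or> snd y = 0" unfolding z_def by (cases x; cases y; cases "snd y") auto
      then show ?thesis using False by (auto simp: scaleC_simps)
    qed
    finally show ?thesis .
  qed
  ultimately show "fermi_D (annihilate y (basis S)) - annihilate y (fermi_D (basis S))
      = - of_nat (snd y) *\<^sub>C annihilate (fst y, snd y - 1) (basis S)"
    by (simp del: of_nat_Suc sum.insert flip: sum_subtractf)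
qed

lemma fermi_D_psi: "fermi_D (psi s n v) - psi s n (fermi_D v) = - of_int n *\<^sub>C psi s (n - 1) v"
proof (cases "n < 0")
  case True
  then have "Suc (nat (- n - 1)) = nat (- (n - 1) - 1)" "of_nat (nat (- (n - 1) - 1)) = (- of_int n :: complex)"
    by simp_all
  then show ?thesis
    using True fermi_D_create[of "(s, nat (- n - 1))" v] by (simp add: psi_def del: of_nat_Suc)
next
  case False
  then show ?thesis
    using fermi_D_annihilate[of "(\<not> s, nat n)" v]
    by (cases "n = 0") (simp_all add: psi_def scaleC_simps nat_diff_distrib)
qed

lemma is_fld_psi: "is_fld (psi s)"
proof (rule is_fld_basisI)
  fix S
  \<comment> \<open>The sum of all occupied levels bounds each of them, so a mode beyond it finds
    nothing to annihilate.\<close>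
  have "psi s n (basis S) = 0" if n: "n \<ge> int (Suc (\<Sum>x\<in>fset S. snd x))" for n
  proof -
    have "(\<not> s, nat n) |\<notin>| S"
    proof
      assume "(\<not> s, nat n) |\<in>| S"
      then have "snd (\<not> s, nat n) \<le> (\<Sum>x\<in>fset S. snd x)"
        by (intro member_le_sum) auto
      then have "nat n \<le> (\<Sum>x\<in>fset S. snd x)" by simp
      then show False using n by linarith
    qed
    moreover have "n \<ge> 0" using n by linarith
    ultimately show ?thesis by (simp add: psi_def annihilate_basis)
  qed
  then show "\<exists>N. \<forall>n\<ge>N. psi s n (basis S) = 0" by blast
qed (rule clinear_psi)

definition fermi_gr :: "bool \<Rightarrow> fock set" where
  "fermi_gr p = cvec.span {basis S | S. odd (fcard S) = p}"

lemma subspace_fermi_gr: "cvec.subspace (fermi_gr p)"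
  unfolding fermi_gr_def by (rule cvec.subspace_span)

lemma psi_gr: "v \<in> fermi_gr p \<Longrightarrow> psi s n v \<in> fermi_gr (\<not> p)"
  unfolding fermi_gr_def[of p]
proof (rule clinear_span_map[OF clinear_psi])
  fix x :: fock assume "x \<in> {basis S | S. odd (fcard S) = p}"
  then obtain S where S: "x = basis S" "odd (fcard S) = p" by blast
  have mem: "c *\<^sub>C basis R \<in> fermi_gr (\<not> p)" if "odd (fcard R) = (\<not> p)" for c R
    unfolding fermi_gr_def by (rule cvec.span_scale, rule cvec.span_base) (use that in blast)
  have 1: "odd (fcard (finsert y S)) = (\<not> p)" if "y |\<notin>| S" for y
    using that S(2) by (auto simp: fcard_finsert_disjoint)
  have 2: "odd (fcard (S |-| {|y|})) = (\<not> p)" if "y |\<in>| S" for y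
    using fcard_Suc_fminus1[OF that] S(2) by (metis even_Suc)
  show "psi s n x \<in> fermi_gr (\<not> p)"
    using mem[OF 1] mem[OF 2] cvec.subspace_0[OF subspace_fermi_gr]
    by (simp add: S(1) psi_def create_basis annihilate_basis)
qed (rule subspace_fermi_gr)

interpretation fermions: generating_fields fermi_gr fermi_vac fermi_D "{(True, psi s) | s. True}"
  rewrites "generating_fields.V fermi_gr fermi_vac {(True, psi s) | s. True} = fermions"
proof -
  interpret graded_space fermi_gr fermi_vac fermi_D
  proof (rule graded_space.intro)
    show "fermi_gr False \<inter> fermi_gr True = {0}"
      using span_basis_inter[of "\<lambda>S :: (bool \<times> nat) fset. odd (fcard S)"] by (simp add: Int_commute fermi_gr_def)
    show "\<exists>u\<in>fermi_gr False. \<exists>w\<in>fermi_gr True. v = u + w" for v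
      using span_basis_sum[of "\<lambda>S. \<not> odd (fcard S)" v] by (simp add: fermi_gr_def)
    show "fermi_vac \<in> fermi_gr False"
      unfolding fermi_vac_def fermi_gr_def by (rule cvec.span_base) (auto intro!: exI[of _ "{||}"] simp: fcard_fempty)
    show "fermi_D fermi_vac = 0" by (simp add: fermi_D_def fermi_vac_def)
  qed (rule clinear_fermi_D subspace_fermi_gr)+
  show "generating_fields fermi_gr fermi_vac fermi_D {(True, psi s) | s. True}"
  proof
    fix p A assume "(p, A) \<in> {(True, psi s) | s. True}"
    then show "good p A"
      by (auto simp: good_def is_fld_psi psi_gr psi_vacuum fermi_D_psi)
  next
    fix p A q B assume "(p, A) \<in> {(True, psi s) | s. True}" "(q, B) \<in> {(True, psi s) | s. True}"
    then obtain s t where st: "p = True" "q = True" "A = psi s" "B = psi t" by auto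
    have eq: "(del ^^ 1) (\<lambda>m k. psi s m (psi t k v) - koszul True True *\<^sub>C psi t k (psi s m v)) = (\<lambda>_ _. 0)" for v
      by (simp add: scaleC_simps psi_anticommutator del_def fun_eq_iff algebra_simps)
    show "mut_local p q A B" unfolding mut_local_def st by (intro exI[of _ 1] allI) (rule eq)
  next
    fix U :: "fock set"
    assume U: "cvec.subspace U" "fermi_vac \<in> U"
      "\<And>p A n v. (p, A) \<in> {(True, psi s) | s. True} \<Longrightarrow> v \<in> U \<Longrightarrow> A n v \<in> U"
    show "U = UNIV"
      by (rule subspace_UNIV_if_basis[OF U(1)], rule basis_if_vacuum[OF U(1) _ U(2)]) (use U(3) in blast)
  qed
  then interpret generating_fields fermi_gr fermi_vac fermi_D "{(True, psi s) | s. True}" .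
  show "V = fermions" unfolding V_def unfolding fermions_def fermi_gr_def[abs_def] ..
qed

section \<open>Commutative fields\<close>

lemma scaleC_eq_mult: "c *\<^sub>C p = Poly_Mapping.single 0 c * (p :: 'i::monoid_add \<Rightarrow>\<^sub>0 complex)"
proof -
  have "c *\<^sub>C p = Poly_Mapping.map ((*) c) p"
    by (rule poly_mapping_eqI)
      (simp add: scaleC_poly_mapping.rep_eq scaleC_complex_def Poly_Mapping.map.rep_eq when_def)
  then show ?thesis by (simp add: mult_map_scale_conv_mult)
qed

lemma clinear_mult: "clinear (\<lambda>v. p * (v :: 'i::comm_monoid_add \<Rightarrow>\<^sub>0 complex))"
  by (rule clinearI) (simp_all add: scaleC_eq_mult algebra_simps)

lemma nat_poly_mapping_induct:
  fixes \<mu> :: "'i \<Rightarrow>\<^sub>0 nat"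
  assumes "P 0" "\<And>x \<mu>. P \<mu> \<Longrightarrow> P (Poly_Mapping.single x 1 + \<mu>)"
  shows "P \<mu>"
proof (induction "\<Sum>x\<in>Poly_Mapping.keys \<mu>. Poly_Mapping.lookup \<mu> x" arbitrary: \<mu>)
  case 0
  then have "\<mu> = 0" by (auto simp: in_keys_iff intro!: poly_mapping_eqI)
  then show ?case using assms(1) by simp
next
  case (Suc n)
  then obtain x where x: "x \<in> Poly_Mapping.keys \<mu>" by (metis sum.empty Zero_not_Suc all_not_in_conv)
  define \<nu> where "\<nu> = \<mu> - Poly_Mapping.single x 1"
  have mu: "\<mu> = Poly_Mapping.single x 1 + \<nu>"
    using x by (auto simp: \<nu>_def in_keys_iff lookup_add lookup_minus lookup_single when_def intro!: poly_mapping_eqI)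
  have sub: "Poly_Mapping.keys \<nu> \<subseteq> Poly_Mapping.keys \<mu>"
    by (auto simp: mu in_keys_iff lookup_add)
  have "(\<Sum>y\<in>Poly_Mapping.keys \<mu>. Poly_Mapping.lookup \<mu> y)
      = (\<Sum>y\<in>Poly_Mapping.keys \<mu>. (if y = x then 1 else 0) + Poly_Mapping.lookup \<nu> y)"
    by (rule sum.cong) (auto simp: mu lookup_add lookup_single when_def)
  also have "\<dots> = 1 + (\<Sum>y\<in>Poly_Mapping.keys \<mu>. Poly_Mapping.lookup \<nu> y)"
    using x by (simp add: sum.distrib)
  also have "(\<Sum>y\<in>Poly_Mapping.keys \<mu>. Poly_Mapping.lookup \<nu> y) = (\<Sum>y\<in>Poly_Mapping.keys \<nu>. Poly_Mapping.lookup \<nu> y)"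
    by (rule sum.mono_neutral_right) (use sub in \<open>auto simp: in_keys_iff\<close>)
  finally have "n = (\<Sum>y\<in>Poly_Mapping.keys \<nu>. Poly_Mapping.lookup \<nu> y)" using Suc.hyps(2) by simp
  then show ?case unfolding mu by (intro assms(2) Suc.hyps(1))
qed

text \<open>The derivation of a polynomial ring with \<open>x \<mapsto> c x * (\<sigma> x)\<close> on the variables.\<close>

definition deriv_mono :: "('i \<Rightarrow> complex) \<Rightarrow> ('i \<Rightarrow> 'i) \<Rightarrow> ('i \<Rightarrow>\<^sub>0 nat) \<Rightarrow> (('i \<Rightarrow>\<^sub>0 nat) \<Rightarrow>\<^sub>0 complex)" where
  "deriv_mono c \<sigma> \<mu> = (\<Sum>x\<in>Poly_Mapping.keys \<mu>. (of_nat (Poly_Mapping.lookup \<mu> x) * c x) *\<^sub>C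
     basis (\<mu> - Poly_Mapping.single x 1 + Poly_Mapping.single (\<sigma> x) 1))"

lemma deriv_mono_0: "deriv_mono c \<sigma> 0 = 0"
  by (simp add: deriv_mono_def)

text \<open>This Leibniz rule is the source of covariance for the creation modes, both here and in
  the lattice algebra.\<close>

lemma deriv_mono_single:
  "deriv_mono c \<sigma> (Poly_Mapping.single y 1 + \<mu>) =
    c y *\<^sub>C basis (Poly_Mapping.single (\<sigma> y) 1 + \<mu>) + basis (Poly_Mapping.single y 1) * deriv_mono c \<sigma> \<mu>"
proof -
  let ?s = "\<lambda>x. Poly_Mapping.single x (1 :: nat)"
  let ?\<nu> = "?s y + \<mu>"
  let ?K = "insert y (Poly_Mapping.keys \<mu>)"
  have K: "Poly_Mapping.keys ?\<nu> = ?K"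
    by (auto simp: in_keys_iff lookup_add lookup_single when_def split: if_splits)
  have "deriv_mono c \<sigma> ?\<nu> = (\<Sum>x\<in>?K. (if x = y then c y *\<^sub>C basis (?s (\<sigma> y) + \<mu>) else 0)
      + (of_nat (Poly_Mapping.lookup \<mu> x) * c x) *\<^sub>C basis (?s y + (\<mu> - ?s x + ?s (\<sigma> x))))"
    unfolding deriv_mono_def K
  proof (rule sum.cong[OF refl])
    fix x
    have 1: "?s y + \<mu> - ?s y + ?s (\<sigma> y) = ?s (\<sigma> y) + \<mu>" by (simp add: add.commute)
    \<comment> \<open>Subtraction of exponents is truncated, so the identity requires that
      \<open>x\<close> occurs in the monomial; otherwise the coefficient of the summand is
      0.\<close>
    have 2: "?s y + \<mu> - ?s x + ?s (\<sigma> x) = ?s y + (\<mu> - ?s x + ?s (\<sigma> x))" if "Poly_Mapping.lookup \<mu> x \<noteq> 0"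
      by (rule poly_mapping_eqI) (use that in \<open>auto simp: lookup_add lookup_minus lookup_single when_def\<close>)
    show "(of_nat (Poly_Mapping.lookup ?\<nu> x) * c x) *\<^sub>C basis (?\<nu> - ?s x + ?s (\<sigma> x))
      = (if x = y then c y *\<^sub>C basis (?s (\<sigma> y) + \<mu>) else 0)
      + (of_nat (Poly_Mapping.lookup \<mu> x) * c x) *\<^sub>C basis (?s y + (\<mu> - ?s x + ?s (\<sigma> x)))"
    proof (cases "Poly_Mapping.lookup \<mu> x = 0")
      case True
      then show ?thesis using 1 by (auto simp: lookup_add lookup_single when_def scaleC_simps)
    next
      case False
      show ?thesis
      proof (cases "x = y")
        case True
        then show ?thesis using 2[OF False] 1
          by (simp add: lookup_add scaleC_simps ring_distribs)
      next
        case n: False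
        then show ?thesis using 2[OF False] by (simp add: lookup_add lookup_single when_def)
      qed
    qed
  qed
  also have "\<dots> = c y *\<^sub>C basis (?s (\<sigma> y) + \<mu>)
      + (\<Sum>x\<in>?K. (of_nat (Poly_Mapping.lookup \<mu> x) * c x) *\<^sub>C basis (?s y + (\<mu> - ?s x + ?s (\<sigma> x))))"
    by (simp add: sum.distrib del: sum.insert)
  also have "(\<Sum>x\<in>?K. (of_nat (Poly_Mapping.lookup \<mu> x) * c x) *\<^sub>C basis (?s y + (\<mu> - ?s x + ?s (\<sigma> x))))
    = (\<Sum>x\<in>Poly_Mapping.keys \<mu>. (of_nat (Poly_Mapping.lookup \<mu> x) * c x) *\<^sub>C basis (?s y + (\<mu> - ?s x + ?s (\<sigma> x))))"
    by (rule sum.mono_neutral_right) (auto simp: in_keys_iff scaleC_simps)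
  also have "\<dots> = basis (?s y) * deriv_mono c \<sigma> \<mu>"
    by (simp add: deriv_mono_def clinear_simps[OF clinear_mult] mult_single)
  finally show ?thesis .
qed

definition comm_D :: "comm_poly \<Rightarrow> comm_poly" where
  "comm_D = lin_ext (deriv_mono (\<lambda>x. of_nat (Suc (snd x))) (\<lambda>x. (fst x, Suc (snd x))))"

lemma clinear_comm_D: "clinear comm_D"
  unfolding comm_D_def by (rule clinear_lin_ext)

lemma comm_D_gam: "comm_D (gam s n * v) - gam s n * comm_D v = (- of_int n) *\<^sub>C (gam s (n - 1) * v)"
proof (cases "n < 0")
  case True
  show ?thesis
  proof (rule clinear_eq_on_keys[where v = v])
    show "clinear (\<lambda>v. comm_D (gam s n * v) - gam s n * comm_D v)"
      by (intro clinear_sub clinear_comp[OF clinear_comm_D clinear_mult] clinear_comp[OF clinear_mult clinear_comm_D])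
    show "clinear (\<lambda>v. (- of_int n) *\<^sub>C (gam s (n - 1) * v))"
      by (rule clinear_comp[OF clinear_scaleC clinear_mult])
    fix \<mu>
    let ?y = "(s, nat (- n - 1))"
    have "Suc (nat (- n - 1)) = nat (- (n - 1) - 1)" "of_nat (nat (- (n - 1) - 1)) = (- of_int n :: complex)"
      using True by simp_all
    then show "comm_D (gam s n * basis \<mu>) - gam s n * comm_D (basis \<mu>) = (- of_int n) *\<^sub>C (gam s (n - 1) * basis \<mu>)"
      using True deriv_mono_single[of "\<lambda>x. of_nat (Suc (snd x))" "\<lambda>x. (fst x, Suc (snd x))" ?y \<mu>]
      by (simp add: comm_D_def gam_def mult_single del: of_nat_Suc)
  qed
next
  \<comment> \<open>For n = 0 the right-hand side contains the nonzero \<open>gam s (- 1)\<close>,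
    but with the factor 0.\<close>
  case False
  then show ?thesis
    by (cases "n = 0") (simp_all add: gam_def clinear_0[OF clinear_comm_D] scaleC_simps)
qed

abbreviation comm_gr :: "bool \<Rightarrow> comm_poly set" where
  "comm_gr p \<equiv> (if p then {0} else UNIV)"

interpretation comm_va: generating_fields comm_gr 1 comm_D "{(False, \<lambda>n v. gam s n * v) | s. True}"
  rewrites "generating_fields.V comm_gr 1 {(False, \<lambda>n v. gam s n * v) | s. True} = comm_va"
proof -
  interpret graded_space comm_gr 1 comm_D
  proof (rule graded_space.intro)
    have "comm_D (basis 0) = 0" unfolding comm_D_def by (simp only: lin_ext_basis deriv_mono_0)
    then show "comm_D 1 = 0" by simp
  qed (use clinear_comm_D in \<open>auto simp: cvec.subspace_UNIV cvec.subspace_single_0\<close>)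
  show "generating_fields comm_gr 1 comm_D {(False, \<lambda>n v. gam s n * v) | s. True}"
  proof
    fix p A assume "(p, A) \<in> {(False, \<lambda>n (v :: comm_poly). gam s n * v) | s. True}"
    then obtain s where A: "p = False" "A = (\<lambda>n v. gam s n * v)" by blast
    have "is_fld A"
      unfolding is_fld_def A using clinear_mult by (auto simp: gam_def intro!: exI[of _ "0 :: int"])
    then show "good p A"
      using comm_D_gam by (auto simp: good_def A) (auto simp: gam_def)
  next
    fix p A q B
    assume "(p, A) \<in> {(False, \<lambda>n (v :: comm_poly). gam s n * v) | s. True}" "(q, B) \<in> {(False, \<lambda>n (v :: comm_poly). gam s n * v) | s. True}"
    then obtain s t where st: "p = False" "q = False" "A = (\<lambda>n v. gam s n * v)" "B = (\<lambda>n v. gam t n * v)" by blast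
    show "mut_local p q A B"
      unfolding mut_local_def st by (rule exI[of _ 0]) (simp add: scaleC_simps mult.left_commute)
  next
    fix U :: "comm_poly set"
    assume U: "cvec.subspace U" "1 \<in> U"
      "\<And>p A n v. (p, A) \<in> {(False, \<lambda>n v. gam s n * v) | s. True} \<Longrightarrow> v \<in> U \<Longrightarrow> A n v \<in> U"
    have "basis \<mu> \<in> U" for \<mu>
    proof (induction \<mu> rule: nat_poly_mapping_induct)
      case 1
      then show ?case using U(2) by simp
    next
      case (2 x \<mu>)
      have "gam (fst x) (- int (snd x) - 1) * basis \<mu> \<in> U"
        using U(3)[OF _ 2, of False "\<lambda>n v. gam (fst x) n * v"] by blast
      then show ?case by (simp add: gam_def mult_single)
    qed
    then show "U = UNIV" by (rule subspace_UNIV_if_basis[OF U(1)])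
  qed
  then interpret generating_fields comm_gr 1 comm_D "{(False, \<lambda>n v. gam s n * v) | s. True}" .
  show "V = comm_va" unfolding V_def comm_va_def ..
qed

interpretation fermions_vsa: based_vsa fermions
proof
  show "vertex_superalgebra fermions" "carrier fermions = UNIV"
    by (rule fermions.vertex_superalgebra_V fermions.carrier_V)+
  show "basis k \<in> vs_grade fermions False \<or> basis k \<in> vs_grade fermions True" for k
  proof -
    have "basis k \<in> fermi_gr (odd (fcard k))"
      unfolding fermi_gr_def by (rule cvec.span_base) blast
    then show ?thesis by (cases "odd (fcard k)") simp_all
  qed
qed

interpretation comm_vsa: based_vsa comm_va
proof
  show "vertex_superalgebra comm_va" "carrier comm_va = UNIV"
    by (rule comm_va.vertex_superalgebra_V comm_va.carrier_V)+
  show "basis k \<in> vs_grade comm_va False \<or> basis k \<in> vs_grade comm_va True" for k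
    by simp
qed

interpretation fm: tensor_vsas fermions comm_va ..

section \<open>The lattice vertex superalgebra\<close>

subsection \<open>Coefficients of exponentials\<close>

lemma clinear_pow_coeff: "(\<And>i. clinear (a i)) \<Longrightarrow> clinear (pow_coeff a l k)"
proof (induction l arbitrary: k)
  case 0
  show ?case by (rule clinearI) (simp_all add: scaleC_simps)
next
  case (Suc l)
  then show ?case
    by (intro clinearI) (simp_all add: clinear_simps[OF Suc.prems] clinear_simps[OF Suc.IH]
        sum.distrib cvec.scale_sum_right)
qed

lemma clinear_exp_coeff: "(\<And>i. clinear (a i)) \<Longrightarrow> clinear (exp_coeff a k)"
  unfolding exp_coeff_def
  by (rule clinearI)
    (simp_all add: clinear_simps[OF clinear_pow_coeff] sum.distrib scaleC_simps cvec.scale_sum_right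
      mult.commute)

text \<open>The series X has no constant term, so X^l starts at x^l.\<close>

lemma pow_coeff_eq_0: "(\<And>i. clinear (a i)) \<Longrightarrow> k < l \<Longrightarrow> pow_coeff a l k v = 0"
proof (induction l arbitrary: k)
  case (Suc l)
  have "a i (pow_coeff a l (k - i) v) = 0" if "i \<in> {1..k}" for i
  proof -
    have "pow_coeff a l (k - i) v = 0" using that Suc.prems by (intro Suc.IH) auto
    then show ?thesis by (simp add: clinear_0[OF Suc.prems(1)])
  qed
  then show ?case by simp
qed simp

lemma sum_triangle_swap:
  "(\<Sum>i=1..k. \<Sum>j=1..k-i. f i j) = (\<Sum>j=1..k. \<Sum>i=1..k-j. f i j)" for k :: nat
proof -
  have "(\<Sum>i=1..k. \<Sum>j=1..k-i. f i j) = (\<Sum>i\<in>{1..k}. \<Sum>j\<in>{j \<in> {1..k}. i + j \<le> k}. f i j)"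
    by (intro sum.cong refl) auto
  also have "\<dots> = (\<Sum>j\<in>{1..k}. \<Sum>i\<in>{i \<in> {1..k}. i + j \<le> k}. f i j)"
    by (rule sum.swap_restrict) auto
  also have "\<dots> = (\<Sum>j=1..k. \<Sum>i=1..k-j. f i j)"
    by (intro sum.cong refl) auto
  finally show ?thesis .
qed

text \<open>The rule x d/dx X^(l+1) = (l + 1) (x X') X^l, for a series X whose coefficients
  commute.\<close>

lemma pow_coeff_deriv:
  assumes lin: "\<And>i. clinear (a i)" and comm: "\<And>i j v. a i (a j v) = a j (a i v)"
  shows "of_nat k *\<^sub>C pow_coeff a (Suc l) k v
    = of_nat (Suc l) *\<^sub>C (\<Sum>i=1..k. of_nat i *\<^sub>C a i (pow_coeff a l (k - i) v))"
proof (induction l arbitrary: k)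
  case 0
  show ?case
    by (simp add: cvec.scale_sum_right scaleC_simps)
      (intro sum.cong refl, auto simp: clinear_0[OF lin] scaleC_simps)
next
  case (Suc l)
  have "of_nat k *\<^sub>C pow_coeff a (Suc (Suc l)) k v
      = (\<Sum>i=1..k. of_nat i *\<^sub>C a i (pow_coeff a (Suc l) (k - i) v))
      + (\<Sum>i=1..k. a i (of_nat (k - i) *\<^sub>C pow_coeff a (Suc l) (k - i) v))"
    unfolding sum.distrib[symmetric] pow_coeff.simps(2)[of a "Suc l"] cvec.scale_sum_right
    by (intro sum.cong refl)
      (simp add: clinear_scale[OF lin] of_nat_diff flip: scaleC_add_left del: pow_coeff.simps)
  also have "(\<Sum>i=1..k. a i (of_nat (k - i) *\<^sub>C pow_coeff a (Suc l) (k - i) v))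
      = of_nat (Suc l) *\<^sub>C (\<Sum>i=1..k. \<Sum>j=1..k-i. of_nat j *\<^sub>C a i (a j (pow_coeff a l (k - i - j) v)))"
    unfolding Suc.IH
    by (simp add: clinear_simps[OF lin] cvec.scale_sum_right del: of_nat_Suc pow_coeff.simps)
  also have "(\<Sum>i=1..k. \<Sum>j=1..k-i. of_nat j *\<^sub>C a i (a j (pow_coeff a l (k - i - j) v)))
      = (\<Sum>j=1..k. of_nat j *\<^sub>C a j (pow_coeff a (Suc l) (k - j) v))"
    by (subst sum_triangle_swap)
      (simp add: clinear_simps[OF lin] cvec.scale_sum_right comm[of _ "_ :: nat"] add.commute)
  finally show ?case
    by (simp only: of_nat_Suc[of "Suc l"] scaleC_add_left scaleC_one)
qed

text \<open>The differential equation x d/dx exp X = (x X') exp X. It serves as a recursion for the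
  coefficients of the exponential: the main identities for vertex operators are proved by induction
  from it, dividing by the index at each step.\<close>

lemma exp_coeff_deriv:
  assumes lin: "\<And>i. clinear (a i)" and comm: "\<And>i j v. a i (a j v) = a j (a i v)"
  shows "of_nat k *\<^sub>C exp_coeff a k v = (\<Sum>i=1..k. of_nat i *\<^sub>C a i (exp_coeff a (k - i) v))"
proof (cases k)
  case (Suc n)
  have "of_nat k *\<^sub>C exp_coeff a k v = (\<Sum>l\<le>n. (1 / fact (Suc l)) *\<^sub>C of_nat k *\<^sub>C pow_coeff a (Suc l) k v)"
    unfolding exp_coeff_def cvec.scale_sum_right Suc
    by (subst sum.atMost_Suc_shift) (simp add: scaleC_simps mult.commute del: of_nat_Suc fact_Suc pow_coeff.simps(2))
  also have "\<dots> = (\<Sum>l\<le>n. (1 / fact l) *\<^sub>C (\<Sum>i=1..k. of_nat i *\<^sub>C a i (pow_coeff a l (k - i) v)))"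
    unfolding pow_coeff_deriv[OF lin comm]
    by (intro sum.cong refl) (simp add: scaleC_scaleC del: of_nat_Suc)
  also have "\<dots> = (\<Sum>i=1..k. of_nat i *\<^sub>C a i (\<Sum>l\<le>n. (1 / fact l) *\<^sub>C pow_coeff a l (k - i) v))"
    by (simp add: cvec.scale_sum_right clinear_simps[OF lin] scaleC_simps mult.commute sum.swap[of _ _ "{..n}"])
  also have "\<dots> = (\<Sum>i=1..k. of_nat i *\<^sub>C a i (exp_coeff a (k - i) v))"
  proof (intro sum.cong refl)
    fix i assume "i \<in> {1..k}"
    then have "(\<Sum>l\<le>n. (1 / fact l) *\<^sub>C pow_coeff a l (k - i) v) = exp_coeff a (k - i) v"
      unfolding exp_coeff_def using Suc
      by (intro sum.mono_neutral_right) (auto simp: pow_coeff_eq_0[OF lin] scaleC_simps)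
    then show "of_nat i *\<^sub>C a i (\<Sum>l\<le>n. (1 / fact l) *\<^sub>C pow_coeff a l (k - i) v)
      = of_nat i *\<^sub>C a i (exp_coeff a (k - i) v)" by simp
  qed
  finally show ?thesis .
qed (simp add: scaleC_simps)

lemma exp_coeff_0: "exp_coeff a 0 v = v"
  by (simp add: exp_coeff_def scaleC_simps)

subsection \<open>The Heisenberg algebra\<close>

lemma clinear_beta: "clinear (beta n)"
  unfolding beta_def by (rule clinear_lin_ext)

lemma beta_neg: "n < 0 \<Longrightarrow> beta n (basis (\<mu>, m)) = basis (\<mu> + Poly_Mapping.single (nat (- n - 1)) 1, m)"
  by (simp add: beta_def)

lemma beta_0: "beta 0 (basis (\<mu>, m)) = - of_int m *\<^sub>C basis (\<mu>, m)"
  by (simp add: beta_def beta_form_def)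

lemma beta_pos: "n > 0 \<Longrightarrow> beta n (basis (\<mu>, m)) =
    (- of_int n * of_nat (Poly_Mapping.lookup \<mu> (nat (n - 1)))) *\<^sub>C
      basis (\<mu> - Poly_Mapping.single (nat (n - 1)) 1, m)"
  by (simp add: beta_def beta_form_def)

lemma beta_comm_basis_pos_neg:
  assumes "k > 0" "n < 0"
  shows "beta k (beta n (basis (\<mu>, l))) - beta n (beta k (basis (\<mu>, l)))
    = (if k + n = 0 then - of_int k *\<^sub>C basis (\<mu>, l) else 0)"
proof -
  let ?a = "nat (k - 1)" and ?b = "nat (- n - 1)"
  let ?s = "\<lambda>x. Poly_Mapping.single x (1 :: nat)"
  \<comment> \<open>Subtraction is truncated here as well: the exchange can fail only where an
    exponent 0 is both raised and lowered.\<close>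
  have *: "\<mu> + ?s ?b - ?s ?a = \<mu> - ?s ?a + ?s ?b" if "?a \<noteq> ?b \<or> Poly_Mapping.lookup \<mu> ?a \<noteq> 0"
    by (rule poly_mapping_eqI) (use that in \<open>auto simp: lookup_add lookup_minus lookup_single when_def\<close>)
  show ?thesis
  proof (cases "?a = ?b")
    case True
    then have "k + n = 0" using assms by linarith
    then show ?thesis
      using True assms *
      by (cases "Poly_Mapping.lookup \<mu> ?a = 0")
        (simp_all add: beta_neg beta_pos clinear_simps[OF clinear_beta] lookup_add scaleC_simps
          algebra_simps del: single_diff)
  next
    case False
    then have "k + n \<noteq> 0" using assms by linarith
    then show ?thesis
      using False assms *
      by (simp add: beta_neg beta_pos clinear_simps[OF clinear_beta] lookup_add lookup_single scaleC_simps)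
  qed
qed

lemma beta_comm_basis:
  "beta k (beta n (basis (\<mu>, l))) - beta n (beta k (basis (\<mu>, l)))
    = (if k + n = 0 then - of_int k *\<^sub>C basis (\<mu>, l) else 0)"
proof -
  let ?s = "\<lambda>x. Poly_Mapping.single x (1 :: nat)"
  consider "k > 0" "n < 0" | "k < 0" "n > 0" | "k < 0" "n < 0" | "k > 0" "n > 0" | "k = 0" | "n = 0" by linarith
  then show ?thesis
  proof cases
    case 1
    then show ?thesis by (rule beta_comm_basis_pos_neg)
  next
    case 2
    then show ?thesis
      using beta_comm_basis_pos_neg[of n k \<mu> l] by (auto simp: algebra_simps scaleC_simps) (simp add: minus_equation_iff[of k n] add_eq_0_iff2)?
  next
    case 3
    then show ?thesis by (simp add: beta_neg add_ac)
  next
    case 4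
    let ?a = "nat (k - 1)" and ?b = "nat (n - 1)"
    have "\<mu> - ?s ?a - ?s ?b = \<mu> - ?s ?b - ?s ?a"
      by (rule poly_mapping_eqI) (auto simp: lookup_minus)
    then show ?thesis
      using 4 by (auto simp: beta_pos clinear_simps[OF clinear_beta] scaleC_simps lookup_minus lookup_single when_def)
  next
    case 5
    then show ?thesis
      by (cases "n > 0"; cases "n = 0")
        (simp_all add: beta_0 beta_pos beta_neg clinear_simps[OF clinear_beta] scaleC_simps mult.commute)
  next
    case 6
    then show ?thesis
      by (cases "k > 0"; cases "k = 0")
        (simp_all add: beta_0 beta_pos beta_neg clinear_simps[OF clinear_beta] scaleC_simps mult.commute)
  qed
qed

lemma beta_comm: "beta k (beta n v) - beta n (beta k v) = (if k + n = 0 then - of_int k *\<^sub>C v else 0)"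
proof (rule clinear_eq_on_keys[where v = v and g = "\<lambda>v. if k + n = 0 then - of_int k *\<^sub>C v else 0"])
  show "clinear (\<lambda>v. beta k (beta n v) - beta n (beta k v))"
    by (intro clinear_sub clinear_comp[OF clinear_beta clinear_beta])
  show "clinear (\<lambda>v. if k + n = 0 then - of_int k *\<^sub>C v else 0)"
    by (rule clinearI) (auto simp: scaleC_simps mult.commute)
  show "beta k (beta n (basis x)) - beta n (beta k (basis x))
    = (if k + n = 0 then - of_int k *\<^sub>C basis x else 0)" for x
    by (cases x) (simp only: beta_comm_basis)
qed

lemma beta_e_vec: "n > 0 \<Longrightarrow> beta n (e_vec r) = 0" "beta 0 (e_vec r) = - of_int r *\<^sub>C e_vec r"
  by (simp_all add: e_vec_def beta_pos beta_0 scaleC_simps)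

lemma lattice_basis_induct:
  assumes "\<And>r. P (e_vec r)" "\<And>i v. P v \<Longrightarrow> P (beta (- int i - 1) v)"
  shows "P (basis (\<mu>, r))"
proof (induction \<mu> rule: nat_poly_mapping_induct)
  case 1
  then show ?case using assms(1)[of r] by (simp add: e_vec_def)
next
  case (2 x \<mu>)
  from assms(2)[OF this, of x] show ?case by (simp add: beta_neg add.commute)
qed

lemma lattice_induct [case_names scale add vac beta]:
  assumes "\<And>c v. P v \<Longrightarrow> P (c *\<^sub>C v)" "\<And>u v. P u \<Longrightarrow> P v \<Longrightarrow> P (u + v)"
    "\<And>r. P (e_vec r)" "\<And>i v. P v \<Longrightarrow> P (beta (- int i - 1) v)"
  shows "P v"
proof (induction v rule: basis_induct)
  case (scale c k)
  have "P (basis k)" by (cases k) (simp add: lattice_basis_induct[of P, OF assms(3,4)])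
  then show ?case by (rule assms(1))
qed (rule assms(2))

text \<open>A family of operators is needed because moving \<open>beta\<close> to the left shifts
  mode numbers: the vanishing of one member on \<open>beta j v\<close> follows from that of several
  members on \<open>v\<close>. Identities thereby reduce to the vectors
  \<open>e_vec r\<close>.\<close>

lemma lattice_vanish:
  assumes "\<And>x. clinear (X x)" "\<And>x r. X x (e_vec r) = 0"
    "\<And>x i v. (\<And>y. X y v = 0) \<Longrightarrow> X x (beta (- int i - 1) v) = 0"
  shows "X x v = 0"
proof (induction v arbitrary: x rule: lattice_induct)
  case (beta i v)
  show ?case using beta by (rule assms(3))
qed (simp_all add: assms clinear_simps[OF assms(1)] scaleC_simps)

subsection \<open>Exponentials of the Heisenberg algebra\<close>

text \<open>The coefficient of \<open>x^p\<close> in \<open>exp(\<Sum>i>0. s m \<beta>(-s i)/i x^i)\<close>, where \<open>s = \<plusminus>1\<close>.\<close>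

definition vexp :: "int \<Rightarrow> int \<Rightarrow> int \<Rightarrow> lattice_space \<Rightarrow> lattice_space" where
  "vexp s m p v = (if p < 0 then 0 else
     exp_coeff (\<lambda>i v. (of_int (s * m) / of_nat i) *\<^sub>C beta (- (s * int i)) v) (nat p) v)"

lemma clinear_vexp: "clinear (vexp s m p)"
proof -
  have "clinear (exp_coeff (\<lambda>i v. (of_int (s * m) / of_nat i) *\<^sub>C beta (- (s * int i)) v) (nat p))"
    by (intro clinear_exp_coeff clinear_comp[OF clinear_scaleC clinear_beta])
  then show ?thesis
    unfolding vexp_def by (cases "p < 0") (auto intro!: clinearI simp: clinear_simps scaleC_simps)
qed

lemma vexp_neg [simp]: "p < 0 \<Longrightarrow> vexp s m p v = 0"
  and vexp_0 [simp]: "vexp s m 0 v = v"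
  by (simp_all add: vexp_def exp_coeff_0)

lemma beta_same_sign_comm:
  assumes "s \<noteq> 0"
  shows "beta (s * int i) (beta (s * int j) v) = beta (s * int j) (beta (s * int i) v)"
proof -
  have "s * int i + s * int j = 0 \<Longrightarrow> i = 0"
    using assms by (simp flip: distrib_left)
  then show ?thesis
    using beta_comm[of "s * int i" "s * int j" v] by (cases "s * int i + s * int j = 0") (auto simp: scaleC_simps)
qed

text \<open>The bound \<open>N\<close> may exceed p because \<open>vexp\<close> vanishes at negative
  arguments; sums belonging to different p can then share a range.\<close>

lemma vexp_deriv:
  assumes s: "s \<noteq> 0" and N: "nat p \<le> N"
  shows "of_int p *\<^sub>C vexp s m p v = of_int (s * m) *\<^sub>C (\<Sum>i=1..N. beta (- (s * int i)) (vexp s m (p - int i) v))"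
proof (cases "p < 0")
  case True
  then show ?thesis by (simp add: clinear_0[OF clinear_beta] scaleC_simps)
next
  case False
  let ?a = "\<lambda>i v. (of_int (s * m) / of_nat i) *\<^sub>C beta (- (s * int i)) v"
  have lin: "clinear (?a i)" for i by (rule clinear_comp[OF clinear_scaleC clinear_beta])
  have comm: "?a i (?a j v) = ?a j (?a i v)" for i j v
    using beta_same_sign_comm[of "- s" i j v] s
    by (simp add: clinear_simps[OF clinear_beta] scaleC_simps mult.commute)
  have "of_int p *\<^sub>C vexp s m p v = of_nat (nat p) *\<^sub>C exp_coeff ?a (nat p) v"
    using False by (simp add: vexp_def)
  also have "\<dots> = (\<Sum>i=1..nat p. of_nat i *\<^sub>C ?a i (exp_coeff ?a (nat p - i) v))"
    by (rule exp_coeff_deriv[of ?a, OF lin comm])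
  also have "\<dots> = (\<Sum>i=1..nat p. of_int (s * m) *\<^sub>C beta (- (s * int i)) (vexp s m (p - int i) v))"
  proof (intro sum.cong refl)
    fix i assume i: "i \<in> {1..nat p}"
    then have "nat (p - int i) = nat p - i" "\<not> p - int i < 0" by auto
    then have "vexp s m (p - int i) v = exp_coeff ?a (nat p - i) v" by (simp add: vexp_def)
    then show "of_nat i *\<^sub>C ?a i (exp_coeff ?a (nat p - i) v)
        = of_int (s * m) *\<^sub>C beta (- (s * int i)) (vexp s m (p - int i) v)"
      using i by (simp add: scaleC_simps)
  qed
  also have "\<dots> = (\<Sum>i=1..N. of_int (s * m) *\<^sub>C beta (- (s * int i)) (vexp s m (p - int i) v))"
    by (rule sum.mono_neutral_left) (use N in \<open>auto simp: clinear_0[OF clinear_beta] scaleC_simps\<close>)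
  finally show ?thesis by (simp add: cvec.scale_sum_right)
qed

lemma int_less_induct [case_names neg zero pos]:
  assumes "\<And>p. p < 0 \<Longrightarrow> P p" "P 0" "\<And>p. p > 0 \<Longrightarrow> (\<And>q. q < p \<Longrightarrow> P q) \<Longrightarrow> P p"
  shows "P (p :: int)"
proof (induction "nat p" arbitrary: p rule: less_induct)
  case less
  show ?case
  proof (cases "p > 0")
    case True
    show ?thesis by (rule assms(3)[OF True]) (use less True in \<open>metis assms(1) not_less zless_nat_conj\<close>)
  next
    case False
    then show ?thesis using assms(1,2) by (cases "p = 0") auto
  qed
qed

lemma scaleC_cancel: "c \<noteq> 0 \<Longrightarrow> c *\<^sub>C u = c *\<^sub>C v \<Longrightarrow> u = v"
  by simp

text \<open>The commutator of \<open>beta j\<close> with the exponent is the scalar -m at x^(s j) if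
  s j is positive, and 0 otherwise. So the exponential reproduces itself with its degree lowered by
  s j.\<close>

lemma beta_vexp:
  assumes s: "s = 1 \<or> s = - 1"
  shows "beta j (vexp s m p v) - vexp s m p (beta j v)
    = (if s * j \<ge> 1 then - of_int m *\<^sub>C vexp s m (p - s * j) v else 0)"
proof (induction p rule: int_less_induct)
  case (pos p)
  have s0: "s \<noteq> 0" and ss: "s * s = 1" using s by auto
  let ?N = "nat p"
  let ?S = "\<lambda>w p. \<Sum>i=1..?N. beta (- (s * int i)) (vexp s m (p - int i) w)"
  have "of_int p *\<^sub>C (beta j (vexp s m p v) - vexp s m p (beta j v))
      = of_int (s * m) *\<^sub>C (\<Sum>i=1..?N. beta j (beta (- (s * int i)) (vexp s m (p - int i) v))
          - beta (- (s * int i)) (vexp s m (p - int i) (beta j v)))"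
    by (simp add: cvec.scale_right_diff_distrib vexp_deriv[OF s0 order_refl] sum_subtractf
        clinear_simps[OF clinear_beta] flip: clinear_scale[OF clinear_beta, of _ "of_int p"])
  also have "\<dots> = of_int (s * m) *\<^sub>C (\<Sum>i=1..?N. (if int i = s * j then - of_int j *\<^sub>C vexp s m (p - int i) v else 0)
      + beta (- (s * int i)) (if s * j \<ge> 1 then - of_int m *\<^sub>C vexp s m (p - int i - s * j) v else 0))"
  proof (intro arg_cong[of _ _ "\<lambda>x. _ *\<^sub>C x"] sum.cong refl)
    fix i assume i: "i \<in> {1..?N}"
    have eq: "j + - (s * int i) = 0 \<longleftrightarrow> int i = s * j"
      using s by auto
    have "beta j (beta (- (s * int i)) (vexp s m (p - int i) v))
        = beta (- (s * int i)) (beta j (vexp s m (p - int i) v))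
          + (if int i = s * j then - of_int j *\<^sub>C vexp s m (p - int i) v else 0)"
      using beta_comm[of j "- (s * int i)" "vexp s m (p - int i) v"] unfolding eq by (simp add: algebra_simps)
    moreover have "beta j (vexp s m (p - int i) v) = vexp s m (p - int i) (beta j v)
        + (if s * j \<ge> 1 then - of_int m *\<^sub>C vexp s m (p - int i - s * j) v else 0)"
      using pos.IH[of "p - int i"] i by (simp add: algebra_simps)
    ultimately show "beta j (beta (- (s * int i)) (vexp s m (p - int i) v))
          - beta (- (s * int i)) (vexp s m (p - int i) (beta j v))
        = (if int i = s * j then - of_int j *\<^sub>C vexp s m (p - int i) v else 0)
          + beta (- (s * int i)) (if s * j \<ge> 1 then - of_int m *\<^sub>C vexp s m (p - int i - s * j) v else 0)"
      by (simp add: clinear_add[OF clinear_beta])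
  qed
  also have "\<dots> = of_int p *\<^sub>C (if s * j \<ge> 1 then - of_int m *\<^sub>C vexp s m (p - s * j) v else 0)"
  proof (cases "s * j \<ge> 1")
    case True
    have 1: "(\<Sum>i=1..?N. (if int i = s * j then - of_int j *\<^sub>C vexp s m (p - int i) v else 0))
        = - of_int j *\<^sub>C vexp s m (p - s * j) v"
    proof (cases "s * j \<le> p")
      case le: True
      have "(\<Sum>i=1..?N. (if int i = s * j then - of_int j *\<^sub>C vexp s m (p - int i) v else 0))
          = (\<Sum>i=1..?N. (if i = nat (s * j) then - of_int j *\<^sub>C vexp s m (p - s * j) v else 0))"
        using True by (intro sum.cong refl) auto
      moreover have "nat (s * j) \<in> {1..?N}" using True le by auto
      ultimately show ?thesis by (simp only: sum.delta finite_atLeastAtMost if_True)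
    next
      case False
      then have "(\<Sum>i=1..?N. (if int i = s * j then - of_int j *\<^sub>C vexp s m (p - int i) v else 0)) = 0"
        by (intro sum.neutral) auto
      then show ?thesis using False by (simp add: scaleC_simps)
    qed
    have 2: "(\<Sum>i=1..?N. beta (- (s * int i)) (- of_int m *\<^sub>C vexp s m (p - int i - s * j) v))
        = - of_int m *\<^sub>C ?S v (p - s * j)"
      by (simp add: clinear_simps[OF clinear_beta] cvec.scale_sum_right algebra_simps)
    have 3: "of_int (s * m) *\<^sub>C ?S v (p - s * j) = of_int (p - s * j) *\<^sub>C vexp s m (p - s * j) v"
      using True by (intro vexp_deriv[OF s0, symmetric]) linarith
    have "of_int (s * m) *\<^sub>C ((- of_int j) *\<^sub>C vexp s m (p - s * j) v + - of_int m *\<^sub>C ?S v (p - s * j))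
        = - of_int m *\<^sub>C (of_int (s * j) *\<^sub>C vexp s m (p - s * j) v + of_int (s * m) *\<^sub>C ?S v (p - s * j))"
      by (simp add: scaleC_simps mult_ac)
    also have "\<dots> = of_int p *\<^sub>C (- of_int m *\<^sub>C vexp s m (p - s * j) v)"
      unfolding 3 by (simp add: scaleC_simps mult.commute flip: scaleC_add_left)
    finally show ?thesis using True by (simp only: True if_True sum.distrib 1 2)
  next
    case False
    then have "(if int i = s * j then - of_int j *\<^sub>C vexp s m (p - int i) v else 0) = 0" if "i \<in> {1..?N}" for i
      using that by auto
    then show ?thesis using False by (simp add: clinear_0[OF clinear_beta] scaleC_simps)
  qed
  finally show ?case
    by (rule scaleC_cancel[rotated]) (use pos(1) in simp)
qed (auto simp: clinear_0[OF clinear_beta])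

subsection \<open>Vertex operators\<close>

definition charge :: "int \<Rightarrow> lattice_space set" where
  "charge n = cvec.span {basis (\<mu>, n) | \<mu>. True}"

lemma subspace_charge: "cvec.subspace (charge n)"
  unfolding charge_def by (rule cvec.subspace_span)

lemma basis_charge: "basis (\<mu>, n) \<in> charge n"
  unfolding charge_def by (rule cvec.span_base) blast

lemma e_vec_charge: "e_vec n \<in> charge n"
  by (simp add: e_vec_def basis_charge)

lemma beta_charge: "v \<in> charge n \<Longrightarrow> beta j v \<in> charge n"
  unfolding charge_def[of n]
proof (rule clinear_span_map[OF clinear_beta])
  fix x :: lattice_space assume "x \<in> {basis (\<mu>, n) | \<mu>. True}"
  then obtain \<mu> where x: "x = basis (\<mu>, n)" by blast
  consider "j < 0" | "j = 0" | "j > 0" by linarith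
  then show "beta j x \<in> cvec.span {basis (\<mu>, n) | \<mu>. True}"
    unfolding charge_def[symmetric]
    by cases (simp_all only: x beta_neg beta_0 beta_pos basis_charge cvec.subspace_scale[OF subspace_charge])
qed simp

lemma beta_0_charge: "v \<in> charge n \<Longrightarrow> beta 0 v = - of_int n *\<^sub>C v"
  unfolding charge_def
proof (induction rule: cvec.span_induct_alt)
  case (step c x y)
  then have "beta 0 x = - of_int n *\<^sub>C x" by (auto simp: beta_0)
  then show ?case using step.IH
    by (simp add: clinear_simps[OF clinear_beta] scaleC_simps mult.commute)
qed (simp add: clinear_0[OF clinear_beta])

lemma vexp_charge: "v \<in> charge n \<Longrightarrow> s = 1 \<or> s = - 1 \<Longrightarrow> vexp s m p v \<in> charge n"
proof (induction p rule: int_less_induct)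
  case (pos p)
  let ?w = "\<Sum>i=1..nat p. beta (- (s * int i)) (vexp s m (p - int i) v)"
  have "?w \<in> charge n"
    using pos by (intro cvec.subspace_sum[OF subspace_charge] beta_charge pos.IH) auto
  moreover have "vexp s m p v = (of_int (s * m) / of_int p) *\<^sub>C ?w"
    using vexp_deriv[of s p "nat p" m v] pos(1,4)
    by (intro scaleC_cancel[of "of_int p" "vexp s m p v"]) (auto simp: scaleC_scaleC)
  ultimately show ?case by (simp add: cvec.subspace_scale[OF subspace_charge])
qed (simp_all add: cvec.subspace_0[OF subspace_charge])

lemma vexp_e_vec: "q > 0 \<Longrightarrow> vexp (- 1) m q (e_vec r) = 0"
proof (induction q rule: int_less_induct)
  case (pos q)
  have "beta (- (- 1 * int i)) (vexp (- 1) m (q - int i) (e_vec r)) = 0" if "i \<in> {1..nat q}" for i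
  proof (cases "int i = q")
    case True
    then show ?thesis using pos(1) by (simp add: beta_e_vec)
  next
    case False
    then have "vexp (- 1) m (q - int i) (e_vec r) = 0" using that by (intro pos.IH) auto
    then show ?thesis by (simp add: clinear_0[OF clinear_beta])
  qed
  then have "of_int q *\<^sub>C vexp (- 1) m q (e_vec r) = 0"
    by (subst vexp_deriv[of "- 1" q "nat q"]) (simp_all add: sum.neutral del: mult_minus_left)
  then show ?case using pos(1) by simp
qed simp_all

text \<open>The exponential of annihilation operators fixes \<open>e_vec r\<close>, and each
  creation operator \<open>beta (- int i - 1)\<close> raises the bound on its degree by at most i +
  1.\<close>

lemma vexp_trunc: "\<exists>Q. \<forall>q\<ge>Q. vexp (- 1) m q v = 0"
proof (induction v rule: lattice_induct)
  case (scale c v)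
  then show ?case by (auto simp: clinear_scale[OF clinear_vexp] scaleC_simps)
next
  case (add u v)
  then obtain Q R where "\<forall>q\<ge>Q. vexp (- 1) m q u = 0" "\<forall>q\<ge>R. vexp (- 1) m q v = 0" by blast
  then have "\<forall>q\<ge>max Q R. vexp (- 1) m q (u + v) = 0" by (simp add: clinear_add[OF clinear_vexp])
  then show ?case by blast
next
  case (vac r)
  show ?case by (rule exI[of _ 1]) (simp add: vexp_e_vec)
next
  case (beta i v)
  then obtain Q where Q: "\<forall>q\<ge>Q. vexp (- 1) m q v = 0" by blast
  have "vexp (- 1) m q (beta (- int i - 1) v) = 0" if "q \<ge> Q + int i + 1" for q
    using beta_vexp[of "- 1" "- int i - 1" m q v] Q that
    by (simp add: clinear_0[OF clinear_beta] scaleC_simps)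
  then show ?case by blast
qed

text \<open>The lattice translation without its cocycle; it commutes with \<open>beta j\<close> for
  every nonzero j.\<close>

definition vshift :: "int \<Rightarrow> lattice_space \<Rightarrow> lattice_space" where
  "vshift m = lin_ext (\<lambda>(\<mu>, n). basis (\<mu>, m + n))"

lemma clinear_vshift: "clinear (vshift m)"
  unfolding vshift_def by (rule clinear_lin_ext)

lemma vshift_basis [simp]: "vshift m (basis (\<mu>, n)) = basis (\<mu>, m + n)"
  by (simp add: vshift_def)

lemma vshift_e_vec [simp]: "vshift m (e_vec n) = e_vec (m + n)"
  by (simp add: e_vec_def)

lemma vshift_charge: "v \<in> charge n \<Longrightarrow> vshift m v \<in> charge (m + n)"
  unfolding charge_def[of n]
  by (rule clinear_span_map[OF clinear_vshift _ subspace_charge]) (auto simp: basis_charge)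

lemma vshift_beta: "j \<noteq> 0 \<Longrightarrow> vshift m (beta j v) = beta j (vshift m v)"
proof (rule clinear_eq_on_keys[where v = v])
  fix x assume "j \<noteq> 0"
  then show "vshift m (beta j (basis x)) = beta j (vshift m (basis x))"
    by (cases x; cases "j < 0") (simp_all add: beta_neg beta_pos clinear_simps[OF clinear_vshift])
qed (intro clinear_comp[OF clinear_vshift clinear_beta] clinear_comp[OF clinear_beta clinear_vshift])+

text \<open>The part of the product of the two exponentials whose degrees differ by
  \<open>c\<close>. The sum runs over all integers, with vanishing terms at negative degrees, so
  that index shifts are bijections.\<close>

definition vsum :: "int \<Rightarrow> int \<Rightarrow> lattice_space \<Rightarrow> lattice_space" where
  "vsum m c w = Sum_any (\<lambda>q::int. vexp 1 m (q + c) (vexp (- 1) m q w))"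

lemma vsum_finite: "finite {q. vexp s m (q + c) (vexp (- 1) m (q + d) w) \<noteq> 0}"
proof -
  obtain Q where Q: "\<And>q. q \<ge> Q \<Longrightarrow> vexp (- 1) m q w = 0" using vexp_trunc by blast
  have "{q. vexp s m (q + c) (vexp (- 1) m (q + d) w) \<noteq> 0} \<subseteq> {- c..Q - d}"
  proof
    fix q assume "q \<in> {q. vexp s m (q + c) (vexp (- 1) m (q + d) w) \<noteq> 0}"
    then have "\<not> q + c < 0" "\<not> q + d \<ge> Q" using Q by (auto simp: clinear_0[OF clinear_vexp])
    then show "q \<in> {- c..Q - d}" by auto
  qed
  then show ?thesis by (rule finite_subset) simp
qed

lemma vsum_finite': "finite {q. vexp s m (q + c) (vexp (- 1) m q w) \<noteq> 0}"
  using vsum_finite[of s m c 0 w] by simp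

lemma clinear_vsum: "clinear (vsum m c)"
  unfolding vsum_def
  by (rule clinearI)
    (simp_all add: clinear_simps[OF clinear_vexp] Sum_any.distrib vsum_finite'
      Sum_any_clinear[OF clinear_scaleC])

lemma clinear_vertex_op: "clinear (vertex_op m k)"
  unfolding vertex_op_def by (rule clinear_lin_ext)

text \<open>On a single charge n the power of z is fixed: \<open>m * n - k - 1\<close> is p - q,
  solved from p - q + <m beta, n beta> = -k - 1. Later arguments are thereby freed from the
  basis.\<close>

lemma vertex_op_charge:
  assumes "v \<in> charge n"
  shows "vertex_op m k v = (- 1) powi (m * n) *\<^sub>C vsum m (m * n - k - 1) (vshift m v)"
  using assms unfolding charge_def
proof (induction rule: cvec.span_induct_alt)
  case base
  then show ?case
    by (simp add: clinear_0[OF clinear_vertex_op] clinear_0[OF clinear_vshift] clinear_0[OF clinear_vsum] scaleC_simps)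
next
  case (step c x y)
  then obtain \<mu> where x: "x = basis (\<mu>, n)" by blast
  let ?w = "basis (\<mu>, m + n)"
  let ?f = "\<lambda>q::int. vexp 1 m (q + (m * n - k - 1)) (vexp (- 1) m q ?w)"
  have "vertex_op m k x = (- 1) powi (m * n) *\<^sub>C Sum_any (\<lambda>q::nat. ?f (int q))"
    unfolding x vertex_op_def lin_ext_basis split_conv
    by (intro arg_cong[of _ _ "\<lambda>x. _ *\<^sub>C x"] arg_cong[of _ _ Sum_any])
      (auto simp: fun_eq_iff Let_def vexp_def beta_form_def algebra_simps)
  also have "Sum_any (\<lambda>q::nat. ?f (int q)) = Sum_any ?f"
  proof -
    have fin: "finite {q. ?f q \<noteq> 0}" by (rule vsum_finite')
    have fin': "finite {q::nat. ?f (int q) \<noteq> 0}"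
      using finite_vimageI[OF fin, of int] by (simp add: vimage_def)
    have "Sum_any ?f = sum ?f (int ` {q::nat. ?f (int q) \<noteq> 0})"
    proof (rule Sum_any.expand_superset)
      show "{q. ?f q \<noteq> 0} \<subseteq> int ` {q::nat. ?f (int q) \<noteq> 0}"
      proof
        fix q assume q: "q \<in> {q. ?f q \<noteq> 0}"
        then have "q \<ge> 0" by (cases "q < 0") (auto simp: clinear_0[OF clinear_vexp])
        then show "q \<in> int ` {q::nat. ?f (int q) \<noteq> 0}"
          using q by (intro image_eqI[of _ _ "nat q"]) simp_all
      qed
    qed (use fin' in simp)
    then show ?thesis by (simp add: sum.reindex Sum_any.expand_set)
  qed
  finally have "vertex_op m k x = (- 1) powi (m * n) *\<^sub>C vsum m (m * n - k - 1) (vshift m x)"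
    by (simp add: vsum_def x)
  then show ?case
    using step.IH by (simp add: clinear_simps[OF clinear_vertex_op] clinear_simps[OF clinear_vsum]
        clinear_simps[OF clinear_vshift] scaleC_simps mult.commute)
qed

lemma vsum_charge: "w \<in> charge n \<Longrightarrow> vsum m c w \<in> charge n"
  unfolding vsum_def Sum_any.expand_set
  by (intro cvec.subspace_sum[OF subspace_charge] vexp_charge) auto

lemma vertex_op_in_charge: "v \<in> charge n \<Longrightarrow> vertex_op m k v \<in> charge (m + n)"
  by (simp only: vertex_op_charge vsum_charge vshift_charge cvec.subspace_scale[OF subspace_charge])

text \<open>For positive j the commutator comes from the exponential of creation operators, for
  negative j from that of annihilation operators; in the latter case an index shift brings it to the
  same form.\<close>

lemma beta_vsum:
  "beta j (vsum m c w) - vsum m c (beta j w) = (if j = 0 then 0 else - of_int m *\<^sub>C vsum m (c - j) w)"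
proof -
  have L: "beta j (vsum m c w) = Sum_any (\<lambda>q. beta j (vexp 1 m (q + c) (vexp (- 1) m q w)))"
    unfolding vsum_def by (rule Sum_any_clinear[OF clinear_beta vsum_finite'])
  have b1: "beta j (vexp 1 m p v) = vexp 1 m p (beta j v)
      + (if j \<ge> 1 then - of_int m *\<^sub>C vexp 1 m (p - j) v else 0)" for p v
    using beta_vexp[of 1 j m p v] by (simp add: algebra_simps)
  have b2: "beta j (vexp (- 1) m q w) = vexp (- 1) m q (beta j w)
      + (if j \<le> - 1 then - of_int m *\<^sub>C vexp (- 1) m (q + j) w else 0)" for q
    using beta_vexp[of "- 1" j m q w] by (simp add: algebra_simps)
  consider "j = 0" | "j \<ge> 1" | "j \<le> - 1" by linarith
  then show ?thesis
  proof cases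
    case 1
    have "Sum_any (\<lambda>q. beta j (vexp 1 m (q + c) (vexp (- 1) m q w))) = vsum m c (beta j w)"
      unfolding vsum_def b1 b2 using 1 by simp
    then show ?thesis unfolding L using 1 by simp
  next
    case j: 2
    have "Sum_any (\<lambda>q. beta j (vexp 1 m (q + c) (vexp (- 1) m q w)))
      = Sum_any (\<lambda>q. vexp 1 m (q + c) (vexp (- 1) m q (beta j w))
          + (- of_int m) *\<^sub>C vexp 1 m (q + (c - j)) (vexp (- 1) m q w))"
      using j by (simp add: b1 b2 add_diff_eq)
    also have "\<dots> = vsum m c (beta j w) + (- of_int m) *\<^sub>C vsum m (c - j) w"
    proof -
      have "finite {q. (- of_int m) *\<^sub>C vexp 1 m (q + (c - j)) (vexp (- 1) m q w) \<noteq> 0}"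
        by (rule finite_subset[OF _ vsum_finite'[of 1 m "c - j" w]]) auto
      then show ?thesis
        unfolding vsum_def Sum_any_clinear[OF clinear_scaleC vsum_finite']
        by (rule Sum_any.distrib[OF vsum_finite'])
    qed
    finally show ?thesis unfolding L using j by simp
  next
    case j: 3
    have "Sum_any (\<lambda>q. beta j (vexp 1 m (q + c) (vexp (- 1) m q w)))
      = Sum_any (\<lambda>q. vexp 1 m (q + c) (vexp (- 1) m q (beta j w))
          + (- of_int m) *\<^sub>C vexp 1 m (q + c) (vexp (- 1) m (q + j) w))"
      using j by (simp add: b1 b2 clinear_simps[OF clinear_vexp] scaleC_simps)
    also have "\<dots> = vsum m c (beta j w) + (- of_int m) *\<^sub>C Sum_any (\<lambda>q. vexp 1 m (q + c) (vexp (- 1) m (q + j) w))"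
    proof -
      have "finite {q. (- of_int m) *\<^sub>C vexp 1 m (q + c) (vexp (- 1) m (q + j) w) \<noteq> 0}"
        by (rule finite_subset[OF _ vsum_finite[of 1 m c j w]]) auto
      then show ?thesis
        unfolding vsum_def Sum_any_clinear[OF clinear_scaleC vsum_finite]
        by (rule Sum_any.distrib[OF vsum_finite'])
    qed
    also have "Sum_any (\<lambda>q. vexp 1 m (q + c) (vexp (- 1) m (q + j) w)) = vsum m (c - j) w"
      unfolding vsum_def
      by (rule Sum_any.reindex_cong[of "\<lambda>q. q - j"])
        (auto simp: fun_eq_iff algebra_simps intro!: o_bij[of "\<lambda>q. q + j"])
    finally show ?thesis unfolding L using j by simp
  qed
qed

lemma clinear_eq_charge:
  assumes "clinear f" "clinear g" "\<And>v n. v \<in> charge n \<Longrightarrow> f v = g v"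
  shows "f v = g v"
  by (rule clinear_eq_on_keys[OF assms(1,2)]) (metis assms(3) basis_charge surj_pair)

text \<open>The vector e^(m beta) is primary for the Heisenberg algebra, with <beta, m beta> = -m.
  For j = 0 the contribution stems from the change of charge by m, otherwise from the
  exponentials.\<close>

theorem beta_vertex_op:
  "beta j (vertex_op m k v) - vertex_op m k (beta j v) = - of_int m *\<^sub>C vertex_op m (k + j) v"
proof (rule clinear_eq_charge[where v = v])
  show "clinear (\<lambda>v. beta j (vertex_op m k v) - vertex_op m k (beta j v))"
    by (intro clinear_sub clinear_comp[OF clinear_beta clinear_vertex_op] clinear_comp[OF clinear_vertex_op clinear_beta])
  show "clinear (\<lambda>v. - of_int m *\<^sub>C vertex_op m (k + j) v)"
    by (rule clinear_comp[OF clinear_scaleC clinear_vertex_op])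
  fix v n assume v: "v \<in> charge n"
  show "beta j (vertex_op m k v) - vertex_op m k (beta j v) = - of_int m *\<^sub>C vertex_op m (k + j) v"
  proof (cases "j = 0")
    case True
    then show ?thesis
      by (simp add: beta_0_charge[OF v] beta_0_charge[OF vertex_op_in_charge[OF v]]
          clinear_simps[OF clinear_vertex_op] scaleC_simps algebra_simps)
  next
    case False
    have c: "m * n - k - 1 - j = m * n - (k + j) - 1" by simp
    show ?thesis
      using beta_vsum[of j m "m * n - k - 1" "vshift m v"] False
      unfolding vertex_op_charge[OF v] vertex_op_charge[OF beta_charge[OF v]] vshift_beta[OF False] c
      by (simp only: clinear_scale[OF clinear_beta] cvec.scale_right_diff_distrib[symmetric] if_False
          scaleC_scaleC mult.commute)
  qed
qed

lemma vertex_op_e_vec: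
  "vertex_op m k (e_vec r) = (- 1) powi (m * r) *\<^sub>C vexp 1 m (m * r - k - 1) (e_vec (m + r))"
proof -
  have "vexp 1 m (q + (m * r - k - 1)) (vexp (- 1) m q (e_vec (m + r)))
      = (if q = 0 then vexp 1 m (m * r - k - 1) (e_vec (m + r)) else 0)" for q
    by (cases "q < 0"; cases "q = 0") (simp_all add: vexp_e_vec clinear_0[OF clinear_vexp])
  then show ?thesis
    by (simp add: vertex_op_charge[OF e_vec_charge] vsum_def)
qed

lemma is_fld_beta: "is_fld beta"
  unfolding is_fld_def
proof (intro conjI allI clinear_beta)
  fix v
  show "\<exists>N. \<forall>n\<ge>N. beta n v = 0"
  proof (induction v rule: lattice_induct)
    case (scale c v)
    then show ?case by (auto simp: clinear_scale[OF clinear_beta] scaleC_simps)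
  next
    case (add u v)
    then obtain N M where "\<forall>n\<ge>N. beta n u = 0" "\<forall>n\<ge>M. beta n v = 0" by blast
    then have "\<forall>n\<ge>max N M. beta n (u + v) = 0" by (simp add: clinear_add[OF clinear_beta])
    then show ?case by blast
  next
    case (vac r)
    show ?case by (rule exI[of _ 1]) (simp add: beta_e_vec)
  next
    case (beta i v)
    then obtain N where N: "\<forall>n\<ge>N. beta n v = 0" by blast
    have "beta n (beta (- int i - 1) v) = 0" if "n \<ge> max N (int i + 2)" for n
      using beta_comm[of n "- int i - 1" v] that N by (simp add: clinear_0[OF clinear_beta])
    then show ?case by blast
  qed
qed

lemma is_fld_vertex_op: "is_fld (vertex_op m)"
  unfolding is_fld_def
proof (intro conjI allI clinear_vertex_op)
  fix v
  show "\<exists>N. \<forall>n\<ge>N. vertex_op m n v = 0"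
  proof (induction v rule: lattice_induct)
    case (scale c v)
    then show ?case by (auto simp: clinear_scale[OF clinear_vertex_op] scaleC_simps)
  next
    case (add u v)
    then obtain N M where "\<forall>n\<ge>N. vertex_op m n u = 0" "\<forall>n\<ge>M. vertex_op m n v = 0" by blast
    then have "\<forall>n\<ge>max N M. vertex_op m n (u + v) = 0" by (simp add: clinear_add[OF clinear_vertex_op])
    then show ?case by blast
  next
    case (vac r)
    show ?case by (rule exI[of _ "m * r"]) (simp add: vertex_op_e_vec scaleC_simps)
  next
    case (beta i v)
    then obtain N where N: "\<forall>n\<ge>N. vertex_op m n v = 0" by blast
    have "vertex_op m n (beta (- int i - 1) v) = 0" if "n \<ge> N + int i + 1" for n
      using beta_vertex_op[of "- int i - 1" m n v] that N by (simp add: clinear_0[OF clinear_beta] scaleC_simps)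
    then show ?case by blast
  qed
qed

subsection \<open>Locality of vertex operators\<close>

text \<open>The numbers (-1)^q binom(-a, q) are the coefficients of F = (1 - x)^(-a), and this is
  the recursion expressed by x F' = a (x / (1 - x)) F.\<close>

lemma vexp_coeff_identity:
  "of_nat q * ((- 1) ^ q * (- a gchoose q)) = a * (\<Sum>j<q. (- 1) ^ j * (- a gchoose j))" for a :: complex
proof (cases q)
  case (Suc r)
  have "(\<Sum>j\<le>r. (- 1) ^ j * (- a gchoose j)) = (- 1) ^ r * (- a - 1 gchoose r)"
    using gbinomial_sum_lower_neg[of "- a" r] by (simp add: mult.commute)
  moreover have "of_nat q * ((- 1) ^ q * (- a gchoose q)) = (- 1) ^ q * (- a * (- a - 1 gchoose r))"
    unfolding Suc gbinomial_absorption[symmetric] by (simp add: algebra_simps)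
  ultimately show ?thesis by (simp add: Suc lessThan_Suc_atMost)
qed simp

text \<open>Moving annihilation operators past creation operators produces the factor (1 - x)^(-mn)
  in the ratio x = w/z, the origin of all poles and zeros at z = w of products of vertex
  operators.\<close>

lemma vexp_vexp_e_vec:
  "vexp (- 1) m (int q) (vexp 1 n p (e_vec t))
    = ((- 1) ^ q * (of_int (- (m * n)) gchoose q)) *\<^sub>C vexp 1 n (p - int q) (e_vec t)"
proof (induction q rule: less_induct)
  case (less q)
  let ?c = "\<lambda>q. (- 1) ^ q * (- of_int (m * n) gchoose q) :: complex"
  show ?case
  proof (cases "q = 0")
    case False
    have b: "beta (int i) (vexp 1 n p' (e_vec t)) = - of_int n *\<^sub>C vexp 1 n (p' - int i) (e_vec t)"
      if "i \<ge> 1" for i p'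
      using beta_vexp[of 1 "int i" n p' "e_vec t"] that
      by (simp add: beta_e_vec clinear_0[OF clinear_vexp])
    have "of_nat q *\<^sub>C vexp (- 1) m (int q) (vexp 1 n p (e_vec t))
        = of_int (- 1 * m) *\<^sub>C (\<Sum>i=1..q. beta (- (- 1 * int i)) (vexp (- 1) m (int q - int i) (vexp 1 n p (e_vec t))))"
      using vexp_deriv[of "- 1" "int q" q m "vexp 1 n p (e_vec t)"] by simp
    also have "\<dots> = of_int (- 1 * m) *\<^sub>C (\<Sum>i=1..q. (- of_int n * ?c (q - i)) *\<^sub>C vexp 1 n (p - int q) (e_vec t))"
    proof (intro arg_cong[of _ _ "\<lambda>x. _ *\<^sub>C x"] sum.cong refl)
      fix i assume i: "i \<in> {1..q}"
      then have iq: "int q - int i = int (q - i)" by auto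
      have "vexp (- 1) m (int q - int i) (vexp 1 n p (e_vec t)) = ?c (q - i) *\<^sub>C vexp 1 n (p - int (q - i)) (e_vec t)"
        using less.IH[of "q - i"] i unfolding iq by simp
      then have "beta (- (- 1 * int i)) (vexp (- 1) m (int q - int i) (vexp 1 n p (e_vec t)))
        = ?c (q - i) *\<^sub>C beta (int i) (vexp 1 n (p - int (q - i)) (e_vec t))"
        by (simp add: clinear_scale[OF clinear_beta])
      also have "\<dots> = ?c (q - i) *\<^sub>C (- of_int n *\<^sub>C vexp 1 n (p - int (q - i) - int i) (e_vec t))"
        using b[of i "p - int (q - i)"] i by simp
      also have "p - int (q - i) - int i = p - int q" using i by auto
      finally show "beta (- (- 1 * int i)) (vexp (- 1) m (int q - int i) (vexp 1 n p (e_vec t)))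
        = (- of_int n * ?c (q - i)) *\<^sub>C vexp 1 n (p - int q) (e_vec t)"
        by (simp add: scaleC_scaleC mult.commute)
    qed
    also have "\<dots> = (of_int (m * n) * (\<Sum>i=1..q. ?c (q - i))) *\<^sub>C vexp 1 n (p - int q) (e_vec t)"
      by (simp add: cvec.scale_sum_right cvec.scale_sum_left scaleC_simps sum_distrib_left mult_ac)
    also have "(\<Sum>i=1..q. ?c (q - i)) = (\<Sum>j<q. ?c j)"
      by (rule sum.reindex_bij_witness[of _ "\<lambda>j. q - j" "\<lambda>i. q - i"]) auto
    also have "of_int (m * n) * (\<Sum>j<q. ?c j) = of_nat q * ?c q"
      by (rule vexp_coeff_identity[symmetric])
    finally have "of_nat q *\<^sub>C vexp (- 1) m (int q) (vexp 1 n p (e_vec t))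
        = of_nat q *\<^sub>C (?c q *\<^sub>C vexp 1 n (p - int q) (e_vec t))"
      by (simp only: scaleC_scaleC)
    then have "vexp (- 1) m (int q) (vexp 1 n p (e_vec t)) = ?c q *\<^sub>C vexp 1 n (p - int q) (e_vec t)"
      by (rule scaleC_cancel[rotated]) (use False in simp)
    then show ?thesis by simp
  qed (simp add: scaleC_simps)
qed

lemma vexp_comm: "vexp 1 m p (vexp 1 n p' v) = vexp 1 n p' (vexp 1 m p v)"
proof (induction p rule: int_less_induct)
  case (pos p)
  have "of_int p *\<^sub>C vexp 1 m p (vexp 1 n p' v)
      = of_int (1 * m) *\<^sub>C (\<Sum>i=1..nat p. beta (- (1 * int i)) (vexp 1 m (p - int i) (vexp 1 n p' v)))"
    by (rule vexp_deriv) simp_all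
  also have "\<dots> = of_int (1 * m) *\<^sub>C (\<Sum>i=1..nat p. vexp 1 n p' (beta (- (1 * int i)) (vexp 1 m (p - int i) v)))"
  proof (intro arg_cong[of _ _ "\<lambda>x. _ *\<^sub>C x"] sum.cong refl)
    fix i assume i: "i \<in> {1..nat p}"
    then have "vexp 1 m (p - int i) (vexp 1 n p' v) = vexp 1 n p' (vexp 1 m (p - int i) v)"
      by (intro pos.IH) auto
    then show "beta (- (1 * int i)) (vexp 1 m (p - int i) (vexp 1 n p' v))
        = vexp 1 n p' (beta (- (1 * int i)) (vexp 1 m (p - int i) v))"
      using beta_vexp[of 1 "- (1 * int i)" n p' "vexp 1 m (p - int i) v"] i by simp
  qed
  also have "\<dots> = vexp 1 n p' (of_int (1 * m) *\<^sub>C (\<Sum>i=1..nat p. beta (- (1 * int i)) (vexp 1 m (p - int i) v)))"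
    by (simp add: clinear_simps[OF clinear_vexp])
  also have "\<dots> = of_int p *\<^sub>C vexp 1 n p' (vexp 1 m p v)"
    using vexp_deriv[of 1 p "nat p" m v] by (simp flip: clinear_scale[OF clinear_vexp])
  finally show ?case
    by (rule scaleC_cancel[rotated]) (use pos(1) in simp)
qed (simp_all add: clinear_0[OF clinear_vexp])

text \<open>The coefficient of \<open>z^(-a-1) w^(-b-1)\<close> in \<open>i\<^sub>z\<^sub>,\<^sub>w (z-w)^c\<close> times a series with coefficients
  \<open>g\<close>, up to a shift of the indices.\<close>

definition binomial_conv :: "(int \<Rightarrow> int \<Rightarrow> 'v::complex_space) \<Rightarrow> int \<Rightarrow> int \<Rightarrow> int \<Rightarrow> 'v" where
  "binomial_conv g c a b = Sum_any (\<lambda>q::nat. ((- 1) ^ q * (of_int c gchoose q)) *\<^sub>C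
     g (a - c + int q) (b - int q))"

lemma binomial_conv_eq:
  assumes "\<And>x y. y < 0 \<Longrightarrow> g x y = 0" "L \<ge> nat (b + 1)"
  shows "binomial_conv g c a b = (\<Sum>q<L. ((- 1) ^ q * (of_int c gchoose q)) *\<^sub>C
     g (a - c + int q) (b - int q))"
  unfolding binomial_conv_def
proof (rule Sum_any.expand_superset)
  show "{q. ((- 1) ^ q * (of_int c gchoose q)) *\<^sub>C g (a - c + int q) (b - int q) \<noteq> 0} \<subseteq> {..<L}"
  proof
    fix q assume "q \<in> {q. ((- 1) ^ q * (of_int c gchoose q)) *\<^sub>C g (a - c + int q) (b - int q) \<noteq> 0}"
    then have "\<not> b - int q < 0" using assms(1) by (auto simp: scaleC_simps)
    then show "q \<in> {..<L}" using assms(2) by auto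
  qed
qed simp

text \<open>Multiplication by z - w, by Pascal's rule. The hypothesis makes the expansion finite,
  since the second argument of \<open>g\<close> decreases with the summation index.\<close>

lemma binomial_conv_step:
  assumes g: "\<And>x y. y < 0 \<Longrightarrow> g x y = 0"
  shows "binomial_conv g c (a - 1) b - binomial_conv g c a (b - 1) = binomial_conv g (c + 1) a b"
proof -
  define L where "L = nat (b + 1)"
  let ?p = "\<lambda>j. g (a - (c + 1) + int j) (b - int j)"
  have E: "binomial_conv g c a b = (\<Sum>q<M. ((- 1) ^ q * (of_int c gchoose q)) *\<^sub>C
     g (a - c + int q) (b - int q))" if "M \<ge> nat (b + 1)" for M c a b
    by (rule binomial_conv_eq[OF _ that]) (rule g)
  have "?p L = 0" using g by (simp add: L_def)
  from pascal_telescope[of ?p L "of_int c", OF this]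
  have "binomial_conv g (c + 1) a b = (\<Sum>j<L. ((- 1) ^ j * (of_int c gchoose j)) *\<^sub>C (?p j - ?p (Suc j)))"
    using E[of b "Suc L" "c + 1" a] by (simp add: L_def)
  moreover have "binomial_conv g c (a - 1) b = (\<Sum>j<L. ((- 1) ^ j * (of_int c gchoose j)) *\<^sub>C ?p j)"
    using E[of b L c "a - 1"] by (simp add: L_def algebra_simps)
  moreover have "binomial_conv g c a (b - 1) = (\<Sum>j<L. ((- 1) ^ j * (of_int c gchoose j)) *\<^sub>C ?p (Suc j))"
    using E[of "b - 1" L c a] by (simp add: L_def algebra_simps)
  ultimately show ?thesis by (simp add: cvec.scale_right_diff_distrib sum_subtractf)
qed

text \<open>For a natural exponent d the two expansions are the same polynomial, up to the sign of
  (w - z)^d against (z - w)^d. Here the two orders of operators meet.\<close>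

lemma binomial_conv_swap:
  "binomial_conv (\<lambda>x y. g y x) (int d) b a = (- 1) ^ d *\<^sub>C binomial_conv g (int d) a b"
proof -
  have eq: "binomial_conv g (int d) a b = (\<Sum>q\<le>d. ((- 1) ^ q * of_nat (d choose q)) *\<^sub>C
      g (a - int d + int q) (b - int q))" for g :: "int \<Rightarrow> int \<Rightarrow> 'a" and a b
  proof -
    have "binomial_conv g (int d) a b = (\<Sum>q\<le>d. ((- 1) ^ q * (of_int (int d) gchoose q)) *\<^sub>C
      g (a - int d + int q) (b - int q))"
      unfolding binomial_conv_def
      by (rule Sum_any.expand_superset) (auto simp: binomial_gbinomial[symmetric] binomial_eq_0 not_le scaleC_simps intro!: leI)
    then show ?thesis by (simp add: binomial_gbinomial)
  qed
  have "(\<Sum>q\<le>d. ((- 1) ^ q * of_nat (d choose q)) *\<^sub>C g (a - int q) (b - int d + int q))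
      = (\<Sum>q\<le>d. ((- 1) ^ (d - q) * of_nat (d choose q)) *\<^sub>C g (a - int d + int q) (b - int q))"
    by (rule sum.reindex_bij_witness[of _ "\<lambda>q. d - q" "\<lambda>q. d - q"])
      (auto simp: binomial_symmetric[symmetric] of_nat_diff algebra_simps)
  also have "\<dots> = (- 1) ^ d *\<^sub>C (\<Sum>q\<le>d. ((- 1) ^ q * of_nat (d choose q)) *\<^sub>C g (a - int d + int q) (b - int q))"
    unfolding cvec.scale_sum_right scaleC_scaleC
  proof (intro sum.cong refl arg_cong2[of _ _ _ _ "(*\<^sub>C)"])
    fix q assume "q \<in> {..d}"
    then have "(- 1 :: complex) ^ d = (- 1) ^ (d - q) * (- 1) ^ q" by (simp flip: power_add)
    moreover have "(- 1 :: complex) ^ q * (- 1) ^ q = 1" by (simp flip: power_mult_distrib)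
    ultimately show "(- 1) ^ (d - q) * of_nat (d choose q) = (- 1 :: complex) ^ d * ((- 1) ^ q * of_nat (d choose q))"
      by simp
  qed
  finally show ?thesis by (simp add: eq)
qed

lemma Sum_any_int_nat:
  assumes "\<And>q. q < 0 \<Longrightarrow> f q = (0 :: 'v::comm_monoid_add)"
  shows "Sum_any f = Sum_any (\<lambda>q::nat. f (int q))"
proof -
  have "{q. f q \<noteq> 0} = int ` {q. f (int q) \<noteq> 0}"
  proof (intro equalityI subsetI)
    fix q assume "q \<in> {q. f q \<noteq> 0}"
    then have "q = int (nat q)" "f q \<noteq> 0" using assms[of q] by (cases "q < 0"; simp)+
    then show "q \<in> int ` {q. f (int q) \<noteq> 0}" by (metis (mono_tags, lifting) imageI mem_Collect_eq)
  qed auto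
  then show ?thesis by (simp add: Sum_any.expand_set sum.reindex)
qed

text \<open>On \<open>e_vec r\<close> the product is a monomial times the expansion of (z - w)^(-mn)
  times two exponentials of creation operators, which commute. The order of the operators shows only
  in the expansion and the cocycle signs.\<close>

lemma vertex_op_vertex_op_e_vec:
  "vertex_op m k (vertex_op n l (e_vec r)) = ((- 1) powi (n * r) * (- 1) powi (m * (n + r))) *\<^sub>C
    binomial_conv (\<lambda>x y. vexp 1 m x (vexp 1 n y (e_vec (m + n + r)))) (- (m * n)) (m * r - k - 1) (n * r - l - 1)"
proof -
  let ?t = "m + n + r"
  let ?p = "n * r - l - 1"
  have ch: "vexp 1 n ?p (e_vec (n + r)) \<in> charge (n + r)" by (simp add: vexp_charge e_vec_charge)
  have shift: "vshift m (vexp 1 n p (e_vec s)) = vexp 1 n p (e_vec (m + s))" for p s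
  proof (induction p rule: int_less_induct)
    case (pos p)
    have "of_int p *\<^sub>C vshift m (vexp 1 n p (e_vec s))
        = of_int (1 * n) *\<^sub>C (\<Sum>i=1..nat p. vshift m (beta (- (1 * int i)) (vexp 1 n (p - int i) (e_vec s))))"
      using vexp_deriv[of 1 p "nat p" n "e_vec s"]
      by (simp add: clinear_simps[OF clinear_vshift] flip: clinear_scale[OF clinear_vshift, of _ "of_int p"])
    also have "\<dots> = of_int (1 * n) *\<^sub>C (\<Sum>i=1..nat p. beta (- (1 * int i)) (vexp 1 n (p - int i) (e_vec (m + s))))"
      using pos.IH by (intro arg_cong[of _ _ "\<lambda>x. _ *\<^sub>C x"] sum.cong refl) (simp add: vshift_beta)
    also have "\<dots> = of_int p *\<^sub>C vexp 1 n p (e_vec (m + s))"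
      by (rule vexp_deriv[symmetric]) simp_all
    finally show ?case
      by (rule scaleC_cancel[rotated]) (use pos(1) in simp)
  qed (simp_all add: clinear_0[OF clinear_vshift])
  have "vertex_op m k (vexp 1 n ?p (e_vec (n + r)))
      = (- 1) powi (m * (n + r)) *\<^sub>C vsum m (m * (n + r) - k - 1) (vexp 1 n ?p (e_vec ?t))"
    by (simp add: vertex_op_charge[OF ch] shift add.assoc)
  also have "vsum m (m * (n + r) - k - 1) (vexp 1 n ?p (e_vec ?t))
      = binomial_conv (\<lambda>x y. vexp 1 m x (vexp 1 n y (e_vec ?t))) (- (m * n)) (m * r - k - 1) ?p"
    unfolding vsum_def binomial_conv_def
    by (subst Sum_any_int_nat)
      (simp_all add: clinear_0[OF clinear_vexp] vexp_vexp_e_vec clinear_scale[OF clinear_vexp] algebra_simps)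
  finally show ?thesis
    by (simp add: vertex_op_e_vec clinear_scale[OF clinear_vertex_op] scaleC_simps)
qed

lemma del_pow_shift: "(del ^^ N) (\<lambda>k l. f (k + i) (l + j)) = (\<lambda>k l. (del ^^ N) f (k + i) (l + j))"
proof (induction N)
  case (Suc N)
  then show ?case by (simp add: del_def algebra_simps)
qed simp

lemma minus_one_powi_nat: "(- 1 :: complex) powi k = (if even k then 1 else - 1)"
  by (auto simp: power_int_def minus_one_power_iff even_nat_iff)

lemma vertex_op_local: "mut_local (odd m) (odd n) (vertex_op m) (vertex_op n)"
proof -
  \<comment> \<open>This exponent makes -mn + N nonnegative, so that after multiplication by (z -
    w)^N both orders involve the same polynomial, whatever the sign of mn.\<close>
  define N where "N = nat \<bar>m * n\<bar>"
  let ?\<kappa> = "koszul (odd m) (odd n)"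
  let ?f = "\<lambda>v k l. vertex_op m k (vertex_op n l v) - ?\<kappa> *\<^sub>C vertex_op n l (vertex_op m k v)"
  let ?X = "\<lambda>x v. (del ^^ N) (?f v) (fst x) (snd x)"
  have "?X x v = 0" for x v
  proof (rule lattice_vanish[of ?X])
    fix x
    have "?f (u + v) = (\<lambda>k l. ?f u k l + ?f v k l)" for u v
      by (simp add: fun_eq_iff clinear_simps[OF clinear_vertex_op] scaleC_simps algebra_simps)
    moreover have "?f (c *\<^sub>C v) = (\<lambda>k l. c *\<^sub>C ?f v k l)" for c v
      by (simp add: fun_eq_iff clinear_simps[OF clinear_vertex_op] scaleC_simps mult.commute)
    ultimately show "clinear (?X x)"
      by (intro clinearI) (simp_all only: del_pow_add del_pow_scale)
  next
    fix x i v
    assume v: "\<And>y. ?X y v = 0"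
    let ?j = "- int i - 1"
    have V: "vertex_op m' k (beta ?j v) = beta ?j (vertex_op m' k v) + of_int m' *\<^sub>C vertex_op m' (k + ?j) v" for m' k v
      using beta_vertex_op[of ?j m' k v] by (simp add: algebra_simps scaleC_simps)
    have "?f (beta ?j v) = (\<lambda>k l. beta ?j (?f v k l) + (of_int m *\<^sub>C ?f v (k + ?j) (l + 0) + of_int n *\<^sub>C ?f v (k + 0) (l + ?j)))"
      by (simp add: fun_eq_iff V clinear_simps[OF clinear_vertex_op] clinear_simps[OF clinear_beta]
          scaleC_simps algebra_simps)
    then have X: "(del ^^ N) (?f (beta ?j v)) k l = beta ?j (?X (k, l) v)
        + (of_int m *\<^sub>C ?X (k + ?j, l + 0) v + of_int n *\<^sub>C ?X (k + 0, l + ?j) v)" for k l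
      by (simp only: del_pow_add del_pow_scale del_pow_clinear[OF clinear_beta] del_pow_shift[of N "?f v"] fst_conv snd_conv)
    show "?X x (beta ?j v) = 0"
      unfolding X v by (simp add: clinear_0[OF clinear_beta] scaleC_simps)
  next
    fix x r
    let ?c = "- (m * n)"
    let ?t = "m + n + r"
    let ?g = "\<lambda>x y. vexp 1 m x (vexp 1 n y (e_vec ?t))"
    let ?g' = "\<lambda>x y. ?g y x"
    let ?\<sigma> = "(- 1) powi (n * r) * (- 1) powi (m * (n + r)) :: complex"
    define A where "A = m * r - 1"
    define B where "B = n * r - 1"
    let ?\<Phi> = "\<lambda>c k l. binomial_conv ?g c (A - k) (B - l)"
    let ?\<Psi> = "\<lambda>c k l. binomial_conv ?g' c (B - l) (A - k)"
    have g: "?g x y = 0" if "x < 0 \<or> y < 0" for x y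
      using that by (auto simp: clinear_0[OF clinear_vexp])
    have s1: "binomial_conv ?g c (a - 1) b - binomial_conv ?g c a (b - 1) = binomial_conv ?g (c + 1) a b" for c a b
      by (rule binomial_conv_step) (rule g, simp)
    have s2: "binomial_conv ?g' c (a - 1) b - binomial_conv ?g' c a (b - 1) = binomial_conv ?g' (c + 1) a b" for c a b
      by (rule binomial_conv_step) (rule g, simp)
    have 1: "(del ^^ M) (?\<Phi> c) = ?\<Phi> (c + int M)" for M c
    proof (induction M)
      case (Suc M)
      have "del (?\<Phi> (c + int M)) = ?\<Phi> (c + int (Suc M))"
      proof (intro ext)
        fix k l
        show "del (?\<Phi> (c + int M)) k l = ?\<Phi> (c + int (Suc M)) k l"
          using s1[of "c + int M" "A - k" "B - l"] by (simp add: del_apply diff_diff_eq add_ac)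
      qed
      then show ?case using Suc by simp
    qed simp
    have 2: "(del ^^ M) (?\<Psi> c) = (\<lambda>k l. (- 1) ^ M *\<^sub>C ?\<Psi> (c + int M) k l)" for M c
    proof (induction M)
      case (Suc M)
      have "del (?\<Psi> (c + int M)) = (\<lambda>k l. - ?\<Psi> (c + int (Suc M)) k l)"
      proof (intro ext)
        fix k l
        show "del (?\<Psi> (c + int M)) k l = - ?\<Psi> (c + int (Suc M)) k l"
          using s2[of "c + int M" "B - l" "A - k", symmetric] by (simp add: del_apply diff_diff_eq add_ac)
      qed
      then have "del (\<lambda>k l. (- 1) ^ M *\<^sub>C ?\<Psi> (c + int M) k l) = (\<lambda>k l. (- 1) ^ M *\<^sub>C (- ?\<Psi> (c + int (Suc M)) k l))"
        using del_pow_scale[of 1 "(- 1) ^ M" "?\<Psi> (c + int M)"] by (simp del: of_nat_Suc)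
      then show ?case using Suc by (simp add: scaleC_simps del: of_nat_Suc)
    qed (simp add: scaleC_simps)
    \<comment> \<open>Both orders carry the same cocycle sign, because mn + mr + nr is symmetric in
      m and n; the sign of the exchange comes from the powers of z - w alone.\<close>
    have "(- 1) powi (m * r) * (- 1) powi (n * (m + r)) = ?\<sigma>"
      by (simp add: minus_one_powi_nat)
    then have f: "?f (e_vec r) = (\<lambda>k l. ?\<sigma> *\<^sub>C (?\<Phi> ?c k l - ?\<kappa> *\<^sub>C ?\<Psi> ?c k l))"
      unfolding vertex_op_vertex_op_e_vec
      by (simp add: A_def B_def fun_eq_iff scaleC_simps vexp_comm[of n] algebra_simps)
    define d where "d = nat (?c + int N)"
    have d: "?c + int N = int d" by (simp add: d_def N_def)
    have "(del ^^ N) (?f (e_vec r)) = (\<lambda>k l. ?\<sigma> *\<^sub>C (?\<Phi> (int d) k l - ?\<kappa> *\<^sub>C (- 1) ^ N *\<^sub>C ?\<Psi> (int d) k l))"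
      unfolding f by (simp only: del_pow_scale del_pow_diff 1 2 d)
    also have "\<dots> = (\<lambda>k l. ?\<sigma> *\<^sub>C (?\<Phi> (int d) k l - (?\<kappa> * ((- 1) ^ N * (- 1) ^ d)) *\<^sub>C ?\<Phi> (int d) k l))"
      by (simp only: binomial_conv_swap[of ?g] scaleC_scaleC mult.assoc)
    \<comment> \<open>N + d is 2 N - mn, so it has the parity of mn, and (-1)^(mn) is the Koszul
      sign.\<close>
    also have "?\<kappa> * ((- 1) ^ N * (- 1) ^ d) = 1"
    proof -
      have "even (int N + int d) \<longleftrightarrow> even (m * n)"
        unfolding d[symmetric] N_def by simp presburger?
      then have "even (N + d) \<longleftrightarrow> even m \<or> even n" by (simp flip: of_nat_add)
      then show ?thesis by (auto simp: koszul_def simp flip: power_add)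
    qed
    finally show "?X x (e_vec r) = 0" by (simp add: scaleC_simps)
  qed
  then show ?thesis unfolding mut_local_def by (intro exI[of _ N]) (force simp: fun_eq_iff)
qed

lemma beta_local: "mut_local False False beta beta"
proof -
  have "(del ^^ 2) (\<lambda>m k. beta m (beta k v) - koszul False False *\<^sub>C beta k (beta m v)) = (\<lambda>_ _. 0)" for v
  proof -
    have "2 *\<^sub>C v = v + v" by (metis one_add_one scaleC_add_left scaleC_one)
    then show ?thesis
      by (simp add: scaleC_simps beta_comm eval_nat_numeral del_def fun_eq_iff algebra_simps)
  qed
  then show ?thesis unfolding mut_local_def by (intro exI[of _ 2]) blast
qed

lemma beta_vertex_op_local: "mut_local False (odd n) beta (vertex_op n)"
proof -
  have "(del ^^ 1) (\<lambda>m k. beta m (vertex_op n k v) - koszul False (odd n) *\<^sub>C vertex_op n k (beta m v)) = (\<lambda>_ _. 0)" for v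
    by (simp add: scaleC_simps beta_vertex_op del_def fun_eq_iff algebra_simps)
  then show ?thesis unfolding mut_local_def by (intro exI[of _ 1]) blast
qed

subsection \<open>Translation\<close>

text \<open>The derivation of the Heisenberg polynomials, corrected by its action on e^(n beta),
  whose derivative is n beta(-1) e^(n beta).\<close>

definition lat_D :: "lattice_space \<Rightarrow> lattice_space" where
  "lat_D = lin_ext (\<lambda>(\<mu>, n). deriv_mono (\<lambda>i. of_nat (Suc i)) Suc \<mu> \<otimes> basis n
     + of_int n *\<^sub>C beta (- 1) (basis (\<mu>, n)))"

lemma clinear_lat_D: "clinear lat_D"
  unfolding lat_D_def by (rule clinear_lin_ext)

lemma beta_tens:
  assumes "j < 0"
  shows "beta j (p \<otimes> basis n) = (basis (Poly_Mapping.single (nat (- j - 1)) 1) * p) \<otimes> basis n"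
proof (rule clinear_eq_on_keys[where v = p])
  show "beta j (basis \<mu> \<otimes> basis n) = (basis (Poly_Mapping.single (nat (- j - 1)) 1) * basis \<mu>) \<otimes> basis n" for \<mu>
    using assms by (simp add: tens_basis beta_neg mult_single add.commute)
qed (intro clinear_comp[OF clinear_beta tens_left] clinear_comp[OF tens_left clinear_mult])+

lemma lat_D_e_vec: "lat_D (e_vec r) = of_int r *\<^sub>C beta (- 1) (e_vec r)"
  by (simp add: lat_D_def e_vec_def deriv_mono_0 tens_simps)

lemma lat_D_beta_neg:
  assumes "j < 0"
  shows "lat_D (beta j v) - beta j (lat_D v) = - of_int j *\<^sub>C beta (j - 1) v"
proof (rule clinear_eq_on_keys[where v = v])
  show "clinear (\<lambda>v. lat_D (beta j v) - beta j (lat_D v))"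
    by (intro clinear_sub clinear_comp[OF clinear_lat_D clinear_beta] clinear_comp[OF clinear_beta clinear_lat_D])
  show "clinear (\<lambda>v. - of_int j *\<^sub>C beta (j - 1) v)"
    by (rule clinear_comp[OF clinear_scaleC clinear_beta])
  fix x :: "(nat \<Rightarrow>\<^sub>0 nat) \<times> int"
  obtain \<mu> n where x: "x = (\<mu>, n)" by (cases x)
  let ?k = "nat (- j - 1)"
  let ?d = "deriv_mono (\<lambda>i. of_nat (Suc i)) Suc"
  have k: "Suc ?k = nat (- (j - 1) - 1)" "of_nat (Suc ?k) = (- of_int j :: complex)"
    using assms by simp_all
  have "lat_D (beta j (basis x)) = ?d (Poly_Mapping.single ?k 1 + \<mu>) \<otimes> basis n
      + of_int n *\<^sub>C beta (- 1) (beta j (basis x))"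
    using assms by (simp add: x beta_neg lat_D_def add.commute)
  also have "?d (Poly_Mapping.single ?k 1 + \<mu>) \<otimes> basis n
      = - of_int j *\<^sub>C beta (j - 1) (basis x) + beta j (?d \<mu> \<otimes> basis n)"
    unfolding deriv_mono_single k using assms
    by (simp add: tens_simps beta_tens tens_basis beta_neg x add.commute)
  also have "of_int n *\<^sub>C beta (- 1) (beta j (basis x)) = beta j (of_int n *\<^sub>C beta (- 1) (basis x))"
    using beta_comm[of "- 1" j "basis x"] assms by (simp add: clinear_scale[OF clinear_beta])
  finally show "lat_D (beta j (basis x)) - beta j (lat_D (basis x)) = - of_int j *\<^sub>C beta (j - 1) (basis x)"
    by (simp add: x lat_D_def clinear_simps[OF clinear_beta])
qed

text \<open>For creation modes this is the Leibniz rule; for the others it is checked on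
  \<open>e_vec r\<close> and carried over by moving creation operators aside.\<close>

lemma lat_D_beta: "lat_D (beta j v) - beta j (lat_D v) = - of_int j *\<^sub>C beta (j - 1) v"
proof (cases "j < 0")
  case False
  define X where "X j v = lat_D (beta (int j) v) - beta (int j) (lat_D v) + of_nat j *\<^sub>C beta (int j - 1) v" for j :: nat and v
  have "X j v = 0" for j v
  proof (rule lattice_vanish[of X])
    fix j
    show "clinear (X j)"
      unfolding X_def
      by (rule clinearI) (simp_all add: clinear_simps[OF clinear_lat_D] clinear_simps[OF clinear_beta] scaleC_simps algebra_simps)
  next
    fix j :: nat and r
    have b: "beta k (beta (- 1) (e_vec r)) = (if k = 1 then - e_vec r else 0)" if "k \<ge> 1" for k
      using beta_comm[of k "- 1" "e_vec r"] that
      by (auto simp: beta_e_vec clinear_0[OF clinear_beta] scaleC_simps)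
    consider "j = 0" | "j = 1" | "j \<ge> 2" by linarith
    then show "X j (e_vec r) = 0"
    proof cases
      case 1
      have "beta (- 1) (e_vec r) \<in> charge r" by (intro beta_charge e_vec_charge)
      then show ?thesis
        using 1 by (simp add: X_def lat_D_e_vec beta_e_vec clinear_simps[OF clinear_lat_D]
            clinear_simps[OF clinear_beta] beta_0_charge scaleC_simps)
    next
      case 2
      then show ?thesis
        by (simp add: X_def lat_D_e_vec beta_e_vec clinear_simps[OF clinear_lat_D]
            clinear_simps[OF clinear_beta] b scaleC_simps)
    next
      case 3
      then show ?thesis
        by (simp add: X_def lat_D_e_vec beta_e_vec clinear_simps[OF clinear_lat_D]
            clinear_simps[OF clinear_beta] b scaleC_simps)
    qed
  next
    fix j i v
    assume v: "\<And>y. X y v = 0"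
    let ?i = "- int i - 1"
    have c: "beta k (beta n w) = beta n (beta k w) + (if k + n = 0 then - of_int k *\<^sub>C w else 0)" for k n w
      using beta_comm[of k n w] by (simp add: algebra_simps)
    have d: "lat_D (beta ?i w) = beta ?i (lat_D w) + of_nat (Suc i) *\<^sub>C beta (?i - 1) w" for w
      using lat_D_beta_neg[of ?i w] by (simp add: algebra_simps)
    have "X j (beta ?i v) = beta ?i (X j v)
       + (of_nat (Suc i) *\<^sub>C (if int j + (?i - 1) = 0 then of_int (int j) *\<^sub>C v else 0)
          - of_nat j *\<^sub>C (if int j - 1 + ?i = 0 then of_int (int j - 1) *\<^sub>C v else 0))"
    proof -
      have "lat_D (beta (int j) (beta ?i v)) = beta ?i (lat_D (beta (int j) v))
          + of_nat (Suc i) *\<^sub>C beta (?i - 1) (beta (int j) v)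
          + (if int j + ?i = 0 then - of_int (int j) *\<^sub>C lat_D v else 0)"
        unfolding c[of "int j" ?i v] by (simp add: clinear_simps[OF clinear_lat_D] d del: of_nat_Suc)
      moreover have "beta (int j) (lat_D (beta ?i v)) = beta ?i (beta (int j) (lat_D v))
          + (if int j + ?i = 0 then - of_int (int j) *\<^sub>C lat_D v else 0)
          + of_nat (Suc i) *\<^sub>C (beta (?i - 1) (beta (int j) v)
            + (if int j + (?i - 1) = 0 then - of_int (int j) *\<^sub>C v else 0))"
        unfolding d clinear_add[OF clinear_beta] clinear_scale[OF clinear_beta]
          c[of "int j" ?i] c[of "int j" "?i - 1"] by simp
      moreover have "beta (int j - 1) (beta ?i v) = beta ?i (beta (int j - 1) v)
          + (if int j - 1 + ?i = 0 then - of_int (int j - 1) *\<^sub>C v else 0)"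
        by (rule c)
      ultimately show ?thesis
        unfolding X_def
        by (simp add: clinear_simps[OF clinear_beta] scaleC_simps algebra_simps del: of_nat_Suc)
    qed
    \<comment> \<open>Both central terms occur exactly for j = i + 2, where each is (i + 1)(i + 2)
      v, and they cancel.\<close>
    also have "\<dots> = 0"
    proof (cases "j = i + 2")
      case True
      then show ?thesis
        by (simp add: v clinear_0[OF clinear_beta] scaleC_simps algebra_simps)
    next
      case False
      then have "int j + (?i - 1) \<noteq> 0" "int j - 1 + ?i \<noteq> 0" by linarith+
      then show ?thesis by (simp add: v clinear_0[OF clinear_beta] scaleC_simps)
    qed
    finally show "X j (beta ?i v) = 0" .
  qed
  from this[of "nat j" v] show ?thesis
    using False by (simp add: X_def algebra_simps scaleC_simps add_eq_0_iff2)
qed (rule lat_D_beta_neg)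

text \<open>The commutator of translation with beta(-i)/i is beta(-i - 1), which commutes with the
  exponential of creation operators; so the commutator with the exponent appears as a
  factor.\<close>

lemma lat_D_vexp:
  assumes "nat p \<le> N"
  shows "lat_D (vexp 1 m p v) - vexp 1 m p (lat_D v)
    = of_int m *\<^sub>C (\<Sum>i=1..N. beta (- int i - 1) (vexp 1 m (p - int i) v))"
  using assms
proof (induction p rule: int_less_induct)
  case (neg p)
  then show ?case by (simp add: clinear_0[OF clinear_lat_D] clinear_0[OF clinear_beta] scaleC_simps)
next
  case zero
  then show ?case by (simp add: clinear_0[OF clinear_beta] scaleC_simps)
next
  case (pos p)
  let ?e = "\<lambda>q w. vexp 1 m q w"
  have VD: "of_int q *\<^sub>C ?e q w = of_int m *\<^sub>C (\<Sum>i=1..N. beta (- int i) (?e (q - int i) w))" if "nat q \<le> N" for q w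
    using vexp_deriv[of 1 q N m w] that by simp
  have Db: "lat_D (beta (- int i) w) = beta (- int i) (lat_D w) + of_nat i *\<^sub>C beta (- int i - 1) w" for i w
    using lat_D_beta[of "- int i" w] by (simp add: algebra_simps)
  have bb: "beta (- int i) (beta (- int j - 1) w) = beta (- int j - 1) (beta (- int i) w)" for i j w
    using beta_comm[of "- int i" "- int j - 1" w] by simp
  have "of_int p *\<^sub>C (lat_D (?e p v) - ?e p (lat_D v))
      = lat_D (of_int p *\<^sub>C ?e p v) - of_int p *\<^sub>C ?e p (lat_D v)"
    by (simp add: clinear_scale[OF clinear_lat_D] scaleC_simps)
  also have "\<dots> = of_int m *\<^sub>C (\<Sum>i=1..N. lat_D (beta (- int i) (?e (p - int i) v)) - beta (- int i) (?e (p - int i) (lat_D v)))"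
    unfolding VD[OF pos.prems] clinear_scale[OF clinear_lat_D] clinear_sum[OF clinear_lat_D]
    by (simp add: sum_subtractf scaleC_simps)
  also have "\<dots> = of_int m *\<^sub>C (\<Sum>i=1..N. of_nat i *\<^sub>C beta (- int i - 1) (?e (p - int i) v)
      + beta (- int i) (of_int m *\<^sub>C (\<Sum>j=1..N. beta (- int j - 1) (?e (p - int i - int j) v))))"
  proof (intro arg_cong[of _ _ "\<lambda>x. _ *\<^sub>C x"] sum.cong refl)
    fix i assume i: "i \<in> {1..N}"
    then have "lat_D (?e (p - int i) v) - ?e (p - int i) (lat_D v)
        = of_int m *\<^sub>C (\<Sum>j=1..N. beta (- int j - 1) (?e (p - int i - int j) v))"
      using pos.prems by (intro pos.IH) auto
    then show "lat_D (beta (- int i) (?e (p - int i) v)) - beta (- int i) (?e (p - int i) (lat_D v))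
        = of_nat i *\<^sub>C beta (- int i - 1) (?e (p - int i) v)
          + beta (- int i) (of_int m *\<^sub>C (\<Sum>j=1..N. beta (- int j - 1) (?e (p - int i - int j) v)))"
      unfolding Db by (simp add: clinear_diff[OF clinear_beta, symmetric] add_diff_eq diff_add_eq)
  qed
  also have "\<dots> = of_int m *\<^sub>C (\<Sum>i=1..N. of_nat i *\<^sub>C beta (- int i - 1) (?e (p - int i) v))
      + of_int m *\<^sub>C (\<Sum>j=1..N. beta (- int j - 1) (of_int m *\<^sub>C (\<Sum>i=1..N. beta (- int i) (?e (p - int j - int i) v))))"
  proof -
    have "(\<Sum>i=1..N. beta (- int i) (of_int m *\<^sub>C (\<Sum>j=1..N. beta (- int j - 1) (?e (p - int i - int j) v))))
        = (\<Sum>i=1..N. \<Sum>j=1..N. of_int m *\<^sub>C beta (- int j - 1) (beta (- int i) (?e (p - int i - int j) v)))"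
      by (simp add: clinear_simps[OF clinear_beta] cvec.scale_sum_right bb)
    also have "\<dots> = (\<Sum>j=1..N. \<Sum>i=1..N. of_int m *\<^sub>C beta (- int j - 1) (beta (- int i) (?e (p - int i - int j) v)))"
      by (rule sum.swap)
    also have "\<dots> = (\<Sum>j=1..N. beta (- int j - 1) (of_int m *\<^sub>C (\<Sum>i=1..N. beta (- int i) (?e (p - int j - int i) v))))"
      by (simp add: clinear_simps[OF clinear_beta] cvec.scale_sum_right diff_right_commute)
    finally show ?thesis by (simp only: sum.distrib scaleC_add_right)
  qed
  also have "\<dots> = of_int m *\<^sub>C (\<Sum>i=1..N. of_nat i *\<^sub>C beta (- int i - 1) (?e (p - int i) v))
      + of_int m *\<^sub>C (\<Sum>j=1..N. beta (- int j - 1) (of_int (p - int j) *\<^sub>C ?e (p - int j) v))"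
  proof -
    have "of_int m *\<^sub>C (\<Sum>i=1..N. beta (- int i) (?e (p - int j - int i) v)) = of_int (p - int j) *\<^sub>C ?e (p - int j) v"
      if "j \<in> {1..N}" for j
      using pos.prems that by (intro VD[symmetric]) auto
    then show ?thesis by simp
  qed
  also have "\<dots> = of_int p *\<^sub>C (of_int m *\<^sub>C (\<Sum>i=1..N. beta (- int i - 1) (?e (p - int i) v)))"
    unfolding clinear_scale[OF clinear_beta] cvec.scale_sum_right scaleC_scaleC
      sum.distrib[symmetric] scaleC_add_left[symmetric]
    by (intro sum.cong refl arg_cong2[of _ _ _ _ "(*\<^sub>C)"]) (simp add: algebra_simps)
  finally show ?case
    by (rule scaleC_cancel[rotated]) (use pos(1) in simp)
qed

lemma lat_D_vertex_op:
  "lat_D (vertex_op m k v) - vertex_op m k (lat_D v) = - of_int k *\<^sub>C vertex_op m (k - 1) v"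
proof -
  define X where "X k v = lat_D (vertex_op m k v) - vertex_op m k (lat_D v) + of_int k *\<^sub>C vertex_op m (k - 1) v" for k v
  have "X k v = 0" for k v
  proof (rule lattice_vanish[of X])
    fix k
    show "clinear (X k)"
      unfolding X_def
      by (rule clinearI) (simp_all add: clinear_simps[OF clinear_lat_D] clinear_simps[OF clinear_vertex_op] scaleC_simps algebra_simps)
  next
    fix k r
    let ?p = "m * r - k - 1" and ?s = "m + r"
    let ?\<sigma> = "(- 1) powi (m * r) :: complex"
    let ?e = "\<lambda>q. vexp 1 m q (e_vec ?s)"
    define N where "N = nat ?p"
    let ?S = "of_int m *\<^sub>C (\<Sum>i=1..N. beta (- int i - 1) (?e (?p - int i)))"
    have V: "vertex_op m k (e_vec r) = ?\<sigma> *\<^sub>C ?e ?p" "vertex_op m (k - 1) (e_vec r) = ?\<sigma> *\<^sub>C ?e (?p + 1)"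
      by (simp_all add: vertex_op_e_vec algebra_simps)
    have Vb: "vertex_op m k (beta (- 1) (e_vec r)) = ?\<sigma> *\<^sub>C (beta (- 1) (?e ?p) + of_int m *\<^sub>C ?e (?p + 1))"
      using beta_vertex_op[of "- 1" m k "e_vec r"] V
      by (simp add: clinear_scale[OF clinear_beta] scaleC_simps algebra_simps)
    have bv: "vexp 1 m ?p (beta (- 1) (e_vec ?s)) = beta (- 1) (?e ?p)"
      using beta_vexp[of 1 "- 1" m ?p "e_vec ?s"] by simp
    have D: "lat_D (?e ?p) = of_int ?s *\<^sub>C beta (- 1) (?e ?p) + ?S"
    proof -
      have "lat_D (?e ?p) = vexp 1 m ?p (lat_D (e_vec ?s)) + ?S"
        using lat_D_vexp[of ?p N m "e_vec ?s"] by (simp add: N_def diff_eq_eq add.commute)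
      then show ?thesis by (simp only: lat_D_e_vec clinear_scale[OF clinear_vexp] bv)
    qed
    \<comment> \<open>The recursion for the coefficient of degree \<open>?p + 1\<close>, with the
      summand i = 1 split off. Its right-hand side is what remains of the translate once the terms
      with factor r are collected.\<close>
    have E: "of_int (?p + 1) *\<^sub>C ?e (?p + 1) = of_int m *\<^sub>C beta (- 1) (?e ?p) + ?S"
    proof -
      have c: "- 1 - int i = - int i - 1" for i by simp
      have "of_int (?p + 1) *\<^sub>C ?e (?p + 1)
          = of_int (1 * m) *\<^sub>C (\<Sum>i=1..Suc N. beta (- (1 * int i)) (vexp 1 m (?p + 1 - int i) (e_vec ?s)))"
        by (rule vexp_deriv) (simp_all add: N_def)
      also have "(\<Sum>i=1..Suc N. beta (- (1 * int i)) (vexp 1 m (?p + 1 - int i) (e_vec ?s)))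
          = beta (- 1) (?e ?p) + (\<Sum>i=1..N. beta (- int i - 1) (?e (?p - int i)))"
        by (subst sum.atLeast_Suc_atMost, simp, subst sum.shift_bounds_cl_Suc_ivl) (simp add: algebra_simps c)
      finally show ?thesis by (simp add: scaleC_simps)
    qed
    have "X k (e_vec r) = ?\<sigma> *\<^sub>C (lat_D (?e ?p) - of_int r *\<^sub>C (beta (- 1) (?e ?p) + of_int m *\<^sub>C ?e (?p + 1))
        + of_int k *\<^sub>C ?e (?p + 1))"
      unfolding X_def lat_D_e_vec clinear_scale[OF clinear_vertex_op] V Vb clinear_scale[OF clinear_lat_D]
      by (simp add: scaleC_simps mult_ac)
    also have "lat_D (?e ?p) - of_int r *\<^sub>C (beta (- 1) (?e ?p) + of_int m *\<^sub>C ?e (?p + 1)) + of_int k *\<^sub>C ?e (?p + 1)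
      = (of_int m *\<^sub>C beta (- 1) (?e ?p) + ?S) - of_int (?p + 1) *\<^sub>C ?e (?p + 1)"
      unfolding D by (simp add: scaleC_simps algebra_simps)
    also have "\<dots> = 0" unfolding E by simp
    finally show "X k (e_vec r) = 0" by (simp add: scaleC_simps)
  next
    fix k i v
    assume v: "\<And>y. X y v = 0"
    let ?j = "- int i - 1"
    have V: "vertex_op m k (beta ?j w) = beta ?j (vertex_op m k w) + of_int m *\<^sub>C vertex_op m (k + ?j) w" for k w
      using beta_vertex_op[of ?j m k w] by (simp add: algebra_simps scaleC_simps)
    have V': "vertex_op m k (beta (?j - 1) w) = beta (?j - 1) (vertex_op m k w) + of_int m *\<^sub>C vertex_op m (k + (?j - 1)) w" for k w
      using beta_vertex_op[of "?j - 1" m k w] by (simp add: algebra_simps scaleC_simps)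
    have d: "lat_D (beta ?j w) = beta ?j (lat_D w) - of_int ?j *\<^sub>C beta (?j - 1) w" for w
      using lat_D_beta_neg[of ?j w] by (simp add: algebra_simps)
    have "X k (beta ?j v) = beta ?j (X k v) + of_int m *\<^sub>C X (k + ?j) v"
      unfolding X_def V V' d clinear_add[OF clinear_lat_D] clinear_scale[OF clinear_lat_D]
        clinear_diff[OF clinear_vertex_op] clinear_scale[OF clinear_vertex_op]
      by (simp add: clinear_simps[OF clinear_beta] scaleC_simps algebra_simps)
    then show "X k (beta ?j v) = 0" by (simp only: v clinear_0[OF clinear_beta] cvec.scale_zero_right add_0_right)
  qed
  then show ?thesis by (simp add: X_def algebra_simps eq_neg_iff_add_eq_0)
qed

definition lat_gr :: "bool \<Rightarrow> lattice_space set" where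
  "lat_gr p = cvec.span {basis (\<mu>, m) | \<mu> m. odd m = p}"

lemma lat_gr_eq: "lat_gr p = cvec.span {basis k | k. odd (snd k) = p}"
  unfolding lat_gr_def by (rule arg_cong[of _ _ cvec.span]) auto

lemma subspace_lat_gr: "cvec.subspace (lat_gr p)"
  unfolding lat_gr_def by (rule cvec.subspace_span)

lemma charge_lat_gr: "odd n = p \<Longrightarrow> charge n \<subseteq> lat_gr p"
  unfolding lat_gr_def charge_def by (rule cvec.span_mono) auto

lemma e_vec_lat_gr: "odd n = p \<Longrightarrow> e_vec n \<in> lat_gr p"
  using charge_lat_gr e_vec_charge by blast

lemma beta_lat_gr: "v \<in> lat_gr p \<Longrightarrow> beta j v \<in> lat_gr p"
  unfolding lat_gr_def[of p]
proof (rule clinear_span_map[OF clinear_beta])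
  fix x :: lattice_space assume "x \<in> {basis (\<mu>, m) | \<mu> m. odd m = p}"
  then obtain \<mu> m where x: "x = basis (\<mu>, m)" "odd m = p" by blast
  from subsetD[OF charge_lat_gr[OF x(2)] beta_charge[OF basis_charge]]
  have "beta j x \<in> lat_gr p" unfolding x(1) .
  then show "beta j x \<in> cvec.span {basis (\<mu>, m) | \<mu> m. odd m = p}" by (simp add: lat_gr_def)
qed simp

lemma vertex_op_lat_gr: "v \<in> lat_gr p \<Longrightarrow> vertex_op n k v \<in> lat_gr (odd n \<noteq> p)"
  unfolding lat_gr_def[of p]
proof (rule clinear_span_map[OF clinear_vertex_op _ subspace_lat_gr])
  fix x :: lattice_space assume "x \<in> {basis (\<mu>, m) | \<mu> m. odd m = p}"
  then obtain \<mu> m where x: "x = basis (\<mu>, m)" "odd m = p" by blast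
  then have "odd (n + m) = (odd n \<noteq> p)" by auto
  from subsetD[OF charge_lat_gr[OF this] vertex_op_in_charge[OF basis_charge]]
  show "vertex_op n k x \<in> lat_gr (odd n \<noteq> p)" unfolding x(1) .
qed

abbreviation "lattice_fields \<equiv> {(False, beta)} \<union> {(odd m, vertex_op m) | m. True}"

interpretation lattice: generating_fields lat_gr "e_vec 0" lat_D lattice_fields
  rewrites "generating_fields.V lat_gr (e_vec 0) lattice_fields = lattice_vsa"
proof -
  interpret graded_space lat_gr "e_vec 0" lat_D
  proof (rule graded_space.intro)
    show "lat_gr False \<inter> lat_gr True = {0}"
      using span_basis_inter[of "\<lambda>k :: (nat \<Rightarrow>\<^sub>0 nat) \<times> int. odd (snd k)"] by (simp add: Int_commute lat_gr_eq)
    show "\<exists>u\<in>lat_gr False. \<exists>w\<in>lat_gr True. v = u + w" for v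
      using span_basis_sum[of "\<lambda>k. \<not> odd (snd k)" v] by (simp add: lat_gr_eq)
    show "e_vec 0 \<in> lat_gr False" by (rule e_vec_lat_gr) simp
    show "lat_D (e_vec 0) = 0" by (simp add: lat_D_e_vec)
  qed (rule clinear_lat_D subspace_lat_gr)+
  show "generating_fields lat_gr (e_vec 0) lat_D lattice_fields"
  proof
    fix p A assume "(p, A) \<in> lattice_fields"
    then consider "p = False" "A = beta" | m where "p = odd m" "A = vertex_op m" by blast
    then show "good p A"
    proof cases
      case 1
      have "beta n (e_vec 0) = 0" if "n \<ge> 0" for n
        using that by (cases "n = 0") (simp_all add: beta_e_vec)
      then show ?thesis
        unfolding good_def 1 by (simp add: is_fld_beta beta_lat_gr lat_D_beta)
    next
      case 2
      show ?thesis
        unfolding good_def 2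
        using vertex_op_lat_gr by (simp add: is_fld_vertex_op lat_D_vertex_op vertex_op_e_vec scaleC_simps)
    qed
  next
    fix p A q B assume "(p, A) \<in> lattice_fields" "(q, B) \<in> lattice_fields"
    then consider "p = False" "A = beta" "q = False" "B = beta"
      | n where "p = False" "A = beta" "q = odd n" "B = vertex_op n"
      | m where "p = odd m" "A = vertex_op m" "q = False" "B = beta"
      | m n where "p = odd m" "A = vertex_op m" "q = odd n" "B = vertex_op n" by blast
    then show "mut_local p q A B"
      by cases (simp_all only: beta_local beta_vertex_op_local vertex_op_local mut_local_sym[OF beta_vertex_op_local])
  next
    fix U :: "lattice_space set"
    assume U: "cvec.subspace U" "e_vec 0 \<in> U"
      "\<And>p A n v. (p, A) \<in> lattice_fields \<Longrightarrow> v \<in> U \<Longrightarrow> A n v \<in> U"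
    have "e_vec r \<in> U" for r
    proof -
      have "vertex_op r (- 1) (e_vec 0) \<in> U" by (rule U(3)[OF _ U(2), of "odd r"]) blast
      then show ?thesis by (simp add: vertex_op_e_vec scaleC_simps)
    qed
    moreover have "beta n v \<in> U" if "v \<in> U" for n v by (rule U(3)[OF _ that, of False]) blast
    ultimately have "basis k \<in> U" for k
      by (cases k) (simp add: lattice_basis_induct[of "\<lambda>v. v \<in> U"])
    then show "U = UNIV" by (rule subspace_UNIV_if_basis[OF U(1)])
  qed
  then interpret generating_fields lat_gr "e_vec 0" lat_D lattice_fields .
  show "V = lattice_vsa" unfolding V_def unfolding lattice_vsa_def lat_gr_def[abs_def] ..
qed

interpretation lattice_vsa: based_vsa lattice_vsa
proof
  show "vertex_superalgebra lattice_vsa" "carrier lattice_vsa = UNIV"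
    by (rule lattice.vertex_superalgebra_V lattice.carrier_V)+
  show "basis k \<in> vs_grade lattice_vsa False \<or> basis k \<in> vs_grade lattice_vsa True" for k
  proof -
    have "basis k \<in> lat_gr (odd (snd k))"
      unfolding lat_gr_eq by (rule cvec.span_base) blast
    then show ?thesis by (cases "odd (snd k)") simp_all
  qed
qed

interpretation fml: tensor_vsas "tensor_vsa fermions comm_va" lattice_vsa ..

section \<open>The universal affine vertex algebra\<close>

lemma clinear_abs_affine_vac: "clinear abs_affine_vac"
  by (rule clinearI) (simp_all add: plus_affine_vac.abs_eq scaleC_affine_vac.abs_eq)

lemma abs_affine_vac_eq_0: "abs_affine_vac p = 0 \<longleftrightarrow> p \<in> verma_kernel (- 2)"
  unfolding zero_affine_vac_def affine_vac.abs_eq_iff by simp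

lemma aff_act_abs: "aff_act a (abs_affine_vac p) = abs_affine_vac (lin_ext (\<lambda>w. basis (a # w)) p)"
  by (simp add: aff_act.abs_eq)

lemma affine_vac_exhaust: obtains p where "v = abs_affine_vac p"
  by (induction v rule: affine_vac.abs_induct) blast

lemma lin_ext_scale_fun: "lin_ext (\<lambda>k. c *\<^sub>C f k) v = c *\<^sub>C lin_ext f v"
  by (simp add: lin_ext_def cvec.scale_sum_right scaleC_simps mult.commute)

lemma clinear_aff_act: "clinear (aff_act a)"
proof (rule clinearI)
  fix u v :: affine_vac and c
  obtain p where u: "u = abs_affine_vac p" by (rule affine_vac_exhaust)
  obtain q where v: "v = abs_affine_vac q" by (rule affine_vac_exhaust)
  show "aff_act a (u + v) = aff_act a u + aff_act a v"
    by (simp add: u v aff_act_abs plus_affine_vac.abs_eq lin_ext_add)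
  show "aff_act a (c *\<^sub>C u) = c *\<^sub>C aff_act a u"
    by (simp add: u aff_act_abs scaleC_affine_vac.abs_eq lin_ext_scale)
qed

abbreviation aff_word :: "aff list \<Rightarrow> affine_vac" where
  "aff_word w \<equiv> abs_affine_vac (basis w)"

lemma aff_word_Nil: "aff_word [] = affine_vacuum"
  by (simp add: affine_vacuum_def)

lemma aff_word_Cons: "aff_word (a # w) = aff_act a (aff_word w)"
  by (simp add: aff_act_abs)

lemma aff_word_induct:
  assumes "\<And>w. P (aff_word w)" "\<And>c v. P v \<Longrightarrow> P (c *\<^sub>C v)" "\<And>u v. P u \<Longrightarrow> P v \<Longrightarrow> P (u + v)"
  shows "P v"
proof -
  obtain p where v: "v = abs_affine_vac p" by (rule affine_vac_exhaust)
  have "P (abs_affine_vac p)"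
    by (induction p rule: basis_induct)
      (simp_all add: clinear_simps[OF clinear_abs_affine_vac] assms)
  then show ?thesis by (simp add: v)
qed

lemma aff_act_comm:
  "aff_act a (aff_act b v) - aff_act b (aff_act a v) = lin_ext (\<lambda>c. aff_act c v) (aff_bracket a b)"
proof (induction v rule: aff_word_induct)
  case (1 w)
  let ?q = "basis [a, b] - basis [b, a] - lin_ext (\<lambda>c. basis [c]) (aff_bracket a b)"
  have "lin_ext (\<lambda>r. basis ([] @ r @ w)) ?q \<in> verma_kernel (- 2)"
    unfolding verma_kernel_def by (intro cvec.span_base UnI1) blast
  then have "abs_affine_vac (lin_ext (\<lambda>r. basis (r @ w)) ?q) = 0"
    by (simp add: abs_affine_vac_eq_0)
  moreover have "lin_ext (\<lambda>r. basis (r @ w)) ?q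
      = basis (a # b # w) - basis (b # a # w) - lin_ext (\<lambda>c. basis (c # w)) (aff_bracket a b)"
    by (simp add: lin_ext_diff lin_ext_lin_ext)
  moreover have "abs_affine_vac (lin_ext (\<lambda>c. basis (c # w)) (aff_bracket a b))
      = lin_ext (\<lambda>c. aff_act c (aff_word w)) (aff_bracket a b)"
    by (simp add: lin_ext_def clinear_simps[OF clinear_abs_affine_vac] aff_word_Cons)
  ultimately show ?case
    by (simp add: clinear_simps[OF clinear_abs_affine_vac] aff_word_Cons)
qed (simp_all add: clinear_simps[OF clinear_aff_act] lin_ext_scale_fun add_diff_add
    flip: lin_ext_plus cvec.scale_right_diff_distrib)

lemma aff_act_vacuum: "n \<ge> 0 \<Longrightarrow> aff_act (Loop x n) affine_vacuum = 0"
proof -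
  assume "n \<ge> 0"
  then have "basis ([] @ [Loop x n]) \<in> verma_kernel (- 2)"
    unfolding verma_kernel_def by (intro cvec.span_base UnI1 UnI2) blast
  then have "aff_word [Loop x n] = 0" by (simp add: abs_affine_vac_eq_0)
  then show ?thesis by (simp add: aff_word_Cons aff_word_Nil)
qed

lemma aff_bracket_Central: "aff_bracket a Central = 0"
  by (cases a) simp_all

text \<open>The central letter commutes with every other and can be moved to the right end of a
  word, where it becomes the level.\<close>

lemma aff_act_Central: "aff_act Central v = (- 2) *\<^sub>C v"
proof (induction v rule: aff_word_induct)
  case (1 w)
  show ?case
  proof (induction w)
    case Nil
    have "basis ([] @ [Central]) - (- 2) *\<^sub>C basis [] \<in> verma_kernel (- 2)"
      unfolding verma_kernel_def by (intro cvec.span_base UnI2) blast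
    then have "abs_affine_vac (basis [Central] - (- 2) *\<^sub>C basis []) = 0"
      by (simp add: abs_affine_vac_eq_0)
    then show ?case
      by (simp add: clinear_simps[OF clinear_abs_affine_vac] aff_word_Cons scaleC_simps eq_neg_iff_add_eq_0)
  next
    case (Cons a w)
    have "aff_act Central (aff_act a (aff_word w)) = aff_act a (aff_act Central (aff_word w))"
      using aff_act_comm[of Central a "aff_word w"] by (simp add: aff_bracket_Central)
    then show ?case
      unfolding aff_word_Cons[of a w] Cons by (simp only: clinear_scale[OF clinear_aff_act])
  qed
qed (simp_all add: clinear_simps[OF clinear_aff_act] scaleC_simps mult.commute)

lemma affine_induct [case_names vacuum act scale add]:
  assumes "P affine_vacuum" "\<And>x n v. P v \<Longrightarrow> P (aff_act (Loop x n) v)"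
    "\<And>c v. P v \<Longrightarrow> P (c *\<^sub>C v)" "\<And>u v. P u \<Longrightarrow> P v \<Longrightarrow> P (u + v)"
  shows "P v"
proof (induction v rule: aff_word_induct)
  case (1 w)
  show ?case
  proof (induction w)
    case Nil
    then show ?case using assms(1) by (simp add: aff_word_Nil)
  next
    case (Cons a w)
    show ?case
    proof (cases a)
      case (Loop x n)
      then show ?thesis using assms(2)[OF Cons] by (simp add: aff_word_Cons)
    next
      case Central
      then show ?thesis using assms(3)[OF Cons] by (simp only: aff_word_Cons aff_act_Central)
    qed
  qed
qed (rule assms(3,4), assumption+)+

abbreviation loop_act :: "sl2 \<Rightarrow> int \<Rightarrow> affine_vac \<Rightarrow> affine_vac" where
  "loop_act x n \<equiv> aff_act (Loop x n)"

lemma loop_act_comm: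
  "loop_act x m (loop_act y k v) - loop_act y k (loop_act x m v)
    = lin_ext (\<lambda>z. loop_act z (m + k) v) (sl2_bracket x y)
      + (if m + k = 0 then (- 2 * (of_int m * sl2_form x y)) *\<^sub>C v else 0)"
  unfolding aff_act_comm
  by (simp add: lin_ext_add lin_ext_lin_ext lin_ext_scale aff_act_Central scaleC_simps mult.commute)

text \<open>The value depends on the chosen representative unless \<open>lin_ext f\<close> vanishes on
  \<open>verma_kernel (- 2)\<close>.\<close>

definition affine_lift :: "(aff list \<Rightarrow> 'v::complex_space) \<Rightarrow> affine_vac \<Rightarrow> 'v" where
  "affine_lift f v = lin_ext f (rep_affine_vac v)"

lemma affine_lift_abs:
  assumes "\<And>p. p \<in> verma_kernel (- 2) \<Longrightarrow> lin_ext f p = 0"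
  shows "affine_lift f (abs_affine_vac p) = lin_ext f p"
proof -
  have "rep_affine_vac (abs_affine_vac p) - p \<in> verma_kernel (- 2)"
    using affine_vac.abs_eq_iff[of "rep_affine_vac (abs_affine_vac p)" p]
      Quotient3_abs_rep[OF Quotient3_affine_vac] by simp
  from assms[OF this] show ?thesis by (simp add: affine_lift_def lin_ext_diff)
qed

lemma clinear_affine_lift:
  assumes "\<And>p. p \<in> verma_kernel (- 2) \<Longrightarrow> lin_ext f p = 0"
  shows "clinear (affine_lift f)"
proof (rule clinearI)
  fix u v :: affine_vac and c
  note abs = affine_lift_abs[of f, OF assms]
  obtain p where u: "u = abs_affine_vac p" by (rule affine_vac_exhaust)
  obtain q where v: "v = abs_affine_vac q" by (rule affine_vac_exhaust)
  show "affine_lift f (u + v) = affine_lift f u + affine_lift f v"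
    by (simp add: u v abs plus_affine_vac.abs_eq lin_ext_add)
  show "affine_lift f (c *\<^sub>C u) = c *\<^sub>C affine_lift f u"
    by (simp add: u abs scaleC_affine_vac.abs_eq lin_ext_scale)
qed

text \<open>The kernel is a left ideal. As the property is assumed to pass through prefixed letters,
  the generators have to be considered only with an empty prefix.\<close>

lemma verma_kernel_induct [consumes 1, case_names bracket nonneg central scale add prefix]:
  assumes "p \<in> verma_kernel k"
    and "\<And>a b w. P (lin_ext (\<lambda>r. basis (r @ w))
      (basis [a, b] - basis [b, a] - lin_ext (\<lambda>c. basis [c]) (aff_bracket a b)))"
    and "\<And>x n. n \<ge> 0 \<Longrightarrow> P (basis [Loop x n])"
    and "P (basis [Central] - k *\<^sub>C basis [])"
    and "\<And>c p. P p \<Longrightarrow> P (c *\<^sub>C p)" "\<And>p q. P p \<Longrightarrow> P q \<Longrightarrow> P (p + q)"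
    and "\<And>a p. p \<in> verma_kernel k \<Longrightarrow> P p \<Longrightarrow> P (lin_ext (\<lambda>w. basis (a # w)) p)"
  shows "P p"
  using assms(1) unfolding verma_kernel_def
proof (induction rule: cvec.span_induct_alt)
  case base
  have "P (0 *\<^sub>C (basis [Central] - k *\<^sub>C basis []))" by (intro assms)
  then show ?case by (simp add: scaleC_simps)
next
  case (step c x y)
  have prefix: "lin_ext (\<lambda>w. basis (u @ w)) p \<in> verma_kernel k \<and> P (lin_ext (\<lambda>w. basis (u @ w)) p)"
    if "p \<in> verma_kernel k" "P p" for u p
  proof (induction u)
    case Nil
    then show ?case using that by simp
  next
    case (Cons a u)
    have "lin_ext (\<lambda>w. basis ((a # u) @ w)) p = lin_ext (\<lambda>w. basis (a # w)) (lin_ext (\<lambda>w. basis (u @ w)) p)"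
      by (simp add: lin_ext_lin_ext)
    then show ?case using Cons assms(7) verma_kernel_left_ideal by metis
  qed
  from step.hyps have "P x"
  proof (elim UnE)
    assume "x \<in> {lin_ext (\<lambda>r. basis (u @ r @ w))
        (basis [a, b] - basis [b, a] - lin_ext (\<lambda>c. basis [c]) (aff_bracket a b)) | u a b w. True}"
    then obtain u b d w where x: "x = lin_ext (\<lambda>r. basis (u @ r @ w))
        (basis [b, d] - basis [d, b] - lin_ext (\<lambda>c. basis [c]) (aff_bracket b d))" by blast
    let ?p = "lin_ext (\<lambda>r. basis (r @ w))
        (basis [b, d] - basis [d, b] - lin_ext (\<lambda>c. basis [c]) (aff_bracket b d))"
    have "lin_ext (\<lambda>r. basis ([] @ r @ w))
        (basis [b, d] - basis [d, b] - lin_ext (\<lambda>c. basis [c]) (aff_bracket b d)) \<in> verma_kernel k"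
      unfolding verma_kernel_def by (intro cvec.span_base UnI1) blast
    then have "?p \<in> verma_kernel k" by simp
    from prefix[OF this assms(2), of u] show "P x" by (simp add: x lin_ext_lin_ext)
  next
    assume "x \<in> {basis (u @ [Loop x n]) | u x n. n \<ge> 0}"
    then obtain u z n where x: "x = basis (u @ [Loop z n])" and n: "n \<ge> 0" by blast
    then have "basis ([] @ [Loop z n]) \<in> verma_kernel k"
      unfolding verma_kernel_def by (intro cvec.span_base UnI1 UnI2) blast
    with prefix[of "basis [Loop z n]" u] assms(3)[OF n, of z] show "P x" by (simp add: x)
  next
    assume "x \<in> {basis (u @ [Central]) - k *\<^sub>C basis u | u. True}"
    then obtain u where x: "x = basis (u @ [Central]) - k *\<^sub>C basis u" by blast
    have "basis ([] @ [Central]) - k *\<^sub>C basis [] \<in> verma_kernel k"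
      unfolding verma_kernel_def by (intro cvec.span_base UnI2) blast
    with prefix[of "basis [Central] - k *\<^sub>C basis []" u] assms(4) show "P x"
      by (simp add: x lin_ext_diff lin_ext_scale)
  qed
  then show ?case using step.IH assms(5,6) by blast
qed

subsection \<open>Translation\<close>

text \<open>The action of the commutator of translation with a letter. On loops translation is
  -d/dt.\<close>

fun aff_deriv :: "aff \<Rightarrow> affine_vac \<Rightarrow> affine_vac" where
  "aff_deriv (Loop x n) v = - of_int n *\<^sub>C loop_act x (n - 1) v"
| "aff_deriv Central v = 0"

fun aff_word_D :: "aff list \<Rightarrow> affine_vac" where
  "aff_word_D [] = 0"
| "aff_word_D (a # w) = aff_act a (aff_word_D w) + aff_deriv a (aff_word w)"

lemma clinear_aff_deriv: "clinear (aff_deriv a)"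
proof (cases a)
  case (Loop x n)
  then have "aff_deriv a = (\<lambda>v. - of_int n *\<^sub>C loop_act x (n - 1) v)" by auto
  then show ?thesis by (simp only: clinear_comp[OF clinear_scaleC clinear_aff_act])
qed (simp add: clinear_iff scaleC_simps)

text \<open>In other words, -d/dt is a derivation of the affine Lie algebra; this makes translation
  compatible with the bracket relations that are divided out.\<close>

lemma aff_deriv_comm:
  "(aff_act a (aff_deriv b v) - aff_deriv b (aff_act a v)) + (aff_deriv a (aff_act b v) - aff_act b (aff_deriv a v))
    = lin_ext (\<lambda>c. aff_deriv c v) (aff_bracket a b)"
proof (cases a; cases b)
  fix x m y k assume ab: "a = Loop x m" "b = Loop y k"
  have 1: "aff_act a (aff_deriv b v) - aff_deriv b (aff_act a v)
      = - of_int k *\<^sub>C (loop_act x m (loop_act y (k - 1) v) - loop_act y (k - 1) (loop_act x m v))"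
    by (simp add: ab clinear_simps[OF clinear_aff_act] scaleC_simps)
  have 2: "aff_deriv a (aff_act b v) - aff_act b (aff_deriv a v)
      = - of_int m *\<^sub>C (loop_act x (m - 1) (loop_act y k v) - loop_act y k (loop_act x (m - 1) v))"
    by (simp add: ab clinear_simps[OF clinear_aff_act] scaleC_simps)
  have i: "m + (k - 1) = m + k - 1" "m - 1 + k = m + k - 1" by simp_all
  have aux: "- of_int k *\<^sub>C (L + c1) + - of_int m *\<^sub>C (L + c2) = - of_int (m + k) *\<^sub>C L"
    if "of_int k *\<^sub>C c1 + of_int m *\<^sub>C c2 = 0" for L c1 c2 :: affine_vac
  proof -
    have "- of_int k *\<^sub>C (L + c1) + - of_int m *\<^sub>C (L + c2)
        = - of_int (m + k) *\<^sub>C L - (of_int k *\<^sub>C c1 + of_int m *\<^sub>C c2)"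
      by (simp add: scaleC_simps algebra_simps)
    then show ?thesis by (simp only: that diff_zero)
  qed
  have "lin_ext (\<lambda>c. aff_deriv c v) (aff_bracket a b)
      = - of_int (m + k) *\<^sub>C lin_ext (\<lambda>z. loop_act z (m + k - 1) v) (sl2_bracket x y)"
  proof -
    have "lin_ext (\<lambda>c. aff_deriv c v) (aff_bracket a b)
      = lin_ext (\<lambda>z. - of_int (m + k) *\<^sub>C loop_act z (m + k - 1) v) (sl2_bracket x y)"
      by (simp add: ab lin_ext_add lin_ext_lin_ext lin_ext_scale scaleC_simps)
    then show ?thesis by (simp only: lin_ext_scale_fun)
  qed
  \<comment> \<open>The central terms live on m + k = 1, where k m + m (m - 1) = 0.\<close>
  moreover have "of_int k *\<^sub>C (if m + k - 1 = 0 then (- 2 * (of_int m * sl2_form x y)) *\<^sub>C v else 0)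
      + of_int m *\<^sub>C (if m + k - 1 = 0 then (- 2 * (of_int (m - 1) * sl2_form x y)) *\<^sub>C v else 0) = 0"
  proof (cases "m + k - 1 = 0")
    case True
    then have k: "k = 1 - m" by simp
    have "of_int k * (- 2 * (of_int m * sl2_form x y)) + of_int m * (- 2 * (of_int (m - 1) * sl2_form x y)) = 0"
      unfolding k by (simp add: algebra_simps)
    then show ?thesis
      unfolding if_P[OF True] scaleC_scaleC scaleC_add_left[symmetric] by (simp only: cvec.scale_zero_left)
  qed (simp add: scaleC_simps)
  ultimately show ?thesis
    unfolding 1 2 loop_act_comm i using aux by metis
qed (simp_all add: aff_act_Central clinear_simps[OF clinear_aff_act] clinear_simps[OF clinear_aff_deriv]
    scaleC_simps mult.commute)

lemma aff_word_D_prefix: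
  "lin_ext aff_word_D (lin_ext (\<lambda>w. basis (a # w)) p)
    = aff_act a (lin_ext aff_word_D p) + aff_deriv a (abs_affine_vac p)"
  by (rule clinear_eq_on_keys[where v = p])
    (auto intro!: clinearI simp: lin_ext_add lin_ext_scale clinear_simps[OF clinear_aff_act]
      clinear_simps[OF clinear_aff_deriv] clinear_simps[OF clinear_abs_affine_vac] scaleC_simps)

lemma aff_word_D_kernel:
  assumes "p \<in> verma_kernel (- 2)"
  shows "lin_ext aff_word_D p = 0"
  using assms
proof (induction rule: verma_kernel_induct)
  case (bracket a b w)
  let ?v = "aff_word w" and ?d = "aff_word_D w"
  have "lin_ext aff_word_D (lin_ext (\<lambda>r. basis (r @ w))
      (basis [a, b] - basis [b, a] - lin_ext (\<lambda>c. basis [c]) (aff_bracket a b)))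
    = aff_word_D (a # b # w) - aff_word_D (b # a # w) - lin_ext (\<lambda>c. aff_word_D (c # w)) (aff_bracket a b)"
    by (simp add: lin_ext_diff lin_ext_lin_ext)
  also have "lin_ext (\<lambda>c. aff_word_D (c # w)) (aff_bracket a b)
      = lin_ext (\<lambda>c. aff_act c ?d) (aff_bracket a b) + lin_ext (\<lambda>c. aff_deriv c ?v) (aff_bracket a b)"
    by (simp add: lin_ext_plus)
  also have "aff_word_D (a # b # w) - aff_word_D (b # a # w)
      = (aff_act a (aff_act b ?d) - aff_act b (aff_act a ?d))
        + ((aff_act a (aff_deriv b ?v) - aff_deriv b (aff_act a ?v)) + (aff_deriv a (aff_act b ?v) - aff_act b (aff_deriv a ?v)))"
    by (simp add: aff_word_Cons clinear_add[OF clinear_aff_act])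
  finally show ?case unfolding aff_act_comm aff_deriv_comm by simp
next
  \<comment> \<open>For n = 0 the factor -n vanishes; for n > 0 the mode n - 1 is still nonnegative
    and kills the vacuum.\<close>
  case (nonneg x n)
  then show ?case
    by (cases "n = 0") (simp_all add: aff_word_Nil aff_act_vacuum clinear_0[OF clinear_aff_act] scaleC_simps)
next
  case (prefix a p)
  then have "abs_affine_vac p = 0" by (simp add: abs_affine_vac_eq_0)
  then show ?case
    using prefix by (simp add: aff_word_D_prefix clinear_0[OF clinear_aff_act] clinear_0[OF clinear_aff_deriv])
qed (simp_all add: lin_ext_diff lin_ext_scale lin_ext_add clinear_0[OF clinear_aff_act] scaleC_simps)

definition aff_D :: "affine_vac \<Rightarrow> affine_vac" where
  "aff_D = affine_lift aff_word_D"

lemma clinear_aff_D: "clinear aff_D"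
  unfolding aff_D_def by (rule clinear_affine_lift) (rule aff_word_D_kernel)

lemma aff_D_vacuum: "aff_D affine_vacuum = 0"
  unfolding aff_D_def aff_word_Nil[symmetric] by (simp add: affine_lift_abs aff_word_D_kernel)

lemma aff_D_loop: "aff_D (loop_act x n v) - loop_act x n (aff_D v) = - of_int n *\<^sub>C loop_act x (n - 1) v"
proof -
  note abs = affine_lift_abs[of aff_word_D, OF aff_word_D_kernel]
  obtain p where v: "v = abs_affine_vac p" by (rule affine_vac_exhaust)
  show ?thesis
    by (simp add: v aff_D_def aff_act_abs abs aff_word_D_prefix)
qed

lemma loop_act_trunc: "\<exists>N. \<forall>x. \<forall>n\<ge>N. loop_act x n v = 0"
proof (induction v rule: affine_induct)
  case vacuum
  show ?case by (rule exI[of _ 0]) (simp add: aff_act_vacuum)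
next
  case (act y k v)
  then obtain N where N: "\<And>x n. n \<ge> N \<Longrightarrow> loop_act x n v = 0" by blast
  have "loop_act x n (loop_act y k v) = 0" if "n \<ge> \<bar>N\<bar> + \<bar>k\<bar> + 1" for x n
  proof -
    have "loop_act z (n + k) v = 0" "loop_act z n v = 0" "n + k \<noteq> 0" for z
      using that N by auto
    then show ?thesis
      using loop_act_comm[of x n y k v] by (simp add: clinear_0[OF clinear_aff_act] lin_ext_def scaleC_simps)
  qed
  then show ?case by blast
next
  case (scale c v)
  then show ?case by (auto simp: clinear_scale[OF clinear_aff_act] scaleC_simps)
next
  case (add u v)
  then obtain N M where "\<forall>x. \<forall>n\<ge>N. loop_act x n u = 0" "\<forall>x. \<forall>n\<ge>M. loop_act x n v = 0" by blast
  then have "\<forall>x. \<forall>n\<ge>max N M. loop_act x n (u + v) = 0" by (simp add: clinear_add[OF clinear_aff_act])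
  then show ?case by blast
qed

abbreviation "affine_gr \<equiv> (\<lambda>p. if p then {0} else (UNIV :: affine_vac set))"
abbreviation "affine_fields \<equiv> {(False, \<lambda>n. aff_act (Loop x n)) | x. True}"

interpretation affine: generating_fields affine_gr affine_vacuum aff_D affine_fields
  rewrites "generating_fields.V affine_gr affine_vacuum affine_fields = universal_affine"
proof -
  interpret graded_space affine_gr affine_vacuum aff_D
    by (rule graded_space.intro)
      (use clinear_aff_D aff_D_vacuum in \<open>auto simp: cvec.subspace_UNIV cvec.subspace_single_0\<close>)
  show "generating_fields affine_gr affine_vacuum aff_D affine_fields"
  proof
    fix p A assume "(p, A) \<in> affine_fields"
    then obtain x where A: "p = False" "A = loop_act x" by blast
    have "is_fld A" unfolding is_fld_def A using clinear_aff_act loop_act_trunc by blast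
    then show "good p A"
      by (auto simp: good_def A aff_act_vacuum aff_D_loop clinear_0[OF clinear_aff_act])
  next
    fix p A q B assume "(p, A) \<in> affine_fields" "(q, B) \<in> affine_fields"
    then obtain x y where xy: "p = False" "q = False" "A = loop_act x" "B = loop_act y" by blast
    have eq: "(del ^^ 2) (\<lambda>m k. loop_act x m (loop_act y k v) - koszul False False *\<^sub>C loop_act y k (loop_act x m v)) = (\<lambda>_ _. 0)" for v
    proof -
      have h: "(- 2 * (of_int (m + 1) * sl2_form x y)) *\<^sub>C v - (- 2 * (of_int m * sl2_form x y)) *\<^sub>C v
          = (- 2 * sl2_form x y) *\<^sub>C v" for m
        by (simp only: cvec.scale_left_diff_distrib[symmetric]) (simp add: algebra_simps)
      \<comment> \<open>The first factor z - w removes the bracket term and leaves a multiple of the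
        delta function, which the second factor kills.\<close>
      have "del (\<lambda>m k. loop_act x m (loop_act y k v) - koszul False False *\<^sub>C loop_act y k (loop_act x m v))
        = (\<lambda>m k. if m + k + 1 = 0 then (- 2 * sl2_form x y) *\<^sub>C v else 0)"
      proof (intro ext)
        fix m k :: int
        have i: "m + 1 + k = m + k + 1" "m + (k + 1) = m + k + 1" by simp_all
        show "del (\<lambda>m k. loop_act x m (loop_act y k v) - koszul False False *\<^sub>C loop_act y k (loop_act x m v)) m k
          = (if m + k + 1 = 0 then (- 2 * sl2_form x y) *\<^sub>C v else 0)"
          unfolding del_apply koszul_simps scaleC_one loop_act_comm i using h[of m]
          by (cases "m + k + 1 = 0") (simp_all only: if_True if_False add_diff_add diff_self add_0 refl)
      qed
      then show ?thesis by (simp add: eval_nat_numeral del_def add_ac)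
    qed
    show "mut_local p q A B" unfolding mut_local_def xy by (intro exI[of _ 2] allI) (rule eq)
  next
    fix U :: "affine_vac set"
    assume U: "cvec.subspace U" "affine_vacuum \<in> U"
      "\<And>p A n v. (p, A) \<in> affine_fields \<Longrightarrow> v \<in> U \<Longrightarrow> A n v \<in> U"
    have "v \<in> U" for v
    proof (induction v rule: affine_induct)
      case (act x n v)
      show ?case by (rule U(3)[OF _ act, of False "loop_act x"]) blast
    qed (use U cvec.subspace_add cvec.subspace_scale in blast)+
    then show "U = UNIV" by blast
  qed
  then interpret generating_fields affine_gr affine_vacuum aff_D affine_fields .
  show "V = universal_affine" unfolding V_def universal_affine_def ..
qed

subsection \<open>The universal property\<close>

locale affine_rep = full_vsa W for W :: "'w::complex_space vsa" +
  fixes X :: "sl2 \<Rightarrow> 'w"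
  assumes X_even: "X x \<in> gr False"
    and X_comm: "Y (X x) m (Y (X y) k v) - Y (X y) k (Y (X x) m v)
      = lin_ext (\<lambda>z. Y (X z) (m + k) v) (sl2_bracket x y)
        + (if m + k = 0 then (- 2 * (of_int m * sl2_form x y)) *\<^sub>C v else 0)"
begin

fun rep :: "aff \<Rightarrow> 'w \<Rightarrow> 'w" where
  "rep (Loop x n) v = Y (X x) n v"
| "rep Central v = (- 2) *\<^sub>C v"

lemma clinear_rep: "clinear (rep a)"
proof (cases a)
  case (Loop x n)
  then have "rep a = Y (X x) n" by auto
  then show ?thesis using Y_right by simp
next
  case Central
  then have "rep a = (\<lambda>v. (- 2) *\<^sub>C v)" by auto
  then show ?thesis by (simp only: clinear_scaleC)
qed

lemma rep_comm: "rep a (rep b v) - rep b (rep a v) = lin_ext (\<lambda>c. rep c v) (aff_bracket a b)"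
proof (cases a; cases b)
  fix x m y k assume "a = Loop x m" "b = Loop y k"
  then show ?thesis
    using X_comm[of x m y k v]
    by (simp add: lin_ext_add lin_ext_lin_ext lin_ext_scale scaleC_simps mult.commute)
qed (simp_all add: clinear_simps[OF Y_right] scaleC_simps)

abbreviation rep_word :: "aff list \<Rightarrow> 'w" where
  "rep_word w \<equiv> foldr rep w vac"

lemma rep_word_prefix: "lin_ext rep_word (lin_ext (\<lambda>w. basis (a # w)) p) = rep a (lin_ext rep_word p)"
  by (rule clinear_eq_on_keys[where v = p])
    (auto intro!: clinearI simp: lin_ext_add lin_ext_scale clinear_simps[OF clinear_rep])

lemma rep_word_kernel: "p \<in> verma_kernel (- 2) \<Longrightarrow> lin_ext rep_word p = 0"
proof (induction rule: verma_kernel_induct)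
  case (bracket a b w)
  show ?case
    using rep_comm[of a b "rep_word w"] by (simp add: lin_ext_diff lin_ext_lin_ext)
next
  case (nonneg x n)
  then show ?case by (simp add: Y_vac)
next
  case (prefix a p)
  then show ?case by (simp only: rep_word_prefix clinear_0[OF clinear_rep])
qed (simp_all add: lin_ext_diff lin_ext_scale lin_ext_add scaleC_simps)

definition hom :: "affine_vac \<Rightarrow> 'w" where
  "hom = affine_lift rep_word"

lemma clinear_hom: "clinear hom"
  unfolding hom_def by (rule clinear_affine_lift) (rule rep_word_kernel)

lemma hom_vacuum: "hom affine_vacuum = vac"
  unfolding hom_def aff_word_Nil[symmetric] by (simp add: affine_lift_abs rep_word_kernel)

lemma hom_loop: "hom (loop_act x n v) = Y (X x) n (hom v)"
proof -
  note abs = affine_lift_abs[of rep_word, OF rep_word_kernel]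
  obtain p where v: "v = abs_affine_vac p" by (rule affine_vac_exhaust)
  show ?thesis
    by (simp add: v hom_def aff_act_abs abs rep_word_prefix)
qed

text \<open>Compatibility with the action of x(n) holds by construction; this induction extends it
  to all generated fields. A linear map commutes with the residue that defines an n-th product, and
  \<open>Y_prod\<close> identifies the result in W.\<close>

lemma hom_gen_fld:
  "gen_fld affine_fields p A \<Longrightarrow> hom (A (- 1) affine_vacuum) \<in> gr p \<and>
    (\<forall>n v. hom (A n v) = Y (hom (A (- 1) affine_vacuum)) n (hom v))"
proof (induction rule: gen_fld.induct)
  case (generator p A)
  then obtain x where "p = False" "A = loop_act x" by blast
  then show ?case by (simp add: hom_loop hom_vacuum Y_vac X_even)
next
  case identity
  then show ?case by (simp add: hom_vacuum Y_vac_left clinear_0[OF clinear_hom] vac_even)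
next
  case (zero p)
  then show ?case
    by (simp add: clinear_0[OF clinear_hom] clinear_0[OF Y_left] cvec.subspace_0[OF gr_subspace])
next
  case (add p A B)
  let ?a = "hom (A (- 1) affine_vacuum)" and ?b = "hom (B (- 1) affine_vacuum)"
  have ab: "?a \<in> gr p" "?b \<in> gr p"
    and A: "\<And>n v. hom (A n v) = Y ?a n (hom v)" and B: "\<And>n v. hom (B n v) = Y ?b n (hom v)"
    using add.IH by blast+
  have main: "hom (A n v + B n v) = Y (?a + ?b) n (hom v)" for n v
    by (simp only: clinear_add[OF clinear_hom] clinear_add[OF Y_left] A[of n v] B[of n v])
  show ?case
    unfolding clinear_add[OF clinear_hom, of "A (- 1) affine_vacuum"]
    by (intro conjI allI main cvec.subspace_add[OF gr_subspace ab])
next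
  case (scale p A c)
  let ?a = "hom (A (- 1) affine_vacuum)"
  have a: "?a \<in> gr p" and A: "\<And>n v. hom (A n v) = Y ?a n (hom v)"
    using scale.IH by blast+
  have main: "hom (c *\<^sub>C A n v) = Y (c *\<^sub>C ?a) n (hom v)" for n v
    by (simp only: clinear_scale[OF clinear_hom] clinear_scale[OF Y_left] A[of n v])
  show ?case
    unfolding clinear_scale[OF clinear_hom, of c "A (- 1) affine_vacuum"]
    by (intro conjI allI main cvec.subspace_scale[OF gr_subspace a])
next
  case (prod p A q B n)
  let ?a = "hom (A (- 1) affine_vacuum)" and ?b = "hom (B (- 1) affine_vacuum)"
  have a: "?a \<in> gr p" and b: "?b \<in> gr q"
    and A: "\<And>n v. hom (A n v) = Y ?a n (hom v)" and B: "\<And>n v. hom (B n v) = Y ?b n (hom v)"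
    using prod.IH by blast+
  have "is_fld A" by (rule affine.good_fld[OF affine.gen_good[OF prod.hyps(1)]])
  have "is_fld B" by (rule affine.good_fld[OF affine.gen_good[OF prod.hyps(2)]])
  have main: "hom (fld_prod p q A n B m v) = Y (Y ?a n ?b) m (hom v)" for m v
  proof -
    obtain K where K: "trunc K (\<lambda>m k. A m (B k v)) (\<lambda>m k. koszul p q *\<^sub>C B k (A m v))"
      using fld_prod_trunc[OF \<open>is_fld A\<close> \<open>is_fld B\<close>] by blast
    show ?thesis
      unfolding Y_prod[OF a b] fld_prod_eq_res
        res_clinear[OF K clinear_hom, symmetric]
      unfolding clinear_scale[OF clinear_hom]
      by (intro arg_cong2[of _ _ _ _ "\<lambda>P Q. res n P Q m"] ext) (metis A B)+
  qed
  have "hom (fld_prod p q A n B (- 1) affine_vacuum) = Y ?a n ?b"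
    by (simp add: main hom_vacuum Y_vac)
  then show ?case using main Y_gr[OF a b] by simp
qed

lemma hom_prod: "hom (vs_prod universal_affine a n b) = Y (hom a) n (hom b)" and hom_even: "hom a \<in> gr False"
proof -
  have "gen_fld affine_fields False (vs_prod universal_affine a)" by (rule affine.gr_gen) simp
  from hom_gen_fld[OF this] show "hom (vs_prod universal_affine a n b) = Y (hom a) n (hom b)" "hom a \<in> gr False"
    by (simp_all add: affine.Y_vac)
qed

lemma hom_generator: "hom (loop_act x (- 1) affine_vacuum) = X x"
  by (simp add: hom_loop hom_vacuum Y_vac)

lemma affine_generator: "vs_prod universal_affine (loop_act x (- 1) affine_vacuum) n = loop_act x n"
  using affine.Y_generator[of False "loop_act x"] by (simp add: fun_eq_iff) blast

text \<open>The map is constructed into the large algebra; its image lies in any subalgebra that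
  contains the images of the generators, so the target can be cut down afterwards.\<close>

theorem vsa_hom_hom:
  assumes U: "cvec.subspace U" "vac \<in> U" "\<And>a b n. a \<in> U \<Longrightarrow> b \<in> U \<Longrightarrow> Y a n b \<in> U" "\<And>x. X x \<in> U"
  shows "vsa_hom universal_affine (restrict_vsa W U) hom"
proof -
  have mem: "hom v \<in> U" for v
  proof (induction v rule: affine_induct)
    case vacuum
    then show ?case using U(2) by (simp add: hom_vacuum)
  next
    case (act x n v)
    then show ?case using U(3,4) by (simp add: hom_loop)
  qed (simp_all add: clinear_simps[OF clinear_hom] cvec.subspace_add[OF U(1)] cvec.subspace_scale[OF U(1)])
  have z: "0 \<in> gr True \<inter> U"
    using cvec.subspace_0[OF U(1)] cvec.subspace_0[OF gr_subspace] by blast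
  show ?thesis
    unfolding vsa_hom_def
    using affine.vertex_superalgebra_V restrict_vertex_superalgebra[OF U(1-3)] mem hom_even z
    by (simp add: restrict_vsa_def hom_prod hom_vacuum clinear_simps[OF clinear_hom])
qed

text \<open>The modes of the generators, applied repeatedly to the vacuum, span the source, and a
  homomorphism commutes with them.\<close>

theorem vsa_hom_unique:
  assumes "vsa_hom universal_affine (restrict_vsa W U) g"
    and "\<And>x. g (loop_act x (- 1) affine_vacuum) = X x"
  shows "g v = hom v"
proof -
  have comb: "g (c *\<^sub>C a + b) = c *\<^sub>C g a + g b" and vac: "g affine_vacuum = vac"
    and prod: "g (vs_prod universal_affine a n b) = Y (g a) n (g b)" for a b c n
    using assms(1) unfolding vsa_hom_def by (simp_all add: affine.carrier_V restrict_vsa_def)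
  have add: "g (a + b) = g a + g b" for a b using comb[of 1 a b] by (simp add: scaleC_one)
  have "g 0 = 0" using add[of 0 0] by simp
  then have scale: "g (c *\<^sub>C a) = c *\<^sub>C g a" for c a using comb[of c a 0] by simp
  show ?thesis
  proof (induction v rule: affine_induct)
    case vacuum
    show ?case by (simp add: vac hom_vacuum)
  next
    case (act x n v)
    then show ?case
      using prod[of "loop_act x (- 1) affine_vacuum" n v] by (simp add: affine_generator assms(2) hom_loop)
  qed (simp_all add: add scale clinear_simps[OF clinear_hom])
qed

end

section \<open>Commutators from operator products\<close>

context full_vsa
begin

text \<open>The field of the translate is the derivative of Y(a,z). This is \<open>Y_prod\<close>
  with the vacuum as second factor, where the coefficients (-1)^j binom(-2, j) are j + 1.\<close>

lemma Y_translate: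
  assumes a: "a \<in> gr p"
  shows "Y (Y a (- 2) vac) n v = - of_int n *\<^sub>C Y a (n - 1) v"
proof -
  have c: "(- 1) ^ j * ((- 2 :: complex) gchoose j) = of_nat j + 1" for j
    using gbinomial_minus[of "2 :: complex" j] gbinomial_of_nat_symmetric[of j "j + 1", where ?'a = complex]
    by (simp add: add.commute flip: power_add mult_2)
  have "Y (Y a (- 2) vac) n v
      = Sum_any (\<lambda>j::nat. (of_nat j + 1) *\<^sub>C
        ((if n + int j = - 1 then Y a (n - 1) v else 0) - (if n - int j = 1 then Y a (n - 1) v else 0)))"
    unfolding Y_prod[OF a vac_even] fld_prod_def
    by (intro Sum_any.cong) (auto simp: c Y_vac_left clinear_0[OF Y_right] intro!: arg_cong[of _ _ "\<lambda>k. Y a k v"])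
  \<comment> \<open>At most one j contributes: -1 - n for negative n and n - 1 for positive n. For n
    = 0 there is none; the index then defaults to 0, with the value 0.\<close>
  also have "\<dots> = Sum_any (\<lambda>j::nat. if j = nat (if n < 0 then - 1 - n else n - 1) then - of_int n *\<^sub>C Y a (n - 1) v else 0)"
    by (intro Sum_any.cong) (auto simp: scaleC_simps split: if_splits)
  finally show ?thesis by simp
qed

text \<open>The commutator formula reduces to j = 0 and j = 1 when poles have order at most two; the
  scalar coefficient of the double pole becomes the central term.\<close>

lemma Y_commutator_affine:
  assumes a: "a \<in> gr False" and b: "b \<in> gr False"
    and 0: "Y a 0 b = c" and 1: "Y a 1 b = \<kappa> *\<^sub>C vac" and 2: "\<forall>n\<ge>2. Y a n b = 0"
  shows "Y a m (Y b k v) - Y b k (Y a m v) = Y c (m + k) v + (if m + k = 0 then (of_int m * \<kappa>) *\<^sub>C v else 0)"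
proof -
  obtain N where N: "\<And>M m k v. M \<ge> N \<Longrightarrow> Y a m (Y b k v) - koszul False False *\<^sub>C Y b k (Y a m v)
      = (\<Sum>j<M. (of_int m gchoose j) *\<^sub>C Y (Y a (int j) b) (m + k - int j) v)"
    using Y_commutator[OF a b] by blast
  have "Y a m (Y b k v) - Y b k (Y a m v)
      = (\<Sum>j<N + 2. (of_int m gchoose j) *\<^sub>C Y (Y a (int j) b) (m + k - int j) v)"
    using N[of "N + 2" m k v] by (simp add: scaleC_one)
  also have "\<dots> = (\<Sum>j<2. (of_int m gchoose j) *\<^sub>C Y (Y a (int j) b) (m + k - int j) v)"
    by (rule sum.mono_neutral_right) (auto simp: 2 clinear_0[OF Y_left] scaleC_simps)
  finally show ?thesis
    by (simp add: 0 1 numeral_2_eq_2 clinear_scale[OF Y_left] Y_vac_left scaleC_simps)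
qed

end

lemma sl2_bracket_antisym: "sl2_bracket y x = - sl2_bracket x y"
  by (cases x; cases y) simp_all

lemma sl2_form_sym: "sl2_form y x = sl2_form x y"
  by (cases x; cases y) simp_all

text \<open>Antisymmetry of the bracket and symmetry of the form give the reversed pairs, so six of
  the nine operator products suffice.\<close>

lemma (in full_vsa) affine_repI:
  assumes even: "\<And>x. X x \<in> gr False"
    and ope: "\<And>x y. (x, y) \<in> {(E, E), (F, F), (H, H), (E, F), (H, E), (H, F)} \<Longrightarrow>
      Y (X x) 0 (X y) = lin_ext X (sl2_bracket x y) \<and>
      Y (X x) 1 (X y) = (- 2 * sl2_form x y) *\<^sub>C vac \<and> (\<forall>n\<ge>2. Y (X x) n (X y) = 0)"
  shows "affine_rep V X"
proof
  show "X x \<in> gr False" for x by (rule even)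
  let ?C = "\<lambda>x y. \<forall>m k v. Y (X x) m (Y (X y) k v) - Y (X y) k (Y (X x) m v)
      = lin_ext (\<lambda>z. Y (X z) (m + k) v) (sl2_bracket x y)
        + (if m + k = 0 then (- 2 * (of_int m * sl2_form x y)) *\<^sub>C v else 0)"
  have direct: "?C x y" if "(x, y) \<in> {(E, E), (F, F), (H, H), (E, F), (H, E), (H, F)}" for x y
  proof (intro allI)
    fix m k v
    have lin: "Y (lin_ext X w) n v = lin_ext (\<lambda>z. Y (X z) n v) w" for w n
      by (rule clinear_eq_on_keys[where v = w])
        (auto intro: clinear_comp[OF Y_left clinear_lin_ext] clinear_lin_ext)
    from ope[OF that] have o: "Y (X x) 0 (X y) = lin_ext X (sl2_bracket x y)"
      "Y (X x) 1 (X y) = (- 2 * sl2_form x y) *\<^sub>C vac" "\<forall>n\<ge>2. Y (X x) n (X y) = 0"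
      by blast+
    show "Y (X x) m (Y (X y) k v) - Y (X y) k (Y (X x) m v)
      = lin_ext (\<lambda>z. Y (X z) (m + k) v) (sl2_bracket x y)
        + (if m + k = 0 then (- 2 * (of_int m * sl2_form x y)) *\<^sub>C v else 0)"
      unfolding Y_commutator_affine[OF even even o] lin by (simp add: mult.left_commute)
  qed
  have reverse: "?C y x" if "?C x y" for x y
  proof (intro allI)
    fix m k v
    have 1: "lin_ext (\<lambda>z. Y (X z) n v) (- w) = - lin_ext (\<lambda>z. Y (X z) n v) w" for n w
      by (rule clinear_minus[OF clinear_lin_ext])
    have "Y (X y) m (Y (X x) k v) - Y (X x) k (Y (X y) m v)
        = - (Y (X x) k (Y (X y) m v) - Y (X y) m (Y (X x) k v))" by simp
    also have "\<dots> = - (lin_ext (\<lambda>z. Y (X z) (k + m) v) (sl2_bracket x y)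
        + (if k + m = 0 then (- 2 * (of_int k * sl2_form x y)) *\<^sub>C v else 0))"
      by (simp only: that[rule_format])
    also have "\<dots> = lin_ext (\<lambda>z. Y (X z) (m + k) v) (sl2_bracket y x)
        + (if m + k = 0 then (- 2 * (of_int m * sl2_form y x)) *\<^sub>C v else 0)"
    proof -
      have "- ((- 2 * (of_int k * sl2_form x y)) *\<^sub>C v) = (- 2 * (of_int m * sl2_form x y)) *\<^sub>C v" if "m + k = 0"
      proof -
        have k: "k = - m" using that by simp
        show ?thesis unfolding k by (simp add: scaleC_simps)
      qed
      then show ?thesis
        unfolding sl2_bracket_antisym[of y x] sl2_form_sym[of y x] 1 add.commute[of k m] minus_add_distrib
        by (simp only: minus_zero split: if_split) simp
    qed
    finally show "Y (X y) m (Y (X x) k v) - Y (X x) k (Y (X y) m v)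
      = lin_ext (\<lambda>z. Y (X z) (m + k) v) (sl2_bracket y x)
        + (if m + k = 0 then (- 2 * (of_int m * sl2_form y x)) *\<^sub>C v else 0)" .
  qed
  show "Y (X x) m (Y (X y) k v) - Y (X y) k (Y (X x) m v)
      = lin_ext (\<lambda>z. Y (X z) (m + k) v) (sl2_bracket x y)
        + (if m + k = 0 then (- 2 * (of_int m * sl2_form x y)) *\<^sub>C v else 0)" for x y m k v
  proof -
    have "(x, y) \<in> {(E, E), (F, F), (H, H), (E, F), (H, E), (H, F)}
      \<or> (y, x) \<in> {(E, E), (F, F), (H, H), (E, F), (H, E), (H, F)}"
      by (cases x; cases y) simp_all
    then have "?C x y"
    proof
      assume "(y, x) \<in> {(E, E), (F, F), (H, H), (E, F), (H, E), (H, F)}"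
      from reverse[OF direct[OF this]] show ?thesis .
    qed (rule direct)
    then show ?thesis by blast
  qed
qed

lemma (in affine_rep) X_E_not_scalar: "vac \<noteq> 0 \<Longrightarrow> X E \<notin> cvec.span {vac}"
proof
  assume vac: "vac \<noteq> 0" and "X E \<in> cvec.span {vac}"
  then obtain c where c: "X E = c *\<^sub>C vac" by (auto simp: cvec.span_singleton)
  have "2 *\<^sub>C X E = Y (X H) 0 (X E)"
    using X_comm[of H 0 E "- 1" vac] by (simp add: Y_vac clinear_0[OF Y_right] lin_ext_scale)
  also have "\<dots> = 0" by (simp add: c clinear_scale[OF Y_right] Y_vac)
  finally have "X E = 0" by simp
  then show False
    using X_comm[of E 1 F "- 1" vac] vac
    by (simp add: Y_vac clinear_0[OF Y_right] clinear_0[OF Y_left])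
qed

section \<open>Operator products in the three factors\<close>

lemma fermions_psi: "vs_prod fermions (psi s (- 1) fermi_vac) = psi s"
  by (rule fermions.Y_generator[where p = True]) blast

lemma fermi_vac_gr: "fermi_vac \<in> vs_grade fermions False"
  using fermions_vsa.vac_even by simp

lemma psi_vac_gr: "psi s n fermi_vac \<in> vs_grade fermions True"
  using psi_gr[OF fermi_vac_gr[simplified], of s n] by simp

text \<open>The state \<open>psi s (- 2) fermi_vac\<close> is the translate of the generating state,
  so its field is the derivative.\<close>

lemma fermions_psi_deriv: "vs_prod fermions (psi s (- 2) fermi_vac) n v = - of_int n *\<^sub>C psi s (n - 1) v"
proof -
  have "psi s (- 2) fermi_vac = vs_prod fermions (psi s (- 1) fermi_vac) (- 2) (vs_vac fermions)"
    by (simp add: fermions_psi)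
  then show ?thesis
    using fermions_vsa.Y_translate[OF psi_vac_gr, of s "- 1" n v] by (simp add: fermions_psi)
qed

lemma psi_psi_vac: "n \<ge> 0 \<Longrightarrow> psi s n (psi t m fermi_vac) = (if s \<noteq> t \<and> n + m = - 1 then fermi_vac else 0)"
  using psi_anticommutator[of s n t m fermi_vac] by (simp add: psi_vacuum clinear_0[OF clinear_psi])

lemma comm_va_gam: "vs_prod comm_va (gam s (- 1)) n v = gam s n * v"
proof -
  have "vs_prod comm_va (gam s (- 1) * 1) = (\<lambda>n v. gam s n * v)"
    by (rule comm_va.Y_generator[where p = False and A = "\<lambda>n v. gam s n * v"]) blast
  then show ?thesis by simp
qed

lemma gam_nonneg: "n \<ge> 0 \<Longrightarrow> gam s n = 0"
  by (simp add: gam_def)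

lemma lattice_beta: "vs_prod lattice_vsa (beta (- 1) (e_vec 0)) = beta"
  by (rule lattice.Y_generator[where p = False]) blast

lemma lattice_e_vec: "vs_prod lattice_vsa (e_vec m) = vertex_op m"
proof -
  have "vs_prod lattice_vsa (vertex_op m (- 1) (e_vec 0)) = vertex_op m"
    by (rule lattice.Y_generator[where p = "odd m"]) blast
  then show ?thesis by (simp add: vertex_op_e_vec scaleC_simps)
qed

section \<open>Operator products in \<open>F \<otimes> M(0)\<close>\<close>

lemma (in tensor_vsas) tsum_vac_right_factor: "tsum u W.vac n u' w' = V.Y u n u' \<otimes> w'"
proof -
  have "tsum u W.vac n u' w' = Sum_any (\<lambda>i. if i = n then V.Y u n u' \<otimes> w' else 0)"
    unfolding tsum_def by (intro Sum_any.cong) (auto simp: W.Y_vac_left tens_simps)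
  then show ?thesis by simp
qed

lemma (in tensor_vsas) tsum_vac_left_factor: "tsum V.vac w n u' w' = u' \<otimes> W.Y w n w'"
proof -
  have "tsum V.vac w n u' w' = Sum_any (\<lambda>i::int. if i = - 1 then u' \<otimes> W.Y w n w' else 0)"
    unfolding tsum_def by (intro Sum_any.cong) (auto simp: V.Y_vac_left tens_simps)
  then show ?thesis by simp
qed

lemma comm_gr [simp]: "v \<in> vs_grade comm_va False" by simp

abbreviation fm_Y :: "fm_space \<Rightarrow> fm_space fld" where
  "fm_Y \<equiv> vs_prod (tensor_vsa fermions comm_va)"

abbreviation fm_vac :: fm_space where
  "fm_vac \<equiv> fermi_vac \<otimes> 1"

lemma tau_gr: "tau s \<in> vs_grade (tensor_vsa fermions comm_va) True"
  unfolding tau_def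
  by (intro cvec.subspace_add[OF fm.X.gr_subspace] fm.tens_gr'[OF psi_vac_gr comm_gr]) simp_all

lemma j_vec_gr: "j_vec \<in> vs_grade (tensor_vsa fermions comm_va) False"
  unfolding j_vec_def by (intro fm.tens_gr'[OF fermi_vac_gr comm_gr]) simp

lemma fm_Z: "fm_Y (u \<otimes> w) n (psi t m fermi_vac \<otimes> w') = fm.tsum u w n (psi t m fermi_vac) w'"
  using fm.Z_tens[OF comm_gr psi_vac_gr] by (simp add: scaleC_one)

text \<open>The modes \<open>gam s i\<close> vanish for nonnegative i, so only fermionic modes from
  \<open>n\<close> on can enter, and the hypothesis leaves a single one. If \<open>k < n\<close>,
  both sides are 0.\<close>

lemma tsum_psi_gam:
  assumes "\<forall>i\<ge>n. i \<noteq> k \<longrightarrow> psi s i v = 0"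
  shows "fm.tsum (psi s (- 1) fermi_vac) (gam s (- 1)) n v w = psi s k v \<otimes> (gam s (n - 1 - k) * w)"
proof -
  have "fm.tsum (psi s (- 1) fermi_vac) (gam s (- 1)) n v w
      = Sum_any (\<lambda>i. if i = k then psi s k v \<otimes> (gam s (n - 1 - k) * w) else 0)"
    unfolding fm.tsum_def
  proof (intro Sum_any.cong)
    fix i
    show "vs_prod fermions (psi s (- 1) fermi_vac) i v \<otimes> vs_prod comm_va (gam s (- 1)) (n - 1 - i) w
      = (if i = k then psi s k v \<otimes> (gam s (n - 1 - k) * w) else 0)"
      using assms by (cases "i \<ge> n") (auto simp: fermions_psi comm_va_gam gam_nonneg tens_simps)
  qed
  then show ?thesis by simp
qed

text \<open>Each of the two fermionic states in \<open>tau t\<close> has its own surviving mode,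
  \<open>k\<close> and \<open>l\<close>. The factor -n comes from the derivative in the first
  summand of \<open>tau s\<close>.\<close>

lemma tau_tau_expand:
  assumes "\<forall>i\<ge>n. i \<noteq> k \<longrightarrow> psi s i (psi t (- 2) fermi_vac) = 0"
    and "\<forall>i\<ge>n. i \<noteq> l \<longrightarrow> psi s i (psi t (- 1) fermi_vac) = 0"
  shows "fm_Y (tau s) n (tau t)
    = - of_int n *\<^sub>C (psi s (n - 1) (psi t (- 2) fermi_vac) \<otimes> 1
        + psi s (n - 1) (psi t (- 1) fermi_vac) \<otimes> gam t (- 1))
      + psi s k (psi t (- 2) fermi_vac) \<otimes> gam s (n - 1 - k)
      + psi s l (psi t (- 1) fermi_vac) \<otimes> (gam s (n - 1 - l) * gam t (- 1))"
proof -
  have vac: "(1 :: comm_poly) = vs_vac comm_va" by simp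
  have A: "fm_Y (psi s (- 2) fermi_vac \<otimes> 1) n (psi t m fermi_vac \<otimes> w)
      = - of_int n *\<^sub>C (psi s (n - 1) (psi t m fermi_vac) \<otimes> w)" for m w
    unfolding fm_Z vac fm.tsum_vac_right_factor fermions_psi_deriv by (simp add: tens_simps)
  show ?thesis
    unfolding tau_def clinear_add[OF fm.Z_left] clinear_add[OF fm.Z_right] A
    unfolding fm_Z tsum_psi_gam[OF assms(1)] tsum_psi_gam[OF assms(2)]
    by (simp add: scaleC_simps)
qed

text \<open>The delicate case is n = -1: the derivative part contributes psi(-2) psi(-1) and the
  part with gamma contributes psi(-1) psi(-2), both tensored with \<open>gam s (- 1)\<close>, and
  these cancel by anticommutation.\<close>

lemma tau_tau_same:
  assumes "n \<ge> - 1" shows "fm_Y (tau s) n (tau s) = 0"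
proof -
  have p: "psi s i (psi s m fermi_vac) = 0" if "i \<ge> 0 \<or> i = m" for i m
  proof -
    have "psi s m (psi s m fermi_vac) + psi s m (psi s m fermi_vac) = 0"
      using psi_anticommutator[of s m s m fermi_vac] by simp
    then have "2 *\<^sub>C psi s m (psi s m fermi_vac) = 0" by (simp add: scaleC_add_left[of 1 1, simplified] scaleC_one)
    then show ?thesis using that psi_psi_vac[of i s s m] by auto
  qed
  have q: "psi s (- 1) (psi s (- 2) fermi_vac) = - psi s (- 2) (psi s (- 1) fermi_vac)"
    using psi_anticommutator[of s "- 1" s "- 2" fermi_vac] by (simp add: eq_neg_iff_add_eq_0)
  have "fm_Y (tau s) n (tau s)
    = - of_int n *\<^sub>C (psi s (n - 1) (psi s (- 2) fermi_vac) \<otimes> 1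
        + psi s (n - 1) (psi s (- 1) fermi_vac) \<otimes> gam s (- 1))
      + psi s (- 1) (psi s (- 2) fermi_vac) \<otimes> gam s (n - 1 - - 1)
      + psi s (- 1) (psi s (- 1) fermi_vac) \<otimes> (gam s (n - 1 - - 1) * gam s (- 1))"
    by (rule tau_tau_expand) (use assms p in auto)
  moreover have "n = - 1 \<or> n = 0 \<or> n \<ge> 1" using assms by linarith
  ultimately show ?thesis
    by (elim disjE) (simp_all add: p q gam_nonneg tens_simps scaleC_simps)
qed

text \<open>For n = 1 the derivative part gives minus \<open>gam (\<not> s) (- 1)\<close> and the
  part with gamma gives \<open>gam s (- 1)\<close>, together plus or minus 2 j. For n = 2 the
  derivative factor -n is the -2 that becomes the level.\<close>

lemma tau_tau_opposite:
  assumes "n \<ge> 1"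
  shows "fm_Y (tau s) n (tau (\<not> s))
    = (if n = 1 then (if s then 2 else - 2) *\<^sub>C j_vec else if n = 2 then - 2 *\<^sub>C fm_vac else 0)"
proof -
  have "fm_Y (tau s) n (tau (\<not> s))
    = - of_int n *\<^sub>C (psi s (n - 1) (psi (\<not> s) (- 2) fermi_vac) \<otimes> 1
        + psi s (n - 1) (psi (\<not> s) (- 1) fermi_vac) \<otimes> gam (\<not> s) (- 1))
      + psi s 1 (psi (\<not> s) (- 2) fermi_vac) \<otimes> gam s (n - 1 - 1)
      + psi s 0 (psi (\<not> s) (- 1) fermi_vac) \<otimes> (gam s (n - 1 - 0) * gam (\<not> s) (- 1))"
    by (rule tau_tau_expand) (use assms in \<open>auto simp: psi_psi_vac\<close>)
  moreover have "n = 1 \<or> n = 2 \<or> n \<ge> 3" using assms by linarith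
  ultimately show ?thesis
    by (elim disjE; cases s)
      (simp_all add: psi_psi_vac gam_nonneg tens_simps scaleC_simps j_vec_def)
qed

text \<open>The fields gamma have creation modes only.\<close>

lemma j_vec_nonneg: "n \<ge> 0 \<Longrightarrow> fm_Y j_vec n x = 0"
proof (rule fm.clinear_eqI[where x = x and g = "\<lambda>_. 0"])
  fix a b assume n: "n \<ge> 0"
  let ?g = "(1 / 2) *\<^sub>C (gam True (- 1) - gam False (- 1))"
  have "fm_Y j_vec n (basis a \<otimes> basis b) = basis a \<otimes> vs_prod comm_va ?g n (basis b)"
    using fm.Z_tens[OF comm_gr fm.basis_in_gr(1), of fermi_vac ?g n a "basis b"] fm.tsum_vac_left_factor[of ?g n]
    unfolding j_vec_def by (simp add: scaleC_one)
  also have "\<dots> = 0"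
    using n by (simp add: clinear_simps[OF comm_vsa.Y_left] comm_va_gam gam_nonneg scaleC_simps tens_simps)
  finally show "fm_Y j_vec n (basis a \<otimes> basis b) = 0" .
qed (rule fm.Z_right, rule clinearI, simp_all add: scaleC_simps)

section \<open>The homomorphism\<close>

lemma e_vec_gr: "e_vec m \<in> vs_grade lattice_vsa (odd m)"
  using e_vec_lat_gr[of m] by simp

abbreviation tgt_Y where
  "tgt_Y \<equiv> vs_prod (tensor_vsa (tensor_vsa fermions comm_va) lattice_vsa)"

abbreviation charge_of :: "bool \<Rightarrow> int" where
  "charge_of s \<equiv> if s then 1 else - 1"

abbreviation charged where
  "charged s \<equiv> tau s \<otimes> e_vec (charge_of s)"

abbreviation cartan where
  "cartan \<equiv> (- 2) *\<^sub>C (fm_vac \<otimes> beta (- 1) (e_vec 0) - j_vec \<otimes> e_vec 0)"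

fun sl2_image where
  "sl2_image E = charged True"
| "sl2_image F = charged False"
| "sl2_image H = cartan"

lemma beta_vac_gr: "beta (- 1) (e_vec 0) \<in> vs_grade lattice_vsa False"
  using beta_lat_gr[of "e_vec 0" False "- 1"] e_vec_lat_gr[of 0] by simp

lemma fm_vac_gr: "fm_vac \<in> vs_grade (tensor_vsa fermions comm_va) False"
  using fm.X.vac_even by (simp add: fm.X_simps)

lemma sl2_image_gr: "sl2_image x \<in> vs_grade (tensor_vsa (tensor_vsa fermions comm_va) lattice_vsa) False"
proof -
  have "charged s \<in> vs_grade (tensor_vsa (tensor_vsa fermions comm_va) lattice_vsa) False" for s
    by (rule fml.tens_gr'[OF tau_gr e_vec_gr]) simp
  moreover have "cartan \<in> vs_grade (tensor_vsa (tensor_vsa fermions comm_va) lattice_vsa) False"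
    by (intro cvec.subspace_scale[OF fml.X.gr_subspace] cvec.subspace_diff[OF fml.X.gr_subspace]
        fml.tens_gr'[OF fm_vac_gr beta_vac_gr] fml.tens_gr'[OF j_vec_gr e_vec_gr]) simp_all
  ultimately show ?thesis by (cases x) (simp_all only: sl2_image.simps)
qed

text \<open>The lattice vector of \<open>charged s\<close> and \<open>tau t\<close> are both odd,
  whence the Koszul sign -1.\<close>

lemma charged_charged: "tgt_Y (charged s) n (charged t) = - fml.tsum (tau s) (e_vec (charge_of s)) n (tau t) (e_vec (charge_of t))"
  using fml.Z_tens[OF e_vec_gr[of "charge_of s"] tau_gr[of t], of "tau s" n "e_vec (charge_of t)"]
  by (simp add: scaleC_simps)

lemma charged_charged_same:
  assumes "n \<ge> 0" shows "tgt_Y (charged s) n (charged s) = 0"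
proof -
  have "fm_Y (tau s) i (tau s) \<otimes> vertex_op (charge_of s) (n - 1 - i) (e_vec (charge_of s)) = 0" for i
  proof (cases "i \<ge> - 1")
    case True
    then show ?thesis by (simp add: tau_tau_same tens_simps)
  next
    case False
    \<comment> \<open>This is the degree of the exponential of creation operators in
      \<open>vertex_op_e_vec\<close>; its leading 1 is the product of the two equal charges.\<close>
    then have "1 - (n - 1 - i) - 1 < 0" using assms by simp
    then show ?thesis by (simp add: vertex_op_e_vec tens_simps scaleC_simps)
  qed
  then show ?thesis unfolding charged_charged fml.tsum_def lattice_e_vec by simp
qed

lemma vexp_1_vac: "vexp 1 m 1 (e_vec r) = of_int m *\<^sub>C beta (- 1) (e_vec r)"
  using vexp_deriv[of 1 1 1 m "e_vec r"] by (simp add: scaleC_simps)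

text \<open>The exponential has degree -2 - k, and the minus sign is the cocycle of beta and -beta.
  The last branch repeats the left-hand side, so the three computed cases form one unconditional
  equation.\<close>

lemma vertex_op_opposite:
  "vertex_op (charge_of s) k (e_vec (charge_of (\<not> s))) = (if k \<ge> - 1 then 0 else if k = - 2 then - e_vec 0
    else if k = - 3 then - of_int (charge_of s) *\<^sub>C beta (- 1) (e_vec 0)
    else vertex_op (charge_of s) k (e_vec (charge_of (\<not> s))))"
  by (cases s) (simp_all add: vertex_op_e_vec vexp_1_vac scaleC_simps)

text \<open>The vertex operator vanishes for i <= n and the product of the tau's for i >= 3, so only
  i = 1 and i = 2 remain. The Koszul sign and the cocycle sign cancel.\<close>

lemma charged_charged_opposite:
  assumes "n \<ge> 0"
  shows "tgt_Y (charged s) n (charged (\<not> s)) = (if n = 0 then of_int (charge_of s) *\<^sub>C cartan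
    else if n = 1 then (- 2) *\<^sub>C (fm_vac \<otimes> e_vec 0) else 0)"
proof -
  let ?c = "of_int (charge_of s)" and ?h = "beta (- 1) (e_vec 0)"
  have "fm_Y (tau s) i (tau (\<not> s)) \<otimes> vertex_op (charge_of s) (n - 1 - i) (e_vec (charge_of (\<not> s)))
    = (if i = 1 \<and> n = 0 then (- 2 * ?c) *\<^sub>C (j_vec \<otimes> e_vec 0) else 0)
    + (if i = 2 then if n = 0 then (2 * ?c) *\<^sub>C (fm_vac \<otimes> ?h) else if n = 1 then 2 *\<^sub>C (fm_vac \<otimes> e_vec 0) else 0 else 0)" for i
  proof -
    consider "i \<le> n" | "i > n" "i = 1" | "i > n" "i = 2" | "i > n" "i \<ge> 3" using assms by linarith
    then show ?thesis
    proof cases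
      case 1
      then have z: "vertex_op (charge_of s) (n - 1 - i) (e_vec (charge_of (\<not> s))) = 0"
        by (subst vertex_op_opposite) simp
      show ?thesis unfolding z using 1 by (auto simp: tens_simps)
    next
      case 2
      then have "n = 0" using assms by simp
      with 2 show ?thesis
        by (subst vertex_op_opposite) (simp add: tau_tau_opposite tens_simps scaleC_simps)
    next
      case 3
      then have "n = 0 \<or> n = 1" using assms by linarith
      with 3 show ?thesis
        by (subst vertex_op_opposite) (auto simp: tau_tau_opposite tens_simps scaleC_simps)
    next
      case 4
      then show ?thesis using assms by (simp add: tau_tau_opposite tens_simps)
    qed
  qed
  then show ?thesis
    unfolding charged_charged fml.tsum_def lattice_e_vec
    by (cases "n = 0"; cases "n = 1") (simp_all add: Sum_any.distrib scaleC_simps)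
qed

lemma cartan_tens:
  assumes u: "u \<in> vs_grade (tensor_vsa fermions comm_va) p" and n: "n \<ge> 0"
  shows "tgt_Y cartan n (u \<otimes> w) = (- 2) *\<^sub>C (u \<otimes> beta n w)"
proof -
  have 1: "tgt_Y (fm_vac \<otimes> beta (- 1) (e_vec 0)) n (u \<otimes> w) = u \<otimes> beta n w"
    using fml.Z_tens[OF beta_vac_gr u, of fm_vac n w] fml.tsum_vac_left_factor[of "beta (- 1) (e_vec 0)" n u w]
    by (simp add: scaleC_one fm.X_simps lattice_beta)
  have 2: "tgt_Y (j_vec \<otimes> e_vec 0) n (u \<otimes> w) = 0"
    using fml.Z_tens[OF lattice_vsa.vac_even u, of j_vec n w] fml.tsum_vac_right_factor[of j_vec n u w]
      j_vec_nonneg[OF n]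
    by (simp add: scaleC_one tens_simps)
  show ?thesis
    unfolding clinear_scale[OF fml.Z_left] clinear_diff[OF fml.Z_left] 1 2 by simp
qed

lemma cartan_charged:
  assumes "n \<ge> 0"
  shows "tgt_Y cartan n (charged s) = (if n = 0 then (2 * of_int (charge_of s)) *\<^sub>C charged s else 0)"
  using assms unfolding cartan_tens[OF tau_gr assms]
  by (cases "n = 0") (simp_all add: beta_e_vec tens_simps scaleC_simps)

text \<open>The constant is (-2)^2 <beta, beta> = -4, which is the level -2 times (h, h) = 2; the
  part from j contributes nothing.\<close>

lemma cartan_cartan:
  assumes "n \<ge> 0"
  shows "tgt_Y cartan n cartan = (if n = 1 then (- 4) *\<^sub>C (fm_vac \<otimes> e_vec 0) else 0)"
proof -
  have b: "beta n (beta (- 1) (e_vec 0)) = (if n = 1 then - e_vec 0 else 0)"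
    using assms beta_comm[of n "- 1" "e_vec 0"]
    by (cases "n = 0") (auto simp: beta_e_vec clinear_0[OF clinear_beta] scaleC_simps)
  have b0: "beta n (e_vec 0) = 0"
    using assms by (cases "n = 0") (simp_all add: beta_e_vec)
  show ?thesis
    unfolding clinear_scale[OF fml.Z_right] clinear_diff[OF fml.Z_right]
      cartan_tens[OF fm_vac_gr assms] cartan_tens[OF j_vec_gr assms] b b0
    by (simp add: tens_simps scaleC_simps)
qed

lemma tgt_vac: "vs_vac (tensor_vsa (tensor_vsa fermions comm_va) lattice_vsa) = fm_vac \<otimes> e_vec 0"
  by (simp add: fml.X_simps fm.X_simps)

interpretation sl2_hat: affine_rep "tensor_vsa (tensor_vsa fermions comm_va) lattice_vsa" sl2_image
proof (rule fml.X.affine_repI[OF sl2_image_gr])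
  fix x y
  assume "(x, y) \<in> {(E, E), (F, F), (H, H), (E, F), (H, E), (H, F)}"
  then consider "x = E" "y = E" | "x = F" "y = F" | "x = H" "y = H" | "x = E" "y = F"
    | "x = H" "y = E" | "x = H" "y = F" by blast
  then show "tgt_Y (sl2_image x) 0 (sl2_image y) = lin_ext sl2_image (sl2_bracket x y) \<and>
      tgt_Y (sl2_image x) 1 (sl2_image y)
        = (- 2 * sl2_form x y) *\<^sub>C vs_vac (tensor_vsa (tensor_vsa fermions comm_va) lattice_vsa) \<and>
      (\<forall>n\<ge>2. tgt_Y (sl2_image x) n (sl2_image y) = 0)"
  proof cases
    case 1
    then show ?thesis using charged_charged_same[of _ True] by (simp add: scaleC_simps)
  next
    case 2
    then show ?thesis using charged_charged_same[of _ False] by (simp add: scaleC_simps)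
  next
    case 3
    then show ?thesis using cartan_cartan by (simp add: tgt_vac del: fml.X_simps)
  next
    case 4
    then show ?thesis using charged_charged_opposite[of _ True] by (simp add: tgt_vac del: fml.X_simps)
  next
    case 5
    then show ?thesis using cartan_charged[of _ True] by (simp add: lin_ext_scale scaleC_simps)
  next
    case 6
    then show ?thesis using cartan_charged[of _ False]
      by (simp add: lin_ext_scale clinear_minus[OF clinear_lin_ext] scaleC_simps)
  qed
qed

section \<open>The subalgebra of the triple tensor product that is the target\<close>

text \<open>\<open>Z_tens\<close> applies to homogeneous factors. The carrier of the restriction
  consists of sums of homogeneous elements of \<open>U\<close>, so the span is generated by tensors
  of homogeneous vectors, for which closure follows from that of \<open>U\<close>.\<close>

lemma (in tensor_vsas) span_tens_closed:
  assumes U: "cvec.subspace U" "\<And>a b n. a \<in> U \<Longrightarrow> b \<in> U \<Longrightarrow> V.Y a n b \<in> U"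
    and x: "x \<in> cvec.span {v \<otimes> w | v w. v \<in> carrier (restrict_vsa V U)}" (is "_ \<in> cvec.span ?T")
    and y: "y \<in> cvec.span {v \<otimes> w | v w. v \<in> carrier (restrict_vsa V U)}"
  shows "Z x n y \<in> cvec.span {v \<otimes> w | v w. v \<in> carrier (restrict_vsa V U)}"
proof -
  let ?H = "{v \<otimes> w | v w p q. v \<in> V.gr p \<inter> U \<and> w \<in> W.gr q}"
  have carrier: "v \<in> carrier (restrict_vsa V U)" if "v \<in> V.gr p \<inter> U" for v p
  proof -
    have 0: "0 \<in> V.gr r \<inter> U" for r
      using cvec.subspace_0[OF U(1)] cvec.subspace_0[OF V.gr_subspace] by blast
    show ?thesis
      unfolding carrier_def restrict_vsa_def
      by (cases p) (use that 0 in \<open>simp_all, force+\<close>)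
  qed
  have "?T \<subseteq> cvec.span ?H"
  proof clarify
    fix v w assume "v \<in> carrier (restrict_vsa V U)"
    then obtain v0 v1 where v: "v0 \<in> V.gr False \<inter> U" "v1 \<in> V.gr True \<inter> U" "v = v0 + v1"
      unfolding carrier_def restrict_vsa_def by auto
    obtain w0 w1 where w: "w0 \<in> W.gr False" "w1 \<in> W.gr True" "w = w0 + w1" using W.grade_sum[of w] by blast
    have "v' \<otimes> w' \<in> cvec.span ?H" if "v' \<in> V.gr p \<inter> U" "w' \<in> W.gr q" for v' w' p q
      by (rule cvec.span_base) (use that in blast)
    then show "v \<otimes> w \<in> cvec.span ?H"
      unfolding v(3) w(3) clinear_add[OF tens_left] clinear_add[OF tens_right]
      using v w by (intro cvec.span_add) blast+
  qed
  then have span: "cvec.span ?T \<subseteq> cvec.span ?H" by (rule cvec.span_minimal) simp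
  have step: "Z a n b \<in> cvec.span ?T" if ab: "a \<in> ?H" "b \<in> ?H" for a b
  proof -
    obtain v w p q v' w' p' where a: "a = v \<otimes> w" "v \<in> V.gr p \<inter> U" "w \<in> W.gr q"
      and b: "b = v' \<otimes> w'" "v' \<in> V.gr p' \<inter> U"
      using ab by blast
    have "V.Y v i v' \<in> V.gr (p \<noteq> p') \<inter> U" for i using a b V.Y_gr U(2) by blast
    then have "V.Y v i v' \<otimes> u \<in> cvec.span ?T" for i u
      by (intro cvec.span_base) (use carrier in blast)
    then have "tsum v w n v' w' \<in> cvec.span ?T"
      unfolding tsum_def Sum_any.expand_set by (rule cvec.span_sum)
    moreover have "Z a n b = koszul q p' *\<^sub>C tsum v w n v' w'"
      unfolding a b using Z_tens[OF a(3)] b(2) by blast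
    ultimately show ?thesis by (simp only: cvec.span_scale)
  qed
  have "Z a n y \<in> cvec.span ?T" if "a \<in> ?H" for a
    by (rule clinear_span_map[OF Z_right _ cvec.subspace_span subsetD[OF span y]]) (rule step[OF that])
  then show ?thesis
    by (rule clinear_span_map[OF Z_left _ cvec.subspace_span subsetD[OF span x]])
qed

definition calV_space :: "fm_space set" where
  "calV_space = \<Inter>{U. vertex_subalgebra (tensor_vsa fermions comm_va) U \<and> {tau True, tau False, j_vec, nu_vec} \<subseteq> U}"

lemma calV_eq: "calV = restrict_vsa (tensor_vsa fermions comm_va) calV_space"
  unfolding calV_def generated_subalgebra_def calV_space_def ..

lemma calV_simps: "vs_prod calV = fm_Y" "vs_vac calV = fm_vac"
  by (simp_all add: calV_eq restrict_vsa_def fm.X_simps)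

lemma calV_space_subspace: "cvec.subspace calV_space"
  unfolding calV_space_def by (rule cvec.subspace_Inter) (auto simp: vertex_subalgebra_def)

lemma calV_space_closed: "a \<in> calV_space \<Longrightarrow> b \<in> calV_space \<Longrightarrow> fm_Y a n b \<in> calV_space"
  unfolding calV_space_def by (auto simp: vertex_subalgebra_def)

lemma calV_space_generators: "fm_vac \<in> calV_space" "tau s \<in> calV_space" "j_vec \<in> calV_space"
proof -
  have "fm_vac \<in> U" if "vertex_subalgebra (tensor_vsa fermions comm_va) U" for U
    using that by (simp add: vertex_subalgebra_def fm.X_simps)
  then show "fm_vac \<in> calV_space" unfolding calV_space_def by blast
  show "tau s \<in> calV_space" unfolding calV_space_def by (cases s) auto
qed (auto simp: calV_space_def)

text \<open>The carrier of \<open>calV\<close> is by definition the sum of the graded pieces of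
  \<open>calV_space\<close>, so membership is established for homogeneous vectors, as the generators
  are.\<close>

lemma carrier_calV: "v \<in> calV_space \<Longrightarrow> v \<in> vs_grade (tensor_vsa fermions comm_va) p \<Longrightarrow> v \<in> carrier calV"
proof -
  assume v: "v \<in> calV_space" "v \<in> vs_grade (tensor_vsa fermions comm_va) p"
  have 0: "0 \<in> vs_grade (tensor_vsa fermions comm_va) r" "0 \<in> calV_space" for r
    using cvec.subspace_0[OF fm.X.gr_subspace] cvec.subspace_0[OF calV_space_subspace] by blast+
  show ?thesis
    unfolding carrier_def calV_eq restrict_vsa_def
    by (cases p) (use v 0 in \<open>simp_all, force+\<close>)
qed

abbreviation calV_lattice_space where
  "calV_lattice_space \<equiv> cvec.span {v \<otimes> w | v w. v \<in> carrier calV \<and> w \<in> carrier lattice_vsa}"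

lemma tens_calV_lattice: "v \<in> calV_space \<Longrightarrow> v \<in> vs_grade (tensor_vsa fermions comm_va) p \<Longrightarrow> v \<otimes> w \<in> calV_lattice_space"
  using carrier_calV by (intro cvec.span_base) auto

lemma calV_lattice_hom: "vsa_hom universal_affine calV_lattice sl2_hat.hom"
  unfolding calV_lattice_def
proof (rule sl2_hat.vsa_hom_hom)
  show "vs_vac (tensor_vsa (tensor_vsa fermions comm_va) lattice_vsa) \<in> calV_lattice_space"
    unfolding tgt_vac by (rule tens_calV_lattice[OF calV_space_generators(1) fm_vac_gr])
  show "tgt_Y a n b \<in> calV_lattice_space" if "a \<in> calV_lattice_space" "b \<in> calV_lattice_space" for a b n
    using fml.span_tens_closed[OF calV_space_subspace calV_space_closed, of a b n] that
    by (simp add: calV_eq)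
  have "charged s \<in> calV_lattice_space" for s
    by (rule tens_calV_lattice[OF calV_space_generators(2) tau_gr])
  moreover have "cartan \<in> calV_lattice_space"
    by (intro cvec.span_scale cvec.span_diff tens_calV_lattice[OF calV_space_generators(1) fm_vac_gr]
        tens_calV_lattice[OF calV_space_generators(3) j_vec_gr])
  ultimately show "sl2_image x \<in> calV_lattice_space" for x
    by (cases x) (simp_all only: sl2_image.simps)
qed simp

theorem proposition6p1:
  defines "images \<equiv> (\<lambda>g :: affine_vac \<Rightarrow> _.
      g (aff_act (Loop E (- 1)) affine_vacuum) = G_mode True (- 2) (vs_vac calV) \<otimes> e_vec 1 \<and>
      g (aff_act (Loop H (- 1)) affine_vacuum) =
        (- 2) *\<^sub>C (vs_vac calV \<otimes> beta (- 1) (vs_vac lattice_vsa)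
                  - T_mode (- 1) (vs_vac calV) \<otimes> vs_vac lattice_vsa) \<and>
      g (aff_act (Loop F (- 1)) affine_vacuum) = G_mode False (- 2) (vs_vac calV) \<otimes> e_vec (- 1))"
  shows "\<exists>g. vsa_hom universal_affine calV_lattice g \<and> images g \<and>
      (\<exists>a\<in>carrier universal_affine. g a \<notin> cvec.span {vs_vac calV_lattice}) \<and>
      (\<forall>g'. vsa_hom universal_affine calV_lattice g' \<and> images g' \<longrightarrow>
        (\<forall>a\<in>carrier universal_affine. g' a = g a))"
proof -
  have vac: "vs_vac (tensor_vsa fermions comm_va) = fm_vac" by (simp add: fm.X_simps)
  have G: "G_mode s (- 2) fm_vac = tau s" for s
    using fm.X.Y_vac(1)[of "tau s"] by (simp add: G_mode_def calV_simps vac)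
  have T: "T_mode (- 1) fm_vac = j_vec"
    using fm.X.Y_vac(1)[of j_vec] by (simp add: T_mode_def calV_simps vac)
  have images: "images g \<longleftrightarrow> (\<forall>x. g (loop_act x (- 1) affine_vacuum) = sl2_image x)" for g
  proof
    assume "images g"
    then show "\<forall>x. g (loop_act x (- 1) affine_vacuum) = sl2_image x"
      unfolding images_def calV_simps G T by (intro allI, rename_tac x, case_tac x) simp_all
  next
    assume "\<forall>x. g (loop_act x (- 1) affine_vacuum) = sl2_image x"
    then show "images g" unfolding images_def calV_simps G T by simp
  qed
  \<comment> \<open>The vacuum is a basis vector and hence nonzero, which is the hypothesis of
    \<open>X_E_not_scalar\<close>.\<close>
  have "fm_vac \<otimes> e_vec 0 \<noteq> 0"
    using basis_nonzero by (simp add: fermi_vac_def e_vec_def tens_basis flip: single_one)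
  then have "sl2_image E \<notin> cvec.span {vs_vac calV_lattice}"
    using sl2_hat.X_E_not_scalar by (simp add: tgt_vac calV_lattice_def restrict_vsa_def)
  then have "\<exists>a\<in>carrier universal_affine. sl2_hat.hom a \<notin> cvec.span {vs_vac calV_lattice}"
    using sl2_hat.hom_generator[of E] affine.carrier_V by (intro bexI[of _ "loop_act E (- 1) affine_vacuum"]) simp_all
  moreover have "g' a = sl2_hat.hom a" if "vsa_hom universal_affine calV_lattice g'" "images g'" for g' a
    by (rule sl2_hat.vsa_hom_unique) (use that images in \<open>auto simp: calV_lattice_def\<close>)
  moreover have "images sl2_hat.hom" unfolding images by (simp add: sl2_hat.hom_generator)
  ultimately show ?thesis using calV_lattice_hom by blast
qed

end
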